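(* Let $\mu\in\mathcal P(\mathbb R^d)$, let $f$ satisfy conditions (a)–(d) below with constants $L,M,N$, and let $T>0$, $h\ge0$ with $L(T^2+Th)\le\frac1{12}$. Let $\tilde{\mathrm Q}$ be a discrete-time Markov transition kernel on $\mathbb R^d$ with stationary distribution $\tilde\nu_{\tilde{\mathrm Q}}$ such that (i) there exist constants $c_1\ge1$, $c_2>0$ with $W_2(\rho\tilde{\mathrm Q}^k,\tilde\nu_{\tilde{\mathrm Q}})\le c_1e^{-c_2k}W_2(\rho,\tilde\nu_{\tilde{\mathrm Q}})$ for every integer $k\ge1$ and every probability distribution $\rho$, and (ii) $W_2(\tilde\nu_{\tilde{\mathrm Q}},\nu)\le\Delta_h$ where $\Delta_h\ge0$ and $\Delta_h\to0$ as $h\to0$. Then for every integer $k\ge0$, \[ \mathsf{KL}(\mu\tilde{\mathrm Q}^k\tilde{\mathrm P}_{T,h}\,\|\,\nu)\le 2c_1^2e^{-2c_2k}\Big(\frac{9}{4T^2}+\frac{363}{2}dM^2T^4\Big)W_2^2(\mu,\tilde\nu_{\tilde{\mathrm Q}})+B, \] where \begin{align*} B&=2\Delta_h^2\Big(\frac{9}{4T^2}+\frac{363}{2}dM^2T^4\Big)+4h^4\Big[45dL^2+\Big(\frac{4L^2}{T^2}+45dM^2\Big)m_2(\mu\tilde{\mathrm Q}^k)+(4L^2+45dM^2T^2)d\\ &\quad+\Big(\frac{4M^2}{T^2}+45d(M^2T^2+N)^2\Big)m_4(\mu\tilde{\mathrm Q}^k)+\big(4M^2T^2+45d(M^2T^4+NT^2)^2\big)d(d+2)\Big].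 \end{align*}
   Context: Let $f:\mathbb R^d\to\mathbb R$ and let $\nu$ be the probability measure with density proportional to $e^{-f}$. Conditions: (a) $f$ has its global minimum at $0$ and $f(0)=0$; (b) $f\in C^2$, $\|\nabla^2f(x)\|_{op}\le L$ for all $x$; (c) $f\in C^3$, $\|\nabla^3f(x)\|_{op}\le M$; (d) $f\in C^4$, $\|\nabla^4f(x)\|_{op}\le N$; for a symmetric $k$-linear form $A$, $\|A\|_{op}=\sup\{|A(u_1,\dots,u_k)|:\|u_i\|=1\}$. For $h>0$ with $T/h\in\mathbb N$ (always assumed when $h>0$), $\tilde q_{T,h}(x,v)=x_N$, $N=T/h$, with $x_0=x,v_0=v$, $x_{j+1}=x_j+hv_j-\frac{h^2}2\nabla f(x_j)$, $v_{j+1}=v_j-\frac h2(\nabla f(x_j)+\nabla f(x_{j+1}))$ (velocity Verlet); for $h=0$, $\tilde q_{T,0}(x,v)$ is the position at time $T$ of the solution of $\dot x_t=v_t,\dot v_t=-\nabla f(x_t)$, $(x_0,v_0)=(x,v)$. The kernel $\tilde{\mathrm P}_{T,h}$ maps $\rho$ to the law of $\tilde q_{T,h}(X,\xi)$, $X\sim\rho$, $\xi\sim\mathcal N(0,I_d)$ independent. $m_k(\rho)=\mathbb E_{X\sim\rho}\|X\|^k$. $W_2$ is the Wasserstein-2 distance; $\mathsf{KL}(\mu\|\pi)=\mathbb E_\mu[\log\frac{d\mu}{d\pi}]$ if $\mu\ll\pi$, else $+\infty$. *)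

theory Defs
  imports "HOL-Analysis.Analysis" "HOL-Probability.Probability"
begin

definition gibbs :: "('a::euclidean_space \<Rightarrow> real) \<Rightarrow> 'a measure" where
  "gibbs f = density lborel
     (\<lambda>x. ennreal (exp (- f x) / (\<integral>y. exp (- f y) \<partial>lborel)))"

definition std_gauss :: "'a::euclidean_space measure" where
  "std_gauss = density lborel
     (\<lambda>v. ennreal ((2 * pi) powr (- real DIM('a) / 2) * exp (- (norm v)\<^sup>2 / 2)))"

definition moment :: "nat \<Rightarrow> 'a::euclidean_space measure \<Rightarrow> ennreal" where
  "moment k \<rho> = (\<integral>\<^sup>+ x. ennreal (norm x ^ k) \<partial>\<rho>)"

definition couplings :: "'a::euclidean_space measure \<Rightarrow> 'a measure \<Rightarrow> ('a \<times> 'a) measure set" where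
  "couplings \<rho> \<sigma> = {\<pi>. sets \<pi> = sets (borel \<Otimes>\<^sub>M borel) \<and>
                        distr \<pi> borel fst = \<rho> \<and> distr \<pi> borel snd = \<sigma>}"

definition W2sq :: "'a::euclidean_space measure \<Rightarrow> 'a measure \<Rightarrow> ennreal" where
  "W2sq \<rho> \<sigma> = (INF \<pi>\<in>couplings \<rho> \<sigma>. \<integral>\<^sup>+ p. ennreal ((dist (fst p) (snd p))\<^sup>2) \<partial>\<pi>)"

definition W2 :: "'a::euclidean_space measure \<Rightarrow> 'a measure \<Rightarrow> ennreal" where
  "W2 \<rho> \<sigma> = (if W2sq \<rho> \<sigma> = \<top> then \<top> else ennreal (sqrt (enn2real (W2sq \<rho> \<sigma>))))"

text \<open>KL(mu || pi) = E_mu[log dmu/dpi] if mu << pi, else +infinity.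
  The expectation of the log-density is taken as (positive part) - (negative part);
  the negative part is always finite for probability measures.\<close>
definition KL :: "'a measure \<Rightarrow> 'a measure \<Rightarrow> ereal" where
  "KL \<mu> \<pi> =
    (if sets \<mu> = sets \<pi> \<and> absolutely_continuous \<pi> \<mu> then
       enn2ereal (\<integral>\<^sup>+ x. ennreal (max 0 (ln (enn2real (RN_deriv \<pi> \<mu> x)))) \<partial>\<mu>)
     - enn2ereal (\<integral>\<^sup>+ x. ennreal (max 0 (- ln (enn2real (RN_deriv \<pi> \<mu> x)))) \<partial>\<mu>)
     else \<infinity>)"

definition verlet_step :: "('a::euclidean_space \<Rightarrow> 'a) \<Rightarrow> real \<Rightarrow> 'a \<times> 'a \<Rightarrow> 'a \<times> 'a" where
  "verlet_step g h s =
     (let x = fst s; v = snd s; x' = x + h *\<^sub>R v - (h\<^sup>2 / 2) *\<^sub>R g x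
      in (x', v - (h / 2) *\<^sub>R (g x + g x')))"

text \<open>Exact Hamiltonian flow position at time T (unique solution, since g is Lipschitz).\<close>
definition ham_flow_pos :: "('a::euclidean_space \<Rightarrow> 'a) \<Rightarrow> real \<Rightarrow> 'a \<Rightarrow> 'a \<Rightarrow> 'a" where
  "ham_flow_pos g T x v =
     (THE p. \<exists>X V. X 0 = x \<and> V 0 = v \<and>
        (\<forall>t. (X has_vector_derivative V t) (at t) \<and>
             (V has_vector_derivative - g (X t)) (at t)) \<and> p = X T)"

text \<open>tilde q_{T,h}(x,v); for h > 0 the number of steps is N = T/h (assumed integral).\<close>
definition qtilde :: "('a::euclidean_space \<Rightarrow> 'a) \<Rightarrow> real \<Rightarrow> real \<Rightarrow> 'a \<Rightarrow> 'a \<Rightarrow> 'a" where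
  "qtilde g T h x v =
     (if h = 0 then ham_flow_pos g T x v
      else fst ((verlet_step g h ^^ nat \<lfloor>T / h\<rfloor>) (x, v)))"

definition Ptilde :: "('a::euclidean_space \<Rightarrow> 'a) \<Rightarrow> real \<Rightarrow> real \<Rightarrow> 'a measure \<Rightarrow> 'a measure" where
  "Ptilde g T h \<rho> = distr (\<rho> \<Otimes>\<^sub>M std_gauss) borel (\<lambda>p. qtilde g T h (fst p) (snd p))"

definition kiter :: "('a \<Rightarrow> 'a measure) \<Rightarrow> nat \<Rightarrow> 'a measure \<Rightarrow> 'a measure" where
  "kiter Q k \<rho> = ((\<lambda>\<sigma>. \<sigma> \<bind> Q) ^^ k) \<rho>"

end

theory Submission
  imports Defs
begin

text \<open>By the Donsker--Varadhan duality it suffices to bound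
  \<open>E \<phi>(q\<^sub>h(X,\<xi>))\<close> by a cost plus \<open>ln E exp \<phi>(Y)\<close> with \<open>Y \<sim> \<nu>\<close>, for bounded \<open>\<phi>\<close>. The measure \<open>\<nu>\<close> is the limit,
  as \<open>m \<rightarrow> \<infinity>\<close>, of its images under the Verlet kernel with step \<open>h/m\<close>: the Verlet map preserves volume and is
  reversible, and its energy error vanishes. So two Verlet kernels with steps \<open>h\<close> and \<open>h/m\<close> are compared.
  For starting points \<open>x\<close>, \<open>y\<close> and a velocity \<open>v\<close>, let \<open>w = w(v)\<close> be the velocity for which the fine
  trajectory from \<open>(y,w)\<close> ends where the coarse trajectory from \<open>(x,v)\<close> does. Changing variables in the
  Gaussian integral costs at most the mean of \<open>|w - v|\<^sup>2/2 + d |Dw - I|\<^sup>2\<close>; both terms are estimated by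
  discrete stability and by the error of the trapezoidal rule, which is where the fourth-order derivatives
  of \<open>f\<close> and the factor \<open>h\<^sup>4\<close> enter. Averaging over a coupling of the starting points gives
  \<open>W\<^sub>2\<^sup>2\<close>, and the triangle inequality through the stationary law of \<open>Q\<close> finishes the proof.
  For \<open>h = 0\<close> both kernels use the step \<open>T/n\<close>, \<open>n \<rightarrow> \<infinity>\<close>.\<close>

section \<open>Donsker--Varadhan duality\<close>

text \<open>Comparing step h with step h/m, not with the exact flow, keeps every map a finite
  composition of smooth steps: the flow is never differentiated, and trajectories and tangents obey
  the same kind of discrete recursion. The price is that \<open>gibbs f\<close> is invariant only in
  the limit; the dual form makes this harmless, since for one fixed bounded test function only
  integrals have to converge. The obstacle in the Gaussian change of variables is of first order:
  with g = w - v, the logarithm of the transformed density contains - v . g + tr Dg, which would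
  spoil a quadratic cost. Gaussian integration by parts shows that this term has mean zero, and
  Jensen's inequality only asks for the mean. What remains is quadratic in g and Dg. The factor h^4
  is a square: refining the trapezoidal rule costs the difference of the squared steps, at most h^2
  uniformly in m. Smallness of L T^2 makes the map from velocity to endpoint T times a small
  perturbation of the identity, so w(v) exists, and keeps |Dg| \<le> 1/2, as the determinant bound
  requires.\<close>

lemma (in prob_space) integrable_bounded:
  fixes g :: "'a \<Rightarrow> real"
  assumes "g \<in> borel_measurable M" "\<And>x. x \<in> space M \<Longrightarrow> \<bar>g x\<bar> \<le> K"
  shows "integrable M g"
  by (rule integrable_const_bound[where B=K]) (use assms in auto)

lemma KL_le_of_dual:
  fixes \<mu> \<pi> :: "'a measure"
  assumes mu: "prob_space \<mu>" and pi: "prob_space \<pi>" and sets: "sets \<mu> = sets \<pi>"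
    and dual: "\<And>\<phi> K. \<phi> \<in> borel_measurable \<pi> \<Longrightarrow> (\<And>x. \<bar>\<phi> x\<bar> \<le> K) \<Longrightarrow>
        (\<integral>x. \<phi> x \<partial>\<mu>) \<le> c + ln (\<integral>x. exp (\<phi> x) \<partial>\<pi>)"
  shows "KL \<mu> \<pi> \<le> ereal c"
proof -
  interpret mu: prob_space \<mu> by fact
  interpret pi: prob_space \<pi> by fact
  note [measurable_cong] = sets
  have sp: "space \<mu> = space \<pi>" using sets by (rule sets_eq_imp_space_eq)
  have meas: "g \<in> borel_measurable \<mu> \<longleftrightarrow> g \<in> borel_measurable \<pi>" for g :: "'a \<Rightarrow> real"
    using measurable_cong_sets[OF sets refl] by blast
  have ac: "absolutely_continuous \<pi> \<mu>"
    unfolding absolutely_continuous_def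
  proof
    fix A assume A: "A \<in> null_sets \<pi>"
    then have As: "A \<in> sets \<pi>" by auto
    \<comment> \<open>The exponential of n times the indicator is 1 almost everywhere for
      \<open>\<pi>\<close>, so the logarithm vanishes and \<open>c\<close> bounds n times the mass
      of A for every n.\<close>
    have "real n * measure \<mu> A \<le> c" for n :: nat
    proof -
      have "(\<integral>x. real n * indicator A x \<partial>\<mu>) \<le> c + ln (\<integral>x. exp (real n * indicator A x) \<partial>\<pi>)"
        by (rule dual[where K="real n"]) (use As in \<open>auto simp: indicator_def\<close>)
      moreover have "(\<integral>x. exp (real n * indicator A x) \<partial>\<pi>) = (\<integral>x. 1 \<partial>\<pi>)"
      proof (rule integral_cong_AE)
        show "AE x in \<pi>. exp (real n * indicator A x) = 1"
          using AE_not_in[OF A] by eventually_elim auto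
      qed (use As in auto)
      moreover have "(\<integral>x. real n * indicator A x \<partial>\<mu>) = real n * measure \<mu> A"
        using As sets by simp
      ultimately show ?thesis by (simp only: pi.prob_space) (simp add: pi.prob_space)
    qed
    then have "measure \<mu> A \<le> 0"
      by (metis linorder_not_less mult.commute reals_Archimedean3)
    then have "measure \<mu> A = 0" using measure_nonneg[of \<mu> A] by linarith
    then show "A \<in> null_sets \<mu>" using As sets by (auto simp: null_sets_def mu.emeasure_eq_measure)
  qed
  define r where "r x = enn2real (RN_deriv \<pi> \<mu> x)" for x
  have [measurable]: "r \<in> borel_measurable \<pi>" unfolding r_def by measurable
  have r_nn[simp]: "0 \<le> r x" for x by (simp add: r_def)
  have AEr: "AE x in \<pi>. RN_deriv \<pi> \<mu> x = ennreal (r x)"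
    using pi.RN_deriv_finite[OF mu.sigma_finite_measure_axioms ac sets]
    by eventually_elim (simp add: r_def ennreal_enn2real_if less_top)
  have dens: "\<mu> = density \<pi> (\<lambda>x. ennreal (r x))"
    using pi.density_RN_deriv[OF ac sets] density_cong[OF _ _ AEr] by simp
  have rint: "(\<integral>\<^sup>+x. ennreal (r x) \<partial>\<pi>) = 1"
  proof -
    have "1 = emeasure \<mu> (space \<mu>)" by (simp add: mu.emeasure_space_1)
    also have "\<dots> = emeasure (density \<pi> (\<lambda>x. ennreal (r x))) (space \<pi>)" using dens sp by simp
    also have "\<dots> = (\<integral>\<^sup>+x. ennreal (r x) \<partial>\<pi>)" by (simp add: emeasure_density cong: nn_integral_cong)
    finally show ?thesis by simp
  qed
  have ri: "integrable \<pi> r" and rI: "integral\<^sup>L \<pi> r = 1"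
    using rint by (auto intro!: integrableI_nonneg simp: integral_eq_nn_integral)
  have AEpos: "AE x in \<mu>. r x > 0"
    by (subst dens) (auto simp: AE_density less_le)
  define P where "P = (\<integral>\<^sup>+ x. ennreal (max 0 (ln (r x))) \<partial>\<mu>)"
  define Nn where "Nn = (\<integral>\<^sup>+ x. ennreal (max 0 (- ln (r x))) \<partial>\<mu>)"
  \<comment> \<open>From -ln r \<le> 1/r. Hence the negative part of the log-density has mean at
    most 1, and the difference defining \<open>KL\<close> is never infinity minus infinity.\<close>
  have rl: "r x * max 0 (- ln (r x)) \<le> 1" for x
  proof (cases "r x > 0")
    case True
    have "ln (1 / r x) \<le> 1 / r x - 1" using True by (intro ln_le_minus_one) auto
    then have "- ln (r x) \<le> 1 / r x" using True by (simp add: ln_div)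
    then have "max 0 (- ln (r x)) \<le> 1 / r x" using True by simp
    then show ?thesis using True by (simp add: field_simps)
  qed (use r_nn[of x] in \<open>auto simp: not_less\<close>)
  have N1: "Nn \<le> 1"
  proof -
    have "Nn = (\<integral>\<^sup>+ x. ennreal (r x) * ennreal (max 0 (- ln (r x))) \<partial>\<pi>)"
      unfolding Nn_def by (subst dens) (simp add: nn_integral_density)
    also have "\<dots> \<le> (\<integral>\<^sup>+ x. 1 \<partial>\<pi>)"
      by (rule nn_integral_mono, subst ennreal_mult[symmetric]) (use rl in \<open>auto simp del: ennreal_le_1 simp: ennreal_le_1[THEN iffD2]\<close>)
    finally show ?thesis by (simp add: pi.emeasure_space_1)
  qed
  define nn where "nn = enn2real Nn"
  have nn: "Nn = ennreal nn" "0 \<le> nn" using N1 by (auto simp: nn_def ennreal_enn2real_if top.extremum_unique)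
  have trunc: "(\<integral>x. min (real n) (max 0 (ln (r x))) \<partial>\<mu>) \<le> c + exp (- real n) + nn" for n :: nat
  proof -
    \<comment> \<open>The value -n at r = 0 has to be forced, since \<open>ln\<close> does not take
      the value minus infinity there. With it the exponential is at most r + e^-n
      everywhere.\<close>
    define \<phi> where "\<phi> x = (if r x = 0 then - real n else max (- real n) (min (real n) (ln (r x))))" for x
    have [measurable]: "\<phi> \<in> borel_measurable \<pi>" unfolding \<phi>_def by measurable
    have b: "\<bar>\<phi> x\<bar> \<le> real n" for x by (auto simp: \<phi>_def)
    have D: "(\<integral>x. \<phi> x \<partial>\<mu>) \<le> c + ln (\<integral>x. exp (\<phi> x) \<partial>\<pi>)" by (rule dual[OF _ b]) measurable
    have le: "exp (\<phi> x) \<le> r x + exp (- real n)" for x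
    proof (cases "r x = 0")
      case False
      then have "r x > 0" using r_nn[of x] by linarith
      then have "exp (min (real n) (ln (r x))) \<le> r x"
        by (metis exp_ln exp_le_cancel_iff min.cobounded2)
      moreover have "\<phi> x = - real n \<or> \<phi> x = min (real n) (ln (r x))" using False by (auto simp: \<phi>_def max_def)
      ultimately show ?thesis
        using exp_gt_zero[of "- real n"] \<open>r x > 0\<close> by (elim disjE) (simp_all add: add_increasing2 less_imp_le)
    qed (simp add: \<phi>_def)
    have ei: "integrable \<pi> (\<lambda>x. exp (\<phi> x))"
      by (rule pi.integrable_bounded[where K="exp (real n)"]) (use b in \<open>auto simp: abs_le_iff\<close>)
    have "(\<integral>x. exp (\<phi> x) \<partial>\<pi>) \<le> (\<integral>x. r x + exp (- real n) \<partial>\<pi>)"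
      by (rule integral_mono[OF ei]) (use ri le in auto)
    also have "\<dots> = 1 + exp (- real n)" using ri rI by (simp add: pi.prob_space)
    finally have I: "(\<integral>x. exp (\<phi> x) \<partial>\<pi>) \<le> 1 + exp (- real n)" .
    have "0 < (\<integral>x. exp (\<phi> x) \<partial>\<pi>)"
    proof -
      have "(\<integral>x. exp (- real n) \<partial>\<pi>) \<le> (\<integral>x. exp (\<phi> x) \<partial>\<pi>)"
        by (rule integral_mono[OF _ ei]) (use b in \<open>auto simp: abs_le_iff minus_le_iff\<close>)
      then have "exp (- real n) \<le> (\<integral>x. exp (\<phi> x) \<partial>\<pi>)" by (simp add: pi.prob_space)
      then show ?thesis using exp_gt_zero[of "- real n"] by linarith
    qed
    then have "ln (\<integral>x. exp (\<phi> x) \<partial>\<pi>) \<le> exp (- real n)"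
      using I ln_le_minus_one[of "\<integral>x. exp (\<phi> x) \<partial>\<pi>"] by linarith
    then have D2: "(\<integral>x. \<phi> x \<partial>\<mu>) \<le> c + exp (- real n)" using D by linarith
    have ip: "integrable \<mu> (\<lambda>x. min (real n) (max 0 (ln (r x))))"
      by (rule mu.integrable_bounded[where K="real n"]) (auto simp: meas)
    have im: "integrable \<mu> (\<lambda>x. min (real n) (max 0 (- ln (r x))))"
      by (rule mu.integrable_bounded[where K="real n"]) (auto simp: meas)
    have "(\<integral>x. \<phi> x \<partial>\<mu>) = (\<integral>x. min (real n) (max 0 (ln (r x))) - min (real n) (max 0 (- ln (r x))) \<partial>\<mu>)"
    proof (rule integral_cong_AE)
      show "AE x in \<mu>. \<phi> x = min (real n) (max 0 (ln (r x))) - min (real n) (max 0 (- ln (r x)))"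
        using AEpos
      proof eventually_elim
        case (elim x)
        then have "\<phi> x = max (- real n) (min (real n) (ln (r x)))" by (simp add: \<phi>_def)
        moreover have "max (- real n) (min (real n) t) = min (real n) (max 0 t) - min (real n) (max 0 (- t))" for t
          by (auto simp: max_def min_def)
        ultimately show ?case by simp
      qed
    qed (auto simp: meas)
    also have "\<dots> = (\<integral>x. min (real n) (max 0 (ln (r x))) \<partial>\<mu>) - (\<integral>x. min (real n) (max 0 (- ln (r x))) \<partial>\<mu>)"
      using ip im by simp
    finally have E: "(\<integral>x. min (real n) (max 0 (ln (r x))) \<partial>\<mu>) = (\<integral>x. \<phi> x \<partial>\<mu>) + (\<integral>x. min (real n) (max 0 (- ln (r x))) \<partial>\<mu>)"
      by simp
    have "ennreal (\<integral>x. min (real n) (max 0 (- ln (r x))) \<partial>\<mu>) = (\<integral>\<^sup>+x. ennreal (min (real n) (max 0 (- ln (r x)))) \<partial>\<mu>)"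
      using im by (intro nn_integral_eq_integral[symmetric]) auto
    also have "\<dots> \<le> Nn" unfolding Nn_def by (intro nn_integral_mono ennreal_leI) auto
    finally have "(\<integral>x. min (real n) (max 0 (- ln (r x))) \<partial>\<mu>) \<le> nn" using nn by simp
    then show ?thesis using E D2 by linarith
  qed
  have c0: "0 \<le> c"
    using dual[of "\<lambda>_. 0" 0] by (simp add: pi.prob_space)
  \<comment> \<open>The level m stays fixed while the error e^-n is sent to 0 along n \<ge>
    m.\<close>
  have trunc2: "(\<integral>\<^sup>+x. ennreal (min (real m) (max 0 (ln (r x)))) \<partial>\<mu>) \<le> ennreal (c + nn)" for m :: nat
  proof -
    have ip: "integrable \<mu> (\<lambda>x. min (real n) (max 0 (ln (r x))))" for n
      by (rule mu.integrable_bounded[where K="real n"]) (auto simp: meas)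
    have lim: "(\<lambda>n. c + exp (- real n) + nn) \<longlonglongrightarrow> c + 0 + nn"
      by (intro tendsto_intros filterlim_compose[OF exp_at_bot] filterlim_compose[OF filterlim_uminus_at_bot_at_top]
           filterlim_real_sequentially)
    have "(\<integral>x. min (real m) (max 0 (ln (r x))) \<partial>\<mu>) \<le> c + 0 + nn"
    proof (rule LIMSEQ_le_const[OF lim], intro exI allI impI)
      fix n assume "m \<le> n"
      then have "(\<integral>x. min (real m) (max 0 (ln (r x))) \<partial>\<mu>) \<le> (\<integral>x. min (real n) (max 0 (ln (r x))) \<partial>\<mu>)"
        by (intro integral_mono ip) auto
      then show "(\<integral>x. min (real m) (max 0 (ln (r x))) \<partial>\<mu>) \<le> c + exp (- real n) + nn" using trunc[of n] by linarith
    qed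
    then show ?thesis using c0 nn by (subst nn_integral_eq_integral[OF ip]) (auto simp del: ennreal_plus intro!: ennreal_leI)
  qed
  have PE: "P = (SUP m. \<integral>\<^sup>+x. ennreal (min (real m) (max 0 (ln (r x)))) \<partial>\<mu>)"
    unfolding P_def
  proof (subst nn_integral_monotone_convergence_SUP[symmetric])
    show "incseq (\<lambda>m x. ennreal (min (real m) (max 0 (ln (r x)))))"
      by (auto simp: incseq_def le_fun_def intro!: ennreal_leI)
    show "(\<lambda>x. ennreal (min (real m) (max 0 (ln (r x))))) \<in> borel_measurable \<mu>" for m
      by measurable
    have "(SUP m. ennreal (min (real m) (max 0 (ln (r x))))) = ennreal (max 0 (ln (r x)))" for x
    proof (rule antisym)
      show "(SUP m. ennreal (min (real m) (max 0 (ln (r x))))) \<le> ennreal (max 0 (ln (r x)))"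
        by (intro SUP_least ennreal_leI) auto
      obtain m :: nat where m: "max 0 (ln (r x)) \<le> real m" using real_arch_simple by blast
      show "ennreal (max 0 (ln (r x))) \<le> (SUP m. ennreal (min (real m) (max 0 (ln (r x)))))"
        by (rule SUP_upper2[of m]) (use m in \<open>auto simp: min_def\<close>)
    qed
    then show "(\<integral>\<^sup>+ x. ennreal (max 0 (ln (r x))) \<partial>\<mu>) = (\<integral>\<^sup>+ x. (SUP m. ennreal (min (real m) (max 0 (ln (r x))))) \<partial>\<mu>)"
      by simp
  qed
  have PN: "P \<le> ennreal (c + nn)" unfolding PE by (rule SUP_least) (rule trunc2)
  define p where "p = enn2real P"
  have p: "P = ennreal p" "0 \<le> p" using PN by (auto simp: p_def ennreal_enn2real_if top.extremum_unique)
  have "KL \<mu> \<pi> = enn2ereal P - enn2ereal Nn"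
    unfolding KL_def P_def Nn_def r_def using ac sets by simp
  also have "\<dots> = ereal (p - nn)" using p nn by (simp add: enn2ereal_ennreal)
  also have "\<dots> \<le> ereal c" using PN p nn c0 by (simp add: ennreal_le_iff del: ennreal_plus)
  finally show ?thesis .
qed

text \<open>Regularity gives, for each measure separately, a compact set inside and an open set
  outside A. The union of the compact sets and the intersection of the open ones serve both measures
  at once, and Urysohn's lemma interpolates between them.\<close>

lemma indicator_approx_continuous:
  fixes \<mu> \<pi> :: "'a::euclidean_space measure"
  assumes mu: "prob_space \<mu>" "sets \<mu> = sets borel" and pi: "prob_space \<pi>" "sets \<pi> = sets borel"
    and A: "A \<in> sets borel" and e: "e > 0"
  shows "\<exists>g::'a \<Rightarrow> real. continuous_on UNIV g \<and> (\<forall>x. \<bar>g x\<bar> \<le> 1) \<and>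
     (\<integral>x. \<bar>indicator A x - g x\<bar> \<partial>\<mu>) \<le> e \<and> (\<integral>x. \<bar>indicator A x - g x\<bar> \<partial>\<pi>) \<le> e"
proof -
  have reg: "\<exists>K U. compact K \<and> open U \<and> K \<subseteq> A \<and> A \<subseteq> U \<and> measure m (U - K) \<le> e"
    if m: "prob_space m" "sets m = sets borel" for m :: "'a measure"
  proof -
    interpret m: prob_space m by fact
    have fin: "emeasure m (space m) \<noteq> \<infinity>" by simp
    have "emeasure m A < emeasure m A + ennreal (e/2)"
      using e by (simp add: m.emeasure_eq_measure ennreal_plus[symmetric] ennreal_less_iff del: ennreal_plus)
    then have "(INF U \<in> {U. A \<subseteq> U \<and> open U}. emeasure m U) < emeasure m A + ennreal (e/2)"
      using outer_regular[OF m(2) fin A] by simp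
    then obtain U where U: "A \<subseteq> U" "open U" "emeasure m U < emeasure m A + ennreal (e/2)"
      by (auto simp: INF_less_iff)
    have "\<exists>K. K \<subseteq> A \<and> compact K \<and> emeasure m A \<le> emeasure m K + ennreal (e/2)"
    proof (cases "emeasure m A = 0")
      case True then show ?thesis by (intro exI[of _ "{}"]) auto
    next
      case False
      then have "emeasure m A - ennreal (e/2) < emeasure m A"
        using e by (intro ennreal_between) (auto simp: less_top[symmetric] zero_less_iff_neq_zero)
      then have "emeasure m A - ennreal (e/2) < (SUP K \<in> {K. K \<subseteq> A \<and> compact K}. emeasure m K)"
        using inner_regular[OF m(2) fin A] by simp
      then obtain K where "K \<subseteq> A" "compact K" "emeasure m A - ennreal (e/2) < emeasure m K"
        by (auto simp: less_SUP_iff)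
      then show ?thesis by (intro exI[of _ K]) (auto simp: ennreal_minus_le_iff add.commute dest!: less_imp_le)
    qed
    then obtain K where K: "K \<subseteq> A" "compact K" "emeasure m A \<le> emeasure m K + ennreal (e/2)" by blast
    have Ks: "K \<in> sets m" and Us: "U \<in> sets m" using K U m(2) by (auto intro: borel_compact)
    have "measure m U < measure m A + e/2" "measure m A \<le> measure m K + e/2"
      using U(3) K(3) e by (auto simp: m.emeasure_eq_measure ennreal_plus[symmetric] ennreal_less_iff simp del: ennreal_plus)
    then have "measure m (U - K) \<le> e"
      using m.finite_measure_Diff[OF Us Ks] K U by auto
    then show ?thesis using K U by blast
  qed
  obtain K1 U1 where 1: "compact K1" "open U1" "K1 \<subseteq> A" "A \<subseteq> U1" "measure \<mu> (U1 - K1) \<le> e" using reg[OF mu] by blast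
  obtain K2 U2 where 2: "compact K2" "open U2" "K2 \<subseteq> A" "A \<subseteq> U2" "measure \<pi> (U2 - K2) \<le> e" using reg[OF pi] by blast
  define K where "K = K1 \<union> K2"
  define U where "U = U1 \<inter> U2"
  have KU: "closed K" "open U" "K \<subseteq> A" "A \<subseteq> U" using 1 2 by (auto simp: K_def U_def compact_imp_closed)
  then have "closed (- U)" "K \<inter> - U = {}" by auto
  then obtain g :: "'a \<Rightarrow> real" where g: "continuous_on UNIV g" "\<And>x. g x \<in> closed_segment 1 0"
    "\<And>x. x \<in> K \<Longrightarrow> g x = 1" "\<And>x. x \<in> - U \<Longrightarrow> g x = 0"
    using Urysohn[OF KU(1), of "- U" "1::real" 0] by metis
  have g01: "0 \<le> g x \<and> g x \<le> 1" for x using g(2)[of x] by (auto simp: closed_segment_eq_real_ivl)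
  have gm: "g \<in> borel_measurable borel" using g(1) by (rule borel_measurable_continuous_onI)
  have bd: "\<bar>indicator A x - g x\<bar> \<le> indicator (U - K) x" for x
    using g01[of x] g(3)[of x] g(4)[of x] KU by (auto simp: indicator_def)
  have main: "(\<integral>x. \<bar>indicator A x - g x\<bar> \<partial>m) \<le> measure m (U - K)"
    if m: "prob_space m" "sets m = sets borel" for m :: "'a measure"
  proof -
    interpret m: prob_space m by fact
    have UK: "U - K \<in> sets m" using KU m(2) by auto
    have As: "A \<in> sets m" using A m by simp
    have gm': "g \<in> borel_measurable m" using gm m(2) by (simp cong: measurable_cong_sets)
    have "(\<integral>x. \<bar>indicator A x - g x\<bar> \<partial>m) \<le> (\<integral>x. indicator (U - K) x \<partial>m)"
    proof (rule integral_mono[OF _ _ bd])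
      show "integrable m (\<lambda>x. \<bar>indicator A x - g x\<bar>)"
        by (rule m.integrable_bounded[where K=1]) (use g01 As gm' in \<open>auto simp: indicator_def\<close>)
    qed (use UK in \<open>auto simp: m.emeasure_eq_measure\<close>)
    then show ?thesis using UK by simp
  qed
  have "measure \<mu> (U - K) \<le> measure \<mu> (U1 - K1)"
  proof -
    interpret m: prob_space \<mu> by fact
    show ?thesis using 1 mu(2) by (intro m.finite_measure_mono) (auto simp: U_def K_def intro: borel_compact)
  qed
  moreover have "measure \<pi> (U - K) \<le> measure \<pi> (U2 - K2)"
  proof -
    interpret m: prob_space \<pi> by fact
    show ?thesis using 2 pi(2) by (intro m.finite_measure_mono) (auto simp: U_def K_def intro: borel_compact)
  qed
  ultimately have "(\<integral>x. \<bar>indicator A x - g x\<bar> \<partial>\<mu>) \<le> e" "(\<integral>x. \<bar>indicator A x - g x\<bar> \<partial>\<pi>) \<le> e"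
    using main[OF mu] main[OF pi] 1 2 by linarith+
  then show ?thesis using g(1) g01 by (intro exI[of _ g]) auto
qed


text \<open>The function rounded down to multiples of 1/n is a finite combination of indicators.
  Each indicator is replaced by a continuous function, and the sum is clamped to [-K, K], which can
  only bring it closer to \<open>\<phi>\<close>.\<close>

lemma bounded_measurable_approx_continuous:
  fixes \<mu> \<pi> :: "'a::euclidean_space measure" and \<phi> :: "'a \<Rightarrow> real"
  assumes mu: "prob_space \<mu>" "sets \<mu> = sets borel" and pi: "prob_space \<pi>" "sets \<pi> = sets borel"
    and phi[measurable]: "\<phi> \<in> borel_measurable borel" and K: "\<And>x. \<bar>\<phi> x\<bar> \<le> K" and e: "e > 0"
  shows "\<exists>g::'a \<Rightarrow> real. continuous_on UNIV g \<and> (\<forall>x. \<bar>g x\<bar> \<le> K) \<and>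
     (\<integral>x. \<bar>\<phi> x - g x\<bar> \<partial>\<mu>) \<le> e \<and> (\<integral>x. \<bar>\<phi> x - g x\<bar> \<partial>\<pi>) \<le> e"
proof -
  have K0: "0 \<le> K" using K[of undefined] by linarith
  obtain n :: nat where n: "n > 0" "1 / real n < e / 2"
    using reals_Archimedean[of "e/2"] e by (metis half_gt_zero inverse_eq_divide zero_less_Suc)
  define J where "J = {\<lfloor>- real n * K\<rfloor> .. \<lfloor>real n * K\<rfloor>}"
  define A where "A j = {x. \<lfloor>real n * \<phi> x\<rfloor> = j}" for j
  have A: "A j \<in> sets borel" for j unfolding A_def by measurable
  \<comment> \<open>S is the total weight of the indicators, increased by 1 so that the error share
    e/(2S) makes sense even if all weights vanish.\<close>
  define S where "S = (\<Sum>j\<in>J. \<bar>real_of_int j / real n\<bar>) + 1"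
  have S: "S > 0" unfolding S_def by (intro add_nonneg_pos sum_nonneg) auto
  have "\<forall>j. \<exists>g::'a \<Rightarrow> real. continuous_on UNIV g \<and> (\<forall>x. \<bar>g x\<bar> \<le> 1) \<and>
     (\<integral>x. \<bar>indicator (A j) x - g x\<bar> \<partial>\<mu>) \<le> e / (2 * S) \<and> (\<integral>x. \<bar>indicator (A j) x - g x\<bar> \<partial>\<pi>) \<le> e / (2 * S)"
    using indicator_approx_continuous[OF mu pi A, of "e / (2 * S)"] e S by auto
  from choice[OF this] obtain g where "\<forall>j. continuous_on UNIV (g j) \<and> (\<forall>x. \<bar>g j x\<bar> \<le> (1::real)) \<and>
     (\<integral>x. \<bar>indicator (A j) x - g j x\<bar> \<partial>\<mu>) \<le> e / (2 * S) \<and> (\<integral>x. \<bar>indicator (A j) x - g j x\<bar> \<partial>\<pi>) \<le> e / (2 * S)" ..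
  then have g: "\<And>j. continuous_on UNIV (g j)" "\<And>j x. \<bar>g j x\<bar> \<le> (1::real)"
     "\<And>j. (\<integral>x. \<bar>indicator (A j) x - g j x\<bar> \<partial>\<mu>) \<le> e / (2 * S)" "\<And>j. (\<integral>x. \<bar>indicator (A j) x - g j x\<bar> \<partial>\<pi>) \<le> e / (2 * S)"
    by blast+
  define G where "G x = (\<Sum>j\<in>J. (real_of_int j / real n) * g j x)" for x
  define H where "H x = max (- K) (min K (G x))" for x
  have cG: "continuous_on UNIV G" unfolding G_def by (intro continuous_intros g(1))
  have cH: "continuous_on UNIV H" unfolding H_def by (intro continuous_intros cG)
  have HK: "\<bar>H x\<bar> \<le> K" for x using K0 by (auto simp: H_def)
  have HG: "\<bar>\<phi> x - H x\<bar> \<le> \<bar>\<phi> x - G x\<bar>" for x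
  proof -
    consider "G x > K" | "G x < - K" | "- K \<le> G x \<and> G x \<le> K" by linarith
    then show ?thesis by cases (use K[of x] K0 in \<open>simp_all add: H_def abs_le_iff\<close>)
  qed
  have dec: "(\<Sum>j\<in>J. (real_of_int j / real n) * indicator (A j) x) = real_of_int \<lfloor>real n * \<phi> x\<rfloor> / real n" for x
  proof -
    have "real n * \<phi> x \<le> real n * K" "- real n * K \<le> real n * \<phi> x"
      using K[of x] n mult_left_mono[of "-K" "\<phi> x" "real n"] by (auto simp: abs_le_iff intro!: mult_left_mono)
    then have "\<lfloor>real n * \<phi> x\<rfloor> \<in> J" unfolding J_def by (auto intro!: floor_mono)
    moreover have "(real_of_int j / real n) * indicator (A j) x = (if j = \<lfloor>real n * \<phi> x\<rfloor> then real_of_int j / real n else 0)" for j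
      by (auto simp: A_def)
    ultimately show ?thesis by (simp add: J_def)
  qed
  have pt: "\<bar>\<phi> x - H x\<bar> \<le> 1 / real n + (\<Sum>j\<in>J. \<bar>real_of_int j / real n\<bar> * \<bar>indicator (A j) x - g j x\<bar>)" for x
  proof -
    have "\<bar>\<phi> x - real_of_int \<lfloor>real n * \<phi> x\<rfloor> / real n\<bar> = \<bar>real n * \<phi> x - real_of_int \<lfloor>real n * \<phi> x\<rfloor>\<bar> / real n"
      using n by (simp add: field_simps abs_divide[symmetric] del: abs_divide)
    also have "\<dots> \<le> 1 / real n" using n by (intro divide_right_mono) (auto, linarith)
    finally have 1: "\<bar>\<phi> x - real_of_int \<lfloor>real n * \<phi> x\<rfloor> / real n\<bar> \<le> 1 / real n" .
    have "\<bar>real_of_int \<lfloor>real n * \<phi> x\<rfloor> / real n - G x\<bar> = \<bar>\<Sum>j\<in>J. (real_of_int j / real n) * (indicator (A j) x - g j x)\<bar>"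
      unfolding dec[symmetric] G_def by (simp add: sum_subtractf algebra_simps)
    also have "\<dots> \<le> (\<Sum>j\<in>J. \<bar>real_of_int j / real n\<bar> * \<bar>indicator (A j) x - g j x\<bar>)"
      by (rule order.trans[OF sum_abs]) (simp only: abs_mult order.refl)
    finally show ?thesis using 1 HG[of x] by linarith
  qed
  have main: "(\<integral>x. \<bar>\<phi> x - H x\<bar> \<partial>m) \<le> e"
    if m: "prob_space m" "sets m = sets borel" and gm: "\<And>j. (\<integral>x. \<bar>indicator (A j) x - g j x\<bar> \<partial>m) \<le> e / (2 * S)" for m :: "'a measure"
  proof -
    interpret m: prob_space m by fact
    note [measurable_cong] = m(2)
    have [measurable]: "g j \<in> borel_measurable borel" "H \<in> borel_measurable borel" "A j \<in> sets borel" for j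
      using g(1) cH A by (auto intro: borel_measurable_continuous_onI)
    have i1: "integrable m (\<lambda>x. \<bar>indicator (A j) x - g j x\<bar>)" for j
    proof (rule m.integrable_bounded[where K=2])
      fix x show "\<bar>\<bar>indicator (A j) x - g j x\<bar>\<bar> \<le> 2" using g(2)[of j x] by (cases "x \<in> A j") (simp_all add: abs_le_iff)
    qed measurable
    have i2: "integrable m (\<lambda>x. \<bar>\<phi> x - H x\<bar>)"
    proof (rule m.integrable_bounded[where K="2*K"])
      fix x show "\<bar>\<bar>\<phi> x - H x\<bar>\<bar> \<le> 2 * K" using K[of x] HK[of x] by linarith
    qed measurable
    have "(\<integral>x. \<bar>\<phi> x - H x\<bar> \<partial>m) \<le> (\<integral>x. 1 / real n + (\<Sum>j\<in>J. \<bar>real_of_int j / real n\<bar> * \<bar>indicator (A j) x - g j x\<bar>) \<partial>m)"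
      by (rule integral_mono[OF i2 _ pt]) (use i1 in auto)
    also have "\<dots> = 1 / real n + (\<Sum>j\<in>J. \<bar>real_of_int j / real n\<bar> * (\<integral>x. \<bar>indicator (A j) x - g j x\<bar> \<partial>m))"
      using i1 by (subst Bochner_Integration.integral_add) (auto simp: m.prob_space simp del: abs_divide)
    also have "\<dots> \<le> 1 / real n + (\<Sum>j\<in>J. \<bar>real_of_int j / real n\<bar> * (e / (2 * S)))"
      by (intro add_left_mono sum_mono mult_left_mono gm) auto
    also have "\<dots> = 1 / real n + (S - 1) * (e / (2 * S))" by (simp only: sum_distrib_right[symmetric] S_def add_diff_cancel_right')
    also have "\<dots> \<le> 1 / real n + S * (e / (2 * S))" using S e by (intro add_left_mono mult_right_mono) auto
    also have "\<dots> \<le> e" using n S by simp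
    finally show ?thesis .
  qed
  show ?thesis
    using cH HK main[OF mu g(3)] main[OF pi g(4)] by (intro exI[of _ H]) auto
qed

lemma exp_diff_le:
  fixes a b K :: real
  assumes "\<bar>a\<bar> \<le> K" "\<bar>b\<bar> \<le> K"
  shows "\<bar>exp a - exp b\<bar> \<le> exp K * \<bar>a - b\<bar>"
proof -
  have *: "exp x - exp y \<le> exp K * (x - y)" if "y \<le> x" "x \<le> K" for x y :: real
  proof -
    have "exp x * (1 + (y - x)) \<le> exp x * exp (y - x)" by (intro mult_left_mono exp_ge_add_one_self) auto
    then have "exp x - exp y \<le> exp x * (x - y)" by (simp add: exp_diff algebra_simps)
    also have "\<dots> \<le> exp K * (x - y)" using that by (intro mult_right_mono) auto
    finally show ?thesis .
  qed
  show ?thesis using *[of a b] *[of b a] assms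
    by (cases "a \<le> b") (auto simp: abs_minus_commute abs_le_iff)
qed

text \<open>All approximants share the bound K, so the exponential integrals stay above e^-K and the
  logarithm passes to the limit. This serves the exact flow, which is reached as a pointwise limit
  of trajectories and therefore tested with continuous functions only.\<close>

lemma dual_of_continuous:
  fixes \<mu> \<pi> :: "'a::euclidean_space measure" and \<phi> :: "'a \<Rightarrow> real"
  assumes mu: "prob_space \<mu>" "sets \<mu> = sets borel" and pi: "prob_space \<pi>" "sets \<pi> = sets borel"
    and dual: "\<And>\<phi> K. continuous_on UNIV \<phi> \<Longrightarrow> (\<And>x. \<bar>\<phi> x\<bar> \<le> K) \<Longrightarrow>
        (\<integral>x. \<phi> x \<partial>\<mu>) \<le> c + ln (\<integral>x. exp (\<phi> x) \<partial>\<pi>)"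
    and phi[measurable]: "\<phi> \<in> borel_measurable borel" and K: "\<And>x. \<bar>\<phi> x\<bar> \<le> K"
  shows "(\<integral>x. \<phi> x \<partial>\<mu>) \<le> c + ln (\<integral>x. exp (\<phi> x) \<partial>\<pi>)"
proof -
  interpret mu: prob_space \<mu> by fact
  interpret pi: prob_space \<pi> by fact
  note [measurable_cong] = mu(2) pi(2)
  have "\<forall>n. \<exists>g::'a \<Rightarrow> real. continuous_on UNIV g \<and> (\<forall>x. \<bar>g x\<bar> \<le> K) \<and>
     (\<integral>x. \<bar>\<phi> x - g x\<bar> \<partial>\<mu>) \<le> 1 / real (Suc n) \<and> (\<integral>x. \<bar>\<phi> x - g x\<bar> \<partial>\<pi>) \<le> 1 / real (Suc n)"
    by (intro allI bounded_measurable_approx_continuous[OF mu pi phi K]) auto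
  from choice[OF this] obtain g where "\<forall>n. continuous_on UNIV (g n) \<and> (\<forall>x. \<bar>g n x\<bar> \<le> K) \<and>
     (\<integral>x. \<bar>\<phi> x - g n x\<bar> \<partial>\<mu>) \<le> 1 / real (Suc n) \<and> (\<integral>x. \<bar>\<phi> x - g n x\<bar> \<partial>\<pi>) \<le> 1 / real (Suc n)" ..
  then have g: "\<And>n. continuous_on UNIV (g n)" "\<And>n x. \<bar>g n x\<bar> \<le> K"
     "\<And>n. (\<integral>x. \<bar>\<phi> x - g n x\<bar> \<partial>\<mu>) \<le> 1 / real (Suc n)" "\<And>n. (\<integral>x. \<bar>\<phi> x - g n x\<bar> \<partial>\<pi>) \<le> 1 / real (Suc n)"
    by blast+
  have [measurable]: "g n \<in> borel_measurable borel" for n using g(1) by (rule borel_measurable_continuous_onI)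
  have i1: "integrable \<mu> \<phi>" "integrable \<mu> (g n)" for n
    by (rule mu.integrable_bounded[where K=K], use K g(2) in auto)+
  have e1: "exp (\<phi> x) \<le> exp K" "exp (g n x) \<le> exp K" "exp (-K) \<le> exp (\<phi> x)" "exp (-K) \<le> exp (g n x)" for n x
    using K[of x] g(2)[of n x] by (auto simp: abs_le_iff)
  have i2: "integrable \<pi> (\<lambda>x. exp (\<phi> x))" "integrable \<pi> (\<lambda>x. exp (g n x))" "integrable \<pi> (\<lambda>x. \<bar>\<phi> x - g n x\<bar>)" for n
  proof -
    show "integrable \<pi> (\<lambda>x. exp (\<phi> x))" "integrable \<pi> (\<lambda>x. exp (g n x))"
      by (rule pi.integrable_bounded[where K="exp K"], use e1 in auto)+
    show "integrable \<pi> (\<lambda>x. \<bar>\<phi> x - g n x\<bar>)"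
    proof (rule pi.integrable_bounded[where K="2*K"])
      fix x show "\<bar>\<bar>\<phi> x - g n x\<bar>\<bar> \<le> 2 * K" using K[of x] g(2)[of n x] by linarith
    qed measurable
  qed
  have z: "(\<lambda>n. C * (1 / real (Suc n))) \<longlonglongrightarrow> 0" for C
    using tendsto_mult_right_zero[OF LIMSEQ_inverse_real_of_nat] by (simp add: inverse_eq_divide)
  have l1: "(\<lambda>n. integral\<^sup>L \<mu> (g n)) \<longlonglongrightarrow> integral\<^sup>L \<mu> \<phi>"
  proof (rule LIM_zero_cancel, rule Lim_null_comparison[OF _ z[of 1]])
    show "\<forall>\<^sub>F n in sequentially. norm (integral\<^sup>L \<mu> (g n) - integral\<^sup>L \<mu> \<phi>) \<le> 1 * (1 / real (Suc n))"
    proof (rule always_eventually, rule allI)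
      fix n
      have "\<bar>integral\<^sup>L \<mu> (g n) - integral\<^sup>L \<mu> \<phi>\<bar> = \<bar>\<integral>x. \<phi> x - g n x \<partial>\<mu>\<bar>" using i1 by simp
      also have "\<dots> \<le> (\<integral>x. \<bar>\<phi> x - g n x\<bar> \<partial>\<mu>)" by (rule integral_abs_bound)
      finally show "norm (integral\<^sup>L \<mu> (g n) - integral\<^sup>L \<mu> \<phi>) \<le> 1 * (1 / real (Suc n))" using g(3)[of n] by simp
    qed
  qed
  have l2: "(\<lambda>n. \<integral>x. exp (g n x) \<partial>\<pi>) \<longlonglongrightarrow> (\<integral>x. exp (\<phi> x) \<partial>\<pi>)"
  proof (rule LIM_zero_cancel, rule Lim_null_comparison[OF _ z[of "exp K"]])
    show "\<forall>\<^sub>F n in sequentially. norm ((\<integral>x. exp (g n x) \<partial>\<pi>) - (\<integral>x. exp (\<phi> x) \<partial>\<pi>)) \<le> exp K * (1 / real (Suc n))"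
    proof (rule always_eventually, rule allI)
      fix n
      have "\<bar>(\<integral>x. exp (g n x) \<partial>\<pi>) - (\<integral>x. exp (\<phi> x) \<partial>\<pi>)\<bar> = \<bar>\<integral>x. exp (\<phi> x) - exp (g n x) \<partial>\<pi>\<bar>" using i2 by simp
      also have "\<dots> \<le> (\<integral>x. \<bar>exp (\<phi> x) - exp (g n x)\<bar> \<partial>\<pi>)" by (rule integral_abs_bound)
      also have "\<dots> \<le> (\<integral>x. exp K * \<bar>\<phi> x - g n x\<bar> \<partial>\<pi>)"
        by (rule integral_mono) (use i2 exp_diff_le[OF K g(2)] in auto)
      also have "\<dots> = exp K * (\<integral>x. \<bar>\<phi> x - g n x\<bar> \<partial>\<pi>)" by simp
      also have "\<dots> \<le> exp K * (1 / real (Suc n))" by (intro mult_left_mono g(4)) auto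
      finally show "norm ((\<integral>x. exp (g n x) \<partial>\<pi>) - (\<integral>x. exp (\<phi> x) \<partial>\<pi>)) \<le> exp K * (1 / real (Suc n))" by simp
    qed
  qed
  have "(\<integral>x. exp (-K) \<partial>\<pi>) \<le> (\<integral>x. exp (\<phi> x) \<partial>\<pi>)" by (rule integral_mono[OF _ i2(1)]) (use e1 in auto)
  then have "exp (-K) \<le> (\<integral>x. exp (\<phi> x) \<partial>\<pi>)" by (simp add: pi.prob_space)
  then have ne: "(\<integral>x. exp (\<phi> x) \<partial>\<pi>) \<noteq> 0" using exp_gt_zero[of "-K"] by linarith
  show ?thesis
    by (rule LIMSEQ_le[OF l1 tendsto_add[OF tendsto_const tendsto_ln[OF l2 ne]]]) (use dual[OF g(1) g(2)] in auto)
qed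

section \<open>Gaussian integrals\<close>

definition gauss_density :: "'a::euclidean_space \<Rightarrow> real" where
  "gauss_density v = (2 * pi) powr (- real DIM('a) / 2) * exp (- (norm v)\<^sup>2 / 2)"

lemma gauss_density_pos[simp]: "0 < gauss_density v" and gauss_density_nonneg[simp]: "0 \<le> gauss_density v"
  by (simp_all add: gauss_density_def)

lemma gauss_density_measurable[measurable]: "gauss_density \<in> borel_measurable borel"
  unfolding gauss_density_def[abs_def] by measurable

lemma std_gauss_eq: "std_gauss = density lborel (\<lambda>v. ennreal (gauss_density v))"
  by (simp add: std_gauss_def gauss_density_def)

lemma sets_std_gauss[simp, measurable_cong]: "sets std_gauss = sets borel"
  by (simp add: std_gauss_def)

lemma space_std_gauss[simp]: "space std_gauss = UNIV"
  by (simp add: std_gauss_def)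

lemma gauss_density_prod: "gauss_density v = (\<Prod>b\<in>Basis. normal_density 0 1 (v \<bullet> b))" for v :: "'a::euclidean_space"
proof -
  have n: "(norm v)\<^sup>2 = (\<Sum>b\<in>Basis. (v \<bullet> b)\<^sup>2)"
    unfolding power2_norm_eq_inner by (subst euclidean_inner) (simp add: power2_eq_square)
  have "(2 * pi) powr (- real DIM('a) / 2) = (1 / sqrt (2 * pi)) ^ DIM('a)"
  proof -
    have "(2 * pi) powr (real DIM('a) / 2) = ((2 * pi) powr (1 / 2)) powr (real DIM('a))"
      by (simp add: powr_powr)
    also have "\<dots> = sqrt (2 * pi) ^ DIM('a)" by (simp add: powr_half_sqrt powr_realpow)
    finally have "inverse ((2 * pi) powr (real DIM('a) / 2)) = inverse (sqrt (2 * pi) ^ DIM('a))" by (rule arg_cong)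
    moreover have "(2 * pi) powr (- real DIM('a) / 2) = inverse ((2 * pi) powr (real DIM('a) / 2))"
      unfolding powr_minus[symmetric] by simp
    ultimately show ?thesis unfolding power_one_over by (simp only: inverse_eq_divide)
  qed
  moreover have "exp (- (norm v)\<^sup>2 / 2) = (\<Prod>b\<in>Basis. exp (- ((v \<bullet> b)\<^sup>2) / 2))"
    by (simp add: n exp_sum[symmetric] sum_divide_distrib sum_negf)
  ultimately show ?thesis
    by (simp add: gauss_density_def normal_density_def prod_dividef power_divide)
qed

lemma prob_space_std_gauss: "prob_space (std_gauss :: 'a::euclidean_space measure)"
proof
  have "emeasure (std_gauss :: 'a measure) (space std_gauss) = (\<integral>\<^sup>+v. ennreal (gauss_density (v::'a)) \<partial>lborel)"
    by (simp add: std_gauss_eq emeasure_density)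
  also have "\<dots> = (\<integral>\<^sup>+v. (\<Prod>b\<in>Basis. ennreal (normal_density 0 1 ((v::'a) \<bullet> b))) \<partial>lborel)"
    by (simp add: gauss_density_prod prod_ennreal)
  also have "\<dots> = (\<Prod>b\<in>(Basis::'a set). \<integral>\<^sup>+x. ennreal (normal_density 0 1 x) \<partial>lborel)"
    by (rule nn_integral_lborel_prod) auto
  also have "(\<integral>\<^sup>+x. ennreal (normal_density 0 1 x) \<partial>lborel) = 1"
    by (subst nn_integral_eq_integral) auto
  finally show "emeasure (std_gauss :: 'a measure) (space std_gauss) = 1" by simp
qed

lemma integrable_std_gauss_iff:
  fixes F :: "'a::euclidean_space \<Rightarrow> real"
  assumes [measurable]: "F \<in> borel_measurable borel"
  shows "integrable std_gauss F \<longleftrightarrow> integrable lborel (\<lambda>v. gauss_density v * F v)"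
  unfolding std_gauss_eq by (subst integrable_density) auto

lemma integral_std_gauss:
  fixes F :: "'a::euclidean_space \<Rightarrow> real"
  assumes [measurable]: "F \<in> borel_measurable borel"
  shows "integral\<^sup>L std_gauss F = (\<integral>v. gauss_density v * F v \<partial>lborel)"
  unfolding std_gauss_eq by (subst integral_density) auto


text \<open>Completing the square turns e^(cx) times the normal density into e^(c^2/2) times the
  density with mean c; the absolute value is handled by c = a and c = -a together.\<close>

lemma nn_integral_normal_exp_abs: "(\<integral>\<^sup>+x. ennreal (normal_density 0 1 x * exp (a * \<bar>x\<bar>)) \<partial>lborel) < \<infinity>"
proof -
  have e: "normal_density 0 1 x * exp (c * x) = exp (c\<^sup>2 / 2) * normal_density c 1 x" for c x :: real
    by (simp add: normal_density_def exp_add[symmetric] power2_diff field_simps)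
  have i: "integrable lborel (\<lambda>x. exp (a\<^sup>2 / 2) * normal_density a 1 x + exp (a\<^sup>2 / 2) * normal_density (- a) 1 x)"
    by (intro Bochner_Integration.integrable_add integrable_mult_right) auto
  have "(\<integral>\<^sup>+x. ennreal (normal_density 0 1 x * exp (a * \<bar>x\<bar>)) \<partial>lborel)
     \<le> (\<integral>\<^sup>+x. ennreal (exp (a\<^sup>2 / 2) * normal_density a 1 x + exp (a\<^sup>2 / 2) * normal_density (- a) 1 x) \<partial>lborel)"
  proof (intro nn_integral_mono ennreal_leI)
    fix x :: real
    have "normal_density 0 1 x * exp (a * \<bar>x\<bar>) \<le> normal_density 0 1 x * (exp (a * x) + exp (- a * x))"
      by (intro mult_left_mono) (auto simp: abs_if)
    also have "\<dots> = exp (a\<^sup>2 / 2) * normal_density a 1 x + exp (a\<^sup>2 / 2) * normal_density (- a) 1 x"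
      using e[of x a] e[of x "-a"] by (simp add: distrib_left)
    finally show "normal_density 0 1 x * exp (a * \<bar>x\<bar>) \<le> exp (a\<^sup>2 / 2) * normal_density a 1 x + exp (a\<^sup>2 / 2) * normal_density (- a) 1 x" .
  qed
  also have "\<dots> < \<infinity>" using i by (subst nn_integral_eq_integral) auto
  finally show ?thesis .
qed

text \<open>For a \<ge> 0 the norm is dominated by the sum of the absolute coordinates, after which
  the integral factors; the general case is dominated by |a|.\<close>

lemma integrable_gauss_density_exp: "integrable lborel (\<lambda>v::'a::euclidean_space. gauss_density v * exp (a * norm v))"
proof -
  have *: "integrable lborel (\<lambda>v::'a. gauss_density v * exp (a * norm v))" if a: "a \<ge> 0" for a
  proof (rule integrableI_nonneg)
    have "(\<integral>\<^sup>+v. ennreal (gauss_density (v::'a) * exp (a * norm v)) \<partial>lborel)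
       \<le> (\<integral>\<^sup>+v. (\<Prod>b\<in>Basis. ennreal (normal_density 0 1 ((v::'a) \<bullet> b) * exp (a * \<bar>v \<bullet> b\<bar>))) \<partial>lborel)"
    proof (intro nn_integral_mono)
      fix v :: 'a
      have "gauss_density v * exp (a * norm v) \<le> gauss_density v * exp (a * (\<Sum>b\<in>Basis. \<bar>v \<bullet> b\<bar>))"
        using a by (intro mult_left_mono) (auto intro!: mult_left_mono norm_le_l1)
      also have "\<dots> = (\<Prod>b\<in>Basis. normal_density 0 1 (v \<bullet> b) * exp (a * \<bar>v \<bullet> b\<bar>))"
        by (simp add: gauss_density_prod prod.distrib exp_sum[symmetric] sum_distrib_left)
      finally show "ennreal (gauss_density v * exp (a * norm v)) \<le> (\<Prod>b\<in>Basis. ennreal (normal_density 0 1 (v \<bullet> b) * exp (a * \<bar>v \<bullet> b\<bar>)))"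
        by (simp add: prod_ennreal ennreal_leI)
    qed
    also have "\<dots> = (\<Prod>b\<in>(Basis::'a set). \<integral>\<^sup>+x. ennreal (normal_density 0 1 x * exp (a * \<bar>x\<bar>)) \<partial>lborel)"
      by (rule nn_integral_lborel_prod) auto
    also have "\<dots> < \<infinity>" using nn_integral_normal_exp_abs[of a] by (simp add: power_less_top_ennreal)
    finally show "(\<integral>\<^sup>+v. ennreal (gauss_density (v::'a) * exp (a * norm v)) \<partial>lborel) < \<infinity>" .
  qed auto
  show ?thesis
    by (rule Bochner_Integration.integrable_bound[OF *[of "\<bar>a\<bar>"]]) (auto intro!: mult_left_mono mult_right_mono AE_I2)
qed

lemma integrable_std_gauss_exp_growth:
  fixes F :: "'a::euclidean_space \<Rightarrow> real"
  assumes F[measurable]: "F \<in> borel_measurable borel" and bd: "\<And>v. \<bar>F v\<bar> \<le> C * exp (a * norm v)"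
  shows "integrable std_gauss F"
  unfolding integrable_std_gauss_iff[OF F]
proof (rule Bochner_Integration.integrable_bound[OF integrable_mult_right[OF integrable_gauss_density_exp[of a], of C]])
  show "AE v in lborel. norm (gauss_density v * F v) \<le> norm (C * (gauss_density v * exp (a * norm v)))"
  proof (rule AE_I2)
    fix v :: 'a
    have "norm (gauss_density v * F v) \<le> gauss_density v * (C * exp (a * norm v))" using bd[of v] by (simp add: abs_mult mult_left_mono)
    then show "norm (gauss_density v * F v) \<le> norm (C * (gauss_density v * exp (a * norm v)))" using abs_ge_self[of "C * (gauss_density v * exp (a * norm v))"] by (simp add: ac_simps)
  qed
qed auto

text \<open>Translation invariance of Lebesgue measure. Letting the increment tend to 0 shows that
  directional derivatives integrate to 0, without any integration along lines.\<close>

lemma gauss_integral_translation_quotient: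
  fixes F :: "'a::euclidean_space \<Rightarrow> real"
  assumes F: "integrable lborel F"
  shows "(\<integral>v. (F (v + c) - F v) / t \<partial>lborel) = 0" "integrable lborel (\<lambda>v. (F (v + c) - F v) / t)"
proof -
  have [measurable]: "F \<in> borel_measurable borel" using F by auto
  have i: "integrable (distr lborel borel ((+) c)) F" using F by (simp add: lborel_distr_plus)
  then have i2: "integrable lborel (\<lambda>v. F (v + c))" by (subst (asm) integrable_distr_eq) (auto simp: add.commute)
  have "integral\<^sup>L (distr lborel borel ((+) c)) F = (\<integral>v. F (c + v) \<partial>lborel)" by (rule integral_distr) auto
  then have "(\<integral>v. F (v + c) \<partial>lborel) = integral\<^sup>L lborel F" by (simp add: lborel_distr_plus add.commute)
  then show "(\<integral>v. (F (v + c) - F v) / t \<partial>lborel) = 0" using i2 F by simp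
  show "integrable lborel (\<lambda>v. (F (v + c) - F v) / t)" using i2 F by simp
qed

text \<open>The cross term costs at most |v|, and s^2/2 only helps. The bound is uniform in s, as
  needed to dominate difference quotients.\<close>

lemma gauss_density_shift_le:
  assumes "0 \<le> s" "s \<le> 1" "norm b = 1"
  shows "gauss_density (v + s *\<^sub>R b) \<le> gauss_density v * exp (norm v)"
proof -
  have n: "(norm (v + s *\<^sub>R b))\<^sup>2 = (norm v)\<^sup>2 + 2 * s * (v \<bullet> b) + s\<^sup>2"
    unfolding power2_norm_eq_inner using assms
    by (simp add: inner_add_left inner_add_right inner_commute[of b v] power2_eq_square norm_eq_1 distrib_left)
  have "\<bar>v \<bullet> b\<bar> \<le> norm v" using Cauchy_Schwarz_ineq2[of v b] assms by simp
  then have "\<bar>s * (v \<bullet> b)\<bar> \<le> norm v" using assms mult_mono[of s 1 "\<bar>v \<bullet> b\<bar>" "norm v"] by (simp add: abs_mult)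
  then have "- (norm (v + s *\<^sub>R b))\<^sup>2 / 2 \<le> - (norm v)\<^sup>2 / 2 + norm v"
  proof -
    define q p w where "q = s\<^sup>2" and "p = s * (v \<bullet> b)" and "w = (norm v)\<^sup>2"
    have "0 \<le> q" "- p \<le> norm v" using \<open>\<bar>s * (v \<bullet> b)\<bar> \<le> norm v\<close> by (simp_all add: q_def p_def abs_le_iff)
    moreover have "(norm (v + s *\<^sub>R b))\<^sup>2 = w + 2 * p + q" unfolding n by (simp add: q_def p_def w_def)
    ultimately show ?thesis unfolding w_def[symmetric] by simp
  qed
  then have "exp (- (norm (v + s *\<^sub>R b))\<^sup>2 / 2) \<le> exp (- (norm v)\<^sup>2 / 2) * exp (norm v)"
    unfolding exp_add[symmetric] by simp
  then show ?thesis by (simp add: gauss_density_def mult.assoc mult_left_mono)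
qed

lemma gauss_density_has_derivative: "(gauss_density has_derivative (\<lambda>u. - (gauss_density v * (v \<bullet> u)))) (at v)"
  unfolding gauss_density_def[abs_def] power2_norm_eq_inner
  by (auto intro!: derivative_eq_intros simp: inner_commute)

text \<open>For the density times G, difference quotients along b have integral 0, converge to
  \<open>D\<close>, and are dominated by \<open>B\<close> through the mean value theorem. The
  integral of \<open>D\<close> is the difference of the two sides.\<close>

lemma gaussian_integration_by_parts_direction:
  fixes G :: "'a::euclidean_space \<Rightarrow> real"
  assumes der: "\<And>v. (G has_derivative G' v) (at v)"
    and meas[measurable]: "(\<lambda>v. G' v b) \<in> borel_measurable borel"
    and gr: "\<And>v. \<bar>G v\<bar> \<le> C * exp (a * norm v)" "\<And>v. \<bar>G' v b\<bar> \<le> C * exp (a * norm v)"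
    and a: "0 \<le> a" and b: "norm b = 1"
  shows "(\<integral>v. (v \<bullet> b) * G v \<partial>std_gauss) = (\<integral>v. G' v b \<partial>std_gauss)"
    and "integrable std_gauss (\<lambda>v. (v \<bullet> b) * G v)" and "integrable std_gauss (\<lambda>v. G' v b)"
proof -
  have [measurable]: "G \<in> borel_measurable borel"
    using der by (intro borel_measurable_continuous_onI) (meson has_derivative_continuous continuous_at_imp_continuous_on)
  have C: "0 \<le> C" using gr(1)[of 0] by simp
  have ne: "norm v \<le> exp (norm v)" for v :: 'a using exp_ge_add_one_self[of "norm v"] by linarith
  have vb: "\<bar>v \<bullet> b\<bar> \<le> norm v" for v using Cauchy_Schwarz_ineq2[of v b] b by simp
  have vG: "\<bar>(v \<bullet> b) * G v\<bar> \<le> C * exp ((a + 1) * norm v)" for v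
  proof -
    have "\<bar>(v \<bullet> b) * G v\<bar> \<le> exp (norm v) * (C * exp (a * norm v))"
      unfolding abs_mult using vb[of v] ne[of v] gr(1)[of v] by (intro mult_mono) auto
    then show ?thesis by (simp add: exp_add[symmetric] algebra_simps)
  qed
  show I1: "integrable std_gauss (\<lambda>v. (v \<bullet> b) * G v)" by (rule integrable_std_gauss_exp_growth[OF _ vG]) measurable
  show I2: "integrable std_gauss (\<lambda>v. G' v b)" by (rule integrable_std_gauss_exp_growth[OF _ gr(2)]) measurable
  have I3: "integrable std_gauss G" by (rule integrable_std_gauss_exp_growth[OF _ gr(1)]) measurable
  define F where "F v = gauss_density v * G v" for v
  define D where "D v = gauss_density v * (G' v b - (v \<bullet> b) * G v)" for v
  have Fi: "integrable lborel F" using I3 unfolding F_def[abs_def] by (subst (asm) integrable_std_gauss_iff) auto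
  have [measurable]: "F \<in> borel_measurable borel" "D \<in> borel_measurable borel" unfolding F_def D_def by measurable
  have dF: "((\<lambda>s. F (v + s *\<^sub>R b)) has_real_derivative D (v + s *\<^sub>R b)) (at s)" for v s
  proof -
    have "(F has_derivative (\<lambda>u. gauss_density w * G' w u + (- (gauss_density w * (w \<bullet> u))) * G w)) (at w)" for w
      unfolding F_def by (intro has_derivative_mult gauss_density_has_derivative der)
    moreover have "((\<lambda>s. v + s *\<^sub>R b) has_derivative (\<lambda>r. r *\<^sub>R b)) (at s)" by (auto intro!: derivative_eq_intros)
    ultimately have H: "((\<lambda>s. F (v + s *\<^sub>R b)) has_derivative (\<lambda>r. gauss_density (v + s *\<^sub>R b) * G' (v + s *\<^sub>R b) (r *\<^sub>R b) + (- (gauss_density (v + s *\<^sub>R b) * ((v + s *\<^sub>R b) \<bullet> (r *\<^sub>R b)))) * G (v + s *\<^sub>R b))) (at s)"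
      by (rule has_derivative_compose[rotated])
    have "G' w (r *\<^sub>R b) = r * G' w b" for w r
      using linear_scale[OF has_derivative_linear[OF der[of w]]] by simp
    then show ?thesis
      unfolding has_field_derivative_def by (intro has_derivative_eq_rhs[OF H]) (auto simp: D_def algebra_simps fun_eq_iff)
  qed
  \<comment> \<open>The factor 2 counts the two terms of \<open>D\<close>; e^a arises because the
    shifted point has norm at most |v| + 1; in a + 2, the shifted density and the factor |w . b|
    cost one e^|v| each.\<close>
  define B where "B v = (2 * C * exp a) * (gauss_density v * exp ((a + 2) * norm v))" for v :: 'a
  have DB: "\<bar>D (v + s *\<^sub>R b)\<bar> \<le> B v" if s: "0 \<le> s" "s \<le> 1" for v s
  proof -
    let ?w = "v + s *\<^sub>R b"
    have "norm ?w \<le> norm v + norm (s *\<^sub>R b)" by (rule norm_triangle_ineq)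
    then have w: "norm ?w \<le> norm v + 1" using s b by simp
    have "\<bar>?w \<bullet> b\<bar> \<le> norm ?w" by (rule vb)
    also have "\<dots> \<le> exp (norm v)" using w exp_ge_add_one_self[of "norm v"] by linarith
    finally have wb: "\<bar>?w \<bullet> b\<bar> \<le> exp (norm v)" .
    have ew: "C * exp (a * norm ?w) \<le> C * (exp a * exp (a * norm v))"
      unfolding exp_add[symmetric] using w a C mult_left_mono[OF w a] by (intro mult_left_mono) (auto simp: algebra_simps)
    have "\<bar>G' ?w b - (?w \<bullet> b) * G ?w\<bar> \<le> \<bar>G' ?w b\<bar> + \<bar>?w \<bullet> b\<bar> * \<bar>G ?w\<bar>"
      unfolding abs_mult[symmetric] by (rule abs_triangle_ineq4)
    also have "\<dots> \<le> C * (exp a * exp (a * norm v)) + exp (norm v) * (C * (exp a * exp (a * norm v)))"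
      using gr[of ?w] ew wb by (intro add_mono mult_mono) auto
    also have "\<dots> \<le> exp (norm v) * (C * (exp a * exp (a * norm v))) + exp (norm v) * (C * (exp a * exp (a * norm v)))"
      using C mult_right_mono[of 1 "exp (norm v)" "C * (exp a * exp (a * norm v))"] by (intro add_right_mono) simp
    finally have "\<bar>D ?w\<bar> \<le> (gauss_density v * exp (norm v)) * (exp (norm v) * (C * (exp a * exp (a * norm v))) + exp (norm v) * (C * (exp a * exp (a * norm v))))"
      unfolding D_def abs_mult using gauss_density_shift_le[OF s b, of v] C by (intro mult_mono) auto
    also have "\<dots> = B v" by (simp add: B_def exp_add[symmetric] algebra_simps)
    finally show ?thesis .
  qed
  have Bi: "integrable lborel B" unfolding B_def by (intro integrable_mult_right integrable_gauss_density_exp)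
  have lim: "(\<lambda>n. \<integral>v. (F (v + inverse (real (Suc n)) *\<^sub>R b) - F v) / inverse (real (Suc n)) \<partial>lborel) \<longlonglongrightarrow> integral\<^sup>L lborel D"
  proof (rule integral_dominated_convergence[where w=B and f=D and s="\<lambda>n v. (F (v + inverse (real (Suc n)) *\<^sub>R b) - F v) / inverse (real (Suc n))"])
    show "integrable lborel B" by (rule Bi)
    show "AE v in lborel. (\<lambda>n. (F (v + inverse (real (Suc n)) *\<^sub>R b) - F v) / inverse (real (Suc n))) \<longlonglongrightarrow> D v"
    proof (rule AE_I2)
      fix v
      have "(\<lambda>h. (F (v + h *\<^sub>R b) - F v) / h) \<midarrow>0\<rightarrow> D v"
        using dF[of v 0] by (simp add: DERIV_def)
      moreover have "filterlim (\<lambda>n. inverse (real (Suc n))) (at 0) sequentially"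
        using LIMSEQ_inverse_real_of_nat by (rule filterlim_atI) auto
      ultimately show "(\<lambda>n. (F (v + inverse (real (Suc n)) *\<^sub>R b) - F v) / inverse (real (Suc n))) \<longlonglongrightarrow> D v"
        by (rule filterlim_compose)
    qed
    fix n
    show "AE v in lborel. norm ((F (v + inverse (real (Suc n)) *\<^sub>R b) - F v) / inverse (real (Suc n))) \<le> B v"
    proof (rule AE_I2)
      fix v
      let ?h = "inverse (real (Suc n))"
      have h: "0 < ?h" "?h \<le> 1" by (auto simp: field_simps)
      obtain z where z: "0 < z" "z < ?h" "F (v + ?h *\<^sub>R b) - F (v + 0 *\<^sub>R b) = (?h - 0) * D (v + z *\<^sub>R b)"
        using MVT2[OF h(1), of "\<lambda>s. F (v + s *\<^sub>R b)" "\<lambda>s. D (v + s *\<^sub>R b)"] dF by blast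
      then have "(F (v + ?h *\<^sub>R b) - F v) / ?h = D (v + z *\<^sub>R b)" using h by (simp add: field_simps)
      then show "norm ((F (v + ?h *\<^sub>R b) - F v) / ?h) \<le> B v" using DB[of z v] z h by simp
    qed
  qed measurable
  have "integral\<^sup>L lborel D = 0"
    using lim unfolding gauss_integral_translation_quotient(1)[OF Fi] by (rule LIMSEQ_unique[OF _ tendsto_const])
  moreover have "integral\<^sup>L lborel D = (\<integral>v. gauss_density v * G' v b \<partial>lborel) - (\<integral>v. gauss_density v * ((v \<bullet> b) * G v) \<partial>lborel)"
    using I1 I2 unfolding D_def[abs_def] by (simp add: integrable_std_gauss_iff right_diff_distrib)
  ultimately show "(\<integral>v. (v \<bullet> b) * G v \<partial>std_gauss) = (\<integral>v. G' v b \<partial>std_gauss)"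
    by (simp add: integral_std_gauss)
qed

text \<open>Stein's identity, summed over an orthonormal basis. Exponential growth is stable under
  multiplication by polynomials, so the same form covers the Gaussian moments and the velocity
  shift.\<close>

lemma gaussian_integration_by_parts:
  fixes g :: "'a::euclidean_space \<Rightarrow> 'a"
  assumes der: "\<And>v. (g has_derivative g' v) (at v)"
    and meas[measurable]: "\<And>b. b \<in> Basis \<Longrightarrow> (\<lambda>v. g' v b \<bullet> b) \<in> borel_measurable borel"
    and gr: "\<And>v. norm (g v) \<le> C * exp (a * norm v)" "\<And>v b. b \<in> Basis \<Longrightarrow> norm (g' v b) \<le> C * exp (a * norm v)"
    and a: "0 \<le> a"
  shows "(\<integral>v. v \<bullet> g v \<partial>std_gauss) = (\<integral>v. (\<Sum>b\<in>Basis. g' v b \<bullet> b) \<partial>std_gauss)"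
    and "integrable std_gauss (\<lambda>v. v \<bullet> g v)" and "integrable std_gauss (\<lambda>v. \<Sum>b\<in>Basis. g' v b \<bullet> b)"
proof -
  have e: "v \<bullet> g v = (\<Sum>b\<in>Basis. (v \<bullet> b) * (g v \<bullet> b))" for v by (rule euclidean_inner)
  have *: "(\<integral>v. (v \<bullet> b) * (g v \<bullet> b) \<partial>std_gauss) = (\<integral>v. g' v b \<bullet> b \<partial>std_gauss)"
      "integrable std_gauss (\<lambda>v. (v \<bullet> b) * (g v \<bullet> b))" "integrable std_gauss (\<lambda>v. g' v b \<bullet> b)" if b: "b \<in> Basis" for b
  proof -
    have n: "norm b = 1" using b by simp
    have d: "((\<lambda>v. g v \<bullet> b) has_derivative (\<lambda>u. g' v u \<bullet> b)) (at v)" for v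
      by (intro has_derivative_inner_left der)
    have c: "\<bar>g v \<bullet> b\<bar> \<le> C * exp (a * norm v)" "\<bar>g' v b \<bullet> b\<bar> \<le> C * exp (a * norm v)" for v
      using gr(1)[of v] gr(2)[OF b, of v] Basis_le_norm[OF b] by (meson order.trans)+
    note ibp = gaussian_integration_by_parts_direction[where G="\<lambda>v. g v \<bullet> b" and G'="\<lambda>v u. g' v u \<bullet> b" and b=b and C=C and a=a]
    show "(\<integral>v. (v \<bullet> b) * (g v \<bullet> b) \<partial>std_gauss) = (\<integral>v. g' v b \<bullet> b \<partial>std_gauss)"
      by (rule ibp(1)) (use d meas[OF b] c a n in simp_all)
    show "integrable std_gauss (\<lambda>v. (v \<bullet> b) * (g v \<bullet> b))"
      by (rule ibp(2)) (use d meas[OF b] c a n in simp_all)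
    show "integrable std_gauss (\<lambda>v. g' v b \<bullet> b)"
      by (rule ibp(3)) (use d meas[OF b] c a n in simp_all)
  qed
  show "(\<integral>v. v \<bullet> g v \<partial>std_gauss) = (\<integral>v. (\<Sum>b\<in>Basis. g' v b \<bullet> b) \<partial>std_gauss)"
    unfolding e using * by (simp add: Bochner_Integration.integral_sum)
  show "integrable std_gauss (\<lambda>v. v \<bullet> g v)" unfolding e using * by simp
  show "integrable std_gauss (\<lambda>v. \<Sum>b\<in>Basis. g' v b \<bullet> b)" using * by simp
qed

section \<open>Second and fourth moments of the Gaussian law\<close>

lemma norm_power_le_exp: "norm (v::'a::real_normed_vector) ^ k \<le> exp (real k * norm v)"
proof -
  have "norm v \<le> exp (norm v)" using exp_ge_add_one_self[of "norm v"] by linarith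
  then have "norm v ^ k \<le> exp (norm v) ^ k" by (intro power_mono) auto
  then show ?thesis by (simp add: exp_of_nat_mult)
qed

text \<open>Stein's identity for the field v, whose divergence is the dimension.\<close>

lemma std_gauss_moment2:
  "(\<integral>v. (norm (v::'a::euclidean_space))\<^sup>2 \<partial>std_gauss) = real DIM('a)"
proof -
  interpret prob_space "std_gauss :: 'a measure" by (rule prob_space_std_gauss)
  define g :: "'a \<Rightarrow> 'a" where "g v = v" for v
  define g' :: "'a \<Rightarrow> 'a \<Rightarrow> 'a" where "g' v u = u" for v u
  have 1: "(g has_derivative g' v) (at v)" for v by (simp add: g_def[abs_def] g'_def[abs_def])
  have 2: "norm (g v) \<le> 1 * exp (1 * norm v)" for v using norm_power_le_exp[of v 1] by (simp add: g_def)
  have 3: "norm (g' v b) \<le> 1 * exp (1 * norm v)" if "b \<in> Basis" for v b using that by (simp add: g'_def)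
  have 4: "(\<lambda>v. g' v b \<bullet> b) \<in> borel_measurable borel" for b by (simp add: g'_def)
  have "(\<integral>v. v \<bullet> g v \<partial>std_gauss) = (\<integral>v. (\<Sum>b\<in>Basis. g' v b \<bullet> b) \<partial>std_gauss)"
    by (rule gaussian_integration_by_parts(1)[OF 1 4 2 3]) auto
  then show ?thesis using prob_space by (simp add: power2_norm_eq_inner g_def g'_def)
qed

text \<open>Stein's identity for the field |v|^2 v, of divergence (d + 2)|v|^2, reduces the claim to
  the second moment.\<close>

lemma std_gauss_moment4:
  "(\<integral>v. (norm (v::'a::euclidean_space))^4 \<partial>std_gauss) = real DIM('a) * (real DIM('a) + 2)"
proof -
  define g :: "'a \<Rightarrow> 'a" where "g v = (norm v)\<^sup>2 *\<^sub>R v" for v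
  define g' :: "'a \<Rightarrow> 'a \<Rightarrow> 'a" where "g' v u = (2 * (v \<bullet> u)) *\<^sub>R v + (norm v)\<^sup>2 *\<^sub>R u" for v u
  have n4: "v \<bullet> g v = norm v ^ 4" for v
  proof -
    have "norm v ^ 4 = (norm v)\<^sup>2 * (norm v)\<^sup>2" by (simp add: power_add[symmetric])
    also have "\<dots> = (norm v)\<^sup>2 * (v \<bullet> v)" by (simp add: power2_norm_eq_inner)
    finally show ?thesis by (simp add: g_def)
  qed
  have 1: "(g has_derivative g' v) (at v)" for v
    unfolding g_def[abs_def] g'_def[abs_def] power2_norm_eq_inner
    by (auto intro!: derivative_eq_intros simp: inner_commute algebra_simps)
  have 2: "norm (g v) \<le> 3 * exp (3 * norm v)" for v
  proof -
    have "norm (g v) = norm v ^ 3" by (simp add: g_def power2_eq_square power3_eq_cube)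
    also have "\<dots> \<le> exp (3 * norm v)" using norm_power_le_exp[of v 3] by simp
    also have "\<dots> \<le> 3 * exp (3 * norm v)" by simp
    finally show ?thesis .
  qed
  have 3: "norm (g' v b) \<le> 3 * exp (3 * norm v)" if b: "b \<in> Basis" for v b
  proof -
    have "norm (g' v b) \<le> 2 * \<bar>v \<bullet> b\<bar> * norm v + (norm v)\<^sup>2"
      unfolding g'_def using b by (intro order.trans[OF norm_triangle_ineq]) (simp add: abs_mult)
    also have "\<dots> \<le> 2 * norm v * norm v + (norm v)\<^sup>2"
      using Basis_le_norm[OF b, of v] by (intro add_right_mono mult_right_mono) auto
    also have "\<dots> = 3 * norm v ^ 2" by (simp add: power2_eq_square)
    also have "\<dots> \<le> 3 * exp (2 * norm v)" using norm_power_le_exp[of v 2] by simp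
    also have "\<dots> \<le> 3 * exp (3 * norm v)" by simp
    finally show ?thesis .
  qed
  have 4: "(\<lambda>v. g' v b \<bullet> b) \<in> borel_measurable borel" for b unfolding g'_def by measurable
  have 5: "(\<Sum>b\<in>Basis. g' v b \<bullet> b) = (real DIM('a) + 2) * (norm v)\<^sup>2" for v
  proof -
    have "(\<Sum>b\<in>Basis. g' v b \<bullet> b) = 2 * (\<Sum>b\<in>Basis. (v \<bullet> b) * (v \<bullet> b)) + (\<Sum>b\<in>(Basis::'a set). (norm v)\<^sup>2)"
      by (simp add: g'_def inner_add_left sum.distrib sum_distrib_left mult.assoc)
    also have "\<dots> = (real DIM('a) + 2) * (norm v)\<^sup>2"
      by (simp add: euclidean_inner[symmetric] power2_norm_eq_inner algebra_simps)
    finally show ?thesis .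
  qed
  have "(\<integral>v. v \<bullet> g v \<partial>std_gauss) = (\<integral>v. (\<Sum>b\<in>Basis. g' v b \<bullet> b) \<partial>std_gauss)"
    by (rule gaussian_integration_by_parts(1)[OF 1 4 2 3]) auto
  then show ?thesis unfolding n4 5 by (simp add: std_gauss_moment2)
qed

section \<open>Perturbations of the identity and change of variables\<close>

text \<open>A permutation other than the identity moves at least two points, so a vanishing factor
  survives the removal of the index i.\<close>

lemma prod_delta_deriv_zero:
  fixes p :: "'n::finite \<Rightarrow> 'n"
  assumes p: "p permutes UNIV" "p \<noteq> id"
  shows "(\<Prod>j\<in>UNIV - {i}. if j = p j then 1 else (0::real)) = 0"
proof -
  obtain j where j: "p j \<noteq> j" using p(2) by (auto simp: fun_eq_iff)
  have "p (p j) \<noteq> p j" using j p(1) by (metis permutes_inj injD)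
  with j have "\<exists>k. k \<noteq> i \<and> p k \<noteq> k" by (cases "j = i") auto
  then obtain k where k: "k \<noteq> i" "p k \<noteq> k" by blast
  show ?thesis by (rule prod_zero) (use k in \<open>auto intro!: bexI[of _ k]\<close>)
qed

text \<open>In the Leibniz expansion only the identity permutation contributes at first order, which
  leaves the diagonal sum.\<close>

lemma det_id_plus_has_derivative:
  fixes C :: "real^'n^'n"
  shows "((\<lambda>s. det (mat 1 + s *\<^sub>R C)) has_real_derivative trace C) (at 0)"
proof -
  have e: "det (mat 1 + s *\<^sub>R C) = (\<Sum>p\<in>{p. p permutes (UNIV::'n set)}. of_int (sign p) * (\<Prod>i\<in>UNIV. (if i = p i then 1 else 0) + s * C $ i $ p i))" for s
    by (simp add: det_def mat_def)
  have "((\<lambda>s. \<Sum>p\<in>{p. p permutes (UNIV::'n set)}. of_int (sign p) * (\<Prod>i\<in>UNIV. (if i = p i then 1 else 0) + s * C $ i $ p i))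
     has_real_derivative (\<Sum>p\<in>{p. p permutes (UNIV::'n set)}. of_int (sign p) *
        (\<Sum>i\<in>UNIV. C $ i $ p i * (\<Prod>j\<in>UNIV - {i}. if j = p j then 1 else 0)))) (at 0)"
  proof (intro DERIV_sum DERIV_cmult)
    fix p
    have "((\<lambda>s. \<Prod>i\<in>UNIV. (if i = p i then 1 else 0) + s * C $ i $ p i) has_real_derivative
       (\<Sum>i\<in>UNIV. C $ i $ p i * (\<Prod>j\<in>UNIV - {i}. (if j = p j then 1 else 0) + 0 * C $ j $ p j))) (at 0)"
      by (rule has_field_derivative_prod) (auto intro!: derivative_eq_intros)
    then show "((\<lambda>s. \<Prod>i\<in>UNIV. (if i = p i then 1 else 0) + s * C $ i $ p i) has_real_derivative
       (\<Sum>i\<in>UNIV. C $ i $ p i * (\<Prod>j\<in>UNIV - {i}. if j = p j then 1 else 0))) (at 0)" by simp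
  qed
  moreover have "(\<Sum>p\<in>{p. p permutes (UNIV::'n set)}. of_int (sign p) *
        (\<Sum>i\<in>UNIV. C $ i $ p i * (\<Prod>j\<in>UNIV - {i}. if j = p j then 1 else 0))) = trace C"
  proof -
    have "(\<Sum>p\<in>{p. p permutes (UNIV::'n set)}. of_int (sign p) *
        (\<Sum>i\<in>UNIV. C $ i $ p i * (\<Prod>j\<in>UNIV - {i}. if j = p j then 1 else 0)))
       = (\<Sum>p\<in>{id}. of_int (sign p) * (\<Sum>i\<in>UNIV. C $ i $ p i * (\<Prod>j\<in>UNIV - {i}. if j = p j then 1 else 0)))"
      by (rule sum.mono_neutral_right) (auto simp: permutes_id prod_delta_deriv_zero)
    then show ?thesis by (simp add: trace_def sign_id)
  qed
  ultimately show ?thesis unfolding e by simp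
qed

lemma abs_trace_le:
  fixes A :: "real^'n^'n"
  assumes "\<And>v. norm (A *v v) \<le> K * norm v"
  shows "\<bar>trace A\<bar> \<le> real CARD('n) * K"
proof -
  have "\<bar>A $ i $ i\<bar> \<le> K" for i
  proof -
    have "A $ i $ i = (A *v axis i 1) $ i"
      by (simp add: matrix_vector_mult_basis column_def)
    also have "\<bar>\<dots>\<bar> \<le> norm (A *v axis i 1)" by (rule component_le_norm_cart)
    also have "\<dots> \<le> K" using assms[of "axis i 1"] by simp
    finally show ?thesis .
  qed
  then have "\<bar>trace A\<bar> \<le> (\<Sum>i\<in>(UNIV::'n set). K)"
    unfolding trace_def by (intro order.trans[OF sum_abs] sum_mono)
  then show ?thesis by simp
qed

text \<open>Along \<open>A t\<close> = I + tB the logarithmic derivative of the determinant is the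
  trace of \<open>C t\<close>, the inverse of \<open>A t\<close> times B, and tr B - tr
  \<open>C t\<close> = t tr(B \<open>C t\<close>) is of second order. The bound 1/2 on \<kappa>
  keeps the inverse of \<open>A t\<close> below norm 2; integrating 2 t d \<kappa>^2 over [0,1]
  gives the loss d \<kappa>^2.\<close>

lemma det_ge_exp_trace:
  fixes B :: "real^'n^'n"
  assumes B: "\<And>v. norm (B *v v) \<le> \<kappa> * norm v" and k: "\<kappa> \<le> 1/2"
  shows "exp (trace B - real CARD('n) * \<kappa>\<^sup>2) \<le> det (mat 1 + B)"
proof -
  have k0: "0 \<le> \<kappa>" using B[of "axis undefined 1"] norm_ge_zero[of "B *v axis undefined 1"] by (simp del: norm_ge_zero)
  define A where "A t = mat 1 + t *\<^sub>R B" for t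
  have Av: "A t *v v = v + t *\<^sub>R (B *v v)" for t v
    by (simp add: A_def matrix_vector_mult_add_rdistrib scaleR_matrix_vector_assoc)
  have low: "norm v / 2 \<le> norm (A t *v v)" if t: "0 \<le> t" "t \<le> 1" for t v
  proof -
    have "norm (t *\<^sub>R (B *v v)) \<le> 1 * (1/2 * norm v)"
      unfolding norm_scaleR using t k B[of v] mult_right_mono[OF k norm_ge_zero[of v]] by (intro mult_mono) auto
    moreover have "norm v \<le> norm (A t *v v) + norm (t *\<^sub>R (B *v v))"
      unfolding Av by (metis add_diff_cancel norm_triangle_ineq4)
    ultimately show ?thesis by simp
  qed
  have inv: "invertible (A t)" if t: "0 \<le> t" "t \<le> 1" for t
  proof -
    have "inj ((*v) (A t))"
      unfolding vec.inj_iff_eq_0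
      using low[OF t] by (metis divide_le_0_iff norm_eq_zero norm_le_zero_iff not_numeral_le_zero)
    then show ?thesis by (simp add: invertible_left_inverse matrix_left_invertible_injective)
  qed
  define C where "C t = (SOME C. A t ** C = B)" for t
  have AC: "A t ** C t = B" if t: "0 \<le> t" "t \<le> 1" for t
  proof -
    obtain I where "A t ** I = mat 1" using inv[OF t] by (auto simp: invertible_right_inverse)
    then have "A t ** (I ** B) = B" by (simp add: matrix_mul_assoc)
    then show ?thesis unfolding C_def by (rule someI)
  qed
  define \<phi> where "\<phi> t = det (A t)" for t
  \<comment> \<open>Multiplicativity moves the derivative at t to a derivative at the
    identity.\<close>
  have fac: "\<phi> (t + s) = \<phi> t * det (mat 1 + s *\<^sub>R C t)" if t: "0 \<le> t" "t \<le> 1" for t s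
  proof -
    have "A (t + s) = A t + s *\<^sub>R (A t ** C t)" unfolding AC[OF t] by (simp add: A_def algebra_simps)
    also have "\<dots> = A t ** (mat 1 + s *\<^sub>R C t)"
      by (simp add: matrix_add_ldistrib matrix_scalar_ac scalar_matrix_assoc)
    finally show ?thesis by (simp add: \<phi>_def det_mul)
  qed
  have der: "(\<phi> has_real_derivative \<phi> t * trace (C t)) (at t)" if t: "0 \<le> t" "t \<le> 1" for t
  proof -
    have "((\<lambda>s. \<phi> t * det (mat 1 + s *\<^sub>R C t)) has_real_derivative \<phi> t * trace (C t)) (at 0)"
      by (intro DERIV_cmult det_id_plus_has_derivative)
    then have "((\<lambda>s. \<phi> (s + t)) has_real_derivative \<phi> t * trace (C t)) (at 0)"
      by (simp add: fac[OF t, symmetric] add.commute)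
    then show ?thesis using DERIV_at_within_shift[of \<phi> "\<phi> t * trace (C t)" t 0 UNIV] by (simp add: add.commute)
  qed
  have cont: "continuous_on {0..1} \<phi>"
    by (rule DERIV_continuous_on[where D="\<lambda>t. \<phi> t * trace (C t)"]) (auto intro: has_field_derivative_at_within der)
  have nz: "\<phi> t \<noteq> 0" if "0 \<le> t" "t \<le> 1" for t
    using inv[OF that] by (simp add: \<phi>_def invertible_det_nz)
  \<comment> \<open>The determinant starts at 1, and a sign change would force a zero, which
    invertibility excludes.\<close>
  have pos: "\<phi> t > 0" if t: "0 \<le> t" "t \<le> 1" for t
  proof (rule ccontr)
    assume "\<not> \<phi> t > 0"
    moreover have "\<phi> 0 = 1" by (simp add: \<phi>_def A_def)
    moreover have "continuous_on {0..t} \<phi>" using cont by (rule continuous_on_subset) (use t in auto)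
    ultimately obtain s where "0 \<le> s" "s \<le> t" "\<phi> s = 0"
      using IVT2'[of \<phi> t 0 0] t by auto
    then show False using nz[of s] t by auto
  qed
  have CB: "trace B - trace (C t) \<le> t * (real CARD('n) * (2 * \<kappa>\<^sup>2))" if t: "0 \<le> t" "t \<le> 1" for t
  proof -
    have Cv: "B *v v = C t *v v + t *\<^sub>R (B *v (C t *v v))" for v
      using AC[OF t] Av[of t "C t *v v"] by (simp add: matrix_vector_mul_assoc)
    have "norm (C t *v v) \<le> 2 * (\<kappa> * norm v)" for v
      using low[OF t, of "C t *v v"] AC[OF t] B[of v] by (simp add: matrix_vector_mul_assoc)
    then have "norm ((B ** C t) *v v) \<le> \<kappa> * (2 * (\<kappa> * norm v))" for v
      unfolding matrix_vector_mul_assoc[symmetric]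
      using B[of "C t *v v"] mult_left_mono[OF _ k0] by (meson order.trans)
    then have tr: "\<bar>trace (B ** C t)\<bar> \<le> real CARD('n) * (2 * \<kappa>\<^sup>2)"
      by (intro abs_trace_le) (simp add: power2_eq_square ac_simps)
    have "B = C t + t *\<^sub>R (B ** C t)"
      unfolding matrix_eq using Cv by (simp add: matrix_vector_mult_add_rdistrib scaleR_matrix_vector_assoc[symmetric] matrix_vector_mul_assoc)
    then have "trace B = trace (C t + t *\<^sub>R (B ** C t))" by simp
    also have "\<dots> = trace (C t) + t * trace (B ** C t)"
      by (simp add: trace_def sum.distrib sum_distrib_left)
    finally show ?thesis using mult_left_mono[OF tr t(1)] t
      by (smt (verit) mult_left_mono)
  qed
  \<comment> \<open>The exponent makes X monotone: its derivative -tr B + 2 t d \<kappa>^2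
    compensates tr \<open>C t\<close> up to the second-order loss bounded in
    \<open>CB\<close>.\<close>
  define X where "X t = \<phi> t * exp (real CARD('n) * \<kappa>\<^sup>2 * t\<^sup>2 - t * trace B)" for t
  have "X 0 \<le> X 1"
  proof (rule DERIV_nonneg_imp_nondecreasing[OF zero_le_one])
    fix t :: real assume t: "0 \<le> t" "t \<le> 1"
    have "(X has_real_derivative X t * (trace (C t) - trace B + t * (real CARD('n) * (2 * \<kappa>\<^sup>2)))) (at t)"
      unfolding X_def
      by (rule derivative_eq_intros refl der t)+ (simp add: algebra_simps)
    moreover have "0 \<le> X t * (trace (C t) - trace B + t * (real CARD('n) * (2 * \<kappa>\<^sup>2)))"
      using pos[OF t] CB[OF t] by (intro mult_nonneg_nonneg) (auto simp: X_def)
    ultimately show "\<exists>y. (X has_real_derivative y) (at t) \<and> 0 \<le> y" by blast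
  qed
  then have "1 \<le> det (mat 1 + B) * exp (real CARD('n) * \<kappa>\<^sup>2 - trace B)"
    by (simp add: X_def \<phi>_def A_def)
  then show ?thesis by (simp add: exp_diff field_simps)
qed

text \<open>Solving y = x + g x means finding the fixed point of the contraction sending x to y - g
  x.\<close>

lemma bij_id_plus_contraction:
  fixes g :: "'a::{real_normed_vector,complete_space} \<Rightarrow> 'a"
  assumes lip: "\<And>x y. norm (g x - g y) \<le> c * norm (x - y)" and c: "0 \<le> c" "c < 1"
  shows "bij (\<lambda>x. x + g x)"
proof -
  have "\<exists>!x. y - g x = x" for y
    by (rule banach_fix_type[OF c]) (use lip in \<open>auto simp: dist_norm norm_minus_commute\<close>)
  then have "\<exists>!x. y = x + g x" for y by (metis add_diff_cancel_right' diff_add_cancel)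
  then show ?thesis unfolding bij_iff by metis
qed

lemma lipschitz_of_derivative_bound:
  fixes g :: "'a::real_normed_vector \<Rightarrow> 'b::real_normed_vector"
  assumes "\<And>x. (g has_derivative g' x) (at x)" and "\<And>x v. norm (g' x v) \<le> c * norm v" "0 \<le> c"
  shows "norm (g x - g y) \<le> c * norm (x - y)"
  by (rule differentiable_bound[of UNIV g g']) (use assms in \<open>auto intro: onorm_bound has_derivative_at_withinI\<close>)

text \<open>On coordinate space the Jacobian of x + g x is a matrix determinant, estimated by
  \<open>det_ge_exp_trace\<close>. A lower bound on it suffices, since the transformed integral is
  only compared from below, and \<kappa> may vary with x.\<close>

lemma change_of_variables_lower_bound_vec:
  fixes g :: "real^'n::{finite,wellorder} \<Rightarrow> real^'n::_" and F :: "real^'n::_ \<Rightarrow> real"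
  assumes der: "\<And>x. (g has_derivative g' x) (at x)"
    and bd: "\<And>x v. norm (g' x v) \<le> \<kappa> x * norm v" and half: "\<And>x. \<kappa> x \<le> 1/2"
    and F: "F \<in> borel_measurable borel" "\<And>x. 0 \<le> F x" "integrable lborel F"
  shows "(\<integral>\<^sup>+x. ennreal (F (x + g x) * exp ((\<Sum>b\<in>Basis. g' x b \<bullet> b) - real (DIM(real^'n::_)) * (\<kappa> x)\<^sup>2)) \<partial>lborel)
     \<le> (\<integral>\<^sup>+x. ennreal (F x) \<partial>lborel)"
proof -
  have bd2: "norm (g' x v) \<le> 1/2 * norm v" for x v
    using bd[of x v] mult_right_mono[OF half norm_ge_zero] by (rule order.trans)
  have lin: "linear (g' x)" for x using der by (metis has_derivative_linear)
  have bij: "bij (\<lambda>x. x + g x)"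
    by (rule bij_id_plus_contraction[OF lipschitz_of_derivative_bound[OF der bd2]]) auto
  define D where "D x = \<bar>det (matrix (\<lambda>v. v + g' x v))\<bar>" for x
  have dPhi: "((\<lambda>x. x + g x) has_derivative (\<lambda>v. v + g' x v)) (at x within UNIV)" for x
    by (intro derivative_intros) (use der in auto)
  have Fl: "integrable lebesgue F" using F by (simp add: integrable_completion)
  then have "F absolutely_integrable_on UNIV" by (simp add: set_integrable_def)
  \<comment> \<open>The change of variables formula concerns vector-valued integrands, hence the
    detour through one-dimensional vectors.\<close>
  then have "(\<lambda>x. vec (F x) :: real^1) absolutely_integrable_on UNIV"
    by (simp add: absolutely_integrable_on_1_iff)
  then have *: "(\<lambda>x. D x *\<^sub>R (vec (F (x + g x)) :: real^1)) absolutely_integrable_on UNIV \<and>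
      integral UNIV (\<lambda>x. D x *\<^sub>R (vec (F (x + g x)) :: real^1)) = integral UNIV (\<lambda>x. vec (F x))"
    unfolding D_def
    using has_absolute_integral_change_of_variables[of UNIV "\<lambda>x. x + g x" "\<lambda>x v. v + g' x v" "\<lambda>x. vec (F x) :: real^1" "integral UNIV (\<lambda>x. vec (F x))"] dPhi bij
    by (simp add: bij_is_surj bij_is_inj)
  have i: "integrable lebesgue (\<lambda>x. D x * F (x + g x))"
    using conjunct1[OF *] unfolding absolutely_integrable_on_1_iff by (simp add: set_integrable_def)
  have "(\<integral>x. D x * F (x + g x) \<partial>lebesgue) = (\<integral>x. F x \<partial>lebesgue)"
    using * by (simp add: integral_on_1_eq integral_lebesgue[OF i, symmetric] integral_lebesgue[OF Fl, symmetric])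
  then have eq: "(\<integral>\<^sup>+x. ennreal (D x * F (x + g x)) \<partial>lebesgue) = (\<integral>\<^sup>+x. ennreal (F x) \<partial>lebesgue)"
    using i Fl F(2) by (simp add: nn_integral_eq_integral D_def)
  have Dge: "exp ((\<Sum>b\<in>Basis. g' x b \<bullet> b) - real (DIM(real^'n::_)) * (\<kappa> x)\<^sup>2) \<le> D x" for x
  proof -
    have m: "matrix (\<lambda>v. v + g' x v) = mat 1 + matrix (g' x)"
      by (simp add: matrix_def mat_def vec_eq_iff axis_def)
    have "exp (trace (matrix (g' x)) - real CARD('n) * (\<kappa> x)\<^sup>2) \<le> det (mat 1 + matrix (g' x))"
      by (rule det_ge_exp_trace) (use bd half lin in \<open>auto simp: matrix_works\<close>)
    moreover have "trace (matrix (g' x)) = (\<Sum>b\<in>Basis. g' x b \<bullet> b)"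
    proof -
      have B: "(Basis :: (real^'n::_) set) = range (\<lambda>i. axis i 1)" by (auto simp: Basis_vec_def)
      have "inj (\<lambda>i. axis i 1 :: real^'n::_)" by (simp add: inj_def axis_eq_axis)
      then show ?thesis unfolding B by (simp add: sum.reindex trace_def matrix_def inner_axis)
    qed
    ultimately show ?thesis unfolding D_def m by simp
  qed
  have "(\<integral>\<^sup>+x. ennreal (F (x + g x) * exp ((\<Sum>b\<in>Basis. g' x b \<bullet> b) - real (DIM(real^'n::_)) * (\<kappa> x)\<^sup>2)) \<partial>lborel)
     \<le> (\<integral>\<^sup>+x. ennreal (D x * F (x + g x)) \<partial>lborel)"
    by (intro nn_integral_mono ennreal_leI) (use Dge F(2) in \<open>simp add: mult.commute[of "F _"] mult_right_mono\<close>)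
  also have "\<dots> = (\<integral>\<^sup>+x. ennreal (F x) \<partial>lborel)"
    using eq by (simp add: nn_integral_completion)
  finally show ?thesis .
qed

text \<open>An index type with as many elements as the dimension of \<open>'a\<close>, ordered like
  an initial segment of the naturals. Then \<open>real^('a basis_index)\<close> is a coordinate copy
  of \<open>'a\<close> whose index type has the sort required by
  \<open>change_of_variables_lower_bound_vec\<close>.\<close>

typedef (overloaded) ('a::euclidean_space) basis_index = "{..<DIM('a)}"
  by (rule exI[of _ 0]) simp

instance basis_index :: (euclidean_space) finite
proof
  show "finite (UNIV :: 'a basis_index set)"
    by (simp add: type_definition.univ[OF type_definition_basis_index])
qed

instantiation basis_index :: (euclidean_space) wellorder
begin
definition "i \<le> j \<longleftrightarrow> Rep_basis_index i \<le> Rep_basis_index j"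
definition "i < j \<longleftrightarrow> Rep_basis_index i < Rep_basis_index j"
instance
proof
  fix i j k :: "'a basis_index"
  show "(i < j) = (i \<le> j \<and> \<not> j \<le> i)" "i \<le> i" "i \<le> j \<or> j \<le> i" by (auto simp: less_eq_basis_index_def less_basis_index_def)
  show "i \<le> j \<Longrightarrow> j \<le> k \<Longrightarrow> i \<le> k" by (auto simp: less_eq_basis_index_def)
  show "i \<le> j \<Longrightarrow> j \<le> i \<Longrightarrow> i = j" by (auto simp: less_eq_basis_index_def Rep_basis_index_inject)
next
  fix P :: "'a basis_index \<Rightarrow> bool" and a
  assume step: "\<And>x. (\<And>y. y < x \<Longrightarrow> P y) \<Longrightarrow> P x"
  show "P a"
  proof (induct a rule: measure_induct_rule[of Rep_basis_index])
    case (less x)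
    show ?case by (rule step, rule less, unfold less_basis_index_def)
  qed
qed
end

lemma card_basis_index: "CARD('a::euclidean_space basis_index) = DIM('a)"
  using type_definition.card[OF type_definition_basis_index] by simp

text \<open>Any bijection from the indices to \<open>Basis\<close> extends linearly. That basis
  vectors go to basis vectors, beyond the isometry, makes boxes correspond to boxes.\<close>

lemma exists_isometry_vec:
  "\<exists>J :: real^('a::euclidean_space basis_index) \<Rightarrow> 'a. linear J \<and> bij J \<and> (\<forall>x. norm (J x) = norm x) \<and> J ` Basis = Basis"
proof -
  obtain \<beta> :: "'a basis_index \<Rightarrow> 'a" where \<beta>: "bij_betw \<beta> UNIV Basis"
    using finite_same_card_bij[of "UNIV :: 'a basis_index set" "Basis :: 'a set"] by (auto simp: card_basis_index)
  have inj: "inj \<beta>" and im: "\<beta> ` UNIV = Basis" using \<beta> by (auto simp: bij_betw_def)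
  define J :: "real^('a basis_index) \<Rightarrow> 'a" where "J x = (\<Sum>i\<in>UNIV. x $ i *\<^sub>R \<beta> i)" for x
  have lin: "linear J" by (rule linearI) (auto simp: J_def sum.distrib scaleR_add_left scaleR_sum_right)
  have comp: "J x \<bullet> \<beta> i = x $ i" for x i
  proof -
    have "J x \<bullet> \<beta> i = (\<Sum>j\<in>UNIV. x $ j * (if j = i then 1 else 0))"
      unfolding J_def inner_sum_left
    proof (rule sum.cong)
      fix j
      have "\<beta> j \<in> Basis" "\<beta> i \<in> Basis" using im by auto
      then have "\<beta> j \<bullet> \<beta> i = (if j = i then 1 else 0)" by (simp add: inner_Basis inj_eq[OF inj])
      then show "x $ j *\<^sub>R \<beta> j \<bullet> \<beta> i = x $ j * (if j = i then 1 else 0)" by simp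
    qed simp
    also have "\<dots> = (\<Sum>j\<in>UNIV. if j = i then x $ j else 0)" by (rule sum.cong) auto
    finally show ?thesis by simp
  qed
  have nrm: "norm (J x) = norm x" for x
  proof -
    have "norm (J x)^2 = (\<Sum>b\<in>Basis. (J x \<bullet> b)^2)"
      unfolding power2_norm_eq_inner by (subst euclidean_inner) (simp add: power2_eq_square)
    also have "\<dots> = (\<Sum>i\<in>UNIV. (J x \<bullet> \<beta> i)^2)" unfolding im[symmetric] by (subst sum.reindex[OF inj]) simp
    also have "\<dots> = norm x ^ 2" unfolding comp by (simp add: norm_vec_def L2_set_def sum_nonneg)
    finally show ?thesis by simp
  qed
  have "surj J"
  proof (rule surjI)
    fix y :: 'a
    have "J (\<chi> i. y \<bullet> \<beta> i) = (\<Sum>b\<in>Basis. (y \<bullet> b) *\<^sub>R b)"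
      unfolding im[symmetric] J_def by (subst sum.reindex[OF inj]) simp
    then show "J (\<chi> i. y \<bullet> \<beta> i) = y" by (simp add: euclidean_representation)
  qed
  moreover have "inj J" unfolding linear_injective_0[OF lin] using nrm by (metis norm_eq_zero)
  moreover have "J (axis i 1) = \<beta> i" for i
  proof -
    have "J (axis i 1) = (\<Sum>j\<in>UNIV. if j = i then \<beta> i else 0)" unfolding J_def by (rule sum.cong) (auto simp: axis_def)
    then show ?thesis by simp
  qed
  then have "J ` range (\<lambda>i. axis i 1) = range \<beta>" by (simp add: image_image)
  then have "J ` Basis = Basis" unfolding im by (simp add: Basis_vec_def full_SetCompr_eq UNION_singleton_eq_range)
  ultimately show ?thesis using lin nrm by (intro exI[of _ J]) (auto simp: bij_def)
qed


text \<open>The preimage of a box is a box with the same side lengths, and boxes determine Lebesgue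
  measure.\<close>

lemma lborel_distr_isometry:
  fixes J :: "'b::euclidean_space \<Rightarrow> 'a::euclidean_space"
  assumes lin: "linear J" and bij: "bij J" and nrm: "\<And>x. norm (J x) = norm x" and B: "J ` Basis = Basis"
  shows "distr lborel borel J = lborel"
proof (rule lborel_eqI[symmetric])
  have Jm[measurable]: "J \<in> borel_measurable borel"
    using lin by (intro borel_measurable_continuous_onI linear_continuous_on) (simp add: linear_linear)
  have inner: "J x \<bullet> J y = x \<bullet> y" for x y
    using nrm lin by (simp add: dot_norm linear_add[OF lin, symmetric])
  have inj: "inj J" using bij by (rule bij_is_inj)
  fix l u :: 'a assume lu: "\<And>b. b \<in> Basis \<Longrightarrow> l \<bullet> b \<le> u \<bullet> b"
  obtain l' u' where [simp]: "l = J l'" "u = J u'" using bij by (metis bij_pointE)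
  have box: "J -` box l u = box l' u'"
    unfolding box_def B[symmetric] by (auto simp: inner)
  have "emeasure (distr lborel borel J) (box l u) = emeasure lborel (box l' u')"
    by (simp add: emeasure_distr box[simplified])
  also have "\<dots> = (\<Prod>b\<in>Basis. (u' - l') \<bullet> b)"
  proof (rule emeasure_lborel_box)
    fix b :: 'b assume "b \<in> Basis"
    then have "J b \<in> Basis" using B by blast
    from lu[OF this] show "l' \<bullet> b \<le> u' \<bullet> b" by (simp add: inner)
  qed
  also have "(\<Prod>b\<in>Basis. (u' - l') \<bullet> b) = (\<Prod>b\<in>Basis. (u - l) \<bullet> b)"
    unfolding B[symmetric] using inj by (subst prod.reindex) (auto simp: inner linear_diff[OF lin, symmetric] intro: inj_on_subset)
  finally show "emeasure (distr lborel borel J) (box l u) = (\<Prod>b\<in>Basis. (u - l) \<bullet> b)" .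
qed simp

text \<open>Conjugation by the isometry J preserves norms, Lebesgue measure and, as basis goes to
  basis, the divergence; so the coordinate version carries over.\<close>

lemma change_of_variables_lower_bound:
  fixes g :: "'a::euclidean_space \<Rightarrow> 'a" and F :: "'a \<Rightarrow> real"
  assumes der: "\<And>x. (g has_derivative g' x) (at x)"
    and bd: "\<And>x v. norm (g' x v) \<le> \<kappa> x * norm v" and half: "\<And>x. \<kappa> x \<le> 1/2"
    and F: "F \<in> borel_measurable borel" "\<And>x. 0 \<le> F x" "integrable lborel F"
    and meas: "\<kappa> \<in> borel_measurable borel" "\<And>b. b \<in> Basis \<Longrightarrow> (\<lambda>x. g' x b \<bullet> b) \<in> borel_measurable borel"
  shows "(\<integral>\<^sup>+x. ennreal (F (x + g x) * exp ((\<Sum>b\<in>Basis. g' x b \<bullet> b) - real DIM('a) * (\<kappa> x)\<^sup>2)) \<partial>lborel)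
     \<le> (\<integral>\<^sup>+x. ennreal (F x) \<partial>lborel)"
proof -
  obtain J :: "real^('a basis_index) \<Rightarrow> 'a" where lin: "linear J" and bij: "bij J" and nrm: "\<And>x. norm (J x) = norm x" and B: "J ` Basis = Basis"
    using exists_isometry_vec by blast
  have distr: "distr lborel borel J = lborel" by (rule lborel_distr_isometry[OF lin bij nrm B])
  have inner: "J x \<bullet> J y = x \<bullet> y" for x y
    using nrm lin by (simp add: dot_norm linear_add[OF lin, symmetric])
  define I where "I = inv J"
  have IJ[simp]: "I (J x) = x" and JI[simp]: "J (I y) = y" for x y
    using bij by (simp_all add: I_def bij_is_inj bij_is_surj surj_f_inv_f)
  have linI: "linear I"  proof (rule linearI)
    show "I (x + y) = I x + I y" for x y by (metis IJ JI linear_add[OF lin])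
    show "I (r *\<^sub>R x) = r *\<^sub>R I x" for r x by (metis IJ JI linear_scale[OF lin])
  qed
  have nrmI: "norm (I y) = norm y" for y using nrm[of "I y"] by simp
  have blJ: "bounded_linear J" and blI: "bounded_linear I" using lin linI by (simp_all add: linear_linear)
  have Jm[measurable]: "J \<in> borel_measurable borel"
    using lin by (intro borel_measurable_continuous_onI linear_continuous_on blJ)
  have gm: "g \<in> borel_measurable borel"
    using der by (intro borel_measurable_continuous_onI) (meson has_derivative_continuous continuous_at_imp_continuous_on)
  note [measurable] = F(1) meas gm
  let ?g = "\<lambda>x. I (g (J x))"
  let ?g' = "\<lambda>x v. I (g' (J x) (J v))"
  let ?F = "\<lambda>x. F (J x)"
  have "(\<integral>\<^sup>+x. ennreal (?F (x + ?g x) * exp ((\<Sum>b\<in>Basis. ?g' x b \<bullet> b) - real (DIM(real^('a basis_index))) * (\<kappa> (J x))\<^sup>2)) \<partial>lborel)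
     \<le> (\<integral>\<^sup>+x. ennreal (?F x) \<partial>lborel)"
  proof (rule change_of_variables_lower_bound_vec)
    fix x v
    show "(?g has_derivative ?g' x) (at x)"
      by (rule bounded_linear.has_derivative[OF blI], rule has_derivative_compose[OF bounded_linear_imp_has_derivative[OF blJ] der])
    show "norm (?g' x v) \<le> \<kappa> (J x) * norm v" using bd[of "J x" "J v"] by (simp add: nrmI nrm)
    have "integrable (distr lborel borel J) F" using F by (simp add: distr)
    then show "integrable lborel ?F" using F(1) by (simp add: integrable_distr_eq)
  qed (use half F in auto)
  moreover have "(\<integral>\<^sup>+x. ennreal (F x) \<partial>lborel) = (\<integral>\<^sup>+x. ennreal (?F x) \<partial>lborel)"
    by (subst distr[symmetric]) (simp add: nn_integral_distr)
  moreover have "(\<integral>\<^sup>+x. ennreal (F (x + g x) * exp ((\<Sum>b\<in>Basis. g' x b \<bullet> b) - real DIM('a) * (\<kappa> x)\<^sup>2)) \<partial>lborel)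
    = (\<integral>\<^sup>+x. ennreal (?F (x + ?g x) * exp ((\<Sum>b\<in>Basis. ?g' x b \<bullet> b) - real (DIM(real^('a basis_index))) * (\<kappa> (J x))\<^sup>2)) \<partial>lborel)"
  proof -
    have "(\<Sum>b\<in>Basis. ?g' x b \<bullet> b) = (\<Sum>b\<in>Basis. g' (J x) b \<bullet> b)" for x
    proof -
      have "?g' x b \<bullet> b = g' (J x) (J b) \<bullet> J b" for b using inner[of "I (g' (J x) (J b))" b] by simp
      then show ?thesis unfolding B[symmetric] using bij by (subst sum.reindex) (auto intro: inj_on_subset bij_is_inj)
    qed
    then show ?thesis
      by (subst distr[symmetric]) (simp add: nn_integral_distr linear_add[OF lin] card_basis_index)
  qed
  ultimately show ?thesis by simp
qed

text \<open>After the substitution v + g v, Gaussian weight and Jacobian produce the exponent - v .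
  g - |g|^2/2 + tr Dg - d \<kappa>^2. Jensen's inequality takes its mean, in which - v . g and tr Dg
  cancel by Stein's identity; the remaining terms are the cost.\<close>

lemma gauss_shift_dual:
  fixes g :: "'a::euclidean_space \<Rightarrow> 'a" and \<phi> :: "'a \<Rightarrow> real"
  assumes der: "\<And>x. (g has_derivative g' x) (at x)"
    and bd: "\<And>x v. norm (g' x v) \<le> \<kappa> x * norm v" and half: "\<And>x. \<kappa> x \<le> 1/2"
    and meas[measurable]: "\<kappa> \<in> borel_measurable borel" "\<And>b. b \<in> Basis \<Longrightarrow> (\<lambda>x. g' x b \<bullet> b) \<in> borel_measurable borel"
    and phi[measurable]: "\<phi> \<in> borel_measurable borel" and K: "\<And>x. \<bar>\<phi> x\<bar> \<le> K"
  shows "(\<integral>v. \<phi> (v + g v) \<partial>std_gauss) \<le> (\<integral>v. (norm (g v))\<^sup>2 / 2 + real DIM('a) * (\<kappa> v)\<^sup>2 \<partial>std_gauss)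
      + ln (\<integral>v. exp (\<phi> v) \<partial>std_gauss)"
    and "integrable std_gauss (\<lambda>v. (norm (g v))\<^sup>2 / 2 + real DIM('a) * (\<kappa> v)\<^sup>2)"
proof -
  interpret G: prob_space "std_gauss :: 'a measure" by (rule prob_space_std_gauss)
  have k0: "0 \<le> \<kappa> x" for x
  proof -
    obtain b :: 'a where "b \<in> Basis" using nonempty_Basis by blast
    then show ?thesis using bd[of x b] norm_ge_zero[of "g' x b"] by (simp del: norm_ge_zero)
  qed
  have bd2: "norm (g' x v) \<le> 1/2 * norm v" for x v
    using bd[of x v] mult_right_mono[OF half norm_ge_zero] by (rule order.trans)
  have [measurable]: "g \<in> borel_measurable borel"
    using der by (intro borel_measurable_continuous_onI) (meson has_derivative_continuous continuous_at_imp_continuous_on)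
  define C where "C = norm (g 0) + 1"
  have C: "1 \<le> C" by (simp add: C_def)
  have gg: "norm (g v) \<le> C * exp (1 * norm v)" for v
  proof -
    have "norm (g v - g 0) \<le> 1/2 * norm (v - 0)" by (rule lipschitz_of_derivative_bound[OF der bd2]) auto
    then have "norm (g v) \<le> norm (g 0) + norm v / 2" using norm_triangle_ineq[of "g v - g 0" "g 0"] by simp
    also have "\<dots> \<le> C * (1 + norm v)"
      by (simp add: C_def algebra_simps add_increasing2)
    also have "\<dots> \<le> C * exp (1 * norm v)" using C by (intro mult_left_mono) (auto simp: exp_ge_add_one_self)
    finally show ?thesis .
  qed
  have gb: "norm (g' v b) \<le> C * exp (1 * norm v)" if "b \<in> Basis" for v b
  proof -
    have "norm (g' v b) \<le> 1 * 1" using bd2[of v b] that by simp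
    also have "\<dots> \<le> C * exp (1 * norm v)" using C by (intro mult_mono) auto
    finally show ?thesis .
  qed
  note ibp = gaussian_integration_by_parts[OF der meas(2) gg gb zero_le_one]
  let ?tr = "\<lambda>v. \<Sum>b\<in>Basis. g' v b \<bullet> b"
  let ?c = "\<lambda>v. (norm (g v))\<^sup>2 / 2 + real DIM('a) * (\<kappa> v)\<^sup>2"
  have i1: "integrable std_gauss (\<lambda>v. (norm (g v))\<^sup>2)"
  proof (rule integrable_std_gauss_exp_growth[where C="C\<^sup>2" and a=2])
    fix v
    have "(norm (g v))\<^sup>2 \<le> (C * exp (1 * norm v))\<^sup>2" by (intro power_mono gg) auto
    then show "\<bar>(norm (g v))\<^sup>2\<bar> \<le> C\<^sup>2 * exp (2 * norm v)" by (simp add: power_mult_distrib exp_double)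
  qed measurable
  have i2: "integrable std_gauss (\<lambda>v. (\<kappa> v)\<^sup>2)"
  proof (rule G.integrable_bounded[where K="(1/2)\<^sup>2"])
    fix v
    have "(\<kappa> v)\<^sup>2 \<le> (1/2)\<^sup>2" using half[of v] k0[of v] by (intro power_mono) auto
    then show "\<bar>(\<kappa> v)\<^sup>2\<bar> \<le> (1/2)\<^sup>2" by simp
  qed measurable
  show i3: "integrable std_gauss ?c" using i1 i2 by simp
  have i4: "integrable std_gauss (\<lambda>v. \<phi> (v + g v))" by (rule G.integrable_bounded[where K=K]) (use K in auto)
  \<comment> \<open>The full exponent after the substitution, test function included.\<close>
  define \<psi> where "\<psi> v = \<phi> (v + g v) - v \<bullet> g v + ?tr v - ?c v" for v
  have [measurable]: "\<psi> \<in> borel_measurable borel" unfolding \<psi>_def by measurable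
  have i5: "integrable std_gauss \<psi>" unfolding \<psi>_def[abs_def] using i4 ibp(2,3) i3 by simp
  define m where "m = integral\<^sup>L std_gauss \<psi>"
  have m: "m = (\<integral>v. \<phi> (v + g v) \<partial>std_gauss) - integral\<^sup>L std_gauss ?c"
  proof -
    have "m = (\<integral>v. \<phi> (v + g v) \<partial>std_gauss) - (\<integral>v. v \<bullet> g v \<partial>std_gauss) + integral\<^sup>L std_gauss ?tr - integral\<^sup>L std_gauss ?c"
      unfolding m_def \<psi>_def[abs_def]
      by (simp only: Bochner_Integration.integral_diff[OF Bochner_Integration.integrable_add[OF Bochner_Integration.integrable_diff[OF i4 ibp(2)] ibp(3)] i3]
          Bochner_Integration.integral_add[OF Bochner_Integration.integrable_diff[OF i4 ibp(2)] ibp(3)] Bochner_Integration.integral_diff[OF i4 ibp(2)])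
    then show ?thesis using ibp(1) by simp
  qed
  have ie: "integrable std_gauss (\<lambda>v. exp (\<phi> v))"
    by (rule G.integrable_bounded[where K="exp K"]) (use K in \<open>auto simp: abs_le_iff\<close>)
  define A where "A = (\<integral>v. exp (\<phi> v) \<partial>std_gauss)"
  define F where "F w = exp (\<phi> w) * gauss_density w" for w
  have [measurable]: "F \<in> borel_measurable borel" unfolding F_def by measurable
  have F: "integrable lborel F" "integral\<^sup>L lborel F = A" "\<And>x. 0 \<le> F x"
    using ie unfolding F_def[abs_def] A_def by (auto simp: integrable_std_gauss_iff integral_std_gauss mult.commute)
  have FA: "(\<integral>\<^sup>+x. ennreal (F x) \<partial>lborel) = ennreal A" using F by (simp add: nn_integral_eq_integral)
  have Fe: "F (v + g v) * exp (?tr v - real DIM('a) * (\<kappa> v)\<^sup>2) = gauss_density v * exp (\<psi> v)" for v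
  proof -
    have "(norm (v + g v))\<^sup>2 = (norm v)\<^sup>2 + 2 * (v \<bullet> g v) + (norm (g v))\<^sup>2"
      by (simp add: power2_norm_eq_inner inner_add_left inner_add_right inner_commute)
    then have "gauss_density (v + g v) = gauss_density v * exp (- (v \<bullet> g v) - (norm (g v))\<^sup>2 / 2)"
      by (simp add: gauss_density_def exp_add[symmetric] mult.assoc add_divide_distrib diff_divide_distrib)
    then show ?thesis by (simp add: F_def \<psi>_def exp_add[symmetric] mult.assoc mult.left_commute[of "exp _" "gauss_density v"] algebra_simps)
  qed
  have "(\<integral>\<^sup>+v. ennreal (exp (\<psi> v)) \<partial>std_gauss) = (\<integral>\<^sup>+v. ennreal (gauss_density v * exp (\<psi> v)) \<partial>lborel)"
    unfolding std_gauss_eq by (subst nn_integral_density) (auto simp: ennreal_mult)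
  also have "\<dots> \<le> (\<integral>\<^sup>+x. ennreal (F x) \<partial>lborel)"
    unfolding Fe[symmetric]
    by (rule change_of_variables_lower_bound[OF der bd half _ F(3) F(1) meas]) measurable
  finally have le: "(\<integral>\<^sup>+v. ennreal (exp (\<psi> v)) \<partial>std_gauss) \<le> ennreal A" unfolding FA .
  have i6: "integrable std_gauss (\<lambda>v. exp (\<psi> v))"
    by (rule integrableI_nonneg) (use le in \<open>auto simp: less_top[symmetric] top_unique\<close>)
  have A0: "0 \<le> A" unfolding A_def by simp
  have "(\<integral>v. exp (\<psi> v) \<partial>std_gauss) \<le> A"
    using le A0 i6 by (simp add: nn_integral_eq_integral)
  \<comment> \<open>Jensen's inequality for the exponential, through its tangent line at the mean
    m.\<close>
  moreover have "exp m \<le> (\<integral>v. exp (\<psi> v) \<partial>std_gauss)"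
  proof -
    have "(\<integral>v. exp m * (1 + (\<psi> v - m)) \<partial>std_gauss) \<le> (\<integral>v. exp (\<psi> v) \<partial>std_gauss)"
    proof (rule integral_mono[OF _ i6])
      show "integrable std_gauss (\<lambda>v. exp m * (1 + (\<psi> v - m)))" using i5 by simp
      fix v
      have "exp m * (1 + (\<psi> v - m)) \<le> exp m * exp (\<psi> v - m)" by (intro mult_left_mono exp_ge_add_one_self) auto
      then show "exp m * (1 + (\<psi> v - m)) \<le> exp (\<psi> v)" by (simp add: exp_diff)
    qed
    moreover have "(\<integral>v. exp m * (1 + (\<psi> v - m)) \<partial>std_gauss) = exp m"
      using i5 G.prob_space by (simp add: m_def)
    ultimately show ?thesis by simp
  qed
  ultimately have "exp m \<le> A" by linarith
  then have "m \<le> ln A" using exp_gt_zero[of m] by (subst ln_ge_iff) linarith+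
  then show "(\<integral>v. \<phi> (v + g v) \<partial>std_gauss) \<le> integral\<^sup>L std_gauss ?c + ln (\<integral>v. exp (\<phi> v) \<partial>std_gauss)"
    using m by (simp add: A_def)
qed

section \<open>Verlet trajectories as trapezoidal double sums\<close>

text \<open>Eliminating the velocities, a Verlet trajectory started at \<open>(p\<^sub>0,v)\<close> with gradients \<open>r\<close> along it is
  \<open>p\<^sub>k = p\<^sub>0 + k\<delta>v - \<delta>\<^sup>2 (\<Sum>j<k. r\<^sub>0/2 + r\<^sub>1 + \<dots> + r\<^sub>j)\<close>; this is the predicate \<open>vform\<close>, which the tangent
  process satisfies too.\<close>

definition trap_weight :: "nat \<Rightarrow> real" where "trap_weight i = (if i = 0 then 1/2 else 1)"

definition trap1 :: "(nat \<Rightarrow> 'b::real_vector) \<Rightarrow> nat \<Rightarrow> 'b" where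
  "trap1 r n = (\<Sum>i<n. trap_weight i *\<^sub>R r i)"

definition trap2 :: "(nat \<Rightarrow> 'b::real_vector) \<Rightarrow> nat \<Rightarrow> 'b" where
  "trap2 r n = (\<Sum>j<n. trap1 r (Suc j))"

definition vform :: "real \<Rightarrow> nat \<Rightarrow> (nat \<Rightarrow> 'b::real_vector) \<Rightarrow> 'b \<Rightarrow> 'b \<Rightarrow> (nat \<Rightarrow> 'b) \<Rightarrow> bool" where
  "vform \<delta> n p p0 v r \<longleftrightarrow> (\<forall>k\<le>n. p k = p0 + (real k * \<delta>) *\<^sub>R v - \<delta>\<^sup>2 *\<^sub>R trap2 r k)"

lemma trap1_0[simp]: "trap1 r 0 = 0" and trap1_Suc: "trap1 r (Suc n) = trap1 r n + trap_weight n *\<^sub>R r n"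
  by (simp_all add: trap1_def)

lemma trap2_0[simp]: "trap2 r 0 = 0" and trap2_Suc: "trap2 r (Suc n) = trap2 r n + trap1 r (Suc n)"
  by (simp_all add: trap2_def)

lemma trap1_diff: "trap1 (\<lambda>i. r i - s i) n = trap1 r n - trap1 s n"
  by (simp add: trap1_def sum_subtractf scaleR_diff_right)

lemma trap2_diff: "trap2 (\<lambda>i. r i - s i) n = trap2 r n - trap2 s n"
  by (simp add: trap2_def sum_subtractf trap1_diff)

text \<open>Interchanging the summations counts r_i once for every later step. The factor n - i
  vanishes at i = n, so halving the first term alone already gives a complete trapezoidal rule for
  (n - i) r_i.\<close>

lemma trap2_eq_sum: "trap2 r n = (\<Sum>i<n. (trap_weight i * real (n - i)) *\<^sub>R r i)"
proof (induction n)
  case (Suc n)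
  have "(\<Sum>i<Suc n. (trap_weight i * real (Suc n - i)) *\<^sub>R r i) = (\<Sum>i<Suc n. (trap_weight i * real (n - i)) *\<^sub>R r i + trap_weight i *\<^sub>R r i)"
    by (intro sum.cong refl) (simp add: Suc_diff_le algebra_simps)
  also have "\<dots> = (\<Sum>i<Suc n. (trap_weight i * real (n - i)) *\<^sub>R r i) + trap1 r (Suc n)"
    by (simp only: sum.distrib trap1_def)
  also have "(\<Sum>i<Suc n. (trap_weight i * real (n - i)) *\<^sub>R r i) = trap2 r n" using Suc by simp
  finally show ?case by (simp add: trap2_Suc)
qed simp

lemma norm_trap1_le:
  fixes r :: "nat \<Rightarrow> 'b::real_normed_vector"
  assumes "\<And>i. i \<le> n \<Longrightarrow> norm (r i) \<le> \<rho>"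
  shows "norm (trap1 r (Suc n)) \<le> (real n + 1/2) * \<rho>"
  using assms
proof (induction n)
  case 0
  then show ?case by (simp add: trap1_Suc trap_weight_def)
next
  case (Suc n)
  have "norm (trap1 r (Suc (Suc n))) \<le> norm (trap1 r (Suc n)) + norm (r (Suc n))"
    unfolding trap1_Suc[of r "Suc n"] by (simp add: trap_weight_def norm_triangle_ineq)
  also have "\<dots> \<le> (real n + 1/2) * \<rho> + \<rho>" using Suc by (intro add_mono) auto
  finally show ?case by (simp add: algebra_simps)
qed

text \<open>Thanks to the halved first term the inner sums are at most (j + 1/2) \<rho>, and these
  add up to exactly n^2/2, the discrete twin of T^2/2.\<close>

lemma norm_trap2_le:
  fixes r :: "nat \<Rightarrow> 'b::real_normed_vector"
  assumes "\<And>i. i < n \<Longrightarrow> norm (r i) \<le> \<rho>"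
  shows "norm (trap2 r n) \<le> (real n)\<^sup>2 / 2 * \<rho>"
  using assms
proof (induction n)
  case (Suc n)
  have "norm (trap2 r (Suc n)) \<le> norm (trap2 r n) + norm (trap1 r (Suc n))"
    unfolding trap2_Suc by (rule norm_triangle_ineq)
  also have "\<dots> \<le> (real n)\<^sup>2 / 2 * \<rho> + (real n + 1/2) * \<rho>" using Suc by (intro add_mono norm_trap1_le) auto
  finally show ?case by (simp add: power2_eq_square field_simps)
qed simp

lemma scaled_trap2_le:
  fixes r :: "nat \<Rightarrow> 'b::real_normed_vector"
  assumes r: "\<And>i. i < n \<Longrightarrow> norm (r i) \<le> \<rho>" and k: "k \<le> n" and d: "0 \<le> \<delta>" "0 \<le> \<rho>"
  shows "norm (\<delta>\<^sup>2 *\<^sub>R trap2 r k) \<le> (real n * \<delta>)\<^sup>2 / 2 * \<rho>"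
proof -
  have "norm (\<delta>\<^sup>2 *\<^sub>R trap2 r k) \<le> \<delta>\<^sup>2 * ((real k)\<^sup>2 / 2 * \<rho>)"
    using norm_trap2_le[of k r \<rho>] r k unfolding norm_scaleR by (intro mult_mono) auto
  also have "\<dots> \<le> \<delta>\<^sup>2 * ((real n)\<^sup>2 / 2 * \<rho>)"
    using k d by (intro mult_left_mono mult_right_mono divide_right_mono power_mono) auto
  finally show ?thesis by (simp add: power_mult_distrib mult_ac)
qed

lemma vform_step:
  assumes "vform \<delta> n p p0 v r" "Suc k \<le> n"
  shows "p (Suc k) - p k = \<delta> *\<^sub>R v - \<delta>\<^sup>2 *\<^sub>R trap1 r (Suc k)"
proof -
  have "p (Suc k) = p0 + (real (Suc k) * \<delta>) *\<^sub>R v - \<delta>\<^sup>2 *\<^sub>R trap2 r (Suc k)" "p k = p0 + (real k * \<delta>) *\<^sub>R v - \<delta>\<^sup>2 *\<^sub>R trap2 r k"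
    using assms by (auto simp: vform_def)
  then show ?thesis unfolding trap2_Suc by (simp only:) (simp add: algebra_simps)
qed

text \<open>The initial velocity drops out: this is the Stoermer form of the scheme.\<close>

lemma vform_second_difference:
  assumes "vform \<delta> n p p0 v r" "Suc (Suc k) \<le> n"
  shows "p (Suc (Suc k)) - 2 *\<^sub>R p (Suc k) + p k = - (\<delta>\<^sup>2 *\<^sub>R r (Suc k))"
proof -
  have "p (Suc (Suc k)) - 2 *\<^sub>R p (Suc k) + p k = (p (Suc (Suc k)) - p (Suc k)) - (p (Suc k) - p k)"
    by (simp add: scaleR_2)
  also have "\<dots> = - (\<delta>\<^sup>2 *\<^sub>R r (Suc k))"
    unfolding vform_step[OF assms(1,2)] using assms by (subst vform_step[OF assms(1)]) (simp_all add: trap1_Suc trap_weight_def algebra_simps)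
  finally show ?thesis .
qed

lemma vform_step_bound:
  fixes p :: "nat \<Rightarrow> 'b::real_normed_vector"
  assumes f: "vform \<delta> n p p0 v r" "Suc k \<le> n" and r: "\<And>i. i < n \<Longrightarrow> norm (r i) \<le> \<rho>"
    and d: "0 \<le> \<delta>" "real n * \<delta> \<le> T" "0 \<le> \<rho>"
  shows "norm (p (Suc k) - p k) \<le> \<delta> * (norm v + T * \<rho>)"
proof -
  have "norm (p (Suc k) - p k) \<le> norm (\<delta> *\<^sub>R v) + norm (\<delta>\<^sup>2 *\<^sub>R trap1 r (Suc k))"
    unfolding vform_step[OF f] by (rule norm_triangle_ineq4)
  also have "norm (\<delta>\<^sup>2 *\<^sub>R trap1 r (Suc k)) \<le> \<delta>\<^sup>2 * ((real k + 1/2) * \<rho>)"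
    using f(2) r by (simp add: mult_left_mono norm_trap1_le)
  also have "\<dots> \<le> \<delta> * (T * \<rho>)"
  proof -
    have "\<delta> * (real k + 1/2) \<le> \<delta> * real n" using f(2) d by (intro mult_left_mono) auto
    then have "\<delta> * (real k + 1/2) \<le> T" using d by (simp add: mult.commute)
    then have "\<delta> * ((\<delta> * (real k + 1/2)) * \<rho>) \<le> \<delta> * (T * \<rho>)" using d by (intro mult_left_mono mult_right_mono) auto
    then show ?thesis by (simp add: power2_eq_square mult_ac)
  qed
  finally show ?thesis using d by (simp add: algebra_simps)
qed

section \<open>Discrete stability by absorption\<close>

lemma ex_max_norm:
  fixes p :: "nat \<Rightarrow> 'b::real_normed_vector"
  shows "\<exists>k\<le>n. \<forall>i\<le>n. norm (p i) \<le> norm (p k)"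
proof -
  have "Max ((\<lambda>i. norm (p i)) ` {..n}) \<in> (\<lambda>i. norm (p i)) ` {..n}" by (intro Max_in) auto
  then obtain k where "k \<in> {..n}" "Max ((\<lambda>i. norm (p i)) ` {..n}) = norm (p k)" by (rule imageE)
  moreover have "norm (p i) \<le> Max ((\<lambda>i. norm (p i)) ` {..n})" if "i \<le> n" for i using that by (intro Max_ge) auto
  ultimately show ?thesis by auto
qed

text \<open>Q stands for L T^2 E and is absorbed on the left. The sharp factor is 24/23, rounded up
  to 11/10.\<close>

lemma bootstrap_bound:
  fixes E P Q :: real
  assumes "E \<le> P + Q / 2" "Q \<le> 1/12 * E" "0 \<le> P"
  shows "E \<le> 11/10 * P"
  using assms by linarith

text \<open>P is T times the unknown velocity and E the largest deviation. Inserting the first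
  inequality in the second gives E \<le> 2R + E/12, hence 24/11, and then 12/11 for P.\<close>

lemma bootstrap_bound_pair:
  fixes E P Q R :: real
  assumes "P \<le> R + Q / 2" "E \<le> R + P + Q / 2" "Q \<le> 1/12 * E"
  shows "E \<le> 24/11 * R" "P \<le> 12/11 * R"
  using assms by linarith+

text \<open>Instead of a Gronwall argument, the recursion is read at the index of largest norm: the
  feedback there is at most L T^2/2 times that norm and is absorbed because L T^2 \<le>
  1/12.\<close>

lemma vform_bound:
  fixes p :: "nat \<Rightarrow> 'b::real_normed_vector"
  assumes f: "vform \<delta> n p p0 v r" and r: "\<And>i. i < n \<Longrightarrow> norm (r i) \<le> L * norm (p i) + \<rho>"
    and d: "0 \<le> \<delta>" "real n * \<delta> = T" and L: "0 \<le> L" "L * T\<^sup>2 \<le> 1/12" and rho: "0 \<le> \<rho>" and k: "k \<le> n"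
  shows "norm (p k) \<le> 11/10 * (norm p0 + T * norm v + T\<^sup>2 / 2 * \<rho>)"
proof -
  obtain j where j: "j \<le> n" "\<And>i. i \<le> n \<Longrightarrow> norm (p i) \<le> norm (p j)" using ex_max_norm[of n p] by blast
  define E where "E = norm (p j)"
  have E0: "0 \<le> E" by (simp add: E_def)
  have rE: "norm (r i) \<le> L * E + \<rho>" if "i < n" for i
    using r[OF that] mult_left_mono[OF j(2)[of i] L(1)] that by (simp add: E_def)
  have jd: "real j * \<delta> \<le> T" using j(1) d by (metis mult_right_mono of_nat_le_iff)
  have "p j = p0 + (real j * \<delta>) *\<^sub>R v - \<delta>\<^sup>2 *\<^sub>R trap2 r j" using f j(1) by (simp add: vform_def)
  then have "E \<le> norm p0 + norm ((real j * \<delta>) *\<^sub>R v) + norm (\<delta>\<^sup>2 *\<^sub>R trap2 r j)"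
    unfolding E_def by (simp only:) (rule order.trans[OF norm_triangle_ineq4 add_right_mono[OF norm_triangle_ineq]])
  also have "norm ((real j * \<delta>) *\<^sub>R v) \<le> T * norm v" using jd d by (simp add: mult_right_mono)
  also have "norm (\<delta>\<^sup>2 *\<^sub>R trap2 r j) \<le> T\<^sup>2 / 2 * (L * E + \<rho>)"
    unfolding d(2)[symmetric] by (rule scaled_trap2_le[OF rE j(1) d(1)]) (use L E0 rho in auto)
  finally have "E \<le> norm p0 + T * norm v + T\<^sup>2 / 2 * (L * E + \<rho>)" by simp
  also have "T\<^sup>2 / 2 * (L * E + \<rho>) = T\<^sup>2 / 2 * \<rho> + (L * T\<^sup>2) * E / 2" by (simp add: field_simps)
  finally have "E \<le> (norm p0 + T * norm v + T\<^sup>2 / 2 * \<rho>) + (L * T\<^sup>2) * E / 2" by simp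
  moreover have "(L * T\<^sup>2) * E \<le> 1/12 * E" using L E0 by (intro mult_right_mono) auto
  moreover have "0 \<le> norm p0 + T * norm v + T\<^sup>2 / 2 * \<rho>" using d rho by (auto intro!: add_nonneg_nonneg mult_nonneg_nonneg)
  ultimately have "E \<le> 11/10 * (norm p0 + T * norm v + T\<^sup>2 / 2 * \<rho>)"
    by (rule bootstrap_bound)
  then show ?thesis using j(2)[OF k] by (simp add: E_def)
qed

text \<open>A boundary value version: the velocity is unknown but the end value is 0. Reading the
  recursion at n bounds T|v|, reading it at the largest norm bounds the deviation, each in terms of
  the other. \<open>\<eta>\<close> carries a quadrature defect and \<open>\<rho>\<close> an external
  force.\<close>

lemma vform_difference_bound:
  fixes e :: "nat \<Rightarrow> 'b::real_normed_vector"
  assumes f: "\<And>k. k \<le> n \<Longrightarrow> e k = e0 + (real k * \<delta>) *\<^sub>R v - \<delta>\<^sup>2 *\<^sub>R trap2 r k + \<eta> k"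
    and e: "e n = 0" and eta: "\<And>k. k \<le> n \<Longrightarrow> norm (\<eta> k) \<le> q"
    and r: "\<And>i. i < n \<Longrightarrow> norm (r i) \<le> L * norm (e i) + \<rho>"
    and d: "0 \<le> \<delta>" "real n * \<delta> = T" and L: "0 \<le> L" "L * T\<^sup>2 \<le> 1/12" and rho: "0 \<le> \<rho>"
  shows "T * norm v \<le> 12/11 * (norm e0 + q + T\<^sup>2 / 2 * \<rho>)"
    and "k \<le> n \<Longrightarrow> norm (e k) \<le> 24/11 * (norm e0 + q + T\<^sup>2 / 2 * \<rho>)"
proof -
  obtain j where j: "j \<le> n" "\<And>i. i \<le> n \<Longrightarrow> norm (e i) \<le> norm (e j)" using ex_max_norm[of n e] by blast
  define E where "E = norm (e j)"
  have E0: "0 \<le> E" by (simp add: E_def)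
  have rE: "norm (r i) \<le> L * E + \<rho>" if "i < n" for i
    using r[OF that] mult_left_mono[OF j(2)[of i] L(1)] that by (simp add: E_def)
  have T0: "0 \<le> T" using d by auto
  have S: "norm (\<delta>\<^sup>2 *\<^sub>R trap2 r i) \<le> T\<^sup>2 / 2 * (L * E + \<rho>)" if "i \<le> n" for i
    unfolding d(2)[symmetric] by (rule scaled_trap2_le[OF rE that d(1)]) (use L E0 rho in auto)
  have jd: "real j * \<delta> \<le> T" using j(1) d by (metis mult_right_mono of_nat_le_iff)
  define R where "R = norm e0 + q + T\<^sup>2 / 2 * \<rho>"
  have q0: "0 \<le> q" using eta[of 0] norm_ge_zero[of "\<eta> 0"] by linarith
  have R0: "0 \<le> R" using q0 rho by (auto simp: R_def intro!: add_nonneg_nonneg mult_nonneg_nonneg)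
  have LE: "(L * T\<^sup>2) * E \<le> 1/12 * E" using L E0 by (intro mult_right_mono) auto
  have "T *\<^sub>R v = \<delta>\<^sup>2 *\<^sub>R trap2 r n - e0 - \<eta> n" using f[of n] e d(2) by (simp add: algebra_simps)
  then have "norm (T *\<^sub>R v) \<le> norm (\<delta>\<^sup>2 *\<^sub>R trap2 r n) + norm e0 + norm (\<eta> n)"
    by (simp only:) (rule order.trans[OF norm_triangle_ineq4 add_right_mono[OF norm_triangle_ineq4]])
  also have "\<dots> \<le> T\<^sup>2 / 2 * (L * E + \<rho>) + norm e0 + q" using S[of n] eta[of n] by simp
  also have "\<dots> = R + (L * T\<^sup>2) * E / 2" by (simp add: R_def algebra_simps)
  finally have 1: "T * norm v \<le> R + (L * T\<^sup>2) * E / 2" using T0 by simp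
  have "E \<le> norm e0 + norm ((real j * \<delta>) *\<^sub>R v) + norm (\<delta>\<^sup>2 *\<^sub>R trap2 r j) + norm (\<eta> j)"
    unfolding E_def f[OF j(1)]
    by (intro order.trans[OF norm_triangle_ineq] add_right_mono order.trans[OF norm_triangle_ineq4] norm_triangle_ineq)
  also have "norm ((real j * \<delta>) *\<^sub>R v) \<le> T * norm v" using jd d by (simp add: mult_right_mono)
  finally have "E \<le> norm e0 + T * norm v + T\<^sup>2 / 2 * (L * E + \<rho>) + q"
    using S[OF j(1)] eta[OF j(1)] by (meson add_mono order.refl order.trans)
  also have "\<dots> = R + T * norm v + (L * T\<^sup>2) * E / 2" by (simp add: R_def algebra_simps)
  finally have 2: "E \<le> R + T * norm v + (L * T\<^sup>2) * E / 2" .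
  note E = bootstrap_bound_pair[OF 1 2 LE]
  show "T * norm v \<le> 12/11 * (norm e0 + q + T\<^sup>2 / 2 * \<rho>)" using E(2) unfolding R_def[symmetric] .
  show "norm (e k) \<le> 24/11 * (norm e0 + q + T\<^sup>2 / 2 * \<rho>)" if "k \<le> n"
    using order.trans[OF j(2)[OF that]] E(1) unfolding R_def[symmetric] E_def by blast
qed

text \<open>\<open>D k\<close> is twice the difference between the composite and the one-step
  trapezoidal rule on k steps. It changes by -\<open>E k\<close> when a step is added, and
  \<open>E k\<close> in turn by k + 1 times a second difference; summing twice gives k(k+1)/2 and
  k(k^2-1)/6.\<close>

lemma trapezoid_cell_error:
  fixes F :: "nat \<Rightarrow> 'b::real_normed_vector"
  assumes A: "\<And>i. Suc i < m \<Longrightarrow> norm (F (Suc (Suc i)) - 2 *\<^sub>R F (Suc i) + F i) \<le> A"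
  shows "norm ((\<Sum>i<m. F i + F (Suc i)) - real m *\<^sub>R (F 0 + F m)) \<le> A * (real m * ((real m)\<^sup>2 - 1) / 6)"
proof -
  define D where "D k = (\<Sum>i<k. F i + F (Suc i)) - real k *\<^sub>R (F 0 + F k)" for k
  define E where "E k = real k *\<^sub>R F (Suc k) - real (Suc k) *\<^sub>R F k + F 0" for k
  have E: "norm (E k) \<le> A * (real k * (real k + 1) / 2)" if "k < m" for k
    using that
  proof (induction k)
    case (Suc k)
    have "E (Suc k) = E k + real (Suc k) *\<^sub>R (F (Suc (Suc k)) - 2 *\<^sub>R F (Suc k) + F k)"
      by (simp add: E_def algebra_simps scaleR_2)
    then have "norm (E (Suc k)) \<le> norm (E k) + real (Suc k) * norm (F (Suc (Suc k)) - 2 *\<^sub>R F (Suc k) + F k)"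
      by (metis norm_triangle_ineq norm_scaleR abs_of_nat)
    also have "\<dots> \<le> A * (real k * (real k + 1) / 2) + real (Suc k) * A"
      using Suc A[of k] by (intro add_mono mult_left_mono) auto
    finally show ?case by (simp add: field_simps)
  qed (simp add: E_def)
  have "norm (D k) \<le> A * (real k * ((real k)\<^sup>2 - 1) / 6)" if "k \<le> m" for k
    using that
  proof (induction k)
    case (Suc k)
    have "D (Suc k) = D k - E k" by (simp add: D_def E_def algebra_simps)
    then have "norm (D (Suc k)) \<le> norm (D k) + norm (E k)" by (metis norm_triangle_ineq4)
    also have "\<dots> \<le> A * (real k * ((real k)\<^sup>2 - 1) / 6) + A * (real k * (real k + 1) / 2)"
      using Suc E[of k] by (intro add_mono) auto
    also have "\<dots> = A * (real (Suc k) * ((real (Suc k))\<^sup>2 - 1) / 6)" by (simp add: power2_eq_square field_simps)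
    finally show ?case .
  qed (simp add: D_def)
  then show ?thesis by (simp add: D_def)
qed

text \<open>The weights leave out the half weight at the right end, which is harmless as F vanishes
  there.\<close>

lemma trap_weight_sum_eq_trapezoid:
  fixes F :: "nat \<Rightarrow> 'b::real_vector"
  assumes "F n = 0"
  shows "(\<Sum>i<n. trap_weight i *\<^sub>R F i) = (1/2) *\<^sub>R (\<Sum>i<n. F i + F (Suc i))"
proof -
  have "(\<Sum>i<k. F i + F (Suc i)) = 2 *\<^sub>R (\<Sum>i<k. trap_weight i *\<^sub>R F i) + (if k = 0 then 0 else F k)" for k
    by (induction k) (auto simp: trap_weight_def algebra_simps scaleR_2)
  then show ?thesis using assms by simp
qed

text \<open>One cell estimate for each of the j coarse steps; half of m(m^2-1)/6 per cell yields the
  classical factor 1/12.\<close>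

lemma trapezoid_refinement_error:
  fixes F :: "nat \<Rightarrow> 'b::real_normed_vector"
  assumes A: "\<And>i. Suc i < j * m \<Longrightarrow> norm (F (Suc (Suc i)) - 2 *\<^sub>R F (Suc i) + F i) \<le> A"
    and A0: "0 \<le> A" and z: "F (j * m) = 0"
  shows "norm ((\<Sum>i<j*m. trap_weight i *\<^sub>R F i) - real m *\<^sub>R (\<Sum>l<j. trap_weight l *\<^sub>R F (l * m))) \<le> A * (real (j * m) * ((real m)\<^sup>2 - 1) / 12)"
proof -
  have blocks: "(\<Sum>i<k*m. F i + F (Suc i)) = (\<Sum>l<k. \<Sum>i<m. F (l*m+i) + F (Suc (l*m+i)))" for k
  proof -
    have "(\<Sum>i<m. F (l*m+i) + F (Suc (l*m+i))) = (\<Sum>i\<in>{l*m..<l*m+m}. F i + F (Suc i))" for l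
      using sum.shift_bounds_nat_ivl[of "\<lambda>i. F i + F (Suc i)" 0 "l*m" m] by (simp add: add.commute atLeast0LessThan)
    then show ?thesis by (simp only: sum.nat_group)
  qed
  have "(\<Sum>i<j*m. trap_weight i *\<^sub>R F i) - real m *\<^sub>R (\<Sum>l<j. trap_weight l *\<^sub>R F (l * m))
    = (1/2) *\<^sub>R (\<Sum>l<j. (\<Sum>i<m. F (l*m+i) + F (Suc (l*m+i))) - real m *\<^sub>R (F (l*m) + F (Suc l*m)))"
    using trap_weight_sum_eq_trapezoid[of F "j*m"] trap_weight_sum_eq_trapezoid[of "\<lambda>l. F (l*m)" j] z
    by (simp add: blocks sum_subtractf scaleR_sum_right scaleR_diff_right)
  also have "norm \<dots> \<le> 1/2 * (\<Sum>l<j. A * (real m * ((real m)\<^sup>2 - 1) / 6))"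
    unfolding norm_scaleR
  proof (intro mult_mono order.trans[OF norm_sum] sum_mono)
    fix l assume l: "l \<in> {..<j}"
    have "norm ((\<Sum>i<m. F (l*m+i) + F (l*m+Suc i)) - real m *\<^sub>R (F (l*m+0) + F (l*m+m))) \<le> A * (real m * ((real m)\<^sup>2 - 1) / 6)"
    proof (rule trapezoid_cell_error)
      fix i assume "Suc i < m"
      moreover have "l*m + m \<le> j*m" using l by (metis Suc_leI add.commute lessThan_iff mult_Suc mult_le_mono1)
      ultimately have "Suc (l*m+i) < j*m" by linarith
      from A[OF this] show "norm (F (l*m+Suc (Suc i)) - 2 *\<^sub>R F (l*m+Suc i) + F (l*m+i)) \<le> A" by simp
    qed
    then show "norm ((\<Sum>i<m. F (l*m+i) + F (Suc (l*m+i))) - real m *\<^sub>R (F (l*m) + F (Suc l*m))) \<le> A * (real m * ((real m)\<^sup>2 - 1) / 6)"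
      by (simp add: add.commute)
  qed (auto intro: sum_nonneg)
  also have "\<dots> = A * (real (j * m) * ((real m)\<^sup>2 - 1) / 12)" by (simp add: field_simps)
  finally show ?thesis .
qed

text \<open>The double sum is a trapezoidal rule for (e - i) r_i with e = jm. By the discrete
  Leibniz rule its second differences contain those of r with weight at most T (in units of time)
  and two first differences of r, whence T \<alpha> + 2 \<beta>; \<delta>^2 (m^2 - 1) is the
  difference of the squared steps.\<close>

lemma trap2_refinement_error:
  fixes r :: "nat \<Rightarrow> 'b::real_normed_vector"
  assumes r1: "\<And>i. i < j * m \<Longrightarrow> norm (r (Suc i) - r i) \<le> \<delta> * \<beta>"
    and r2: "\<And>i. Suc i < j * m \<Longrightarrow> norm (r (Suc (Suc i)) - 2 *\<^sub>R r (Suc i) + r i) \<le> \<delta>\<^sup>2 * \<alpha>"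
    and d: "0 \<le> \<delta>" "real (j * m) * \<delta> \<le> T" and ab: "0 \<le> \<alpha>" "0 \<le> \<beta>" and m: "1 \<le> m"
  shows "norm (\<delta>\<^sup>2 *\<^sub>R trap2 r (j * m) - (real m * \<delta>)\<^sup>2 *\<^sub>R trap2 (\<lambda>l. r (l * m)) j)
      \<le> \<delta>\<^sup>2 * ((real m)\<^sup>2 - 1) * T * (T * \<alpha> + 2 * \<beta>) / 12"
proof -
  define e where "e = j * m"
  define F where "F i = (real e - real i) *\<^sub>R r i" for i
  have T0: "0 \<le> T" using d by (meson mult_nonneg_nonneg of_nat_0_le_iff order.trans)
  have A: "norm (F (Suc (Suc i)) - 2 *\<^sub>R F (Suc i) + F i) \<le> \<delta> * (T * \<alpha> + 2 * \<beta>)" if i: "Suc i < j * m" for i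
  proof -
    have "F (Suc (Suc i)) - 2 *\<^sub>R F (Suc i) + F i =
      (real e - real (Suc i)) *\<^sub>R (r (Suc (Suc i)) - 2 *\<^sub>R r (Suc i) + r i) - (r (Suc (Suc i)) - r (Suc i)) - (r (Suc i) - r i)"
    proof -
      have id: "(c - 1) *\<^sub>R x - 2 *\<^sub>R (c *\<^sub>R y) + (c + 1) *\<^sub>R z = c *\<^sub>R (x - 2 *\<^sub>R y + z) - (x - y) - (y - z)" for c :: real and x y z :: 'b
        by (simp add: scaleR_left_diff_distrib scaleR_left_distrib scaleR_right_diff_distrib scaleR_right_distrib scaleR_2 del: scaleR_scaleR)
      have "F (Suc (Suc i)) = (real e - real (Suc i) - 1) *\<^sub>R r (Suc (Suc i))" "F i = (real e - real (Suc i) + 1) *\<^sub>R r i"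
        "F (Suc i) = (real e - real (Suc i)) *\<^sub>R r (Suc i)"
        by (auto simp: F_def intro!: arg_cong2[where f=scaleR])
      then show ?thesis using id[of "real e - real (Suc i)" "r (Suc (Suc i))" "r (Suc i)" "r i"] by (simp only:)
    qed
    also have "norm \<dots> \<le> norm ((real e - real (Suc i)) *\<^sub>R (r (Suc (Suc i)) - 2 *\<^sub>R r (Suc i) + r i)) + norm (r (Suc (Suc i)) - r (Suc i)) + norm (r (Suc i) - r i)"
      by (intro order.trans[OF norm_triangle_ineq4] add_right_mono norm_triangle_ineq4)
    also have "\<dots> \<le> (real e - real (Suc i)) * (\<delta>\<^sup>2 * \<alpha>) + \<delta> * \<beta> + \<delta> * \<beta>"
    proof -
      have "real (Suc i) \<le> real e" using i unfolding e_def of_nat_le_iff by simp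
      then show ?thesis
        using i r1[of i] r1[of "Suc i"] r2[OF i] unfolding norm_scaleR by (intro add_mono mult_mono) auto
    qed
    also have "(real e - real (Suc i)) * (\<delta>\<^sup>2 * \<alpha>) \<le> real e * (\<delta>\<^sup>2 * \<alpha>)"
      using ab by (intro mult_right_mono) auto
    also have "\<dots> = \<delta> * ((real e * \<delta>) * \<alpha>)" by (simp add: power2_eq_square)
    also have "\<dots> \<le> \<delta> * (T * \<alpha>)" using d ab by (intro mult_left_mono mult_right_mono) (auto simp: e_def)
    finally show ?thesis by (simp add: algebra_simps)
  qed
  have fine: "trap2 r (j * m) = (\<Sum>i<j*m. trap_weight i *\<^sub>R F i)"
    unfolding trap2_eq_sum F_def e_def by (intro sum.cong) (auto simp: of_nat_diff less_imp_le)
  have coarse: "real m *\<^sub>R trap2 (\<lambda>l. r (l * m)) j = (\<Sum>l<j. trap_weight l *\<^sub>R F (l * m))"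
    unfolding trap2_eq_sum F_def e_def scaleR_sum_right by (intro sum.cong) (auto simp: of_nat_diff less_imp_le algebra_simps)
  have "\<delta>\<^sup>2 *\<^sub>R trap2 r (j * m) - (real m * \<delta>)\<^sup>2 *\<^sub>R trap2 (\<lambda>l. r (l * m)) j
      = \<delta>\<^sup>2 *\<^sub>R ((\<Sum>i<j*m. trap_weight i *\<^sub>R F i) - real m *\<^sub>R (\<Sum>l<j. trap_weight l *\<^sub>R F (l * m)))"
    unfolding fine coarse[symmetric] by (simp add: power2_eq_square algebra_simps)
  also have "norm \<dots> \<le> \<delta>\<^sup>2 * ((\<delta> * (T * \<alpha> + 2 * \<beta>)) * (real (j * m) * ((real m)\<^sup>2 - 1) / 12))"
    unfolding norm_scaleR using d ab T0 A
    by (intro mult_mono trapezoid_refinement_error) (auto simp: F_def e_def)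
  also have "\<dots> = \<delta>\<^sup>2 * ((real m)\<^sup>2 - 1) * (real (j * m) * \<delta>) * (T * \<alpha> + 2 * \<beta>) / 12" by simp
  also have "\<dots> \<le> \<delta>\<^sup>2 * ((real m)\<^sup>2 - 1) * T * (T * \<alpha> + 2 * \<beta>) / 12"
    using d ab T0 m by (intro divide_right_mono mult_right_mono mult_left_mono) auto
  finally show ?thesis .
qed

section \<open>Verlet iterates, their tangents and the inversion of the endpoint map\<close>

definition vpos :: "('a::euclidean_space \<Rightarrow> 'a) \<Rightarrow> real \<Rightarrow> nat \<Rightarrow> 'a \<Rightarrow> 'a \<Rightarrow> 'a" where
  "vpos g \<delta> k x v = fst ((verlet_step g \<delta> ^^ k) (x, v))"

definition vvel :: "('a::euclidean_space \<Rightarrow> 'a) \<Rightarrow> real \<Rightarrow> nat \<Rightarrow> 'a \<Rightarrow> 'a \<Rightarrow> 'a" where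
  "vvel g \<delta> k x v = snd ((verlet_step g \<delta> ^^ k) (x, v))"

lemma vpos_0[simp]: "vpos g \<delta> 0 x v = x" and vvel_0[simp]: "vvel g \<delta> 0 x v = v"
  by (simp_all add: vpos_def vvel_def)

lemma vpos_Suc: "vpos g \<delta> (Suc k) x v = vpos g \<delta> k x v + \<delta> *\<^sub>R vvel g \<delta> k x v - (\<delta>\<^sup>2 / 2) *\<^sub>R g (vpos g \<delta> k x v)"
  and vvel_Suc: "vvel g \<delta> (Suc k) x v = vvel g \<delta> k x v - (\<delta> / 2) *\<^sub>R (g (vpos g \<delta> k x v) + g (vpos g \<delta> (Suc k) x v))"
  by (simp_all add: vpos_def vvel_def verlet_step_def Let_def)

text \<open>The second conjunct concerns the velocity half a step later. Unlike the velocity at a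
  grid point it changes by \<delta> times a single gradient, which closes the induction.\<close>

lemma vpos_trap2:
  "vpos g \<delta> k x v = x + (real k * \<delta>) *\<^sub>R v - \<delta>\<^sup>2 *\<^sub>R trap2 (\<lambda>i. g (vpos g \<delta> i x v)) k
   \<and> vvel g \<delta> k x v - (\<delta> / 2) *\<^sub>R g (vpos g \<delta> k x v) = v - \<delta> *\<^sub>R trap1 (\<lambda>i. g (vpos g \<delta> i x v)) (Suc k)"
proof (induction k)
  case 0
  show ?case by (simp add: trap1_Suc trap_weight_def)
next
  case (Suc k)
  let ?q = "\<lambda>i. vpos g \<delta> i x v"
  let ?r = "\<lambda>i. g (?q i)"
  have v: "vvel g \<delta> k x v = v - \<delta> *\<^sub>R trap1 ?r (Suc k) + (\<delta> / 2) *\<^sub>R ?r k" using Suc by (simp add: algebra_simps)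
  have "?q (Suc k) = ?q k + \<delta> *\<^sub>R v - \<delta>\<^sup>2 *\<^sub>R trap1 ?r (Suc k)"
    unfolding vpos_Suc v by (simp add: algebra_simps power2_eq_square)
  also have "?q k = x + (real k * \<delta>) *\<^sub>R v - \<delta>\<^sup>2 *\<^sub>R trap2 ?r k" using Suc by blast
  finally have 1: "?q (Suc k) = x + (real (Suc k) * \<delta>) *\<^sub>R v - \<delta>\<^sup>2 *\<^sub>R trap2 ?r (Suc k)"
    by (simp add: trap2_Suc algebra_simps)
  have "vvel g \<delta> (Suc k) x v - (\<delta> / 2) *\<^sub>R ?r (Suc k) = v - \<delta> *\<^sub>R trap1 ?r (Suc k) - \<delta> *\<^sub>R ?r (Suc k)"
  proof -
    have "(\<delta> / 2) *\<^sub>R ?r (Suc k) + (\<delta> / 2) *\<^sub>R ?r (Suc k) = \<delta> *\<^sub>R ?r (Suc k)" by (simp add: scaleR_left_distrib[symmetric])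
    then show ?thesis unfolding vvel_Suc v scaleR_right_distrib by (simp add: algebra_simps)
  qed
  then have 2: "vvel g \<delta> (Suc k) x v - (\<delta> / 2) *\<^sub>R ?r (Suc k) = v - \<delta> *\<^sub>R trap1 ?r (Suc (Suc k))"
    unfolding trap1_Suc[of ?r "Suc k"] by (simp add: trap_weight_def algebra_simps)
  show ?case using 1 2 by blast
qed

lemma vform_vpos: "vform \<delta> n (\<lambda>k. vpos g \<delta> k x v) x v (\<lambda>k. g (vpos g \<delta> k x v))"
  unfolding vform_def using vpos_trap2 by blast

text \<open>Both neighbours are expanded at the middle point with remainder B s^2 each; the linear
  parts add up to the derivative applied to the second difference of the points.\<close>

lemma second_difference_bound:
  fixes G :: "'a::real_normed_vector \<Rightarrow> 'b::real_normed_vector"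
  assumes der: "\<And>x. (G has_derivative G' x) (at x)" and A: "\<And>x v. norm (G' x v) \<le> A * norm v"
    and B: "\<And>x y v. norm (G' x v - G' y v) \<le> B * norm (x - y) * norm v" and B0: "0 \<le> B"
    and s: "norm (p2 - p1) \<le> s" "norm (p1 - p0) \<le> s" and t: "norm (p2 - 2 *\<^sub>R p1 + p0) \<le> t" and A0: "0 \<le> A"
  shows "norm (G p2 - 2 *\<^sub>R G p1 + G p0) \<le> 2 * B * s\<^sup>2 + A * t"
proof -
  have taylor: "norm (G y - G p1 - G' p1 (y - p1)) \<le> B * s\<^sup>2" if y: "norm (y - p1) \<le> s" for y
  proof -
    have bl: "bounded_linear (G' p1)" using der by (rule has_derivative_bounded_linear)
    have "norm ((G y - G' p1 y) - (G p1 - G' p1 p1)) \<le> (B * s) * norm (y - p1)"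
    proof (rule differentiable_bound[of "cball p1 s" "\<lambda>z. G z - G' p1 z" "\<lambda>z v. G' z v - G' p1 v"])
      show "((\<lambda>z. G z - G' p1 z) has_derivative (\<lambda>v. G' z v - G' p1 v)) (at z within cball p1 s)" for z
        by (rule has_derivative_at_withinI, intro has_derivative_diff der bounded_linear_imp_has_derivative bl)
      show "onorm (\<lambda>v. G' z v - G' p1 v) \<le> B * s" if "z \<in> cball p1 s" for z
      proof (rule onorm_bound)
        show "0 \<le> B * s" using B0 order.trans[OF norm_ge_zero y] by simp
        fix v
        have "norm (G' z v - G' p1 v) \<le> B * norm (z - p1) * norm v" by (rule B)
        also have "\<dots> \<le> B * s * norm v" using that B0 by (intro mult_right_mono mult_left_mono) (simp_all add: dist_norm norm_minus_commute[of p1 z])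
        finally show "norm (G' z v - G' p1 v) \<le> B * s * norm v" .
      qed
      show "y \<in> cball p1 s" "p1 \<in> cball p1 s" using y order.trans[OF norm_ge_zero y] by (simp_all add: dist_norm norm_minus_commute[of p1 y])
    qed auto
    also have "\<dots> \<le> (B * s) * s" using y B0 order.trans[OF norm_ge_zero y] by (intro mult_left_mono) simp_all
    finally have "norm ((G y - G' p1 y) - (G p1 - G' p1 p1)) \<le> B * s\<^sup>2" by (simp add: power2_eq_square mult.assoc)
    moreover have "(G y - G' p1 y) - (G p1 - G' p1 p1) = G y - G p1 - G' p1 (y - p1)"
      unfolding linear_diff[OF bounded_linear.linear[OF bl]] by simp
    ultimately show ?thesis by simp
  qed
  have lin: "linear (G' p1)" using der by (metis has_derivative_linear)
  have "G p2 - 2 *\<^sub>R G p1 + G p0 = (G p2 - G p1 - G' p1 (p2 - p1)) + (G p0 - G p1 - G' p1 (p0 - p1)) + G' p1 (p2 - 2 *\<^sub>R p1 + p0)"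
    by (simp add: linear_diff[OF lin] linear_add[OF lin] linear_scale[OF lin] scaleR_2)
  also have "norm \<dots> \<le> norm (G p2 - G p1 - G' p1 (p2 - p1)) + norm (G p0 - G p1 - G' p1 (p0 - p1)) + norm (G' p1 (p2 - 2 *\<^sub>R p1 + p0))"
    by (intro order.trans[OF norm_triangle_ineq] add_right_mono norm_triangle_ineq)
  also have "\<dots> \<le> B * s\<^sup>2 + B * s\<^sup>2 + A * t"
    using taylor[OF s(1)] taylor[of p0] s(2) order.trans[OF A[of p1 "p2 - 2 *\<^sub>R p1 + p0"] mult_left_mono[OF t A0]]
    unfolding norm_minus_commute[of p1 p0] by (intro add_mono)
  finally show ?thesis by simp
qed

text \<open>Higher derivatives are curried vector fields: \<open>D2 x u\<close> is the Hessian
  applied to u, and \<open>D3\<close>, \<open>D4\<close> differentiate it further. A bound on such a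
  vector is the operator norm bound of the multilinear form with one slot dualised. The horizon T
  belongs to the locale because every absorption argument rests on L T^2 \<le> 1/12.\<close>

locale potential =
  fixes grad :: "'a::euclidean_space \<Rightarrow> 'a" and D2 :: "'a \<Rightarrow> 'a \<Rightarrow> 'a"
    and D3 :: "'a \<Rightarrow> 'a \<Rightarrow> 'a \<Rightarrow> 'a" and D4 :: "'a \<Rightarrow> 'a \<Rightarrow> 'a \<Rightarrow> 'a \<Rightarrow> 'a" and L M N T :: real
  assumes hess: "\<And>x. (grad has_derivative D2 x) (at x)"
    and der3: "\<And>x u. ((\<lambda>y. D2 y u) has_derivative D3 x u) (at x)"
    and der4: "\<And>x u v. ((\<lambda>y. D3 y u v) has_derivative D4 x u v) (at x)"
    and D2_bd: "\<And>x u. norm (D2 x u) \<le> L * norm u"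
    and D3_bd: "\<And>x u v. norm (D3 x u v) \<le> M * norm u * norm v"
    and D4_bd: "\<And>x u v w. norm (D4 x u v w) \<le> N * norm u * norm v * norm w"
    and grad0: "grad 0 = 0" and T: "0 < T" and LT: "L * T\<^sup>2 \<le> 1/12"
begin

lemma L0: "0 \<le> L" and M0: "0 \<le> M" and N0: "0 \<le> N"
proof -
  obtain b :: 'a where b: "b \<in> Basis" using nonempty_Basis by blast
  show "0 \<le> L" using order.trans[OF norm_ge_zero D2_bd[of 0 b]] b by simp
  show "0 \<le> M" using order.trans[OF norm_ge_zero D3_bd[of 0 b b]] b by simp
  show "0 \<le> N" using order.trans[OF norm_ge_zero D4_bd[of 0 b b b]] b by simp
qed

lemma grad_lip: "norm (grad x - grad y) \<le> L * norm (x - y)"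
  by (rule lipschitz_of_derivative_bound[OF hess D2_bd L0])

lemma grad_bd: "norm (grad x) \<le> L * norm x"
  using grad_lip[of x 0] by (simp add: grad0)

lemma D2_lip: "norm (D2 x u - D2 y u) \<le> M * norm (x - y) * norm u"
proof -
  have "norm (D2 x u - D2 y u) \<le> (M * norm u) * norm (x - y)"
    by (rule lipschitz_of_derivative_bound[where g="\<lambda>y. D2 y u" and g'="\<lambda>x. D3 x u", OF der3 D3_bd]) (simp add: M0)
  then show ?thesis by (simp add: mult_ac)
qed

lemma D3_lip: "norm (D3 x u v - D3 y u v) \<le> N * norm (x - y) * norm u * norm v"
proof -
  have "norm (D3 x u v - D3 y u v) \<le> (N * norm u * norm v) * norm (x - y)"
    by (rule lipschitz_of_derivative_bound[where g="\<lambda>y. D3 y u v" and g'="\<lambda>x. D4 x u v", OF der4 D4_bd]) (simp add: N0)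
  then show ?thesis by (simp add: mult_ac)
qed

lemma D2_linear: "linear (D2 x)"
  using hess by (metis has_derivative_linear)

lemma grad_continuous: "continuous_on UNIV grad"
  using hess by (meson has_derivative_continuous continuous_at_imp_continuous_on)

lemma vpos_vvel_continuous:
  "continuous_on UNIV (\<lambda>p. (verlet_step grad \<delta> ^^ k) p)"
proof (induction k)
  case (Suc k)
  have c: "continuous_on UNIV (\<lambda>p. grad (f p))" if "continuous_on UNIV f" for f :: "'a \<times> 'a \<Rightarrow> 'a"
    using continuous_on_compose2[OF grad_continuous that] by auto
  have "continuous_on UNIV (verlet_step grad \<delta>)"
    unfolding verlet_step_def[abs_def] Let_def by (intro continuous_intros c)
  then show ?case using Suc by (auto intro: continuous_on_compose2 simp: o_def)
qed (simp add: continuous_on_id)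

lemma vpos_continuous: "continuous_on UNIV (\<lambda>p. vpos grad \<delta> k (fst p) (snd p))"
  unfolding vpos_def by (auto intro!: continuous_intros vpos_vvel_continuous)

lemma vpos_measurable: "(\<lambda>p. vpos grad \<delta> k (fst p) (snd p)) \<in> borel_measurable borel"
  by (rule borel_measurable_continuous_onI[OF vpos_continuous])

lemma vpos_measurable_pair: "(\<lambda>p. vpos grad \<delta> k (fst p) (snd p)) \<in> borel_measurable (borel \<Otimes>\<^sub>M borel)"
  using vpos_measurable by (simp add: borel_prod)

definition dvpos :: "real \<Rightarrow> nat \<Rightarrow> 'a \<Rightarrow> 'a \<Rightarrow> 'a \<Rightarrow> 'a" where
  "dvpos \<delta> k x v = frechet_derivative (\<lambda>v. vpos grad \<delta> k x v) (at v)"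

text \<open>Strong induction, since the double sum at k involves all earlier positions.
  Differentiating the trapezoidal form shows that tangents satisfy \<open>vform\<close> with the
  Hessian in the place of the gradient.\<close>

lemma vpos_has_derivative: "((\<lambda>v. vpos grad \<delta> k x v) has_derivative dvpos \<delta> k x v) (at v)"
  and dvpos_eq: "dvpos \<delta> k x v u = (real k * \<delta>) *\<^sub>R u - \<delta>\<^sup>2 *\<^sub>R trap2 (\<lambda>i. D2 (vpos grad \<delta> i x v) (dvpos \<delta> i x v u)) k"
proof -
  have "((\<lambda>v. vpos grad \<delta> k x v) has_derivative dvpos \<delta> k x v) (at v) \<and>
    (\<forall>u. dvpos \<delta> k x v u = (real k * \<delta>) *\<^sub>R u - \<delta>\<^sup>2 *\<^sub>R trap2 (\<lambda>i. D2 (vpos grad \<delta> i x v) (dvpos \<delta> i x v u)) k)"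
  proof (induction k rule: less_induct)
    case (less k)
    let ?D = "\<lambda>u. (real k * \<delta>) *\<^sub>R u - \<delta>\<^sup>2 *\<^sub>R trap2 (\<lambda>i. D2 (vpos grad \<delta> i x v) (dvpos \<delta> i x v u)) k"
    have "((\<lambda>v. vpos grad \<delta> k x v) has_derivative ?D) (at v)"
    proof -
      have g: "((\<lambda>v. grad (vpos grad \<delta> i x v)) has_derivative (\<lambda>u. D2 (vpos grad \<delta> i x v) (dvpos \<delta> i x v u))) (at v)" if "i < k" for i
        using has_derivative_compose[OF _ hess] less[OF that] by blast
      have "((\<lambda>v. x + (real k * \<delta>) *\<^sub>R v - \<delta>\<^sup>2 *\<^sub>R trap2 (\<lambda>i. grad (vpos grad \<delta> i x v)) k) has_derivative (\<lambda>u. 0 + (real k * \<delta>) *\<^sub>R u - \<delta>\<^sup>2 *\<^sub>R trap2 (\<lambda>i. D2 (vpos grad \<delta> i x v) (dvpos \<delta> i x v u)) k)) (at v)"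
        unfolding trap2_eq_sum
        by (intro has_derivative_diff has_derivative_add has_derivative_const has_derivative_scaleR_right has_derivative_ident has_derivative_sum g) auto
      then show ?thesis using vpos_trap2[of grad \<delta> k x] by simp
    qed
    moreover from this have "dvpos \<delta> k x v = ?D"
      unfolding dvpos_def by (intro frechet_derivative_at[symmetric])
    ultimately show ?case by simp
  qed
  then show "((\<lambda>v. vpos grad \<delta> k x v) has_derivative dvpos \<delta> k x v) (at v)"
    "dvpos \<delta> k x v u = (real k * \<delta>) *\<^sub>R u - \<delta>\<^sup>2 *\<^sub>R trap2 (\<lambda>i. D2 (vpos grad \<delta> i x v) (dvpos \<delta> i x v u)) k"
    by blast+
qed

lemma vform_dvpos: "vform \<delta> n (\<lambda>k. dvpos \<delta> k x v u) 0 u (\<lambda>k. D2 (vpos grad \<delta> k x v) (dvpos \<delta> k x v u))"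
  unfolding vform_def add_0 using dvpos_eq by blast

text \<open>11/240 is the product of L T^2/2 \<le> 1/24 and the factor 11/10 of
  \<open>vform_bound\<close>; it is rounded up to 1/20.\<close>

lemma dvpos_near:
  assumes d: "0 \<le> \<delta>" "real n * \<delta> = T"
  shows "norm (dvpos \<delta> n x v u - T *\<^sub>R u) \<le> T / 20 * norm u"
proof -
  have b: "norm (dvpos \<delta> i x v u) \<le> 11/10 * T * norm u" if "i \<le> n" for i
    using vform_bound[OF vform_dvpos, where L=L and \<rho>=0 and n=n and k=i and T=T and \<delta>=\<delta>] D2_bd d L0 LT that by (simp add: mult.assoc)
  have "norm (D2 (vpos grad \<delta> i x v) (dvpos \<delta> i x v u)) \<le> L * (11/10 * T * norm u)" if "i < n" for i
    using order.trans[OF D2_bd mult_left_mono[OF b L0]] that by simp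
  then have "norm (\<delta>\<^sup>2 *\<^sub>R trap2 (\<lambda>i. D2 (vpos grad \<delta> i x v) (dvpos \<delta> i x v u)) n) \<le> T\<^sup>2 / 2 * (L * (11/10 * T * norm u))"
    unfolding d(2)[symmetric] using d L0 by (intro scaled_trap2_le) auto
  also have "\<dots> = (L * T\<^sup>2) * (11/20 * T * norm u)" by simp
  also have "\<dots> \<le> 1/12 * (11/20 * T * norm u)" using LT T by (intro mult_right_mono) auto
  also have "\<dots> \<le> T / 20 * norm u" using T by simp
  finally show ?thesis using dvpos_eq[of \<delta> n x v u] d(2) by simp
qed

text \<open>The shooting map: the initial velocity that reaches a prescribed endpoint from x in n
  steps. It is a genuine inverse once n \<delta> = T.\<close>

definition vinv :: "real \<Rightarrow> nat \<Rightarrow> 'a \<Rightarrow> 'a \<Rightarrow> 'a" where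
  "vinv \<delta> n x = inv (vpos grad \<delta> n x)"

context
  fixes \<delta> n assumes d: "0 \<le> \<delta>" "real n * \<delta> = T"
begin

lemma vpos_expanding: "norm (vpos grad \<delta> n x v - vpos grad \<delta> n x w - T *\<^sub>R (v - w)) \<le> T / 20 * norm (v - w)"
proof -
  have "norm ((vpos grad \<delta> n x v - T *\<^sub>R v) - (vpos grad \<delta> n x w - T *\<^sub>R w)) \<le> T / 20 * norm (v - w)"
  proof (rule lipschitz_of_derivative_bound[where g'="\<lambda>v u. dvpos \<delta> n x v u - T *\<^sub>R u"])
    show "((\<lambda>v. vpos grad \<delta> n x v - T *\<^sub>R v) has_derivative (\<lambda>u. dvpos \<delta> n x v u - T *\<^sub>R u)) (at v)" for v
      by (intro has_derivative_diff vpos_has_derivative has_derivative_scaleR_right has_derivative_ident)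
  qed (use dvpos_near[OF d] T in auto)
  then show ?thesis by (simp add: algebra_simps)
qed

text \<open>The endpoint map is T times a perturbation of the identity with Lipschitz constant
  1/20.\<close>

lemma vpos_bij: "bij (vpos grad \<delta> n x)"
proof -
  define g where "g v = (1 / T) *\<^sub>R (vpos grad \<delta> n x v - T *\<^sub>R v)" for v
  have "bij (\<lambda>v. v + g v)"
  proof (rule bij_id_plus_contraction[where c="1/20"])
    fix v w
    have "g v - g w = (1 / T) *\<^sub>R (vpos grad \<delta> n x v - vpos grad \<delta> n x w - T *\<^sub>R (v - w))"
      using T by (simp add: g_def algebra_simps)
    then have "norm (g v - g w) = (1 / T) * norm (vpos grad \<delta> n x v - vpos grad \<delta> n x w - T *\<^sub>R (v - w))" using T by simp
    also have "\<dots> \<le> (1 / T) * (T / 20 * norm (v - w))" using T by (intro mult_left_mono vpos_expanding) auto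
    finally show "norm (g v - g w) \<le> 1/20 * norm (v - w)" using T by simp
  qed auto
  moreover have "bij (\<lambda>y::'a. T *\<^sub>R y)"
    by (rule o_bij[of "\<lambda>y. (1 / T) *\<^sub>R y"]) (use T in \<open>simp_all add: fun_eq_iff\<close>)
  ultimately have "bij ((\<lambda>y. T *\<^sub>R y) \<circ> (\<lambda>v. v + g v))" by (rule bij_comp)
  moreover have "(\<lambda>y. T *\<^sub>R y) \<circ> (\<lambda>v. v + g v) = vpos grad \<delta> n x"
    using T by (simp add: fun_eq_iff g_def scaleR_right_distrib)
  ultimately show ?thesis by simp
qed

lemma vpos_vinv[simp]: "vpos grad \<delta> n x (vinv \<delta> n x z) = z"
  and vinv_vpos[simp]: "vinv \<delta> n x (vpos grad \<delta> n x v) = v"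
  unfolding vinv_def by (rule surj_f_inv_f[OF bij_is_surj[OF vpos_bij]], rule inv_f_f[OF bij_is_inj[OF vpos_bij]])

text \<open>The endpoint map expands distances by at least 19 T/20, so 2/T is a generous Lipschitz
  constant for its inverse.\<close>

lemma vinv_lipschitz: "norm (vinv \<delta> n x y - vinv \<delta> n x z) \<le> (2 / T) * norm (y - z)"
proof -
  define v w where "v = vinv \<delta> n x y" and "w = vinv \<delta> n x z"
  have "norm (T *\<^sub>R (v - w)) \<le> norm (vpos grad \<delta> n x v - vpos grad \<delta> n x w) + norm (vpos grad \<delta> n x v - vpos grad \<delta> n x w - T *\<^sub>R (v - w))"
    using norm_triangle_sub[of "T *\<^sub>R (v - w)" "vpos grad \<delta> n x v - vpos grad \<delta> n x w"]
    by (simp only: norm_minus_commute[of "T *\<^sub>R (v - w)"])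
  then have "T * norm (v - w) \<le> norm (y - z) + T / 20 * norm (v - w)"
    using vpos_expanding[of x v w] T by (simp add: v_def w_def)
  then have "T * norm (v - w) \<le> 2 * norm (y - z)" using T norm_ge_zero[of "y - z"] by argo
  then show ?thesis using T by (simp add: v_def w_def field_simps)
qed

text \<open>The derivative at the preimage is close to T times the identity, hence injective and,
  the dimension being finite, invertible. The Lipschitz bound supplies the continuity that the
  inverse rule asks for.\<close>

lemma vinv_differentiable: "vinv \<delta> n x differentiable (at z)"
proof -
  let ?f' = "dvpos \<delta> n x (vinv \<delta> n x z)"
  have lin: "linear ?f'" using vpos_has_derivative by (metis has_derivative_linear)
  have "?f' u = 0 \<Longrightarrow> u = 0" for u
  proof -
    assume "?f' u = 0"
    then have "T * norm u \<le> T / 20 * norm u" using dvpos_near[OF d, of x "vinv \<delta> n x z" u] T by simp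
    then have "T * norm u \<le> 0" by linarith
    then show "u = 0" using T by (simp add: mult_le_0_iff)
  qed
  then have "inj ?f'" by (simp add: linear_injective_0[OF lin])
  then obtain g' where g': "linear g'" "g' \<circ> ?f' = id" using linear_injective_left_inverse[OF lin] by blast
  have "(vinv \<delta> n x has_derivative g') (at z)"
  proof (rule has_derivative_inverse_basic[OF vpos_has_derivative, where T=UNIV])
    show "bounded_linear g'" using g' by (simp add: linear_linear)
    show "continuous (at z) (vinv \<delta> n x)"
      unfolding continuous_at_eps_delta
    proof (intro allI impI)
      fix e :: real assume e: "e > 0"
      have "dist (vinv \<delta> n x z') (vinv \<delta> n x z) < e" if "dist z' z < e * T / 2" for z'
      proof -
        have "dist (vinv \<delta> n x z') (vinv \<delta> n x z) \<le> (2 / T) * dist z' z" unfolding dist_norm by (rule vinv_lipschitz)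
        also have "\<dots> < (2 / T) * (e * T / 2)" using that T by (intro mult_strict_left_mono) auto
        finally show ?thesis using T by simp
      qed
      then show "\<exists>d>0. \<forall>z'. dist z' z < d \<longrightarrow> dist (vinv \<delta> n x z') (vinv \<delta> n x z) < e"
        using e T by (intro exI[of _ "e * T / 2"]) auto
    qed
  qed (use g' in auto)
  then show ?thesis by (rule differentiableI)
qed

end

end

section \<open>Numerical slack in the a priori bounds\<close>

lemma quadratic_split: "(5/4 * s + 1/4 * t)\<^sup>2 \<le> 25/8 * s\<^sup>2 + 1/8 * t\<^sup>2" for s t :: real
proof -
  have "25/8 * s\<^sup>2 + 1/8 * t\<^sup>2 - (5/4 * s + 1/4 * t)\<^sup>2 = (5/4 * s - 1/4 * t)\<^sup>2"
    by (simp add: power2_eq_square algebra_simps)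
  then show ?thesis using zero_le_power2[of "5/4 * s - 1/4 * t"] by linarith
qed

text \<open>Solving for W gives the factors 251/229 and 22/229, rounded up to 11/10 and
  1/10.\<close>

lemma velocity_bound_arith:
  fixes W \<nu> \<xi> D q :: real
  assumes "W \<le> \<nu> + D" "D \<le> 11/240 * (2 * \<xi> + \<nu> + W)" "0 \<le> \<nu>" "0 \<le> \<xi>"
  shows "W \<le> 11/10 * \<nu> + 1/10 * \<xi>"
  using assms by (simp add: field_simps)

text \<open>Both coefficients come out as 121/100, below 5/4.\<close>

lemma position_bound_arith:
  fixes W \<nu> \<xi> q :: real
  assumes "q \<le> 11/10 * (\<xi> + W)" "W \<le> 11/10 * \<nu> + 1/10 * \<xi>" "0 \<le> \<nu>" "0 \<le> \<xi>"
  shows "q \<le> 5/4 * (\<xi> + \<nu>)"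
  using assms by (simp add: field_simps)

lemma perturbed_velocity_arith:
  fixes W \<nu> \<xi> V q :: real
  assumes "W \<le> 11/10 * \<nu> + 1/10 * \<xi>" "V = 5/4 * \<nu> + 1/4 * \<xi>" "0 \<le> \<xi>" "q \<le> 5/48 * (\<xi> + \<nu>)" "0 \<le> \<nu>"
  shows "W + q \<le> V"
  using assms by (simp add: field_simps)

text \<open>Bookkeeping for \<open>uB_close\<close>: the lower case letters together with L are the
  seven monomials of the tangent error, A to G the defect terms. Every monomial ends up with a
  coefficient below 1.\<close>

lemma tangent_defect_arith:
  fixes A B C D E F G L a b c d e f :: real
  assumes "A \<le> 25/8 * f + 1/8 * d" "B \<le> 5/48 * a + 5/48 * b" "C \<le> L * (1/12)" "D = 5/4 * b + 1/4 * a"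
    "E \<le> 25/8 * e + 1/8 * c" "F \<le> 5/576 * a + 5/576 * b" "G \<le> 1/12 * D"
    "0 \<le> a" "0 \<le> b" "0 \<le> c" "0 \<le> d" "0 \<le> e" "0 \<le> f" "0 \<le> L"
  shows "12/11 * ((5/48) * (2 * A + B + C + 4 * D + 2 * L) + (5/44) * (2 * E + F + 2 * G)) \<le> L + a + b + c + d + e + f"
proof -
  have 1: "2 * A + B + C + 4 * D + 2 * L \<le> 25/4 * f + 1/4 * d + 9/8 * a + 41/8 * b + 17/8 * L"
    using assms by (simp add: field_simps)
  have 2: "2 * E + F + 2 * G \<le> 25/4 * e + 1/4 * c + 1/8 * a + 1/4 * b"
    using assms by (simp add: field_simps)
  have "12/11 * ((5/48) * (2 * A + B + C + 4 * D + 2 * L) + (5/44) * (2 * E + F + 2 * G))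
     \<le> 12/11 * ((5/48) * (25/4 * f + 1/4 * d + 9/8 * a + 41/8 * b + 17/8 * L) + (5/44) * (25/4 * e + 1/4 * c + 1/8 * a + 1/4 * b))"
    by (intro mult_left_mono add_mono 1 2) auto
  also have "\<dots> \<le> L + a + b + c + d + e + f" using assms(8-14) by (simp add: field_simps)
  finally show ?thesis .
qed

context potential
begin

text \<open>Equal starting and end points turn T(w - v) into a difference of two force sums, each at
  most 11/240 of its scale. The estimate does not see the step sizes; it supplies the a priori
  bounds on which the refined comparison rests. The forces r and s are left abstract so that
  tangents are covered as well.\<close>

lemma velocity_comparison:
  assumes p: "vform h K p x v r" "real K * h = T" "0 \<le> h" and q: "vform \<delta> n q x w s" "real n * \<delta> = T" "0 \<le> \<delta>"
    and r: "\<And>i. norm (r i) \<le> L * norm (p i)" and s: "\<And>i. norm (s i) \<le> L * norm (q i)" and e: "p K = q n"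
  shows "T * norm (w - v) \<le> 11/240 * (2 * norm x + T * norm v + T * norm w)"
    and "T * norm w \<le> 11/10 * (T * norm v) + 1/10 * norm x"
    and "k \<le> n \<Longrightarrow> norm (q k) \<le> 5/4 * (norm x + T * norm v)"
proof -
  have pb: "norm (p k) \<le> 11/10 * (norm x + T * norm v)" if "k \<le> K" for k
    using vform_bound[OF p(1), where L=L and \<rho>=0 and T=T and k=k] r p L0 LT that by simp
  have qb: "norm (q k) \<le> 11/10 * (norm x + T * norm w)" if "k \<le> n" for k
    using vform_bound[OF q(1), where L=L and \<rho>=0 and T=T and k=k] s q L0 LT that by simp
  have c: "T\<^sup>2 / 2 * (L * (11/10 * z)) \<le> 11/240 * z" if "0 \<le> z" for z
    using mult_right_mono[OF LT that] by (simp add: mult_ac)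
  have nv: "0 \<le> T * norm v" "0 \<le> T * norm w" "0 \<le> norm x" using T by simp_all
  have z: "0 \<le> norm x + T * norm v" "0 \<le> norm x + T * norm w" using T by simp_all
  have P: "norm (h\<^sup>2 *\<^sub>R trap2 r K) \<le> 11/240 * (norm x + T * norm v)"
  proof -
    have "norm (h\<^sup>2 *\<^sub>R trap2 r K) \<le> (real K * h)\<^sup>2 / 2 * (L * (11/10 * (norm x + T * norm v)))"
    proof (rule scaled_trap2_le[OF _ order.refl p(3)])
      show "norm (r i) \<le> L * (11/10 * (norm x + T * norm v))" if "i < K" for i
        using that by (intro order.trans[OF r mult_left_mono[OF pb L0]]) simp
    qed (use L0 z in simp)
    also note p(2)
    also note c[OF z(1)]
    finally show ?thesis .
  qed
  have Q: "norm (\<delta>\<^sup>2 *\<^sub>R trap2 s n) \<le> 11/240 * (norm x + T * norm w)"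
  proof -
    have "norm (\<delta>\<^sup>2 *\<^sub>R trap2 s n) \<le> (real n * \<delta>)\<^sup>2 / 2 * (L * (11/10 * (norm x + T * norm w)))"
    proof (rule scaled_trap2_le[OF _ order.refl q(3)])
      show "norm (s i) \<le> L * (11/10 * (norm x + T * norm w))" if "i < n" for i
        using that by (intro order.trans[OF s mult_left_mono[OF qb L0]]) simp
    qed (use L0 z in simp)
    also note q(2)
    also note c[OF z(2)]
    finally show ?thesis .
  qed
  have "x + T *\<^sub>R v - h\<^sup>2 *\<^sub>R trap2 r K = x + T *\<^sub>R w - \<delta>\<^sup>2 *\<^sub>R trap2 s n"
    using p(1,2) q(1,2) e by (simp add: vform_def)
  then have "T *\<^sub>R (w - v) = \<delta>\<^sup>2 *\<^sub>R trap2 s n - h\<^sup>2 *\<^sub>R trap2 r K" by (simp add: algebra_simps)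
  then have "norm (T *\<^sub>R (w - v)) \<le> norm (\<delta>\<^sup>2 *\<^sub>R trap2 s n) + norm (h\<^sup>2 *\<^sub>R trap2 r K)" by (simp only: norm_triangle_ineq4)
  then show 1: "T * norm (w - v) \<le> 11/240 * (2 * norm x + T * norm v + T * norm w)" using P Q T by simp
  have "norm w \<le> norm v + norm (w - v)" by (rule norm_triangle_sub)
  then have "T * norm w \<le> T * norm v + T * norm (w - v)" using T unfolding distrib_left[symmetric] by (intro mult_left_mono) auto
  from velocity_bound_arith[OF this 1 nv(1,3)] show 2: "T * norm w \<le> 11/10 * (T * norm v) + 1/10 * norm x" .
  show "norm (q k) \<le> 5/4 * (norm x + T * norm v)" if "k \<le> n"
    by (rule position_bound_arith[OF qb[OF that] 2 nv(1,3)])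
qed

end

section \<open>Comparison of a coarse and a fine trajectory\<close>

text \<open>The trajectories \<open>a\<close> (step \<open>m\<delta>\<close>) and \<open>b\<close> (step \<open>\<delta>\<close>) start at the same point \<open>x\<close> and end at the same point;
  \<open>X\<close> and \<open>V\<close> are a priori bounds for positions and velocities, \<open>H\<close> is the difference of the squared steps.\<close>

locale two_grids = potential +
  fixes \<delta> :: real and m K :: nat and a b :: "nat \<Rightarrow> 'a" and x v vB :: 'a
  assumes m: "1 \<le> m" and d0: "0 \<le> \<delta>" and dT: "real (K * m) * \<delta> = T"
    and a: "vform (real m * \<delta>) K a x v (\<lambda>k. grad (a k))"
    and b: "vform \<delta> (K * m) b x vB (\<lambda>k. grad (b k))"
    and ab: "a K = b (K * m)"
begin

definition "V = 5/4 * norm v + 1/4 * norm x / T"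
definition "X = 5/4 * (norm x + T * norm v)"
definition "H = \<delta>\<^sup>2 * ((real m)\<^sup>2 - 1)"
text \<open>The bound of \<open>trap2_refinement_error\<close> for the gradient along
  \<open>b\<close>, whose first and second differences are at most \<delta> L V and \<delta>^2 (2 M
  V^2 + L L X).\<close>

definition "Q0 = H * T * (T * (2 * M * V\<^sup>2 + L * (L * X)) + 2 * (L * V)) / 12"

lemma coarse_horizon: "real K * (real m * \<delta>) = T" "0 \<le> real m * \<delta>"
  using dT d0 by (simp_all add: mult_ac)

lemma V0: "0 \<le> V" and X0: "0 \<le> X" and H0: "0 \<le> H" and Q00: "0 \<le> Q0"
proof -
  show V0: "0 \<le> V" and X0: "0 \<le> X" using T by (auto simp: V_def X_def)
  have "1 \<le> (real m)\<^sup>2" using m by simp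
  then show H0: "0 \<le> H" unfolding H_def by simp
  show "0 \<le> Q0" unfolding Q0_def using V0 X0 H0 M0 L0 T by (auto intro!: mult_nonneg_nonneg add_nonneg_nonneg)
qed

lemma vB_bound: "T * norm vB \<le> 11/10 * (T * norm v) + 1/10 * norm x"
  and b_bound: "k \<le> K * m \<Longrightarrow> norm (b k) \<le> X"
  using velocity_comparison(2,3)[OF a coarse_horizon b dT d0 grad_bd grad_bd ab] by (auto simp: X_def)

lemma T_L_X_le: "T * (L * X) \<le> 5/48 * (norm x / T + norm v)"
proof -
  have "T * (T * (L * X)) = (L * T\<^sup>2) * X" by (simp add: power2_eq_square)
  also have "\<dots> \<le> 1/12 * X" using LT X0 by (rule mult_right_mono)
  also have "\<dots> = T * (5/48 * (norm x / T + norm v))" using T by (simp add: X_def field_simps)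
  finally show ?thesis using T by simp
qed

lemma b_step: "Suc k \<le> K * m \<Longrightarrow> norm (b (Suc k) - b k) \<le> \<delta> * V"
proof -
  assume k: "Suc k \<le> K * m"
  have "norm (b (Suc k) - b k) \<le> \<delta> * (norm vB + T * (L * X))"
  proof (rule vform_step_bound[OF b k])
    show "norm (grad (b i)) \<le> L * X" if "i < K * m" for i
      using order.trans[OF grad_bd mult_left_mono[OF b_bound L0]] that by simp
  qed (use d0 dT L0 X0 in auto)
  also have "\<dots> \<le> \<delta> * V"
  proof (rule mult_left_mono[OF _ d0])
    have "norm vB \<le> 11/10 * norm v + 1/10 * (norm x / T)" using vB_bound T by (simp add: field_simps)
    moreover have "V = 5/4 * norm v + 1/4 * (norm x / T)" by (simp add: V_def)
    moreover have "0 \<le> norm x / T" using T by simp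
    ultimately show "norm vB + T * (L * X) \<le> V" using T_L_X_le norm_ge_zero[of v] by (rule perturbed_velocity_arith)
  qed
  finally show ?thesis .
qed

lemma b_second_difference: "Suc (Suc k) \<le> K * m \<Longrightarrow> norm (b (Suc (Suc k)) - 2 *\<^sub>R b (Suc k) + b k) \<le> \<delta>\<^sup>2 * (L * X)"
  unfolding vform_second_difference[OF b]
  using order.trans[OF grad_bd mult_left_mono[OF b_bound L0], of "Suc k"] by (simp add: mult_left_mono)

lemma grad_b_refinement:
  assumes "j \<le> K"
  shows "norm (\<delta>\<^sup>2 *\<^sub>R trap2 (\<lambda>k. grad (b k)) (j * m) - (real m * \<delta>)\<^sup>2 *\<^sub>R trap2 (\<lambda>l. grad (b (l * m))) j) \<le> Q0"
proof -
  have jm: "j * m \<le> K * m" using assms by simp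
  have "norm (\<delta>\<^sup>2 *\<^sub>R trap2 (\<lambda>k. grad (b k)) (j * m) - (real m * \<delta>)\<^sup>2 *\<^sub>R trap2 (\<lambda>l. grad (b (l * m))) j)
    \<le> \<delta>\<^sup>2 * ((real m)\<^sup>2 - 1) * T * (T * (2 * M * V\<^sup>2 + L * (L * X)) + 2 * (L * V)) / 12"
  proof (rule trap2_refinement_error)
    fix i assume "i < j * m"
    then have "Suc i \<le> K * m" using jm by linarith
    from order.trans[OF grad_lip mult_left_mono[OF b_step[OF this] L0]]
    show "norm (grad (b (Suc i)) - grad (b i)) \<le> \<delta> * (L * V)" by (simp add: mult_ac)
  next
    fix i assume i: "Suc i < j * m"
    then have i1: "Suc (Suc i) \<le> K * m" and i0: "Suc i \<le> K * m" using jm by linarith+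
    have "norm (grad (b (Suc (Suc i))) - 2 *\<^sub>R grad (b (Suc i)) + grad (b i)) \<le> 2 * M * (\<delta> * V)\<^sup>2 + L * (\<delta>\<^sup>2 * (L * X))"
      by (rule second_difference_bound[OF hess D2_bd D2_lip M0])
        (use b_step[OF i0] b_step[OF i1] b_second_difference[OF i1] L0 in auto)
    then show "norm (grad (b (Suc (Suc i))) - 2 *\<^sub>R grad (b (Suc i)) + grad (b i)) \<le> \<delta>\<^sup>2 * (2 * M * V\<^sup>2 + L * (L * X))"
      by (simp add: power_mult_distrib algebra_simps)
  next
    have "real (j * m) * \<delta> \<le> real (K * m) * \<delta>" using jm d0 by (intro mult_right_mono) (simp_all only: of_nat_le_iff)
    then show "real (j * m) * \<delta> \<le> T" using dT by simp
  qed (use d0 m V0 X0 M0 L0 in auto)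
  then show ?thesis by (simp add: Q0_def H_def)
qed

text \<open>On the coarse grid the gap between the trajectories is itself a Verlet recursion with
  unknown velocity v - \<open>vB\<close>, perturbed by the quadrature error of the fine trajectory.
  This is the input format of \<open>vform_difference_bound\<close>.\<close>

lemma coarse_fine_difference:
  assumes "j \<le> K"
  shows "a j - b (j * m) = 0 + (real j * (real m * \<delta>)) *\<^sub>R (v - vB)
    - (real m * \<delta>)\<^sup>2 *\<^sub>R trap2 (\<lambda>l. grad (a l) - grad (b (l * m))) j
    + (\<delta>\<^sup>2 *\<^sub>R trap2 (\<lambda>k. grad (b k)) (j * m) - (real m * \<delta>)\<^sup>2 *\<^sub>R trap2 (\<lambda>l. grad (b (l * m))) j)"
proof -
  have "a j = x + (real j * (real m * \<delta>)) *\<^sub>R v - (real m * \<delta>)\<^sup>2 *\<^sub>R trap2 (\<lambda>k. grad (a k)) j"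
    using a assms by (simp add: vform_def)
  moreover have "b (j * m) = x + (real (j * m) * \<delta>) *\<^sub>R vB - \<delta>\<^sup>2 *\<^sub>R trap2 (\<lambda>k. grad (b k)) (j * m)"
    using b assms unfolding vform_def by (metis mult_le_mono1)
  moreover have "real (j * m) * \<delta> = real j * (real m * \<delta>)" by simp
  ultimately show ?thesis unfolding trap2_diff by (simp only: scaleR_diff_right) simp
qed

lemma vB_diff: "T * norm (vB - v) \<le> 12/11 * Q0"
  and ab_diff: "j \<le> K \<Longrightarrow> norm (a j - b (j * m)) \<le> 24/11 * Q0"
proof -
  note D = vform_difference_bound[where e="\<lambda>j. a j - b (j * m)" and n=K and \<delta>="real m * \<delta>" and ?e0.0=0 and v="v - vB"
    and r="\<lambda>l. grad (a l) - grad (b (l * m))" and q=Q0 and L=L and \<rho>=0 and T=T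
    and \<eta>="\<lambda>j. \<delta>\<^sup>2 *\<^sub>R trap2 (\<lambda>k. grad (b k)) (j * m) - (real m * \<delta>)\<^sup>2 *\<^sub>R trap2 (\<lambda>l. grad (b (l * m))) j"]
  have z: "a K - b (K * m) = 0" using ab by simp
  have g: "norm (grad (a l) - grad (b (l * m))) \<le> L * norm (a l - b (l * m)) + 0" for l using grad_lip by simp
  have "T * norm (v - vB) \<le> 12/11 * (norm (0::'a) + Q0 + T\<^sup>2 / 2 * 0)"
    by (rule D(1)) (assumption | rule coarse_fine_difference z grad_b_refinement g coarse_horizon L0 LT order.refl)+
  then show "T * norm (vB - v) \<le> 12/11 * Q0" by (simp add: norm_minus_commute)
  have "norm (a j - b (j * m)) \<le> 24/11 * (norm (0::'a) + Q0 + T\<^sup>2 / 2 * 0)" if "j \<le> K"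
    by (rule D(2)) (assumption | rule coarse_fine_difference z grad_b_refinement g coarse_horizon L0 LT order.refl that)+
  then show "j \<le> K \<Longrightarrow> norm (a j - b (j * m)) \<le> 24/11 * Q0" by simp
qed

lemma T_V_sq_le: "T * V\<^sup>2 \<le> 25/8 * (T * (norm v)\<^sup>2) + 1/8 * ((norm x)\<^sup>2 / T)"
proof -
  have "T * V\<^sup>2 \<le> T * (25/8 * (norm v)\<^sup>2 + 1/8 * (norm x / T)\<^sup>2)"
    unfolding V_def using quadratic_split[of "norm v" "norm x / T"] T by (intro mult_left_mono) simp_all
  also have "\<dots> = 25/8 * (T * (norm v)\<^sup>2) + 1/8 * ((norm x)\<^sup>2 / T)"
    using T by (simp add: power2_eq_square field_simps)
  finally show ?thesis .
qed

lemma Q0_le: "12/11 * Q0 \<le> T * (H * (L * norm x / T + L * norm v + M * (norm x)\<^sup>2 / T + M * T * (norm v)\<^sup>2))"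
proof -
  have 1: "M * (T * V\<^sup>2) \<le> M * (25/8 * (T * (norm v)\<^sup>2) + 1/8 * ((norm x)\<^sup>2 / T))"
    by (intro mult_left_mono T_V_sq_le M0)
  have 2: "L * (T * (L * X)) \<le> L * (5/48 * (norm x / T + norm v))"
    by (intro mult_left_mono T_L_X_le L0)
  have 1: "M * (T * V\<^sup>2) \<le> 25/8 * (M * (T * (norm v)\<^sup>2)) + 1/8 * (M * ((norm x)\<^sup>2 / T))"
    using 1 by (simp only: distrib_left mult.left_commute)
  have 2: "L * (T * (L * X)) \<le> 5/48 * (L * (norm x / T) + L * norm v)"
    using 2 by (simp only: distrib_left mult.left_commute)
  have nn: "0 \<le> L * (norm x / T)" "0 \<le> L * norm v" "0 \<le> M * ((norm x)\<^sup>2 / T)" "0 \<le> M * (T * (norm v)\<^sup>2)"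
    using L0 M0 T by simp_all
  have "T * (2 * M * V\<^sup>2 + L * (L * X)) + 2 * (L * V) = 2 * (M * (T * V\<^sup>2)) + L * (T * (L * X)) + 5/2 * (L * norm v) + 1/2 * (L * (norm x / T))"
    by (simp add: V_def algebra_simps)
  \<comment> \<open>The largest coefficient on the left is 25/4; the value 11 is taken because it
    cancels against 12/11 and the 1/12 in \<open>Q0\<close>.\<close>
  also have "\<dots> \<le> 11 * (L * (norm x / T) + L * norm v + M * ((norm x)\<^sup>2 / T) + M * (T * (norm v)\<^sup>2))"
    using 1 2 nn by argo
  finally have "12/11 * Q0 \<le> 12/11 * (H * T * (11 * (L * (norm x / T) + L * norm v + M * ((norm x)\<^sup>2 / T) + M * (T * (norm v)\<^sup>2))) / 12)"
    unfolding Q0_def using H0 T by (intro mult_left_mono divide_right_mono) auto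
  then show ?thesis using T by (simp add: algebra_simps)
qed

lemma vB_close: "norm (vB - v) \<le> H * (L * norm x / T + L * norm v + M * (norm x)\<^sup>2 / T + M * T * (norm v)\<^sup>2)"
  using order.trans[OF vB_diff Q0_le] T by simp

end

text \<open>The primed sequences model derivatives in the initial velocity, in the directions u and
  \<open>uB\<close>. They start from 0 because the starting point is fixed, and share their end
  value as derivatives of a common endpoint.\<close>

locale two_grids_tangent = two_grids +
  fixes a' b' :: "nat \<Rightarrow> 'a" and u uB :: 'a
  assumes a': "vform (real m * \<delta>) K a' 0 u (\<lambda>k. D2 (a k) (a' k))"
    and b': "vform \<delta> (K * m) b' 0 uB (\<lambda>k. D2 (b k) (b' k))"
    and ab': "a' K = b' (K * m)"
begin

definition "X' = 5/4 * (T * norm u)"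
definition "V' = 5/4 * norm u"
text \<open>\<open>\<alpha>'\<close> and \<open>\<beta>'\<close> bound the second and first
  differences, divided by \<delta>^2 and \<delta>, of the Hessian along \<open>b\<close> applied to
  the tangent. The three groups in \<open>\<alpha>'\<close> are those of the discrete product
  rule.\<close>

definition "\<alpha>' = (2 * N * V\<^sup>2 + M * (L * X)) * X' + L * (L * X') + 2 * M * V * V'"
definition "\<beta>' = M * V * X' + L * V'"
definition "Q1 = H * T * (T * \<alpha>' + 2 * \<beta>') / 12"

lemma X'0: "0 \<le> X'" and \<alpha>'0: "0 \<le> \<alpha>'" and \<beta>'0: "0 \<le> \<beta>'"
proof -
  have "0 \<le> V'" by (simp add: V'_def)
  moreover show "0 \<le> X'" using T by (simp add: X'_def)
  ultimately show "0 \<le> \<alpha>'" "0 \<le> \<beta>'" using V0 X0 L0 M0 N0 by (auto simp: \<alpha>'_def \<beta>'_def intro!: add_nonneg_nonneg mult_nonneg_nonneg)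
qed

lemma uB_bound: "T * norm uB \<le> 11/10 * (T * norm u)"
  and b'_bound: "k \<le> K * m \<Longrightarrow> norm (b' k) \<le> X'"
  using velocity_comparison(2,3)[OF a' coarse_horizon b' dT d0 D2_bd D2_bd ab'] by (auto simp: X'_def)

lemma b'_step: "Suc k \<le> K * m \<Longrightarrow> norm (b' (Suc k) - b' k) \<le> \<delta> * V'"
proof -
  assume k: "Suc k \<le> K * m"
  have "norm (b' (Suc k) - b' k) \<le> \<delta> * (norm uB + T * (L * X'))"
  proof (rule vform_step_bound[OF b' k])
    show "norm (D2 (b i) (b' i)) \<le> L * X'" if "i < K * m" for i
      using order.trans[OF D2_bd mult_left_mono[OF b'_bound L0]] that by simp
  qed (use d0 dT L0 X'0 in auto)
  also have "\<dots> \<le> \<delta> * V'"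
  proof (rule mult_left_mono[OF _ d0])
    have "norm uB \<le> 11/10 * norm u" using uB_bound T by simp
    moreover have "T * (L * X') = (L * T\<^sup>2) * (5/4 * norm u)" by (simp add: X'_def power2_eq_square)
    moreover have "(L * T\<^sup>2) * (5/4 * norm u) \<le> 1/12 * (5/4 * norm u)" using LT by (intro mult_right_mono) auto
    ultimately show "norm uB + T * (L * X') \<le> V'" unfolding V'_def using norm_ge_zero[of u] by linarith
  qed
  finally show ?thesis .
qed

lemma b'_second_difference: "Suc (Suc k) \<le> K * m \<Longrightarrow> norm (b' (Suc (Suc k)) - 2 *\<^sub>R b' (Suc k) + b' k) \<le> \<delta>\<^sup>2 * (L * X')"
  unfolding vform_second_difference[OF b']
  using order.trans[OF D2_bd mult_left_mono[OF b'_bound L0], of "Suc k"] by (simp add: mult_left_mono)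

lemma D2_b_refinement:
  assumes "j \<le> K"
  shows "norm (\<delta>\<^sup>2 *\<^sub>R trap2 (\<lambda>k. D2 (b k) (b' k)) (j * m) - (real m * \<delta>)\<^sup>2 *\<^sub>R trap2 (\<lambda>l. D2 (b (l * m)) (b' (l * m))) j) \<le> Q1"
proof -
  have jm: "j * m \<le> K * m" using assms by simp
  have "norm (\<delta>\<^sup>2 *\<^sub>R trap2 (\<lambda>k. D2 (b k) (b' k)) (j * m) - (real m * \<delta>)\<^sup>2 *\<^sub>R trap2 (\<lambda>l. D2 (b (l * m)) (b' (l * m))) j)
    \<le> \<delta>\<^sup>2 * ((real m)\<^sup>2 - 1) * T * (T * \<alpha>' + 2 * \<beta>') / 12"
  proof (rule trap2_refinement_error)
    fix i assume "i < j * m"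
    then have i: "Suc i \<le> K * m" using jm by linarith
    have "D2 (b (Suc i)) (b' (Suc i)) - D2 (b i) (b' i) = (D2 (b (Suc i)) (b' (Suc i)) - D2 (b i) (b' (Suc i))) + D2 (b i) (b' (Suc i) - b' i)"
      by (simp add: linear_diff[OF D2_linear])
    also have "norm \<dots> \<le> norm (D2 (b (Suc i)) (b' (Suc i)) - D2 (b i) (b' (Suc i))) + norm (D2 (b i) (b' (Suc i) - b' i))"
      by (rule norm_triangle_ineq)
    also have "\<dots> \<le> M * (\<delta> * V) * X' + L * (\<delta> * V')"
      using b_step[OF i] b'_bound[OF i] b'_step[OF i] M0 L0 d0 V0
      by (intro add_mono order.trans[OF D2_lip] order.trans[OF D2_bd] mult_mono mult_left_mono) auto
    finally show "norm (D2 (b (Suc i)) (b' (Suc i)) - D2 (b i) (b' i)) \<le> \<delta> * \<beta>'" by (simp add: \<beta>'_def algebra_simps)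
  next
    fix i assume i: "Suc i < j * m"
    then have i1: "Suc (Suc i) \<le> K * m" and i0: "Suc i \<le> K * m" using jm by linarith+
    let ?H = "\<lambda>k. D2 (b k)"
    \<comment> \<open>Discrete product rule: the second difference of the Hessian at a fixed
      tangent, the Hessian applied to the second difference of the tangent, and two mixed products
      of first differences.\<close>
    have eq: "?H (Suc (Suc i)) (b' (Suc (Suc i))) - 2 *\<^sub>R ?H (Suc i) (b' (Suc i)) + ?H i (b' i)
      = (?H (Suc (Suc i)) (b' (Suc i)) - 2 *\<^sub>R ?H (Suc i) (b' (Suc i)) + ?H i (b' (Suc i)))
        + ?H (Suc (Suc i)) (b' (Suc (Suc i)) - 2 *\<^sub>R b' (Suc i) + b' i)
        + ((?H (Suc (Suc i)) (b' (Suc i) - b' i) - ?H (Suc i) (b' (Suc i) - b' i)) + (?H (Suc i) (b' (Suc i) - b' i) - ?H i (b' (Suc i) - b' i)))"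
    proof -
      have gen: "p - 2 *\<^sub>R s + t0 = (q - 2 *\<^sub>R s + t) + (p - 2 *\<^sub>R q + r) + (((q - r) - (s - s0)) + ((s - s0) - (t - t0)))"
        for p q r s s0 t t0 :: 'a by (simp add: scaleR_2)
      show ?thesis
        unfolding linear_add[OF D2_linear] linear_diff[OF D2_linear] linear_scale[OF D2_linear] by (rule gen)
    qed
    have "norm (?H (Suc (Suc i)) (b' (Suc (Suc i))) - 2 *\<^sub>R ?H (Suc i) (b' (Suc i)) + ?H i (b' i))
        \<le> norm (?H (Suc (Suc i)) (b' (Suc i)) - 2 *\<^sub>R ?H (Suc i) (b' (Suc i)) + ?H i (b' (Suc i)))
        + norm (?H (Suc (Suc i)) (b' (Suc (Suc i)) - 2 *\<^sub>R b' (Suc i) + b' i))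
        + (norm (?H (Suc (Suc i)) (b' (Suc i) - b' i) - ?H (Suc i) (b' (Suc i) - b' i)) + norm (?H (Suc i) (b' (Suc i) - b' i) - ?H i (b' (Suc i) - b' i)))"
      unfolding eq
      by (rule order.trans[OF norm_triangle_ineq add_mono[OF norm_triangle_ineq norm_triangle_ineq]])
    also have "\<dots> \<le> (2 * (N * norm (b' (Suc i))) * (\<delta> * V)\<^sup>2 + (M * norm (b' (Suc i))) * (\<delta>\<^sup>2 * (L * X)))
        + L * (\<delta>\<^sup>2 * (L * X')) + (M * (\<delta> * V) * (\<delta> * V') + M * (\<delta> * V) * (\<delta> * V'))"
    proof (intro add_mono)
      show "norm (?H (Suc (Suc i)) (b' (Suc i)) - 2 *\<^sub>R ?H (Suc i) (b' (Suc i)) + ?H i (b' (Suc i)))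
        \<le> 2 * (N * norm (b' (Suc i))) * (\<delta> * V)\<^sup>2 + (M * norm (b' (Suc i))) * (\<delta>\<^sup>2 * (L * X))"
      proof (rule second_difference_bound[where G="\<lambda>y. D2 y (b' (Suc i))" and G'="\<lambda>y. D3 y (b' (Suc i))"])
        show "norm (D3 y (b' (Suc i)) w - D3 z (b' (Suc i)) w) \<le> N * norm (b' (Suc i)) * norm (y - z) * norm w" for y z w
          using D3_lip[of y "b' (Suc i)" w z] by (simp add: mult_ac)
        show "((\<lambda>y. D2 y (b' (Suc i))) has_derivative D3 y (b' (Suc i))) (at y)" for y by (rule der3)
        show "norm (D3 y (b' (Suc i)) w) \<le> M * norm (b' (Suc i)) * norm w" for y w by (rule D3_bd)
        show "0 \<le> N * norm (b' (Suc i))" "0 \<le> M * norm (b' (Suc i))" using N0 M0 by simp_all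
      qed (fact b_step[OF i1] b_step[OF i0] b_second_difference[OF i1])+
      show "norm (?H (Suc (Suc i)) (b' (Suc (Suc i)) - 2 *\<^sub>R b' (Suc i) + b' i)) \<le> L * (\<delta>\<^sup>2 * (L * X'))"
        by (rule order.trans[OF D2_bd mult_left_mono[OF b'_second_difference[OF i1] L0]])
      show "norm (?H (Suc (Suc i)) (b' (Suc i) - b' i) - ?H (Suc i) (b' (Suc i) - b' i)) \<le> M * (\<delta> * V) * (\<delta> * V')"
        using b_step[OF i1] b'_step[OF i0] M0 d0 V0 by (intro order.trans[OF D2_lip] mult_mono mult_left_mono) auto
      show "norm (?H (Suc i) (b' (Suc i) - b' i) - ?H i (b' (Suc i) - b' i)) \<le> M * (\<delta> * V) * (\<delta> * V')"
        using b_step[OF i0] b'_step[OF i0] M0 d0 V0 by (intro order.trans[OF D2_lip] mult_mono mult_left_mono) auto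
    qed
    also have "\<dots> \<le> (2 * (N * X') * (\<delta> * V)\<^sup>2 + (M * X') * (\<delta>\<^sup>2 * (L * X)))
        + L * (\<delta>\<^sup>2 * (L * X')) + (M * (\<delta> * V) * (\<delta> * V') + M * (\<delta> * V) * (\<delta> * V'))"
    proof (intro add_mono order.refl)
      show "2 * (N * norm (b' (Suc i))) * (\<delta> * V)\<^sup>2 \<le> 2 * (N * X') * (\<delta> * V)\<^sup>2"
        using b'_bound[OF i0] N0 by (intro mult_right_mono mult_left_mono) auto
      show "M * norm (b' (Suc i)) * (\<delta>\<^sup>2 * (L * X)) \<le> M * X' * (\<delta>\<^sup>2 * (L * X))"
        using b'_bound[OF i0] M0 L0 X0 by (intro mult_right_mono mult_left_mono) auto
    qed
    also have "\<dots> = \<delta>\<^sup>2 * \<alpha>'" unfolding \<alpha>'_def power_mult_distrib by (simp add: power2_eq_square algebra_simps)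
    finally show "norm (?H (Suc (Suc i)) (b' (Suc (Suc i))) - 2 *\<^sub>R ?H (Suc i) (b' (Suc i)) + ?H i (b' i)) \<le> \<delta>\<^sup>2 * \<alpha>'" .
  next
    have "real (j * m) * \<delta> \<le> real (K * m) * \<delta>" using jm d0 by (intro mult_right_mono) (simp_all only: of_nat_le_iff)
    then show "real (j * m) * \<delta> \<le> T" using dT by simp
  qed (use d0 m \<alpha>'0 \<beta>'0 in auto)
  then show ?thesis by (simp add: Q1_def H_def)
qed

lemma coarse_fine_tangent_difference:
  assumes "j \<le> K"
  shows "a' j - b' (j * m) = 0 + (real j * (real m * \<delta>)) *\<^sub>R (u - uB)
    - (real m * \<delta>)\<^sup>2 *\<^sub>R trap2 (\<lambda>l. D2 (a l) (a' l) - D2 (b (l * m)) (b' (l * m))) j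
    + (\<delta>\<^sup>2 *\<^sub>R trap2 (\<lambda>k. D2 (b k) (b' k)) (j * m) - (real m * \<delta>)\<^sup>2 *\<^sub>R trap2 (\<lambda>l. D2 (b (l * m)) (b' (l * m))) j)"
proof -
  have "a' j = 0 + (real j * (real m * \<delta>)) *\<^sub>R u - (real m * \<delta>)\<^sup>2 *\<^sub>R trap2 (\<lambda>k. D2 (a k) (a' k)) j"
    using a' assms by (simp add: vform_def)
  moreover have "b' (j * m) = 0 + (real (j * m) * \<delta>) *\<^sub>R uB - \<delta>\<^sup>2 *\<^sub>R trap2 (\<lambda>k. D2 (b k) (b' k)) (j * m)"
    using b' assms unfolding vform_def by (metis mult_le_mono1)
  moreover have "real (j * m) * \<delta> = real j * (real m * \<delta>)" by simp
  ultimately show ?thesis unfolding trap2_diff by (simp only: scaleR_diff_right) simp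
qed

text \<open>Tangents feel the change of grid twice: through their own quadrature defect
  \<open>Q1\<close>, and because the Hessian is evaluated along positions up to 24/11
  \<open>Q0\<close> apart.\<close>

lemma uB_diff: "T * norm (uB - u) \<le> 12/11 * (Q1 + T\<^sup>2 / 2 * (M * (24/11 * Q0) * X'))"
proof -
  have "T * norm (u - uB) \<le> 12/11 * (norm (0::'a) + Q1 + T\<^sup>2 / 2 * (M * (24/11 * Q0) * X'))"
  proof (rule vform_difference_bound(1)[where e="\<lambda>j. a' j - b' (j * m)" and n=K and \<delta>="real m * \<delta>" and ?e0.0=0 and v="u - uB"
    and r="\<lambda>l. D2 (a l) (a' l) - D2 (b (l * m)) (b' (l * m))" and q=Q1 and L=L and \<rho>="M * (24/11 * Q0) * X'" and T=T
    and \<eta>="\<lambda>j. \<delta>\<^sup>2 *\<^sub>R trap2 (\<lambda>k. D2 (b k) (b' k)) (j * m) - (real m * \<delta>)\<^sup>2 *\<^sub>R trap2 (\<lambda>l. D2 (b (l * m)) (b' (l * m))) j"])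
    show "a' K - b' (K * m) = 0" using ab' by simp
    show "a' j - b' (j * m) = 0 + (real j * (real m * \<delta>)) *\<^sub>R (u - uB)
    - (real m * \<delta>)\<^sup>2 *\<^sub>R trap2 (\<lambda>l. D2 (a l) (a' l) - D2 (b (l * m)) (b' (l * m))) j
    + (\<delta>\<^sup>2 *\<^sub>R trap2 (\<lambda>k. D2 (b k) (b' k)) (j * m) - (real m * \<delta>)\<^sup>2 *\<^sub>R trap2 (\<lambda>l. D2 (b (l * m)) (b' (l * m))) j)" if "j \<le> K" for j
      using that by (rule coarse_fine_tangent_difference)
    show "norm (\<delta>\<^sup>2 *\<^sub>R trap2 (\<lambda>k. D2 (b k) (b' k)) (j * m) - (real m * \<delta>)\<^sup>2 *\<^sub>R trap2 (\<lambda>l. D2 (b (l * m)) (b' (l * m))) j) \<le> Q1" if "j \<le> K" for j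
      using that by (rule D2_b_refinement)
    fix i assume i: "i < K"
    then have im: "i * m \<le> K * m" by simp
    have "D2 (a i) (a' i) - D2 (b (i * m)) (b' (i * m)) = D2 (a i) (a' i - b' (i * m)) + (D2 (a i) (b' (i * m)) - D2 (b (i * m)) (b' (i * m)))"
      by (simp add: linear_diff[OF D2_linear])
    also have "norm \<dots> \<le> L * norm (a' i - b' (i * m)) + M * (24/11 * Q0) * X'"
      using ab_diff[of i] i b'_bound[OF im] M0 Q00
      by (intro order.trans[OF norm_triangle_ineq] add_mono D2_bd order.trans[OF D2_lip] mult_mono mult_left_mono) auto
    finally show "norm (D2 (a i) (a' i) - D2 (b (i * m)) (b' (i * m))) \<le> L * norm (a' i - b' (i * m)) + M * (24/11 * Q0) * X'" .
  qed (use coarse_horizon L0 LT M0 Q00 X'0 in auto)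
  then show ?thesis by (simp add: norm_minus_commute)
qed

definition "tangent_error = H * (L + M * norm x + M * T * norm v + (M\<^sup>2 * T\<^sup>2 + N) * (norm x)\<^sup>2 + (M\<^sup>2 * T^4 + N * T\<^sup>2) * (norm v)\<^sup>2)"

lemma T_sq_V_sq_le: "T\<^sup>2 * V\<^sup>2 \<le> 25/8 * (T\<^sup>2 * (norm v)\<^sup>2) + 1/8 * (norm x)\<^sup>2"
proof -
  have "T\<^sup>2 * V\<^sup>2 = T * (T * V\<^sup>2)" by (simp add: power2_eq_square)
  also have "\<dots> \<le> T * (25/8 * (T * (norm v)\<^sup>2) + 1/8 * ((norm x)\<^sup>2 / T))" using T by (intro mult_left_mono T_V_sq_le) auto
  also have "\<dots> = 25/8 * (T\<^sup>2 * (norm v)\<^sup>2) + 1/8 * (norm x)\<^sup>2" using T by (simp add: power2_eq_square field_simps)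
  finally show ?thesis .
qed

lemma uB_close: "norm (uB - u) \<le> tangent_error * norm u"
proof -
  define \<xi> \<nu> where "\<xi> = norm x" and "\<nu> = norm v"
  have nn0: "0 \<le> \<xi>" "0 \<le> \<nu>" by (auto simp: \<xi>_def \<nu>_def)
  \<comment> \<open>A to D collect the terms of \<open>Q1\<close>, and E to G those inherited from
    \<open>Q0\<close>, once the common factor H T |u| is taken out.\<close>
  define A where "A = N * (T\<^sup>2 * V\<^sup>2)"
  define B where "B = M * (T\<^sup>2 * (L * X))"
  define C where "C = L * (L * T\<^sup>2)"
  define D where "D = M * (T * V)"
  define E where "E = M\<^sup>2 * T\<^sup>2 * (T\<^sup>2 * V\<^sup>2)"
  define F where "F = M * (T\<^sup>2 * (T\<^sup>2 * (L * (L * X))))"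
  define G where "G = M * (T\<^sup>2 * (L * (T * V)))"
  have lx: "T\<^sup>2 * (L * X) \<le> 1/12 * X" using mult_right_mono[OF LT X0] by (simp add: mult_ac)
  have 1: "A \<le> N * (25/8 * (T\<^sup>2 * \<nu>\<^sup>2) + 1/8 * \<xi>\<^sup>2)"
    unfolding A_def \<xi>_def \<nu>_def by (intro mult_left_mono T_sq_V_sq_le N0)
  have 2: "B \<le> M * (1/12 * X)" unfolding B_def by (intro mult_left_mono lx M0)
  have 3: "C \<le> L * (1/12)" unfolding C_def by (intro mult_left_mono LT L0)
  have TV: "T * V = 5/4 * (T * \<nu>) + 1/4 * \<xi>" using T by (simp add: V_def \<xi>_def \<nu>_def field_simps)
  have 4: "D = 5/4 * (M * (T * \<nu>)) + 1/4 * (M * \<xi>)" unfolding D_def TV by (simp add: algebra_simps)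
  have 5: "E \<le> M\<^sup>2 * T\<^sup>2 * (25/8 * (T\<^sup>2 * \<nu>\<^sup>2) + 1/8 * \<xi>\<^sup>2)"
    unfolding E_def \<xi>_def \<nu>_def by (intro mult_left_mono T_sq_V_sq_le) auto
  have 6: "F \<le> M * (1/12 * (1/12 * X))"
  proof -
    have "T\<^sup>2 * (T\<^sup>2 * (L * (L * X))) = (L * T\<^sup>2) * (T\<^sup>2 * (L * X))" by (simp add: mult_ac)
    also have "\<dots> \<le> 1/12 * (1/12 * X)" by (rule mult_mono[OF LT lx]) (use L0 X0 in simp_all)
    finally show ?thesis unfolding F_def by (intro mult_left_mono M0)
  qed
  have 7: "G \<le> M * (1/12 * (T * V))"
  proof -
    have "T\<^sup>2 * (L * (T * V)) \<le> 1/12 * (T * V)" using mult_right_mono[OF LT, of "T * V"] T V0 by (simp add: mult_ac)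
    then show ?thesis unfolding G_def by (intro mult_left_mono M0)
  qed
  have MX: "M * X = 5/4 * (M * \<xi>) + 5/4 * (M * (T * \<nu>))" by (simp add: X_def \<xi>_def \<nu>_def algebra_simps)
  \<comment> \<open>5/48 is 5/4 divided by 12; in \<open>Q0e\<close> the further factors 1/2 and
    24/11 turn it into 5/44.\<close>
  have Q1e: "Q1 = H * T * norm u * (5/48) * (2 * A + B + C + 4 * D + 2 * L)"
    by (simp add: Q1_def \<alpha>'_def \<beta>'_def X'_def V'_def A_def B_def C_def D_def power2_eq_square algebra_simps)
  have Q0e: "T\<^sup>2 / 2 * (M * (24/11 * Q0) * X') = H * T * norm u * (5/44) * (2 * E + F + 2 * G)"
    by (simp add: Q0_def X'_def E_def F_def G_def power2_eq_square algebra_simps)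
  define R where "R = L + M * \<xi> + M * (T * \<nu>) + (M\<^sup>2 * T\<^sup>2) * \<xi>\<^sup>2 + N * \<xi>\<^sup>2 + (M\<^sup>2 * T\<^sup>2 * T\<^sup>2) * \<nu>\<^sup>2 + N * T\<^sup>2 * \<nu>\<^sup>2"
  have nn: "0 \<le> M * \<xi>" "0 \<le> M * (T * \<nu>)" "0 \<le> (M\<^sup>2 * T\<^sup>2) * \<xi>\<^sup>2" "0 \<le> N * \<xi>\<^sup>2" "0 \<le> (M\<^sup>2 * T\<^sup>2 * T\<^sup>2) * \<nu>\<^sup>2" "0 \<le> N * T\<^sup>2 * \<nu>\<^sup>2"
    using nn0 M0 N0 T by (auto intro!: mult_nonneg_nonneg)
  have A': "A \<le> 25/8 * (N * T\<^sup>2 * \<nu>\<^sup>2) + 1/8 * (N * \<xi>\<^sup>2)" using 1 by (simp add: algebra_simps)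
  have B': "B \<le> 5/48 * (M * \<xi>) + 5/48 * (M * (T * \<nu>))" using 2 MX by simp
  have E': "E \<le> 25/8 * ((M\<^sup>2 * T\<^sup>2 * T\<^sup>2) * \<nu>\<^sup>2) + 1/8 * ((M\<^sup>2 * T\<^sup>2) * \<xi>\<^sup>2)" using 5 by (simp add: algebra_simps)
  have F': "F \<le> 5/576 * (M * \<xi>) + 5/576 * (M * (T * \<nu>))" using 6 MX by simp
  have G': "G \<le> 1/12 * D" using 7 by (simp add: D_def)
  have tot: "12/11 * ((5/48) * (2 * A + B + C + 4 * D + 2 * L) + (5/44) * (2 * E + F + 2 * G)) \<le> R"
    unfolding R_def by (rule tangent_defect_arith[OF A' B' 3 4 E' F' G' nn L0])
  have "T * norm (uB - u) \<le> 12/11 * (Q1 + T\<^sup>2 / 2 * (M * (24/11 * Q0) * X'))" by (rule uB_diff)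
  also have "\<dots> = (H * T * norm u) * (12/11 * ((5/48) * (2 * A + B + C + 4 * D + 2 * L) + (5/44) * (2 * E + F + 2 * G)))"
  proof -
    have "12/11 * (z * (5/48) * P + z * (5/44) * Q) = z * (12/11 * ((5/48) * P + (5/44) * Q))" for z P Q :: real
      by (simp add: algebra_simps)
    then show ?thesis unfolding Q1e Q0e .
  qed
  also have "\<dots> \<le> (H * T * norm u) * R" using H0 T by (intro mult_left_mono tot) auto
  also have "\<dots> = T * (tangent_error * norm u)"
    by (simp add: tangent_error_def R_def \<xi>_def \<nu>_def power2_eq_square power4_eq_xxxx algebra_simps)
  finally show ?thesis using T by simp
qed

end

text \<open>The fine trajectory \<open>c\<close> starts at \<open>y\<close> and ends where \<open>a\<close> and \<open>b\<close> do; primed sequences are derivatives in the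
  initial velocity.\<close>

locale three_trajectories = two_grids_tangent +
  fixes c c' :: "nat \<Rightarrow> 'a" and y w uC :: 'a
  assumes c: "vform \<delta> (K * m) c y w (\<lambda>k. grad (c k))"
    and c': "vform \<delta> (K * m) c' 0 uC (\<lambda>k. D2 (c k) (c' k))"
    and ac: "a K = c (K * m)" and ac': "a' K = c' (K * m)"
begin

text \<open>Here the grid is the same and only the starting point changes, so there is no quadrature
  defect and the bound is proportional to |x - y|.\<close>

lemma w_vB: "T * norm (w - vB) \<le> 12/11 * norm (x - y)"
  and c_b: "k \<le> K * m \<Longrightarrow> norm (c k - b k) \<le> 24/11 * norm (x - y)"
proof -
  have f: "c k - b k = (y - x) + (real k * \<delta>) *\<^sub>R (w - vB) - \<delta>\<^sup>2 *\<^sub>R trap2 (\<lambda>i. grad (c i) - grad (b i)) k + 0" if "k \<le> K * m" for k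
  proof -
    have "b k = x + (real k * \<delta>) *\<^sub>R vB - \<delta>\<^sup>2 *\<^sub>R trap2 (\<lambda>k. grad (b k)) k" "c k = y + (real k * \<delta>) *\<^sub>R w - \<delta>\<^sup>2 *\<^sub>R trap2 (\<lambda>k. grad (c k)) k"
      using b c that by (simp_all add: vform_def)
    then show ?thesis unfolding trap2_diff by (simp only: scaleR_diff_right) simp
  qed
  note D = vform_difference_bound[where e="\<lambda>k. c k - b k" and n="K*m" and \<eta>="\<lambda>_. 0" and q=0 and L=L and \<rho>=0 and T=T
    and \<delta>=\<delta> and ?e0.0="y - x" and v="w - vB" and r="\<lambda>i. grad (c i) - grad (b i)"]
  have z: "c (K * m) - b (K * m) = 0" using ab ac by simp
  have g: "norm (grad (c l) - grad (b l)) \<le> L * norm (c l - b l) + 0" for l using grad_lip by simp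
  have z0: "norm (0::'a) \<le> 0" by simp
  have "T * norm (w - vB) \<le> 12/11 * (norm (y - x) + 0 + T\<^sup>2 / 2 * 0)"
    by (rule D(1)) (assumption | rule f z g z0 d0 dT L0 LT order.refl)+
  then show "T * norm (w - vB) \<le> 12/11 * norm (x - y)" by (simp add: norm_minus_commute)
  have "norm (c k - b k) \<le> 24/11 * (norm (y - x) + 0 + T\<^sup>2 / 2 * 0)" if "k \<le> K * m"
    by (rule D(2)) (assumption | rule f z g z0 d0 dT L0 LT order.refl that)+
  then show "k \<le> K * m \<Longrightarrow> norm (c k - b k) \<le> 24/11 * norm (x - y)" by (simp add: norm_minus_commute)
qed

lemma w_vB_close: "norm (w - vB) \<le> 12 / 11 * norm (x - y) / T"
  using w_vB T by (simp add: field_simps)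

text \<open>The tangent difference is driven by Hessians at positions up to 24/11 |x - y| apart. The
  resulting constant is 180/121, rounded up to 2.\<close>

lemma uC_uB_close: "norm (uC - uB) \<le> 2 * M * T\<^sup>2 * norm (x - y) * norm u"
proof -
  have f: "c' k - b' k = 0 + (real k * \<delta>) *\<^sub>R (uC - uB) - \<delta>\<^sup>2 *\<^sub>R trap2 (\<lambda>i. D2 (c i) (c' i) - D2 (b i) (b' i)) k + 0" if "k \<le> K * m" for k
  proof -
    have "b' k = 0 + (real k * \<delta>) *\<^sub>R uB - \<delta>\<^sup>2 *\<^sub>R trap2 (\<lambda>k. D2 (b k) (b' k)) k" "c' k = 0 + (real k * \<delta>) *\<^sub>R uC - \<delta>\<^sup>2 *\<^sub>R trap2 (\<lambda>k. D2 (c k) (c' k)) k"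
      using b' c' that by (simp_all add: vform_def)
    then show ?thesis unfolding trap2_diff by (simp only: scaleR_diff_right) simp
  qed
  have "T * norm (uC - uB) \<le> 12/11 * (norm (0::'a) + 0 + T\<^sup>2 / 2 * (M * (24/11 * norm (x - y)) * X'))"
  proof (rule vform_difference_bound(1)[where e="\<lambda>k. c' k - b' k" and n="K*m" and \<eta>="\<lambda>_. 0" and q=0 and L=L and T=T
    and \<rho>="M * (24/11 * norm (x - y)) * X'" and \<delta>=\<delta> and ?e0.0=0 and v="uC - uB" and r="\<lambda>i. D2 (c i) (c' i) - D2 (b i) (b' i)"])
    show "c' k - b' k = 0 + (real k * \<delta>) *\<^sub>R (uC - uB) - \<delta>\<^sup>2 *\<^sub>R trap2 (\<lambda>i. D2 (c i) (c' i) - D2 (b i) (b' i)) k + 0" if "k \<le> K * m" for k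
      using that by (rule f)
    show "c' (K * m) - b' (K * m) = 0" using ab' ac' by simp
    fix i assume i: "i < K * m"
    have "D2 (c i) (c' i) - D2 (b i) (b' i) = D2 (c i) (c' i - b' i) + (D2 (c i) (b' i) - D2 (b i) (b' i))"
      by (simp add: linear_diff[OF D2_linear])
    also have "norm \<dots> \<le> L * norm (c' i - b' i) + M * (24/11 * norm (x - y)) * X'"
      using c_b[of i] i b'_bound[of i] M0
      by (intro order.trans[OF norm_triangle_ineq] add_mono D2_bd order.trans[OF D2_lip] mult_mono mult_left_mono) auto
    finally show "norm (D2 (c i) (c' i) - D2 (b i) (b' i)) \<le> L * norm (c' i - b' i) + M * (24/11 * norm (x - y)) * X'" .
  qed (use d0 dT L0 LT M0 X'0 in auto)
  also have "\<dots> = T * (180/121 * (M * T\<^sup>2 * norm (x - y) * norm u))" by (simp add: X'_def algebra_simps)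
  also have "\<dots> \<le> T * (2 * (M * T\<^sup>2 * norm (x - y) * norm u))" using T M0 by (intro mult_left_mono mult_right_mono) auto
  finally show ?thesis using T by (simp add: mult_ac)
qed

text \<open>The crude comparison of \<open>a'\<close> and \<open>c'\<close> is enough: both tangents
  start at 0 even though the trajectories start at different points. This is the bound 1/2 required
  by the determinant estimate, valid for all x, y and v.\<close>

lemma uC_u_half: "norm (uC - u) \<le> 1/2 * norm u"
proof -
  note vc = velocity_comparison[OF a' coarse_horizon c' dT d0 D2_bd D2_bd ac']
  have 1: "T * norm (uC - u) \<le> 11/240 * (T * norm u + T * norm uC)" using vc(1) by simp
  have 2: "T * norm uC \<le> 11/10 * (T * norm u)" using vc(2) by simp
  have 3: "0 \<le> T * norm u" using T by simp
  have "p \<le> 1/2 * q" if "p \<le> 11/240 * (q + r)" "r \<le> 11/10 * q" "0 \<le> q" for p q r :: real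
    using that by (simp add: field_simps)
  from this[OF 1 2 3] have "T * norm (uC - u) \<le> T * (1/2 * norm u)" by simp
  then show ?thesis using T by simp
qed

text \<open>The shift is split at the velocity of the fine trajectory from x. Enlarging 12/11 to 3/2
  produces the constant 9/4, and the four terms of \<open>vB_close\<close> are squared at the price
  of a factor 4.\<close>

lemma total_shift: "(norm (w - v))\<^sup>2 / 2 \<le> 9 / (4 * T\<^sup>2) * (norm (x - y))\<^sup>2
    + 4 * H\<^sup>2 * (L\<^sup>2 * (norm x)\<^sup>2 / T\<^sup>2 + L\<^sup>2 * (norm v)\<^sup>2 + M\<^sup>2 * (norm x)^4 / T\<^sup>2 + M\<^sup>2 * T\<^sup>2 * (norm v)^4)"
proof -
  have s2: "(p + q)\<^sup>2 \<le> 2 * p\<^sup>2 + 2 * q\<^sup>2" for p q :: real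
    using zero_le_power2[of "p - q"] by (simp add: power2_eq_square algebra_simps)
  have s4: "(p + q + r + s)\<^sup>2 \<le> 4 * (p\<^sup>2 + q\<^sup>2 + r\<^sup>2 + s\<^sup>2)" for p q r s :: real
    using s2[of "p + q" "r + s"] s2[of p q] s2[of r s] by (simp add: add.assoc)
  have "norm (w - v) \<le> norm (w - vB) + norm (vB - v)" using norm_triangle_ineq[of "w - vB" "vB - v"] by simp
  then have "(norm (w - v))\<^sup>2 \<le> (norm (w - vB) + norm (vB - v))\<^sup>2" by (intro power_mono) auto
  also have "\<dots> \<le> 2 * (norm (w - vB))\<^sup>2 + 2 * (norm (vB - v))\<^sup>2" by (rule s2)
  also have "(norm (w - vB))\<^sup>2 \<le> (3/2 * norm (x - y) / T)\<^sup>2"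
  proof (intro power_mono)
    have "12/11 * norm (x - y) / T \<le> 3/2 * norm (x - y) / T" using T by (intro divide_right_mono mult_right_mono) auto
    then show "norm (w - vB) \<le> 3/2 * norm (x - y) / T" using w_vB_close by (rule order.trans[rotated])
  qed auto
  also have "(norm (vB - v))\<^sup>2 \<le> (H * (L * norm x / T + L * norm v + M * (norm x)\<^sup>2 / T + M * T * (norm v)\<^sup>2))\<^sup>2"
    by (intro power_mono vB_close) auto
  also have "\<dots> = H\<^sup>2 * (L * norm x / T + L * norm v + M * (norm x)\<^sup>2 / T + M * T * (norm v)\<^sup>2)\<^sup>2" by (simp add: power_mult_distrib)
  also have "\<dots> \<le> H\<^sup>2 * (4 * ((L * norm x / T)\<^sup>2 + (L * norm v)\<^sup>2 + (M * (norm x)\<^sup>2 / T)\<^sup>2 + (M * T * (norm v)\<^sup>2)\<^sup>2))"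
    by (intro mult_left_mono s4) auto
  finally have F: "(norm (w - v))\<^sup>2 \<le> 2 * (3/2 * norm (x - y) / T)\<^sup>2
     + 2 * (H\<^sup>2 * (4 * ((L * norm x / T)\<^sup>2 + (L * norm v)\<^sup>2 + (M * (norm x)\<^sup>2 / T)\<^sup>2 + (M * T * (norm v)\<^sup>2)\<^sup>2)))" by simp
  have p4: "(z\<^sup>2)\<^sup>2 = z^4" for z :: real by (simp flip: power_mult)
  have e1: "(3/2 * norm (x - y) / T)\<^sup>2 = 9 / (4 * T\<^sup>2) * (norm (x - y))\<^sup>2" by (simp add: power2_eq_square)
  have e2: "(L * norm x / T)\<^sup>2 + (L * norm v)\<^sup>2 + (M * (norm x)\<^sup>2 / T)\<^sup>2 + (M * T * (norm v)\<^sup>2)\<^sup>2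
    = L\<^sup>2 * (norm x)\<^sup>2 / T\<^sup>2 + L\<^sup>2 * (norm v)\<^sup>2 + M\<^sup>2 * (norm x)^4 / T\<^sup>2 + M\<^sup>2 * T\<^sup>2 * (norm v)^4"
    by (simp add: power_mult_distrib power_divide p4)
  have "p / 2 \<le> e + 4 * q * s" if "p \<le> 2 * e + 2 * (q * (4 * s))" for p e q s :: real
    using that by simp
  from this[OF F[unfolded e1 e2]] show ?thesis .
qed

lemma total_tangent: "norm (uC - u) \<le> (2 * M * T\<^sup>2 * norm (x - y) + tangent_error) * norm u"
proof -
  have "norm (uC - u) \<le> norm (uC - uB) + norm (uB - u)" using norm_triangle_ineq[of "uC - uB" "uB - u"] by simp
  then show ?thesis using uC_uB_close uB_close by (simp add: distrib_right)
qed

end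

section \<open>The dual inequality for two fixed starting points\<close>

lemma borel_measurable_directional_derivative:
  fixes g :: "'a::euclidean_space \<Rightarrow> 'b::euclidean_space"
  assumes der: "\<And>v. (g has_derivative g' v) (at v)"
  shows "(\<lambda>v. g' v b) \<in> borel_measurable borel"
proof (rule borel_measurable_LIMSEQ_metric)
  have [measurable]: "g \<in> borel_measurable borel"
    using der by (intro borel_measurable_continuous_onI) (meson has_derivative_continuous continuous_at_imp_continuous_on)
  show "(\<lambda>v. (1 / inverse (real (Suc n))) *\<^sub>R (g (v + inverse (real (Suc n)) *\<^sub>R b) - g v)) \<in> borel_measurable borel" for n
    by measurable
  fix v
  have "((\<lambda>s. v + s *\<^sub>R b) has_vector_derivative b) (at 0)"
    by (auto intro!: derivative_eq_intros)
  then have "((\<lambda>s. g (v + s *\<^sub>R b)) has_vector_derivative g' v b) (at 0)"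
    using vector_derivative_diff_chain_within[of "\<lambda>s. v + s *\<^sub>R b" b 0 UNIV g "g' v"] der[of v] by (simp add: o_def has_derivative_at_withinI)
  then have lim: "((\<lambda>h. norm (g (v + h *\<^sub>R b) - g v - h *\<^sub>R g' v b) / \<bar>h\<bar>) \<longlongrightarrow> 0) (at 0)"
    by (simp add: has_vector_derivative_def has_derivative_iff_norm)
  have "((\<lambda>h. (1 / h) *\<^sub>R (g (v + h *\<^sub>R b) - g v)) \<longlongrightarrow> g' v b) (at 0)"
  proof (rule LIM_zero_cancel, rule tendsto_norm_zero_cancel, rule Lim_transform_eventually[OF lim])
    show "\<forall>\<^sub>F h in at 0. norm (g (v + h *\<^sub>R b) - g v - h *\<^sub>R g' v b) / \<bar>h\<bar> = norm ((1 / h) *\<^sub>R (g (v + h *\<^sub>R b) - g v) - g' v b)"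
      unfolding eventually_at_filter
    proof (intro always_eventually allI impI)
      fix h :: real assume "h \<noteq> 0"
      then have "(1 / h) *\<^sub>R (g (v + h *\<^sub>R b) - g v) - g' v b = (1 / h) *\<^sub>R (g (v + h *\<^sub>R b) - g v - h *\<^sub>R g' v b)"
        by (simp add: scaleR_diff_right)
      then show "norm (g (v + h *\<^sub>R b) - g v - h *\<^sub>R g' v b) / \<bar>h\<bar> = norm ((1 / h) *\<^sub>R (g (v + h *\<^sub>R b) - g v) - g' v b)"
        by simp
    qed
  qed
  moreover have "filterlim (\<lambda>n. inverse (real (Suc n))) (at 0) sequentially"
    using LIMSEQ_inverse_real_of_nat by (rule filterlim_atI) auto
  ultimately show "(\<lambda>n. (1 / inverse (real (Suc n))) *\<^sub>R (g (v + inverse (real (Suc n)) *\<^sub>R b) - g v)) \<longlonglongrightarrow> g' v b"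
    by (rule filterlim_compose)
qed

context potential
begin

definition "transport_const = 9 / (4 * T\<^sup>2) + 363/2 * real DIM('a) * M\<^sup>2 * T^4"

text \<open>The h^4 bracket of the theorem before averaging: \<xi> is |x|, while \<open>s2\<close>
  and \<open>s4\<close> are slots for |v|^2 and |v|^4, later for their Gaussian means. It is affine
  in these slots, so integrating over v merely substitutes the moments.\<close>

definition "verlet_error H \<xi> s2 s4 = 4 * H\<^sup>2 * (45 * real DIM('a) * L\<^sup>2
   + (4 * L\<^sup>2 / T\<^sup>2 + 45 * real DIM('a) * M\<^sup>2) * \<xi>\<^sup>2
   + (4 * L\<^sup>2 + 45 * real DIM('a) * M\<^sup>2 * T\<^sup>2) * s2
   + (4 * M\<^sup>2 / T\<^sup>2 + 45 * real DIM('a) * (M\<^sup>2 * T\<^sup>2 + N)\<^sup>2) * \<xi>^4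
   + (4 * M\<^sup>2 * T\<^sup>2 + 45 * real DIM('a) * (M\<^sup>2 * T^4 + N * T\<^sup>2)\<^sup>2) * s4)"

definition "tangent_error_at H \<xi> \<nu> = H * (L + M * \<xi> + M * T * \<nu> + (M\<^sup>2 * T\<^sup>2 + N) * \<xi>\<^sup>2 + (M\<^sup>2 * T^4 + N * T\<^sup>2) * \<nu>\<^sup>2)"

lemma tangent_error_at_sq: "(tangent_error_at H \<xi> \<nu>)\<^sup>2 \<le> 5 * H\<^sup>2 * (L\<^sup>2 + M\<^sup>2 * \<xi>\<^sup>2 + M\<^sup>2 * T\<^sup>2 * \<nu>\<^sup>2 + (M\<^sup>2 * T\<^sup>2 + N)\<^sup>2 * \<xi>^4 + (M\<^sup>2 * T^4 + N * T\<^sup>2)\<^sup>2 * \<nu>^4)"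
proof -
  have s5: "(p + q + r + s + t)\<^sup>2 \<le> 5 * (p\<^sup>2 + q\<^sup>2 + r\<^sup>2 + s\<^sup>2 + t\<^sup>2)" for p q r s t :: real
  proof -
    have "5 * (p\<^sup>2 + q\<^sup>2 + r\<^sup>2 + s\<^sup>2 + t\<^sup>2) - (p + q + r + s + t)\<^sup>2
      = (p-q)\<^sup>2 + (p-r)\<^sup>2 + (p-s)\<^sup>2 + (p-t)\<^sup>2 + (q-r)\<^sup>2 + (q-s)\<^sup>2 + (q-t)\<^sup>2 + (r-s)\<^sup>2 + (r-t)\<^sup>2 + (s-t)\<^sup>2"
      by (simp add: power2_eq_square algebra_simps)
    also have "0 \<le> \<dots>" by (intro add_nonneg_nonneg) auto
    finally show ?thesis by simp
  qed
  have p4: "(z\<^sup>2)\<^sup>2 = z^4" for z :: real by (simp flip: power_mult)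
  have "(tangent_error_at H \<xi> \<nu>)\<^sup>2 = H\<^sup>2 * (L + M * \<xi> + M * T * \<nu> + (M\<^sup>2 * T\<^sup>2 + N) * \<xi>\<^sup>2 + (M\<^sup>2 * T^4 + N * T\<^sup>2) * \<nu>\<^sup>2)\<^sup>2"
    by (simp add: tangent_error_at_def power_mult_distrib)
  also have "\<dots> \<le> H\<^sup>2 * (5 * (L\<^sup>2 + (M * \<xi>)\<^sup>2 + (M * T * \<nu>)\<^sup>2 + ((M\<^sup>2 * T\<^sup>2 + N) * \<xi>\<^sup>2)\<^sup>2 + ((M\<^sup>2 * T^4 + N * T\<^sup>2) * \<nu>\<^sup>2)\<^sup>2))"
    by (intro mult_left_mono s5) auto
  finally show ?thesis unfolding power_mult_distrib p4 by (simp add: distrib_left mult_ac)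
qed

lemma verlet_error_mono: "H\<^sup>2 \<le> G\<^sup>2 \<Longrightarrow> 0 \<le> s2 \<Longrightarrow> 0 \<le> s4 \<Longrightarrow> verlet_error H \<xi> s2 s4 \<le> verlet_error G \<xi> s2 s4"
  unfolding verlet_error_def by (intro mult_right_mono mult_left_mono add_nonneg_nonneg mult_nonneg_nonneg) auto

text \<open>Squaring produces the coefficients 8 (transport), 10 (tangent error) and 4 (shift
  error); the constants 363/2, 180 = 4 times 45 and 16 = 4 times 4 of the theorem dominate
  them.\<close>

lemma total_cost_bound:
  assumes g: "G\<^sup>2 / 2 \<le> 9 / (4 * T\<^sup>2) * D\<^sup>2
    + 4 * H\<^sup>2 * (L\<^sup>2 * \<xi>\<^sup>2 / T\<^sup>2 + L\<^sup>2 * \<nu>\<^sup>2 + M\<^sup>2 * \<xi>^4 / T\<^sup>2 + M\<^sup>2 * T\<^sup>2 * \<nu>^4)"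
    and k: "0 \<le> \<kappa>" "\<kappa> \<le> 2 * M * T\<^sup>2 * D + tangent_error_at H \<xi> \<nu>"
  shows "G\<^sup>2 / 2 + real DIM('a) * \<kappa>\<^sup>2 \<le> transport_const * D\<^sup>2 + verlet_error H \<xi> (\<nu>\<^sup>2) (\<nu>^4)"
proof -
  define d where "d = real DIM('a)"
  have d: "0 \<le> d" by (simp add: d_def)
  define E1 where "E1 = L\<^sup>2 * \<xi>\<^sup>2 / T\<^sup>2 + L\<^sup>2 * \<nu>\<^sup>2 + M\<^sup>2 * \<xi>^4 / T\<^sup>2 + M\<^sup>2 * T\<^sup>2 * \<nu>^4"
  define E2 where "E2 = L\<^sup>2 + M\<^sup>2 * \<xi>\<^sup>2 + M\<^sup>2 * T\<^sup>2 * \<nu>\<^sup>2 + (M\<^sup>2 * T\<^sup>2 + N)\<^sup>2 * \<xi>^4 + (M\<^sup>2 * T^4 + N * T\<^sup>2)\<^sup>2 * \<nu>^4"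
  have E: "0 \<le> E1" "0 \<le> E2" unfolding E1_def E2_def by (auto intro!: add_nonneg_nonneg mult_nonneg_nonneg)
  have s2: "(p + q)\<^sup>2 \<le> 2 * p\<^sup>2 + 2 * q\<^sup>2" for p q :: real
    using zero_le_power2[of "p - q"] by (simp add: power2_eq_square algebra_simps)
  have "\<kappa>\<^sup>2 \<le> (2 * M * T\<^sup>2 * D + tangent_error_at H \<xi> \<nu>)\<^sup>2" using k by (intro power_mono)
  also have "\<dots> \<le> 2 * (2 * M * T\<^sup>2 * D)\<^sup>2 + 2 * (tangent_error_at H \<xi> \<nu>)\<^sup>2" by (rule s2)
  also have "(2 * M * T\<^sup>2 * D)\<^sup>2 = 4 * (M\<^sup>2 * T^4 * D\<^sup>2)" by (simp add: power_mult_distrib flip: power_mult)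
  finally have "\<kappa>\<^sup>2 \<le> 8 * (M\<^sup>2 * T^4 * D\<^sup>2) + 10 * (H\<^sup>2 * E2)"
    using tangent_error_at_sq[of H \<xi> \<nu>] unfolding E2_def[symmetric] by (simp add: mult.assoc)
  then have "d * \<kappa>\<^sup>2 \<le> d * (8 * (M\<^sup>2 * T^4 * D\<^sup>2) + 10 * (H\<^sup>2 * E2))" using d by (rule mult_left_mono)
  also have "\<dots> \<le> d * (363/2 * (M\<^sup>2 * T^4 * D\<^sup>2) + 180 * (H\<^sup>2 * E2))"
    using d E by (intro mult_left_mono add_mono mult_right_mono) auto
  finally have "G\<^sup>2 / 2 + d * \<kappa>\<^sup>2 \<le> 9 / (4 * T\<^sup>2) * D\<^sup>2 + 16 * (H\<^sup>2 * E1) + d * (363/2 * (M\<^sup>2 * T^4 * D\<^sup>2) + 180 * (H\<^sup>2 * E2))"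
  proof (rule add_mono[rotated])
    have "4 * H\<^sup>2 * E1 \<le> 16 * (H\<^sup>2 * E1)" using mult_nonneg_nonneg[of "H\<^sup>2" E1] E by simp
    with g[folded E1_def] show "G\<^sup>2 / 2 \<le> 9 / (4 * T\<^sup>2) * D\<^sup>2 + 16 * (H\<^sup>2 * E1)" by linarith
  qed
  also have "\<dots> = transport_const * D\<^sup>2 + verlet_error H \<xi> (\<nu>\<^sup>2) (\<nu>^4)"
    unfolding transport_const_def verlet_error_def E1_def E2_def d_def[symmetric] by (simp add: algebra_simps)
  finally show ?thesis by (simp add: d_def)
qed

text \<open>The perturbation is g v = w(v) - v, where w(v) shoots from y to the coarse endpoint.
  Composing the test function with the fine endpoint map from y makes the left side of
  \<open>gauss_shift_dual\<close> the mean over the coarse endpoint.\<close>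

lemma verlet_pair_dual:
  fixes \<phi> :: "'a \<Rightarrow> real"
  assumes m: "1 \<le> m" and d0: "0 \<le> \<delta>" and dT: "real (K * m) * \<delta> = T"
    and phi[measurable]: "\<phi> \<in> borel_measurable borel" and bd: "\<And>x. \<bar>\<phi> x\<bar> \<le> B"
  shows "(\<integral>v. \<phi> (vpos grad (real m * \<delta>) K x v) \<partial>std_gauss)
    \<le> transport_const * (norm (x - y))\<^sup>2 + verlet_error (\<delta>\<^sup>2 * ((real m)\<^sup>2 - 1)) (norm x) (real DIM('a)) (real DIM('a) * (real DIM('a) + 2))
      + ln (\<integral>w. exp (\<phi> (vpos grad \<delta> (K * m) y w)) \<partial>std_gauss)"
proof -
  define h n HH where "h = real m * \<delta>" and "n = K * m" and "HH = \<delta>\<^sup>2 * ((real m)\<^sup>2 - 1)"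
  have dT': "real n * \<delta> = T" using dT by (simp add: n_def)
  define z where "z v = vpos grad h K x v" for v
  define inv' where "inv' x0 v = frechet_derivative (vinv \<delta> n x0) (at (z v))" for x0 v
  define vv where "vv x0 v = vinv \<delta> n x0 (z v)" for x0 v
  define vv' where "vv' x0 v u = inv' x0 v (dvpos h K x v u)" for x0 v u
  have zd: "(z has_derivative dvpos h K x v) (at v)" for v
    unfolding z_def[abs_def] by (rule vpos_has_derivative)
  have vd: "((\<lambda>v. vv x0 v) has_derivative vv' x0 v) (at v)" for x0 v
    unfolding vv_def vv'_def inv'_def
    by (rule has_derivative_compose[OF zd frechet_derivative_works[THEN iffD1, OF vinv_differentiable[OF d0 dT']]])
  have zv: "vpos grad \<delta> n x0 (vv x0 v) = z v" for x0 v unfolding vv_def by (rule vpos_vinv[OF d0 dT'])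
  \<comment> \<open>Both sides are derivatives of the same endpoint map at v, taken directly and
    through the velocity \<open>vv\<close>.\<close>
  have zv': "dvpos h K x v u = dvpos \<delta> n x0 (vv x0 v) (vv' x0 v u)" for x0 v u
  proof -
    have "((\<lambda>v. vpos grad \<delta> n x0 (vv x0 v)) has_derivative (\<lambda>u. dvpos \<delta> n x0 (vv x0 v) (vv' x0 v u))) (at v)"
      by (rule has_derivative_compose[OF vd vpos_has_derivative])
    then have "(z has_derivative (\<lambda>u. dvpos \<delta> n x0 (vv x0 v) (vv' x0 v u))) (at v)" by (simp add: zv)
    from has_derivative_unique[OF this zd] show ?thesis by metis
  qed
  define g where "g v = vv y v - v" for v
  define g' where "g' v u = vv' y v u - u" for v u
  have gd': "(g has_derivative g' v) (at v)" for v
    unfolding g_def[abs_def] g'_def[abs_def] by (intro has_derivative_diff vd has_derivative_ident)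
  \<comment> \<open>Both entries bound the derivative of g. The error term grows with |v|, so the
    constant 1/2 takes over where it is large.\<close>
  define \<kappa> :: "'a \<Rightarrow> real" where "\<kappa> v = min (1/2) (2 * M * T\<^sup>2 * norm (x - y) + tangent_error_at HH (norm x) (norm v))" for v
  have T3: "three_trajectories grad D2 D3 D4 L M N T \<delta> m K (\<lambda>k. vpos grad h k x v) (\<lambda>k. vpos grad \<delta> k x (vv x v)) x v (vv x v)
     (\<lambda>k. dvpos h k x v u) (\<lambda>k. dvpos \<delta> k x (vv x v) (vv' x v u)) u (vv' x v u)
     (\<lambda>k. vpos grad \<delta> k y (vv y v)) (\<lambda>k. dvpos \<delta> k y (vv y v) (vv' y v u)) y (vv y v) (vv' y v u)" for v u
  proof unfold_locales
    show "1 \<le> m" "0 \<le> \<delta>" "real (K * m) * \<delta> = T" by fact+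
    show "vform (real m * \<delta>) K (\<lambda>k. vpos grad h k x v) x v (\<lambda>k. grad (vpos grad h k x v))"
      unfolding h_def by (rule vform_vpos)
    show "vform (real m * \<delta>) K (\<lambda>k. dvpos h k x v u) 0 u (\<lambda>k. D2 (vpos grad h k x v) (dvpos h k x v u))"
      unfolding h_def by (rule vform_dvpos)
    show "vform \<delta> (K * m) (\<lambda>k. vpos grad \<delta> k x (vv x v)) x (vv x v) (\<lambda>k. grad (vpos grad \<delta> k x (vv x v)))"
      "vform \<delta> (K * m) (\<lambda>k. vpos grad \<delta> k y (vv y v)) y (vv y v) (\<lambda>k. grad (vpos grad \<delta> k y (vv y v)))"
      by (rule vform_vpos)+
    show "vform \<delta> (K * m) (\<lambda>k. dvpos \<delta> k x (vv x v) (vv' x v u)) 0 (vv' x v u) (\<lambda>k. D2 (vpos grad \<delta> k x (vv x v)) (dvpos \<delta> k x (vv x v) (vv' x v u)))"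
      "vform \<delta> (K * m) (\<lambda>k. dvpos \<delta> k y (vv y v) (vv' y v u)) 0 (vv' y v u) (\<lambda>k. D2 (vpos grad \<delta> k y (vv y v)) (dvpos \<delta> k y (vv y v) (vv' y v u)))"
      by (rule vform_dvpos)+
    show "vpos grad h K x v = vpos grad \<delta> (K * m) x (vv x v)" "vpos grad h K x v = vpos grad \<delta> (K * m) y (vv y v)"
      using zv by (simp_all add: z_def n_def)
    show "dvpos h K x v u = dvpos \<delta> (K * m) x (vv x v) (vv' x v u)" "dvpos h K x v u = dvpos \<delta> (K * m) y (vv y v) (vv' y v u)"
      using zv' by (simp_all add: n_def)
  qed
  have k0: "0 \<le> tangent_error_at HH (norm x) (norm v)" for v
  proof -
    have "0 \<le> HH" unfolding HH_def using m by simp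
    then show ?thesis using L0 M0 N0 T unfolding tangent_error_at_def by (intro mult_nonneg_nonneg add_nonneg_nonneg) auto
  qed
  have kap: "0 \<le> \<kappa> v" "\<kappa> v \<le> 1/2" "\<kappa> v \<le> 2 * M * T\<^sup>2 * norm (x - y) + tangent_error_at HH (norm x) (norm v)" for v
  proof -
    show "0 \<le> \<kappa> v" unfolding \<kappa>_def using k0[of v] M0 T by simp
    show "\<kappa> v \<le> 1/2" unfolding \<kappa>_def by (rule min.cobounded1)
    show "\<kappa> v \<le> 2 * M * T\<^sup>2 * norm (x - y) + tangent_error_at HH (norm x) (norm v)" unfolding \<kappa>_def by (rule min.cobounded2)
  qed
  have kbd: "norm (g' v u) \<le> \<kappa> v * norm u" for v u
  proof -
    interpret three_trajectories grad D2 D3 D4 L M N T \<delta> m K "\<lambda>k. vpos grad h k x v" "\<lambda>k. vpos grad \<delta> k x (vv x v)" x v "vv x v"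
     "\<lambda>k. dvpos h k x v u" "\<lambda>k. dvpos \<delta> k x (vv x v) (vv' x v u)" u "vv' x v u"
     "\<lambda>k. vpos grad \<delta> k y (vv y v)" "\<lambda>k. dvpos \<delta> k y (vv y v) (vv' y v u)" y "vv y v" "vv' y v u"
      by (rule T3)
    have "norm (g' v u) \<le> (2 * M * T\<^sup>2 * norm (x - y) + tangent_error_at HH (norm x) (norm v)) * norm u"
      using total_tangent unfolding g'_def tangent_error_def tangent_error_at_def HH_def H_def .
    moreover have "norm (g' v u) \<le> 1/2 * norm u" using uC_u_half unfolding g'_def .
    ultimately show ?thesis by (simp add: \<kappa>_def min_def)
  qed
  have gbd: "(norm (g v))\<^sup>2 / 2 \<le> 9 / (4 * T\<^sup>2) * (norm (x - y))\<^sup>2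
    + 4 * HH\<^sup>2 * (L\<^sup>2 * (norm x)\<^sup>2 / T\<^sup>2 + L\<^sup>2 * (norm v)\<^sup>2 + M\<^sup>2 * (norm x)^4 / T\<^sup>2 + M\<^sup>2 * T\<^sup>2 * (norm v)^4)" for v
  proof -
    \<comment> \<open>The tangent direction is set to 0, as the shift concerns velocities
      only.\<close>
    interpret three_trajectories grad D2 D3 D4 L M N T \<delta> m K "\<lambda>k. vpos grad h k x v" "\<lambda>k. vpos grad \<delta> k x (vv x v)" x v "vv x v"
     "\<lambda>k. dvpos h k x v 0" "\<lambda>k. dvpos \<delta> k x (vv x v) (vv' x v 0)" 0 "vv' x v 0"
     "\<lambda>k. vpos grad \<delta> k y (vv y v)" "\<lambda>k. dvpos \<delta> k y (vv y v) (vv' y v 0)" y "vv y v" "vv' y v 0"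
      by (rule T3)
    show ?thesis using total_shift unfolding g_def HH_def H_def .
  qed
  have km[measurable]: "\<kappa> \<in> borel_measurable borel" unfolding \<kappa>_def tangent_error_at_def by measurable
  have g'm: "(\<lambda>v. g' v b \<bullet> b) \<in> borel_measurable borel" for b
    using borel_measurable_directional_derivative[OF gd', of b] by measurable
  have vm[measurable]: "(\<lambda>w. vpos grad \<delta> n y w) \<in> borel_measurable borel"
    using vpos_has_derivative by (intro borel_measurable_continuous_onI) (meson has_derivative_continuous continuous_at_imp_continuous_on)
  have S: "(\<integral>v. \<phi> (vpos grad \<delta> n y (v + g v)) \<partial>std_gauss) \<le> (\<integral>v. (norm (g v))\<^sup>2 / 2 + real DIM('a) * (\<kappa> v)\<^sup>2 \<partial>std_gauss)
      + ln (\<integral>v. exp (\<phi> (vpos grad \<delta> n y v)) \<partial>std_gauss)"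
    "integrable std_gauss (\<lambda>v. (norm (g v))\<^sup>2 / 2 + real DIM('a) * (\<kappa> v)\<^sup>2)"
    using gauss_shift_dual[where g=g and g'=g' and \<kappa>=\<kappa> and \<phi>="\<lambda>w. \<phi> (vpos grad \<delta> n y w)" and K=B, OF gd' kbd kap(2) km g'm _ bd] by measurable
  interpret G: prob_space "std_gauss :: 'a measure" by (rule prob_space_std_gauss)
  have i2: "integrable std_gauss (\<lambda>v::'a. (norm v)\<^sup>2)"
    by (rule integrable_std_gauss_exp_growth[where C=1 and a=2]) (use norm_power_le_exp[of _ 2] in auto)
  have i4: "integrable std_gauss (\<lambda>v::'a. (norm v)^4)"
    by (rule integrable_std_gauss_exp_growth[where C=1 and a=4]) (use norm_power_le_exp[of _ 4] in auto)
  have "(\<integral>v. (norm (g v))\<^sup>2 / 2 + real DIM('a) * (\<kappa> v)\<^sup>2 \<partial>std_gauss)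
     \<le> (\<integral>v. transport_const * (norm (x - y))\<^sup>2 + verlet_error HH (norm x) ((norm (v::'a))\<^sup>2) ((norm v)^4) \<partial>std_gauss)"
  proof (rule integral_mono[OF S(2)])
    show "integrable std_gauss (\<lambda>v::'a. transport_const * (norm (x - y))\<^sup>2 + verlet_error HH (norm x) ((norm v)\<^sup>2) ((norm v)^4))"
      unfolding verlet_error_def using i2 i4 by simp
    show "(norm (g v))\<^sup>2 / 2 + real DIM('a) * (\<kappa> v)\<^sup>2 \<le> transport_const * (norm (x - y))\<^sup>2 + verlet_error HH (norm x) ((norm v)\<^sup>2) ((norm v)^4)" for v :: 'a
      by (rule total_cost_bound[OF gbd kap(1) kap(3)])
  qed
  also have "\<dots> = transport_const * (norm (x - y))\<^sup>2 + verlet_error HH (norm x) (real DIM('a)) (real DIM('a) * (real DIM('a) + 2))"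
  proof -
    define p q r where "p = transport_const * (norm (x - y))\<^sup>2 + verlet_error HH (norm x) 0 0"
      and "q = 4 * HH\<^sup>2 * (4 * L\<^sup>2 + 45 * real DIM('a) * M\<^sup>2 * T\<^sup>2)"
      and "r = 4 * HH\<^sup>2 * (4 * M\<^sup>2 * T\<^sup>2 + 45 * real DIM('a) * (M\<^sup>2 * T^4 + N * T\<^sup>2)\<^sup>2)"
    have e: "transport_const * (norm (x - y))\<^sup>2 + verlet_error HH (norm x) s t = p + q * s + r * t" for s t
      unfolding p_def q_def r_def verlet_error_def by (simp add: algebra_simps)
    show ?thesis unfolding e using i2 i4 G.prob_space by (simp add: std_gauss_moment2 std_gauss_moment4)
  qed
  finally show ?thesis using S(1) zv unfolding h_def HH_def n_def z_def g_def by simp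
qed

end

section \<open>Couplings and the triangle inequality for the squared Wasserstein distance\<close>

lemma couplings_prob:
  assumes "prob_space \<rho>" "sets \<rho> = sets borel" "\<pi> \<in> couplings \<rho> \<sigma>"
  shows "prob_space \<pi>" "sets \<pi> = sets (borel \<Otimes>\<^sub>M borel)" "space \<pi> = UNIV" "distr \<pi> borel fst = \<rho>" "distr \<pi> borel snd = \<sigma>"
proof -
  show s: "sets \<pi> = sets (borel \<Otimes>\<^sub>M borel)" and f: "distr \<pi> borel fst = \<rho>" and "distr \<pi> borel snd = \<sigma>"
    using assms(3) by (auto simp: couplings_def)
  show sp: "space \<pi> = UNIV" using sets_eq_imp_space_eq[OF s] by (simp add: space_pair_measure)
  have "fst \<in> measurable \<pi> borel" unfolding measurable_cong_sets[OF s refl] by (rule measurable_fst)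
  then have "emeasure \<pi> (space \<pi>) = emeasure (distr \<pi> borel fst) (space borel)" by (simp add: emeasure_distr sp)
  also have "\<dots> = 1" using prob_space.emeasure_space_1[OF assms(1)] sets_eq_imp_space_eq[OF assms(2)] by (simp add: f)
  finally show "prob_space \<pi>" by (rule prob_spaceI)
qed

text \<open>Integrating the pointwise inequality over the coupling leaves the mean of ln
  \<open>J2\<close>; concavity, in the form of the tangent line of ln at the mean m, moves the
  logarithm outside. Each side then depends on one marginal only, which gives back the two
  kernels.\<close>

lemma dual_coupling:
  fixes \<rho> \<sigma> :: "'a::euclidean_space measure" and \<phi> :: "'a \<Rightarrow> real" and q1 q2 :: "'a \<Rightarrow> 'a \<Rightarrow> 'a" and c :: "'a \<Rightarrow> 'a \<Rightarrow> real"
  assumes rho: "prob_space \<rho>" "sets \<rho> = sets borel" and sigma: "prob_space \<sigma>" "sets \<sigma> = sets borel"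
    and pi: "\<pi> \<in> couplings \<rho> \<sigma>"
    and q1[measurable]: "(\<lambda>p. q1 (fst p) (snd p)) \<in> borel_measurable (borel \<Otimes>\<^sub>M borel)"
    and q2[measurable]: "(\<lambda>p. q2 (fst p) (snd p)) \<in> borel_measurable (borel \<Otimes>\<^sub>M borel)"
    and phi[measurable]: "\<phi> \<in> borel_measurable borel" and K: "\<And>x. \<bar>\<phi> x\<bar> \<le> K"
    and c[measurable]: "(\<lambda>p. c (fst p) (snd p)) \<in> borel_measurable (borel \<Otimes>\<^sub>M borel)" and c0: "\<And>x y. 0 \<le> c x y"
    and pt: "\<And>x y. (\<integral>v. \<phi> (q1 x v) \<partial>std_gauss) \<le> c x y + ln (\<integral>w. exp (\<phi> (q2 y w)) \<partial>std_gauss)"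
    and R: "(\<integral>\<^sup>+p. ennreal (c (fst p) (snd p)) \<partial>\<pi>) \<le> ennreal R" "0 \<le> R"
  shows "(\<integral>x. \<phi> x \<partial>distr (\<rho> \<Otimes>\<^sub>M std_gauss) borel (\<lambda>p. q1 (fst p) (snd p)))
    \<le> R + ln (\<integral>x. exp (\<phi> x) \<partial>distr (\<sigma> \<Otimes>\<^sub>M std_gauss) borel (\<lambda>p. q2 (fst p) (snd p)))"
proof -
  interpret rho: prob_space \<rho> by fact
  interpret sigma: prob_space \<sigma> by fact
  interpret G: prob_space "std_gauss :: 'a measure" by (rule prob_space_std_gauss)
  interpret RG: pair_prob_space \<rho> "std_gauss :: 'a measure" ..
  interpret SG: pair_prob_space \<sigma> "std_gauss :: 'a measure" ..
  note cp = couplings_prob[OF rho pi]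
  interpret pi: prob_space \<pi> by (rule cp(1))
  note [measurable_cong] = rho(2) sigma(2) cp(2)
  define J1 where "J1 x = (\<integral>v. \<phi> (q1 x v) \<partial>std_gauss)" for x
  define J2 where "J2 y = (\<integral>w. exp (\<phi> (q2 y w)) \<partial>std_gauss)" for y
  have q1': "(\<lambda>v. q1 x v) \<in> borel_measurable borel" and q2': "(\<lambda>v. q2 x v) \<in> borel_measurable borel" for x
    using measurable_compose[OF measurable_Pair1'[of x borel borel] q1] measurable_compose[OF measurable_Pair1'[of x borel borel] q2] by simp_all
  have b1: "\<bar>J1 x\<bar> \<le> K" for x
  proof -
    have i: "integrable std_gauss (\<lambda>v. \<phi> (q1 x v))"
      by (rule G.integrable_bounded[where K=K]) (use K q1'[of x] in \<open>auto intro: measurable_compose[OF _ phi]\<close>)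
    have "J1 x \<le> (\<integral>v. K \<partial>(std_gauss :: 'a measure))" unfolding J1_def
      by (rule integral_mono[OF i]) (use K in \<open>auto simp: abs_le_iff\<close>)
    moreover have "(\<integral>v. - K \<partial>(std_gauss :: 'a measure)) \<le> J1 x" unfolding J1_def
      by (rule integral_mono[OF _ i]) (use K in \<open>auto simp: abs_le_iff minus_le_iff\<close>)
    ultimately show ?thesis using G.prob_space by (simp add: abs_le_iff)
  qed
  have b2: "exp (-K) \<le> J2 y" "J2 y \<le> exp K" for y
  proof -
    have i: "integrable std_gauss (\<lambda>v. exp (\<phi> (q2 y v)))"
      by (rule G.integrable_bounded[where K="exp K"]) (use K q2'[of y] in \<open>auto intro: measurable_compose[OF _ phi] simp: abs_le_iff\<close>)
    have "J2 y \<le> (\<integral>v. exp K \<partial>(std_gauss :: 'a measure))" unfolding J2_def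
      by (rule integral_mono[OF i]) (use K in \<open>auto simp: abs_le_iff\<close>)
    then show "J2 y \<le> exp K" using G.prob_space by simp
    have "(\<integral>v. exp (- K) \<partial>(std_gauss :: 'a measure)) \<le> J2 y" unfolding J2_def
      by (rule integral_mono[OF _ i]) (use K in \<open>auto simp: abs_le_iff minus_le_iff\<close>)
    then show "exp (-K) \<le> J2 y" using G.prob_space by simp
  qed
  have J1m[measurable]: "J1 \<in> borel_measurable borel"
  proof -
    have "(\<lambda>x. \<integral>v. \<phi> (q1 (fst (x, v)) (snd (x, v))) \<partial>std_gauss) \<in> borel_measurable borel"
      by (rule G.borel_measurable_lebesgue_integral) measurable
    then show ?thesis by (simp add: J1_def[abs_def])
  qed
  have J2m[measurable]: "J2 \<in> borel_measurable borel"
  proof -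
    have "(\<lambda>x. \<integral>v. exp (\<phi> (q2 (fst (x, v)) (snd (x, v)))) \<partial>std_gauss) \<in> borel_measurable borel"
      by (rule G.borel_measurable_lebesgue_integral) measurable
    then show ?thesis by (simp add: J2_def[abs_def])
  qed
  have E1: "(\<integral>x. \<phi> x \<partial>distr (\<rho> \<Otimes>\<^sub>M std_gauss) borel (\<lambda>p. q1 (fst p) (snd p))) = (\<integral>p. J1 (fst p) \<partial>\<pi>)"
  proof -
    have i: "integrable (\<rho> \<Otimes>\<^sub>M std_gauss) (\<lambda>p. \<phi> (q1 (fst p) (snd p)))"
      by (rule RG.integrable_bounded[where K=K]) (use K in auto)
    have "(\<integral>x. \<phi> x \<partial>distr (\<rho> \<Otimes>\<^sub>M std_gauss) borel (\<lambda>p. q1 (fst p) (snd p))) = (\<integral>p. \<phi> (q1 (fst p) (snd p)) \<partial>(\<rho> \<Otimes>\<^sub>M std_gauss))"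
      by (rule integral_distr) measurable
    also have "\<dots> = (\<integral>x. J1 x \<partial>\<rho>)" unfolding J1_def using RG.integral_fst'[OF i] by simp
    also have "\<dots> = (\<integral>p. J1 (fst p) \<partial>\<pi>)" unfolding cp(4)[symmetric] by (rule integral_distr) measurable
    finally show ?thesis .
  qed
  have E2: "(\<integral>x. exp (\<phi> x) \<partial>distr (\<sigma> \<Otimes>\<^sub>M std_gauss) borel (\<lambda>p. q2 (fst p) (snd p))) = (\<integral>p. J2 (snd p) \<partial>\<pi>)"
  proof -
    have i: "integrable (\<sigma> \<Otimes>\<^sub>M std_gauss) (\<lambda>p. exp (\<phi> (q2 (fst p) (snd p))))"
      by (rule SG.integrable_bounded[where K="exp K"]) (use K in \<open>auto simp: abs_le_iff\<close>)
    have "(\<integral>x. exp (\<phi> x) \<partial>distr (\<sigma> \<Otimes>\<^sub>M std_gauss) borel (\<lambda>p. q2 (fst p) (snd p))) = (\<integral>p. exp (\<phi> (q2 (fst p) (snd p))) \<partial>(\<sigma> \<Otimes>\<^sub>M std_gauss))"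
      by (rule integral_distr) measurable
    also have "\<dots> = (\<integral>x. J2 x \<partial>\<sigma>)" unfolding J2_def using SG.integral_fst'[OF i] by simp
    also have "\<dots> = (\<integral>p. J2 (snd p) \<partial>\<pi>)" unfolding cp(5)[symmetric] by (rule integral_distr) measurable
    finally show ?thesis .
  qed
  have ic: "integrable \<pi> (\<lambda>p. c (fst p) (snd p))"
    by (rule integrableI_nonneg) (use R c0 in \<open>auto simp: less_top[symmetric] top_unique\<close>)
  have cR: "(\<integral>p. c (fst p) (snd p) \<partial>\<pi>) \<le> R"
    using R c0 ic by (simp add: nn_integral_eq_integral)
  have i1: "integrable \<pi> (\<lambda>p. J1 (fst p))" by (rule pi.integrable_bounded[where K=K]) (use b1 in auto)
  have i2: "integrable \<pi> (\<lambda>p. J2 (snd p))"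
  proof (rule pi.integrable_bounded[where K="exp K"])
    show "\<bar>J2 (snd x)\<bar> \<le> exp K" for x :: "'a \<times> 'a"
      using b2[of "snd x"] order.trans[OF exp_ge_zero b2(1)[of "snd x"]] by simp
  qed measurable
  define m where "m = (\<integral>p. J2 (snd p) \<partial>\<pi>)"
  have m: "m > 0"
  proof -
    have "(\<integral>p. exp (-K) \<partial>\<pi>) \<le> m" unfolding m_def by (rule integral_mono[OF _ i2]) (use b2 in auto)
    then have "exp (-K) \<le> m" by (simp add: pi.prob_space)
    then show ?thesis using exp_gt_zero[of "-K"] by linarith
  qed
  have lnJ: "ln (J2 y) \<le> ln m + (J2 y - m) / m" for y
  proof -
    have J: "J2 y > 0" using b2(1)[of y] exp_gt_zero[of "-K"] by linarith
    have "ln (J2 y / m) \<le> J2 y / m - 1" using J m by (intro ln_le_minus_one) auto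
    then show ?thesis using J m by (simp add: ln_div diff_divide_distrib)
  qed
  have "(\<integral>p. J1 (fst p) \<partial>\<pi>) \<le> (\<integral>p. c (fst p) (snd p) + (ln m + (J2 (snd p) - m) / m) \<partial>\<pi>)"
  proof (rule integral_mono[OF i1])
    show "integrable \<pi> (\<lambda>p. c (fst p) (snd p) + (ln m + (J2 (snd p) - m) / m))" using ic i2 by simp
    show "J1 (fst p) \<le> c (fst p) (snd p) + (ln m + (J2 (snd p) - m) / m)" for p
      using pt[of "fst p" "snd p"] lnJ[of "snd p"] unfolding J1_def J2_def by linarith
  qed
  also have "\<dots> = (\<integral>p. c (fst p) (snd p) \<partial>\<pi>) + (\<integral>p. ln m + (J2 (snd p) - m) / m \<partial>\<pi>)"
    by (rule Bochner_Integration.integral_add) (use ic i2 in auto)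
  also have "(\<integral>p. ln m + (J2 (snd p) - m) / m \<partial>\<pi>) = ln m"
    using i2 by (simp add: pi.prob_space m_def[symmetric])
  finally show ?thesis using cR unfolding E1 E2 m_def[symmetric] by linarith
qed

lemma ennreal_two_mult: "0 \<le> t \<Longrightarrow> ennreal (2 * t) = 2 * ennreal t"
  by (simp add: ennreal_mult)

text \<open>Young's inequality with weight \<epsilon> for the middle term; e \<le> 2\<epsilon> makes
  e^2/\<epsilon> at most 4\<epsilon>.\<close>

lemma square_triangle_eps:
  fixes a b e \<epsilon> :: real
  assumes "0 < \<epsilon>" "0 \<le> e" "e \<le> 2 * \<epsilon>"
  shows "(a + e + b)\<^sup>2 \<le> (1 + \<epsilon>) * (2 * a\<^sup>2 + 2 * b\<^sup>2) + (4 * \<epsilon>\<^sup>2 + 4 * \<epsilon>)"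
proof -
  have "0 \<le> (\<epsilon> * (a + b) - e)\<^sup>2" by simp
  then have "2 * (a + b) * e * \<epsilon> \<le> (\<epsilon> * (a + b)\<^sup>2) * \<epsilon> + e\<^sup>2" by (simp add: power2_eq_square algebra_simps)
  also have "e\<^sup>2 \<le> (2 * \<epsilon>)\<^sup>2" using assms by (intro power_mono) auto
  also have "(\<epsilon> * (a + b)\<^sup>2) * \<epsilon> + (2 * \<epsilon>)\<^sup>2 = (\<epsilon> * (a + b)\<^sup>2 + 4 * \<epsilon>) * \<epsilon>" by (simp add: power2_eq_square algebra_simps)
  finally have 1: "2 * (a + b) * e \<le> \<epsilon> * (a + b)\<^sup>2 + 4 * \<epsilon>" using assms(1) by simp
  have 2: "e\<^sup>2 \<le> 4 * \<epsilon>\<^sup>2" using power_mono[of e "2 * \<epsilon>" 2] assms by (simp add: power_mult_distrib)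
  have 3: "(a + b)\<^sup>2 \<le> 2 * a\<^sup>2 + 2 * b\<^sup>2" using zero_le_power2[of "a - b"] by (simp add: power2_eq_square algebra_simps)
  have "(a + e + b)\<^sup>2 = (a + b)\<^sup>2 + 2 * (a + b) * e + e\<^sup>2" by (simp add: power2_eq_square algebra_simps)
  also have "\<dots> \<le> (a + b)\<^sup>2 + (\<epsilon> * (a + b)\<^sup>2 + 4 * \<epsilon>) + 4 * \<epsilon>\<^sup>2" using 1 2 by simp
  also have "\<dots> = (1 + \<epsilon>) * (a + b)\<^sup>2 + (4 * \<epsilon>\<^sup>2 + 4 * \<epsilon>)" by (simp add: algebra_simps)
  also have "\<dots> \<le> (1 + \<epsilon>) * (2 * a\<^sup>2 + 2 * b\<^sup>2) + (4 * \<epsilon>\<^sup>2 + 4 * \<epsilon>)" using 3 assms by (intro add_right_mono mult_left_mono) auto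
  finally show ?thesis .
qed

text \<open>\<open>k y\<close> is the index of the first member of a countable dense sequence within
  \<epsilon> of y, so points with the same index are 2\<epsilon>-close.\<close>

lemma ex_small_cells:
  assumes e: "0 < \<epsilon>"
  shows "\<exists>k :: 'a::euclidean_space \<Rightarrow> nat. k \<in> measurable borel (count_space UNIV) \<and> (\<forall>y z. k y = k z \<longrightarrow> dist y z \<le> 2 * \<epsilon>)"
proof -
  obtain X :: "'a set" where X: "countable X" "\<And>Y. open Y \<Longrightarrow> Y \<noteq> {} \<Longrightarrow> \<exists>d\<in>X. d \<in> Y" using countable_dense_setE by blast
  have ne: "X \<noteq> {}" using X(2)[of UNIV] by auto
  define d where "d n = from_nat_into X n" for n
  have ex: "\<exists>n. dist y (d n) < \<epsilon>" for y
  proof -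
    obtain x where "x \<in> X" "x \<in> ball y \<epsilon>" using X(2)[of "ball y \<epsilon>"] e by auto
    moreover obtain n where "d n = x" using from_nat_into_surj[OF X(1) \<open>x \<in> X\<close>] by (auto simp: d_def)
    ultimately show ?thesis by auto
  qed
  define k where "k y = (LEAST n. dist y (d n) < \<epsilon>)" for y
  have k: "dist y (d (k y)) < \<epsilon>" for y unfolding k_def using ex by (rule LeastI_ex)
  have "k \<in> measurable borel (count_space UNIV)" unfolding k_def by measurable
  moreover have "dist y z \<le> 2 * \<epsilon>" if "k y = k z" for y z
    using k[of y] k[of z] dist_triangle2[of y z "d (k z)"] that by simp
  ultimately show ?thesis by blast
qed

text \<open>Exact gluing would ask for conditional laws given the middle variable. Instead the
  middle variable is matched only up to a cell of diameter 2\<epsilon>: \<open>\<pi>1\<close> and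
  \<open>\<pi>2\<close> are taken independent and reweighted by the inverse mass of the cell when
  their middle points share it. The outer marginals are exact; only the cost carries an error in
  \<epsilon>.\<close>

lemma approximate_gluing:
  fixes \<rho> \<sigma> \<tau> :: "'a::euclidean_space measure"
  assumes rho: "prob_space \<rho>" "sets \<rho> = sets borel" and sigma: "prob_space \<sigma>" "sets \<sigma> = sets borel"
    and p1: "\<pi>1 \<in> couplings \<rho> \<sigma>" and p2: "\<pi>2 \<in> couplings \<sigma> \<tau>" and e: "0 < \<epsilon>"
  shows "W2sq \<rho> \<tau> \<le> ennreal (1 + \<epsilon>) * (2 * (\<integral>\<^sup>+ p. ennreal ((dist (fst p) (snd p))\<^sup>2) \<partial>\<pi>1) + 2 * (\<integral>\<^sup>+ p. ennreal ((dist (fst p) (snd p))\<^sup>2) \<partial>\<pi>2))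
     + ennreal (4 * \<epsilon>\<^sup>2 + 4 * \<epsilon>)"
proof -
  note c1 = couplings_prob[OF rho p1] and c2 = couplings_prob[OF sigma p2]
  interpret P1: prob_space \<pi>1 by (rule c1(1))
  interpret P2: prob_space \<pi>2 by (rule c2(1))
  interpret S: prob_space \<sigma> by fact
  interpret P: pair_prob_space \<pi>1 \<pi>2 ..
  note [measurable_cong] = c1(2) c2(2) sigma(2) rho(2)
  obtain k :: "'a \<Rightarrow> nat" where k[measurable]: "k \<in> measurable borel (count_space UNIV)"
    and kd: "\<And>y z. k y = k z \<Longrightarrow> dist y z \<le> 2 * \<epsilon>" using ex_small_cells[OF e] by blast
  define s where "s n = emeasure \<sigma> {y. k y = n}" for n
  \<comment> \<open>In a cell of mass s the weight is 1/s, so that integrating either middle point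
    against \<open>\<sigma>\<close> gives 1. On null cells the weight is infinite;
    \<open>pos\<close> shows that these are almost never met.\<close>
  define w where "w y y' = (if real (k y) = real (k y') then inverse (s (k y)) else 0)" for y y'
  have [measurable]: "(\<lambda>y. real (k y)) \<in> borel_measurable borel" "(\<lambda>y. s (k y)) \<in> borel_measurable borel"
    by (rule measurable_compose[OF k], simp)+
  have wm[measurable]: "(\<lambda>p. w (snd (fst p)) (fst (snd p))) \<in> borel_measurable (\<pi>1 \<Otimes>\<^sub>M \<pi>2)"
    unfolding w_def by measurable
  have cell[measurable]: "{y. k y = n} \<in> sets borel" for n
  proof -
    have "{y. k y = n} = k -` {n} \<inter> space borel" by auto
    then show ?thesis using measurable_sets[OF k, of "{n}"] by simp
  qed
  have sfin: "s n \<noteq> \<top>" for n unfolding s_def by (simp add: S.emeasure_eq_measure)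
  have pos: "AE y in \<sigma>. s (k y) \<noteq> 0"
  proof -
    have "(\<Union>n\<in>{n. s n = 0}. {y. k y = n}) \<in> null_sets \<sigma>"
      by (rule null_sets_UN') (auto simp: s_def null_sets_def sigma(2))
    then show ?thesis by (rule AE_not_in[THEN AE_mp]) (rule AE_I2, auto)
  qed
  have int_w: "(\<integral>\<^sup>+y'. w y y' \<partial>\<sigma>) = 1" if "s (k y) \<noteq> 0" for y
  proof -
    have "(\<integral>\<^sup>+y'. w y y' \<partial>\<sigma>) = (\<integral>\<^sup>+y'. inverse (s (k y)) * indicator {y'. k y' = k y} y' \<partial>\<sigma>)"
      by (rule nn_integral_cong) (auto simp: w_def)
    also have "\<dots> = inverse (s (k y)) * s (k y)" unfolding s_def using sigma(2) by (simp add: nn_integral_cmult_indicator)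
    also have "\<dots> = s (k y) / s (k y)" by (simp add: divide_ennreal_def mult.commute)
    also have "\<dots> = 1" using that sfin[of "k y"] by (simp add: ennreal_divide_self less_top)
    finally show ?thesis .
  qed
  have w_sym: "w y y' = w y' y" for y y' by (simp add: w_def)
  have A1: "AE p in \<pi>1. (\<integral>\<^sup>+p'. w (snd p) (fst p') \<partial>\<pi>2) = 1"
  proof -
    have "AE y in distr \<pi>1 borel snd. s (k y) \<noteq> 0" unfolding c1(5) by (rule pos)
    then have "AE p in \<pi>1. s (k (snd p)) \<noteq> 0" by (subst (asm) AE_distr_iff) auto
    then show ?thesis
    proof eventually_elim
      case (elim p)
      have "(\<integral>\<^sup>+p'. w (snd p) (fst p') \<partial>\<pi>2) = (\<integral>\<^sup>+y'. w (snd p) y' \<partial>distr \<pi>2 borel fst)"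
        by (rule nn_integral_distr[symmetric]) (auto simp: w_def)
      then show ?case using int_w[OF elim] by (simp add: c2(4))
    qed
  qed
  have A2: "AE p' in \<pi>2. (\<integral>\<^sup>+p. w (snd p) (fst p') \<partial>\<pi>1) = 1"
  proof -
    have "AE y in distr \<pi>2 borel fst. s (k y) \<noteq> 0" unfolding c2(4) by (rule pos)
    then have "AE p in \<pi>2. s (k (fst p)) \<noteq> 0" by (subst (asm) AE_distr_iff) auto
    then show ?thesis
    proof eventually_elim
      case (elim p')
      have "(\<integral>\<^sup>+p. w (snd p) (fst p') \<partial>\<pi>1) = (\<integral>\<^sup>+y. w (fst p') y \<partial>distr \<pi>1 borel snd)"
        unfolding w_sym[of _ "fst p'"] by (rule nn_integral_distr[symmetric]) (auto simp: w_def)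
      then show ?case using int_w[OF elim] by (simp add: c1(5))
    qed
  qed
  define Gm where "Gm = distr (density (\<pi>1 \<Otimes>\<^sub>M \<pi>2) (\<lambda>p. w (snd (fst p)) (fst (snd p)))) (borel \<Otimes>\<^sub>M borel) (\<lambda>p. (fst (fst p), snd (snd p)))"
  have int1: "(\<integral>\<^sup>+p. w (snd (fst p)) (fst (snd p)) * F (fst p) \<partial>(\<pi>1 \<Otimes>\<^sub>M \<pi>2)) = (\<integral>\<^sup>+p. F p \<partial>\<pi>1)"
    if [measurable]: "F \<in> borel_measurable \<pi>1" for F :: "'a \<times> 'a \<Rightarrow> ennreal"
  proof -
    have "(\<integral>\<^sup>+p. w (snd (fst p)) (fst (snd p)) * F (fst p) \<partial>(\<pi>1 \<Otimes>\<^sub>M \<pi>2)) = (\<integral>\<^sup>+p. (\<integral>\<^sup>+p'. w (snd p) (fst p') * F p \<partial>\<pi>2) \<partial>\<pi>1)"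
      by (subst P2.nn_integral_fst[symmetric]) simp_all
    also have "\<dots> = (\<integral>\<^sup>+p. (\<integral>\<^sup>+p'. w (snd p) (fst p') \<partial>\<pi>2) * F p \<partial>\<pi>1)"
      by (intro nn_integral_cong nn_integral_multc) (auto simp: w_def)
    also have "\<dots> = (\<integral>\<^sup>+p. F p \<partial>\<pi>1)"
      by (rule nn_integral_cong_AE) (use A1 in eventually_elim, simp)
    finally show ?thesis .
  qed
  have int2: "(\<integral>\<^sup>+p. w (snd (fst p)) (fst (snd p)) * F (snd p) \<partial>(\<pi>1 \<Otimes>\<^sub>M \<pi>2)) = (\<integral>\<^sup>+p. F p \<partial>\<pi>2)"
    if [measurable]: "F \<in> borel_measurable \<pi>2" for F :: "'a \<times> 'a \<Rightarrow> ennreal"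
  proof -
    have "(\<integral>\<^sup>+p. w (snd (fst p)) (fst (snd p)) * F (snd p) \<partial>(\<pi>1 \<Otimes>\<^sub>M \<pi>2)) = (\<integral>\<^sup>+p'. (\<integral>\<^sup>+p. w (snd p) (fst p') * F p' \<partial>\<pi>1) \<partial>\<pi>2)"
      by (subst P.nn_integral_snd[symmetric]) (simp_all add: case_prod_beta')
    also have "\<dots> = (\<integral>\<^sup>+p'. (\<integral>\<^sup>+p. w (snd p) (fst p') \<partial>\<pi>1) * F p' \<partial>\<pi>2)"
      by (intro nn_integral_cong nn_integral_multc) (auto simp: w_def)
    also have "\<dots> = (\<integral>\<^sup>+p. F p \<partial>\<pi>2)"
      by (rule nn_integral_cong_AE) (use A2 in eventually_elim, simp)
    finally show ?thesis .
  qed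
  have "Gm \<in> couplings \<rho> \<tau>"
  proof -
    have "distr Gm borel fst = \<rho>"
    proof (rule measure_eqI)
      fix A assume "A \<in> sets (distr Gm borel fst)"
      then have A[measurable]: "A \<in> sets borel" by simp
      have "emeasure (distr Gm borel fst) A = (\<integral>\<^sup>+p. indicator A (fst p) \<partial>Gm)"
        by (simp add: Gm_def nn_integral_indicator[symmetric] nn_integral_distr del: nn_integral_indicator)
      also have "\<dots> = (\<integral>\<^sup>+p. w (snd (fst p)) (fst (snd p)) * indicator A (fst (fst p)) \<partial>(\<pi>1 \<Otimes>\<^sub>M \<pi>2))"
        by (simp add: Gm_def nn_integral_distr nn_integral_density)
      also have "\<dots> = (\<integral>\<^sup>+p. indicator A (fst p) \<partial>\<pi>1)" by (rule int1) measurable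
      also have "\<dots> = (\<integral>\<^sup>+x. indicator A x \<partial>distr \<pi>1 borel fst)" by (rule nn_integral_distr[symmetric]) auto
      also have "\<dots> = emeasure \<rho> A" using A rho(2) by (simp add: c1(4))
      finally show "emeasure (distr Gm borel fst) A = emeasure \<rho> A" .
    qed (simp add: rho(2))
    moreover have "distr Gm borel snd = \<tau>"
    proof (rule measure_eqI)
      fix A assume "A \<in> sets (distr Gm borel snd)"
      then have A[measurable]: "A \<in> sets borel" by simp
      have "emeasure (distr Gm borel snd) A = (\<integral>\<^sup>+p. indicator A (snd p) \<partial>Gm)"
        by (simp add: Gm_def nn_integral_indicator[symmetric] nn_integral_distr del: nn_integral_indicator)
      also have "\<dots> = (\<integral>\<^sup>+p. w (snd (fst p)) (fst (snd p)) * indicator A (snd (snd p)) \<partial>(\<pi>1 \<Otimes>\<^sub>M \<pi>2))"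
        by (simp add: Gm_def nn_integral_distr nn_integral_density)
      also have "\<dots> = (\<integral>\<^sup>+p. indicator A (snd p) \<partial>\<pi>2)" by (rule int2) measurable
      also have "\<dots> = (\<integral>\<^sup>+x. indicator A x \<partial>distr \<pi>2 borel snd)" by (rule nn_integral_distr[symmetric]) auto
      also have "\<dots> = emeasure \<tau> A" using A c2(5) by (metis nn_integral_indicator sets_distr)
      finally show "emeasure (distr Gm borel snd) A = emeasure \<tau> A" .
    qed (use c2(5) in auto)
    ultimately show ?thesis by (simp add: couplings_def Gm_def)
  qed
  then have "W2sq \<rho> \<tau> \<le> (\<integral>\<^sup>+ p. ennreal ((dist (fst p) (snd p))\<^sup>2) \<partial>Gm)"
    unfolding W2sq_def by (rule INF_lower)
  also have "\<dots> = (\<integral>\<^sup>+p. w (snd (fst p)) (fst (snd p)) * ennreal ((dist (fst (fst p)) (snd (snd p)))\<^sup>2) \<partial>(\<pi>1 \<Otimes>\<^sub>M \<pi>2))"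
    by (simp add: Gm_def nn_integral_distr nn_integral_density)
  also have "\<dots> \<le> (\<integral>\<^sup>+p. w (snd (fst p)) (fst (snd p)) * (ennreal (1 + \<epsilon>) * 2 * ennreal ((dist (fst (fst p)) (snd (fst p)))\<^sup>2))
      + w (snd (fst p)) (fst (snd p)) * (ennreal (1 + \<epsilon>) * 2 * ennreal ((dist (fst (snd p)) (snd (snd p)))\<^sup>2) + ennreal (4 * \<epsilon>\<^sup>2 + 4 * \<epsilon>)) \<partial>(\<pi>1 \<Otimes>\<^sub>M \<pi>2))"
  proof (rule nn_integral_mono)
    fix p :: "('a \<times> 'a) \<times> ('a \<times> 'a)"
    obtain x y y' z where p: "p = ((x, y), (y', z))" by (cases p) auto
    show "w (snd (fst p)) (fst (snd p)) * ennreal ((dist (fst (fst p)) (snd (snd p)))\<^sup>2)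
      \<le> w (snd (fst p)) (fst (snd p)) * (ennreal (1 + \<epsilon>) * 2 * ennreal ((dist (fst (fst p)) (snd (fst p)))\<^sup>2))
      + w (snd (fst p)) (fst (snd p)) * (ennreal (1 + \<epsilon>) * 2 * ennreal ((dist (fst (snd p)) (snd (snd p)))\<^sup>2) + ennreal (4 * \<epsilon>\<^sup>2 + 4 * \<epsilon>))"
    proof (cases "k y = k y'")
      case False
      then show ?thesis by (simp add: p w_def)
    next
      case True
      have "dist x z \<le> dist x y + dist y y' + dist y' z"
        using dist_triangle[of x z y] dist_triangle[of y z y'] by linarith
      then have "(dist x z)\<^sup>2 \<le> (dist x y + dist y y' + dist y' z)\<^sup>2" by (intro power_mono) auto
      also have "\<dots> \<le> (1 + \<epsilon>) * (2 * (dist x y)\<^sup>2 + 2 * (dist y' z)\<^sup>2) + (4 * \<epsilon>\<^sup>2 + 4 * \<epsilon>)"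
        by (rule square_triangle_eps[OF e zero_le_dist kd[OF True]])
      also have "\<dots> = (1 + \<epsilon>) * 2 * (dist x y)\<^sup>2 + ((1 + \<epsilon>) * 2 * (dist y' z)\<^sup>2 + (4 * \<epsilon>\<^sup>2 + 4 * \<epsilon>))" by (simp add: algebra_simps)
      finally have "ennreal ((dist x z)\<^sup>2) \<le> ennreal ((1 + \<epsilon>) * 2 * (dist x y)\<^sup>2 + ((1 + \<epsilon>) * 2 * (dist y' z)\<^sup>2 + (4 * \<epsilon>\<^sup>2 + 4 * \<epsilon>)))"
        by (rule ennreal_leI)
      also have "\<dots> = ennreal (1 + \<epsilon>) * 2 * ennreal ((dist x y)\<^sup>2) + (ennreal (1 + \<epsilon>) * 2 * ennreal ((dist y' z)\<^sup>2) + ennreal (4 * \<epsilon>\<^sup>2 + 4 * \<epsilon>))"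
      proof -
        have m: "ennreal ((1 + \<epsilon>) * 2 * t) = ennreal (1 + \<epsilon>) * 2 * ennreal t" if "0 \<le> t" for t
          unfolding mult.assoc ennreal_two_mult[OF that, symmetric] by (rule ennreal_mult) (use e that in auto)
        have "ennreal ((1 + \<epsilon>) * 2 * (dist x y)\<^sup>2 + ((1 + \<epsilon>) * 2 * (dist y' z)\<^sup>2 + (4 * \<epsilon>\<^sup>2 + 4 * \<epsilon>)))
          = ennreal ((1 + \<epsilon>) * 2 * (dist x y)\<^sup>2) + ennreal ((1 + \<epsilon>) * 2 * (dist y' z)\<^sup>2 + (4 * \<epsilon>\<^sup>2 + 4 * \<epsilon>))"
          by (rule ennreal_plus) (use e in auto)
        also have "ennreal ((1 + \<epsilon>) * 2 * (dist y' z)\<^sup>2 + (4 * \<epsilon>\<^sup>2 + 4 * \<epsilon>)) = ennreal ((1 + \<epsilon>) * 2 * (dist y' z)\<^sup>2) + ennreal (4 * \<epsilon>\<^sup>2 + 4 * \<epsilon>)"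
          by (rule ennreal_plus) (use e in auto)
        finally show ?thesis unfolding m[OF zero_le_power2] .
      qed
      finally show ?thesis unfolding p fst_conv snd_conv distrib_left[symmetric] by (intro mult_left_mono) auto
    qed
  qed
  also have "\<dots> = (\<integral>\<^sup>+p. w (snd (fst p)) (fst (snd p)) * (ennreal (1 + \<epsilon>) * 2 * ennreal ((dist (fst (fst p)) (snd (fst p)))\<^sup>2)) \<partial>(\<pi>1 \<Otimes>\<^sub>M \<pi>2))
      + (\<integral>\<^sup>+p. w (snd (fst p)) (fst (snd p)) * (ennreal (1 + \<epsilon>) * 2 * ennreal ((dist (fst (snd p)) (snd (snd p)))\<^sup>2) + ennreal (4 * \<epsilon>\<^sup>2 + 4 * \<epsilon>)) \<partial>(\<pi>1 \<Otimes>\<^sub>M \<pi>2))"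
    by (rule nn_integral_add) measurable
  also have "\<dots> = (\<integral>\<^sup>+p. ennreal (1 + \<epsilon>) * 2 * ennreal ((dist (fst p) (snd p))\<^sup>2) \<partial>\<pi>1)
      + (\<integral>\<^sup>+p. ennreal (1 + \<epsilon>) * 2 * ennreal ((dist (fst p) (snd p))\<^sup>2) + ennreal (4 * \<epsilon>\<^sup>2 + 4 * \<epsilon>) \<partial>\<pi>2)"
    by (intro arg_cong2[where f="(+)"] int1 int2) measurable
  also have "\<dots> = ennreal (1 + \<epsilon>) * (2 * (\<integral>\<^sup>+ p. ennreal ((dist (fst p) (snd p))\<^sup>2) \<partial>\<pi>1) + 2 * (\<integral>\<^sup>+ p. ennreal ((dist (fst p) (snd p))\<^sup>2) \<partial>\<pi>2))
     + ennreal (4 * \<epsilon>\<^sup>2 + 4 * \<epsilon>)"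
    by (simp add: nn_integral_add nn_integral_cmult P2.emeasure_space_1 distrib_left mult.assoc add.assoc del: ennreal_plus)
  finally show ?thesis .
qed

text \<open>\<epsilon> tends to 0 in the approximate gluing of near-optimal couplings. The factor 2,
  from (a + b)^2 \<le> 2a^2 + 2b^2, is the one visible in the theorem.\<close>

lemma W2sq_triangle:
  fixes \<rho> \<sigma> \<tau> :: "'a::euclidean_space measure"
  assumes rho: "prob_space \<rho>" "sets \<rho> = sets borel" and sigma: "prob_space \<sigma>" "sets \<sigma> = sets borel"
  shows "W2sq \<rho> \<tau> \<le> 2 * W2sq \<rho> \<sigma> + 2 * W2sq \<sigma> \<tau>"
proof (cases "W2sq \<rho> \<sigma> = \<top> \<or> W2sq \<sigma> \<tau> = \<top>")
  case True
  then show ?thesis by (auto simp: ennreal_mult_eq_top_iff)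
next
  case False
  define a b where "a = enn2real (W2sq \<rho> \<sigma>)" and "b = enn2real (W2sq \<sigma> \<tau>)"
  have ab: "W2sq \<rho> \<sigma> = ennreal a" "W2sq \<sigma> \<tau> = ennreal b" "0 \<le> a" "0 \<le> b"
    using False by (auto simp: a_def b_def ennreal_enn2real_if)
  have main: "W2sq \<rho> \<tau> \<le> ennreal ((1 + \<epsilon>) * (2 * (a + \<epsilon>) + 2 * (b + \<epsilon>)) + (4 * \<epsilon>\<^sup>2 + 4 * \<epsilon>))" if e: "0 < \<epsilon>" for \<epsilon>
  proof -
    have "W2sq \<rho> \<sigma> < ennreal (a + \<epsilon>)" "W2sq \<sigma> \<tau> < ennreal (b + \<epsilon>)" using ab e by (simp_all add: ennreal_less_iff)
    then obtain p1 p2 where p: "p1 \<in> couplings \<rho> \<sigma>" "p2 \<in> couplings \<sigma> \<tau>"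
      "(\<integral>\<^sup>+ p. ennreal ((dist (fst p) (snd p))\<^sup>2) \<partial>p1) < ennreal (a + \<epsilon>)" "(\<integral>\<^sup>+ p. ennreal ((dist (fst p) (snd p))\<^sup>2) \<partial>p2) < ennreal (b + \<epsilon>)"
      unfolding W2sq_def INF_less_iff by blast
    have "W2sq \<rho> \<tau> \<le> ennreal (1 + \<epsilon>) * (2 * ennreal (a + \<epsilon>) + 2 * ennreal (b + \<epsilon>)) + ennreal (4 * \<epsilon>\<^sup>2 + 4 * \<epsilon>)"
      by (rule order.trans[OF approximate_gluing[OF rho sigma p(1,2) e]])
        (intro add_mono mult_left_mono order.refl less_imp_le[OF p(3)] less_imp_le[OF p(4)], auto)
    also have "\<dots> = ennreal ((1 + \<epsilon>) * (2 * (a + \<epsilon>) + 2 * (b + \<epsilon>)) + (4 * \<epsilon>\<^sup>2 + 4 * \<epsilon>))"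
    proof -
      have n: "0 \<le> a + \<epsilon>" "0 \<le> b + \<epsilon>" using ab e by simp_all
      have "ennreal ((1 + \<epsilon>) * (2 * (a + \<epsilon>) + 2 * (b + \<epsilon>)) + (4 * \<epsilon>\<^sup>2 + 4 * \<epsilon>))
        = ennreal ((1 + \<epsilon>) * (2 * (a + \<epsilon>) + 2 * (b + \<epsilon>))) + ennreal (4 * \<epsilon>\<^sup>2 + 4 * \<epsilon>)"
        using ab e n by (intro ennreal_plus mult_nonneg_nonneg add_nonneg_nonneg) auto
      also have "ennreal ((1 + \<epsilon>) * (2 * (a + \<epsilon>) + 2 * (b + \<epsilon>))) = ennreal (1 + \<epsilon>) * ennreal (2 * (a + \<epsilon>) + 2 * (b + \<epsilon>))"
        using ab e n by (intro ennreal_mult add_nonneg_nonneg) auto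
      also have "ennreal (2 * (a + \<epsilon>) + 2 * (b + \<epsilon>)) = ennreal (2 * (a + \<epsilon>)) + ennreal (2 * (b + \<epsilon>))"
        using n by (intro ennreal_plus) auto
      finally show ?thesis unfolding ennreal_two_mult[OF n(1)] ennreal_two_mult[OF n(2)] by (rule sym)
    qed
    finally show ?thesis .
  qed
  have "W2sq \<rho> \<tau> \<noteq> \<top>" using main[of 1] by (auto simp: top_unique)
  then obtain t where t: "W2sq \<rho> \<tau> = ennreal t" "0 \<le> t" by (cases "W2sq \<rho> \<tau>") auto
  have "t \<le> (1 + 0) * (2 * (a + 0) + 2 * (b + 0)) + (4 * 0\<^sup>2 + 4 * 0)"
  proof (rule tendsto_le[of "at_right 0"])
    show "((\<lambda>\<epsilon>. (1 + \<epsilon>) * (2 * (a + \<epsilon>) + 2 * (b + \<epsilon>)) + (4 * \<epsilon>\<^sup>2 + 4 * \<epsilon>)) \<longlongrightarrow> (1 + 0) * (2 * (a + 0) + 2 * (b + 0)) + (4 * 0\<^sup>2 + 4 * 0)) (at_right (0::real))"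
      by (intro tendsto_intros)
    show "\<forall>\<^sub>F \<epsilon> in at_right 0. t \<le> (1 + \<epsilon>) * (2 * (a + \<epsilon>) + 2 * (b + \<epsilon>)) + (4 * \<epsilon>\<^sup>2 + 4 * \<epsilon>)"
      unfolding eventually_at_right_field
    proof (intro exI[of _ 1] conjI allI impI zero_less_one)
      fix \<epsilon> :: real assume e: "0 < \<epsilon>" "\<epsilon> < 1"
      have "0 \<le> (1 + \<epsilon>) * (2 * (a + \<epsilon>) + 2 * (b + \<epsilon>)) + (4 * \<epsilon>\<^sup>2 + 4 * \<epsilon>)" using e ab by (intro add_nonneg_nonneg mult_nonneg_nonneg) auto
      then show "t \<le> (1 + \<epsilon>) * (2 * (a + \<epsilon>) + 2 * (b + \<epsilon>)) + (4 * \<epsilon>\<^sup>2 + 4 * \<epsilon>)" using main[OF e(1)] t by (simp del: ennreal_plus)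
    qed
  qed auto
  then have "ennreal t \<le> ennreal (2 * a + 2 * b)" by (intro ennreal_leI) simp
  also have "\<dots> = 2 * ennreal a + 2 * ennreal b"
    unfolding ennreal_two_mult[OF ab(3), symmetric] ennreal_two_mult[OF ab(4), symmetric] using ab by (intro ennreal_plus) auto
  finally show ?thesis by (simp add: t ab)
qed

lemma W2_squared: "(W2 \<rho> \<sigma>)\<^sup>2 = W2sq \<rho> \<sigma>"
proof (cases "W2sq \<rho> \<sigma> = \<top>")
  case True
  then show ?thesis by (simp add: W2_def power2_eq_square ennreal_top_mult)
next
  case False
  then have "(W2 \<rho> \<sigma>)\<^sup>2 = ennreal ((sqrt (enn2real (W2sq \<rho> \<sigma>)))\<^sup>2)" by (simp add: W2_def ennreal_power)
  also have "\<dots> = ennreal (enn2real (W2sq \<rho> \<sigma>))" by simp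
  also have "\<dots> = W2sq \<rho> \<sigma>" using False by (simp only: ennreal_enn2real_if if_False)
  finally show ?thesis .
qed

section \<open>Invariance of the Gibbs measure in the limit of small steps\<close>

abbreviation (input) "lb2 \<equiv> (lborel :: 'a::euclidean_space measure) \<Otimes>\<^sub>M (lborel :: 'a measure)"

lemma nn_integral_lborel_shift:
  fixes F :: "'a::euclidean_space \<Rightarrow> ennreal"
  assumes [measurable]: "F \<in> borel_measurable borel"
  shows "(\<integral>\<^sup>+v. F (v + c) \<partial>lborel) = (\<integral>\<^sup>+v. F v \<partial>lborel)"
proof -
  have "(\<integral>\<^sup>+v. F v \<partial>distr lborel borel ((+) c)) = (\<integral>\<^sup>+v. F (c + v) \<partial>lborel)"
    by (rule nn_integral_distr) auto
  then show ?thesis by (simp add: lborel_distr_plus add.commute)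
qed

lemma nn_integral_shear_snd:
  fixes F :: "'a::euclidean_space \<times> 'a \<Rightarrow> ennreal"
  assumes [measurable]: "F \<in> borel_measurable (borel \<Otimes>\<^sub>M borel)" "a \<in> borel_measurable borel"
  shows "(\<integral>\<^sup>+p. F (fst p, snd p + a (fst p)) \<partial>lb2) = (\<integral>\<^sup>+p. F p \<partial>lb2)"
proof -
  have "(\<integral>\<^sup>+p. F (fst p, snd p + a (fst p)) \<partial>lb2) = (\<integral>\<^sup>+x. \<integral>\<^sup>+v. F (x, v + a x) \<partial>lborel \<partial>lborel)"
    by (subst lborel.nn_integral_fst[symmetric]) simp_all
  also have "\<dots> = (\<integral>\<^sup>+x. \<integral>\<^sup>+v. F (x, v) \<partial>lborel \<partial>lborel)"
    by (intro nn_integral_cong nn_integral_lborel_shift) measurable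
  also have "\<dots> = (\<integral>\<^sup>+p. F p \<partial>lb2)" by (rule lborel.nn_integral_fst) simp
  finally show ?thesis .
qed

lemma nn_integral_shear_fst:
  fixes F :: "'a::euclidean_space \<times> 'a \<Rightarrow> ennreal"
  assumes [measurable]: "F \<in> borel_measurable (borel \<Otimes>\<^sub>M borel)" "a \<in> borel_measurable borel"
  shows "(\<integral>\<^sup>+p. F (fst p + a (snd p), snd p) \<partial>lb2) = (\<integral>\<^sup>+p. F p \<partial>lb2)"
proof -
  have "(\<integral>\<^sup>+p. F (fst p + a (snd p), snd p) \<partial>lb2) = (\<integral>\<^sup>+v. \<integral>\<^sup>+x. F (x + a v, v) \<partial>lborel \<partial>lborel)"
    by (subst lborel_pair.nn_integral_snd[symmetric]) (simp_all add: case_prod_beta')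
  also have "\<dots> = (\<integral>\<^sup>+v. \<integral>\<^sup>+x. F (x, v) \<partial>lborel \<partial>lborel)"
    by (intro nn_integral_cong nn_integral_lborel_shift) measurable
  also have "\<dots> = (\<integral>\<^sup>+p. F p \<partial>lb2)" by (subst lborel_pair.nn_integral_snd[symmetric]) (simp_all add: case_prod_beta')
  finally show ?thesis .
qed

text \<open>A step is kick, drift, kick: three shears, each a translation in one variable while the
  other is fixed.\<close>

lemma nn_integral_verlet_step:
  fixes F :: "'a::euclidean_space \<times> 'a \<Rightarrow> ennreal"
  assumes F[measurable]: "F \<in> borel_measurable (borel \<Otimes>\<^sub>M borel)" and g[measurable]: "g \<in> borel_measurable borel"
  shows "(\<integral>\<^sup>+p. F (verlet_step g \<delta> p) \<partial>lb2) = (\<integral>\<^sup>+p. F p \<partial>lb2)"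
proof -
  \<comment> \<open>\<open>F1\<close> absorbs the last kick and \<open>F2\<close> the drift, so the
    first kick is the outermost substitution.\<close>
  define F1 where "F1 p = F (fst p, snd p + - ((\<delta> / 2) *\<^sub>R g (fst p)))" for p
  define F2 where "F2 p = F1 (fst p + \<delta> *\<^sub>R snd p, snd p)" for p
  have [measurable]: "F1 \<in> borel_measurable (borel \<Otimes>\<^sub>M borel)" unfolding F1_def by measurable
  have [measurable]: "F2 \<in> borel_measurable (borel \<Otimes>\<^sub>M borel)" unfolding F2_def by measurable
  have "F (verlet_step g \<delta> p) = F2 (fst p, snd p + - ((\<delta> / 2) *\<^sub>R g (fst p)))" for p
    by (simp add: verlet_step_def Let_def F1_def F2_def algebra_simps power2_eq_square)
  then have "(\<integral>\<^sup>+p. F (verlet_step g \<delta> p) \<partial>lb2) = (\<integral>\<^sup>+p. F2 (fst p, snd p + - ((\<delta> / 2) *\<^sub>R g (fst p))) \<partial>lb2)" by simp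
  also have "\<dots> = (\<integral>\<^sup>+p. F2 p \<partial>lb2)" by (rule nn_integral_shear_snd) measurable
  also have "\<dots> = (\<integral>\<^sup>+p. F1 p \<partial>lb2)" unfolding F2_def by (rule nn_integral_shear_fst) measurable
  also have "\<dots> = (\<integral>\<^sup>+p. F p \<partial>lb2)" unfolding F1_def by (rule nn_integral_shear_snd) measurable
  finally show ?thesis .
qed

text \<open>Flipping the velocity conjugates one step to its inverse, whatever the force; the
  induction cancels the innermost pair of steps.\<close>

lemma verlet_reversible:
  defines "R \<equiv> \<lambda>p. (fst p, - snd p)"
  shows "R ((verlet_step g \<delta> ^^ n) (R ((verlet_step g \<delta> ^^ n) p))) = p"
proof (induction n arbitrary: p)
  case 0
  then show ?case by (simp add: R_def)
next
  case (Suc n)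
  have one: "R (verlet_step g \<delta> (R (verlet_step g \<delta> q))) = q" for q
  proof -
    obtain x v where q: "q = (x, v)" by (cases q)
    define x' where "x' = x + \<delta> *\<^sub>R v - (\<delta>\<^sup>2 / 2) *\<^sub>R g x"
    define v' where "v' = v - (\<delta> / 2) *\<^sub>R (g x + g x')"
    have 1: "verlet_step g \<delta> q = (x', v')" by (simp add: verlet_step_def Let_def q x'_def v'_def)
    have h: "(\<delta> * \<delta> / 2) *\<^sub>R y + (\<delta> * \<delta> / 2) *\<^sub>R y = (\<delta> * \<delta>) *\<^sub>R y" for y :: 'a by (simp add: scaleR_left_distrib[symmetric])
    have x: "x' + \<delta> *\<^sub>R (- v') - (\<delta>\<^sup>2 / 2) *\<^sub>R g x' = x"
      by (simp add: v'_def x'_def power2_eq_square algebra_simps)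
    have "verlet_step g \<delta> (x', - v') = (x, - v' - (\<delta> / 2) *\<^sub>R (g x' + g x))"
      unfolding verlet_step_def Let_def fst_conv snd_conv x ..
    then have 2: "verlet_step g \<delta> (x', - v') = (x, - v)" by (simp add: v'_def algebra_simps)
    have 3: "R (x', v') = (x', - v')" by (simp add: R_def)
    show ?thesis unfolding 1 3 2 by (simp add: R_def q)
  qed
  have RR: "R (R q) = q" for q by (simp add: R_def)
  have "R ((verlet_step g \<delta> ^^ Suc n) (R ((verlet_step g \<delta> ^^ Suc n) p)))
    = R ((verlet_step g \<delta> ^^ n) (verlet_step g \<delta> (R (verlet_step g \<delta> ((verlet_step g \<delta> ^^ n) p)))))"
    by (simp add: funpow_swap1)
  also have "verlet_step g \<delta> (R (verlet_step g \<delta> ((verlet_step g \<delta> ^^ n) p))) = R ((verlet_step g \<delta> ^^ n) p)"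
    using arg_cong[OF one[of "(verlet_step g \<delta> ^^ n) p"], of R] by (simp only: RR)
  finally show ?case using Suc.IH by simp
qed

section \<open>Phase space density and the energy error of the scheme\<close>

locale gibbs_potential = potential +
  fixes f :: "'a \<Rightarrow> real"
  assumes f_deriv: "\<And>x. (f has_derivative (\<lambda>u. grad x \<bullet> u)) (at x)"
    and f_int: "integrable lborel (\<lambda>x. exp (- f x))"
begin

definition "Z = (\<integral>y. exp (- f y) \<partial>lborel)"

lemma f_continuous: "continuous_on UNIV f"
  using f_deriv by (meson has_derivative_continuous continuous_at_imp_continuous_on)

lemma f_measurable[measurable]: "f \<in> borel_measurable borel"
  by (rule borel_measurable_continuous_onI[OF f_continuous])

lemma grad_measurable[measurable]: "grad \<in> borel_measurable borel"
  by (rule borel_measurable_continuous_onI[OF grad_continuous])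

lemma Z_pos: "0 < Z"
proof -
  have "Z \<noteq> 0"
  proof
    assume "Z = 0"
    then have "AE x in lborel. exp (- f x) = 0" unfolding Z_def using integral_nonneg_eq_0_iff_AE[OF f_int] by simp
    then have "AE x in (lborel :: 'a measure). False" by eventually_elim simp
    then have "(UNIV :: 'a set) \<in> null_sets lborel" by (simp add: AE_iff_null)
    then show False by (simp add: null_sets_def)
  qed
  moreover have "0 \<le> Z" unfolding Z_def by simp
  ultimately show ?thesis by simp
qed

lemma gibbs_eq: "gibbs f = density lborel (\<lambda>x. ennreal (exp (- f x) / Z))"
  by (simp add: gibbs_def Z_def)

lemma sets_gibbs[simp, measurable_cong]: "sets (gibbs f) = sets borel"
  by (simp add: gibbs_def)

lemma prob_space_gibbs: "prob_space (gibbs f)"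
proof
  have "emeasure (gibbs f) (space (gibbs f)) = (\<integral>\<^sup>+x. ennreal (exp (- f x) / Z) \<partial>lborel)"
    by (simp add: gibbs_eq emeasure_density)
  also have "\<dots> = ennreal (\<integral>x. exp (- f x) / Z \<partial>lborel)"
    using f_int Z_pos by (intro nn_integral_eq_integral) auto
  also have "(\<integral>x. exp (- f x) / Z \<partial>lborel) = 1" using Z_pos by (simp add: Z_def[symmetric])
  finally show "emeasure (gibbs f) (space (gibbs f)) = 1" by simp
qed

definition energy :: "'a \<times> 'a \<Rightarrow> real" where "energy p = f (fst p) + (norm (snd p))\<^sup>2 / 2"

definition phase_density :: "'a \<times> 'a \<Rightarrow> real" where "phase_density p = exp (- f (fst p)) / Z * gauss_density (snd p)"

lemma phase_density_nonneg: "0 \<le> phase_density p" using Z_pos by (simp add: phase_density_def)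

lemma phase_density_energy: "phase_density p = (2 * pi) powr (- real DIM('a) / 2) / Z * exp (- energy p)"
  by (simp add: phase_density_def gauss_density_def energy_def exp_add[symmetric])

lemma phase_density_measurable[measurable]: "phase_density \<in> borel_measurable (borel \<Otimes>\<^sub>M borel)"
  unfolding phase_density_def by measurable

lemma joint_density: "gibbs f \<Otimes>\<^sub>M std_gauss = density lb2 (\<lambda>p. ennreal (phase_density p))"
proof -
  interpret G: prob_space "gibbs f" by (rule prob_space_gibbs)
  interpret S: prob_space "std_gauss :: 'a measure" by (rule prob_space_std_gauss)
  have "gibbs f \<Otimes>\<^sub>M std_gauss = density lb2 (\<lambda>(x, v). ennreal (exp (- f x) / Z) * ennreal (gauss_density v))"
    unfolding gibbs_eq std_gauss_eq
    by (rule pair_measure_density) (use S.sigma_finite_measure_axioms in \<open>auto simp: std_gauss_eq intro: lborel.sigma_finite_measure_axioms\<close>)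
  moreover have "(\<lambda>(x, v). ennreal (exp (- f x) / Z) * ennreal (gauss_density v)) = (\<lambda>p. ennreal (phase_density p))"
    using Z_pos by (auto simp: fun_eq_iff phase_density_def ennreal_mult[symmetric])
  ultimately show ?thesis by simp
qed

lemma verlet_measurable: "(\<lambda>p. (verlet_step grad \<delta> ^^ n) p) \<in> measurable (borel \<Otimes>\<^sub>M borel) (borel \<Otimes>\<^sub>M borel)"
  using borel_measurable_continuous_onI[OF vpos_vvel_continuous[where \<delta>=\<delta> and k=n]] by (simp add: borel_prod)

lemma verlet_preserves_volume: "distr lb2 (borel \<Otimes>\<^sub>M borel) (\<lambda>p. (verlet_step grad \<delta> ^^ n) p) = (lb2 :: ('a \<times> 'a) measure)"
proof (rule measure_eqI)
  fix A :: "('a \<times> 'a) set" assume "A \<in> sets (distr lb2 (borel \<Otimes>\<^sub>M borel) (\<lambda>p. (verlet_step grad \<delta> ^^ n) p))"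
  then have A[measurable]: "A \<in> sets (borel \<Otimes>\<^sub>M borel)" by simp
  note [measurable] = verlet_measurable
  have it: "(\<integral>\<^sup>+p. F ((verlet_step grad \<delta> ^^ n) p) \<partial>lb2) = (\<integral>\<^sup>+p. F p \<partial>lb2)" if "F \<in> borel_measurable (borel \<Otimes>\<^sub>M borel)" for F :: "'a \<times> 'a \<Rightarrow> ennreal"
    using that
  proof (induction n arbitrary: F)
    case (Suc n)
    have m1: "verlet_step grad \<delta> \<in> measurable (borel \<Otimes>\<^sub>M borel) (borel \<Otimes>\<^sub>M borel)" using verlet_measurable[where \<delta>=\<delta> and n=1] by simp
    have "(\<integral>\<^sup>+p. F ((verlet_step grad \<delta> ^^ Suc n) p) \<partial>lb2) = (\<integral>\<^sup>+p. F (verlet_step grad \<delta> p) \<partial>lb2)"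
      using Suc.IH[OF measurable_compose[OF m1 Suc.prems]] by simp
    then show ?case using nn_integral_verlet_step[OF Suc.prems grad_measurable] by simp
  qed simp
  have "emeasure (distr lb2 (borel \<Otimes>\<^sub>M borel) (\<lambda>p. (verlet_step grad \<delta> ^^ n) p)) A
     = (\<integral>\<^sup>+p. indicator A p \<partial>distr lb2 (borel \<Otimes>\<^sub>M borel) (\<lambda>p. (verlet_step grad \<delta> ^^ n) p))" by simp
  also have "\<dots> = (\<integral>\<^sup>+p. indicator A ((verlet_step grad \<delta> ^^ n) p) \<partial>lb2)"
    by (rule nn_integral_distr) auto
  also have "\<dots> = (\<integral>\<^sup>+p. indicator A p \<partial>lb2)" by (rule it) auto
  also have "\<dots> = emeasure lb2 A" using A by (simp cong: sets_pair_measure_cong)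
  finally show "emeasure (distr lb2 (borel \<Otimes>\<^sub>M borel) (\<lambda>p. (verlet_step grad \<delta> ^^ n) p)) A = emeasure lb2 A" .
qed simp

lemma f_taylor: "\<bar>f y - f x - grad x \<bullet> (y - x)\<bar> \<le> L * (norm (y - x))\<^sup>2"
proof -
  have "norm ((f y - grad x \<bullet> y) - (f x - grad x \<bullet> x)) \<le> (L * norm (y - x)) * norm (y - x)"
  proof (rule differentiable_bound[of "cball x (norm (y - x))" "\<lambda>z. f z - grad x \<bullet> z" "\<lambda>z u. grad z \<bullet> u - grad x \<bullet> u"])
    show "((\<lambda>z. f z - grad x \<bullet> z) has_derivative (\<lambda>u. grad z \<bullet> u - grad x \<bullet> u)) (at z within cball x (norm (y - x)))" for z
      by (rule has_derivative_at_withinI, intro has_derivative_diff f_deriv has_derivative_inner_right has_derivative_ident)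
    show "onorm (\<lambda>u. grad z \<bullet> u - grad x \<bullet> u) \<le> L * norm (y - x)" if z: "z \<in> cball x (norm (y - x))" for z
    proof (rule onorm_bound)
      show "0 \<le> L * norm (y - x)" using L0 by simp
      fix u
      have "norm (grad z \<bullet> u - grad x \<bullet> u) \<le> norm (grad z - grad x) * norm u"
        unfolding inner_diff_left[symmetric] real_norm_def by (rule Cauchy_Schwarz_ineq2)
      also have "\<dots> \<le> (L * norm (z - x)) * norm u" by (intro mult_right_mono grad_lip) auto
      also have "\<dots> \<le> (L * norm (y - x)) * norm u"
        using z L0 by (intro mult_right_mono mult_left_mono) (simp_all add: dist_norm norm_minus_commute[of x z])
      finally show "norm (grad z \<bullet> u - grad x \<bullet> u) \<le> L * norm (y - x) * norm u" .
    qed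
  qed (simp_all add: dist_norm norm_minus_commute[of x y])
  then show ?thesis by (simp add: power2_eq_square inner_diff_right algebra_simps)
qed

text \<open>The first-order term \<delta> v . \<open>grad x\<close> cancels between potential and
  kinetic energy. An error of order \<delta>^2 per step suffices, as there are T/\<delta>
  steps.\<close>

lemma energy_step:
  assumes d: "0 \<le> \<delta>" and X: "norm x \<le> X" "norm x' \<le> X" and V: "norm v \<le> V"
    and x': "x' = x + \<delta> *\<^sub>R v - (\<delta>\<^sup>2 / 2) *\<^sub>R grad x" and v': "v' = v - (\<delta> / 2) *\<^sub>R (grad x + grad x')"
    and dT: "\<delta> \<le> T"
  shows "\<bar>energy (x', v') - energy (x, v)\<bar> \<le> \<delta>\<^sup>2 * (L * (V + T * (L * X))\<^sup>2 + (L * X)\<^sup>2 + V * (L * (V + T * (L * X))))"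
proof -
  have X0: "0 \<le> X" "0 \<le> V" using X(1) V by (meson norm_ge_zero order.trans)+
  have gx: "norm (grad x) \<le> L * X" "norm (grad x') \<le> L * X" using X grad_bd L0 by (meson mult_left_mono order.trans)+
  define A where "A = V + T * (L * X)"
  have A0: "0 \<le> A" using X0 L0 T by (simp add: A_def)
  have dx: "norm (x' - x) \<le> \<delta> * A"
  proof -
    have "x' - x = \<delta> *\<^sub>R (v - (\<delta> / 2) *\<^sub>R grad x)" by (simp add: x' power2_eq_square algebra_simps)
    then have "norm (x' - x) = \<delta> * norm (v - (\<delta> / 2) *\<^sub>R grad x)" using d by simp
    also have "norm (v - (\<delta> / 2) *\<^sub>R grad x) \<le> norm v + norm ((\<delta> / 2) *\<^sub>R grad x)" by (rule norm_triangle_ineq4)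
    also have "\<dots> \<le> V + T * (L * X)"
      unfolding norm_scaleR using V gx d dT T by (intro add_mono mult_mono) auto
    finally show ?thesis using d unfolding A_def by (simp add: mult_left_mono)
  qed
  have e1: "\<bar>f x' - f x - grad x \<bullet> (x' - x)\<bar> \<le> \<delta>\<^sup>2 * (L * A\<^sup>2)"
  proof -
    have "L * (norm (x' - x))\<^sup>2 \<le> L * (\<delta> * A)\<^sup>2" using dx L0 by (intro mult_left_mono power_mono) auto
    also have "L * (\<delta> * A)\<^sup>2 = \<delta>\<^sup>2 * (L * A\<^sup>2)" by (simp add: power_mult_distrib)
    finally show ?thesis using f_taylor[of x' x] by (rule order.trans[rotated])
  qed
  have gg: "norm (grad x' - grad x) \<le> \<delta> * (L * A)"
    using order.trans[OF grad_lip mult_left_mono[OF dx L0]] by (simp add: mult_ac)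
  have e2: "\<bar>v \<bullet> (grad x' - grad x)\<bar> \<le> V * (\<delta> * (L * A))"
    using order.trans[OF Cauchy_Schwarz_ineq2 mult_mono[OF V gg X0(2) norm_ge_zero]] .
  have e3: "(norm (grad x))\<^sup>2 \<le> (L * X)\<^sup>2" using gx by (intro power_mono) auto
  have vv: "norm (v' - v) \<le> \<delta> * (L * X)"
  proof -
    have "norm (grad x + grad x') \<le> 2 * (L * X)" using norm_triangle_ineq[of "grad x" "grad x'"] gx by simp
    then have "(\<delta> / 2) * norm (grad x + grad x') \<le> (\<delta> / 2) * (2 * (L * X))" using d by (intro mult_left_mono) auto
    then show ?thesis using d by (simp add: v')
  qed
  have e4: "(norm (v' - v))\<^sup>2 \<le> \<delta>\<^sup>2 * (L * X)\<^sup>2" using power_mono[OF vv norm_ge_zero, of 2] by (simp add: power_mult_distrib)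
  have n: "(norm v')\<^sup>2 = (norm v)\<^sup>2 + 2 * (v \<bullet> (v' - v)) + (norm (v' - v))\<^sup>2"
    by (simp add: power2_norm_eq_inner inner_diff_left inner_diff_right inner_commute)
  have i1: "v \<bullet> (v' - v) = - \<delta> * (v \<bullet> grad x) - (\<delta> / 2) * (v \<bullet> (grad x' - grad x))"
    by (simp add: v' inner_diff_right inner_add_right algebra_simps)
  have i2: "grad x \<bullet> (x' - x) = \<delta> * (v \<bullet> grad x) - (\<delta>\<^sup>2 / 2) * (norm (grad x))\<^sup>2"
    by (simp add: x' inner_diff_right inner_add_right power2_norm_eq_inner inner_commute)
  have eq: "energy (x', v') - energy (x, v) = (f x' - f x - grad x \<bullet> (x' - x)) - (\<delta>\<^sup>2 / 2) * (norm (grad x))\<^sup>2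
      - (\<delta> / 2) * (v \<bullet> (grad x' - grad x)) + (norm (v' - v))\<^sup>2 / 2"
    unfolding energy_def fst_conv snd_conv n i1 i2 by (simp add: field_simps)
  have "\<bar>energy (x', v') - energy (x, v)\<bar> \<le> \<bar>f x' - f x - grad x \<bullet> (x' - x)\<bar> + (\<delta>\<^sup>2 / 2) * (norm (grad x))\<^sup>2
      + (\<delta> / 2) * \<bar>v \<bullet> (grad x' - grad x)\<bar> + (norm (v' - v))\<^sup>2 / 2"
  proof -
    have "\<bar>p - q - r + s\<bar> \<le> \<bar>p\<bar> + q + \<bar>r\<bar> + s" if "0 \<le> q" "0 \<le> s" for p q r s :: real using that by arith
    note gen = this[of "(\<delta>\<^sup>2 / 2) * (norm (grad x))\<^sup>2" "(norm (v' - v))\<^sup>2 / 2"]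
    have r: "(\<delta> / 2) * \<bar>v \<bullet> (grad x' - grad x)\<bar> = \<bar>(\<delta> / 2) * (v \<bullet> (grad x' - grad x))\<bar>" using d by (simp add: abs_mult)
    show ?thesis unfolding eq r by (rule gen) auto
  qed
  also have "\<dots> \<le> \<delta>\<^sup>2 * (L * A\<^sup>2) + (\<delta>\<^sup>2 / 2) * (L * X)\<^sup>2 + (\<delta> / 2) * (V * (\<delta> * (L * A))) + (\<delta>\<^sup>2 * (L * X)\<^sup>2) / 2"
    by (intro add_mono e1 mult_left_mono e3 e2 divide_right_mono e4) (use d in auto)
  also have "\<dots> = \<delta>\<^sup>2 * (L * A\<^sup>2 + (L * X)\<^sup>2 + (V * (L * A)) / 2)"
    by (simp add: power2_eq_square field_simps)
  also have "\<dots> \<le> \<delta>\<^sup>2 * (L * A\<^sup>2 + (L * X)\<^sup>2 + V * (L * A))"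
    using X0 L0 A0 by (intro mult_left_mono add_left_mono) auto
  finally show ?thesis unfolding A_def .
qed

text \<open>The constant may depend on the starting point, because only pointwise convergence of the
  energy is used later. Velocities stay bounded since k \<delta> + \<delta> \<le> 3T.\<close>

lemma energy_error:
  "\<exists>C. \<forall>\<delta> n. 0 \<le> \<delta> \<longrightarrow> \<delta> \<le> T \<longrightarrow> real n * \<delta> = T \<longrightarrow> \<bar>energy ((verlet_step grad \<delta> ^^ n) (x, v)) - energy (x, v)\<bar> \<le> C * \<delta>"
proof -
  define X where "X = 11/10 * (norm x + T * norm v)"
  define V where "V = norm v + 3 * T * (L * X)"
  define E where "E = L * (V + T * (L * X))\<^sup>2 + (L * X)\<^sup>2 + V * (L * (V + T * (L * X)))"
  have X0: "0 \<le> X" using T by (simp add: X_def)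
  have "\<bar>energy ((verlet_step grad \<delta> ^^ n) (x, v)) - energy (x, v)\<bar> \<le> (T * E) * \<delta>"
    if d: "0 \<le> \<delta>" "\<delta> \<le> T" "real n * \<delta> = T" for \<delta> n
  proof -
    have xb: "norm (vpos grad \<delta> k x v) \<le> X" if "k \<le> n" for k
      using vform_bound[OF vform_vpos[where g=grad and \<delta>=\<delta> and x=x and v=v], where L=L and \<rho>=0 and T=T and k=k and n=n] grad_bd d L0 LT that by (simp add: X_def)
    have gb: "norm (grad (vpos grad \<delta> k x v)) \<le> L * X" if "k \<le> n" for k
      using order.trans[OF grad_bd mult_left_mono[OF xb[OF that] L0]] .
    have vb: "norm (vvel grad \<delta> k x v) \<le> V" if k: "k \<le> n" for k
    proof -
      have "vvel grad \<delta> k x v = v - \<delta> *\<^sub>R trap1 (\<lambda>i. grad (vpos grad \<delta> i x v)) (Suc k) + (\<delta> / 2) *\<^sub>R grad (vpos grad \<delta> k x v)"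
        using vpos_trap2[of grad \<delta> k x v] by (simp add: algebra_simps)
      then have "norm (vvel grad \<delta> k x v) \<le> norm v + norm (\<delta> *\<^sub>R trap1 (\<lambda>i. grad (vpos grad \<delta> i x v)) (Suc k)) + norm ((\<delta> / 2) *\<^sub>R grad (vpos grad \<delta> k x v))"
        by (simp only:) (rule order.trans[OF norm_triangle_ineq add_right_mono[OF norm_triangle_ineq4]])
      also have "\<dots> \<le> norm v + \<delta> * ((real k + 1/2) * (L * X)) + (\<delta> / 2) * (L * X)"
        unfolding norm_scaleR using d gb k by (intro add_mono order.refl mult_mono norm_trap1_le) auto
      also have "\<dots> = norm v + (real k * \<delta> + \<delta>) * (L * X)" by (simp add: field_simps)
      also have "\<dots> \<le> norm v + (3 * T) * (L * X)"
      proof (intro add_left_mono mult_right_mono)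
        have "real k * \<delta> \<le> real n * \<delta>" using k d by (intro mult_right_mono) auto
        then show "real k * \<delta> + \<delta> \<le> 3 * T" using d T by linarith
      qed (use L0 X0 in simp)
      finally show ?thesis by (simp add: V_def)
    qed
    have "\<bar>energy ((verlet_step grad \<delta> ^^ k) (x, v)) - energy (x, v)\<bar> \<le> real k * (\<delta>\<^sup>2 * E)" if "k \<le> n" for k
      using that
    proof (induction k)
      case (Suc k)
      have p: "(verlet_step grad \<delta> ^^ j) (x, v) = (vpos grad \<delta> j x v, vvel grad \<delta> j x v)" for j by (simp add: vpos_def vvel_def)
      have "\<bar>energy (vpos grad \<delta> (Suc k) x v, vvel grad \<delta> (Suc k) x v) - energy (vpos grad \<delta> k x v, vvel grad \<delta> k x v)\<bar> \<le> \<delta>\<^sup>2 * E"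
        unfolding E_def by (rule energy_step[OF d(1) xb xb vb vpos_Suc vvel_Suc d(2)]) (use Suc.prems in auto)
      then have 1: "\<bar>energy ((verlet_step grad \<delta> ^^ Suc k) (x, v)) - energy ((verlet_step grad \<delta> ^^ k) (x, v))\<bar> \<le> \<delta>\<^sup>2 * E" unfolding p .
      have 2: "\<bar>energy ((verlet_step grad \<delta> ^^ k) (x, v)) - energy (x, v)\<bar> \<le> real k * (\<delta>\<^sup>2 * E)" using Suc by simp
      have "\<bar>energy ((verlet_step grad \<delta> ^^ Suc k) (x, v)) - energy (x, v)\<bar> \<le> \<delta>\<^sup>2 * E + real k * (\<delta>\<^sup>2 * E)"
        using abs_triangle_ineq[of "energy ((verlet_step grad \<delta> ^^ Suc k) (x, v)) - energy ((verlet_step grad \<delta> ^^ k) (x, v))" "energy ((verlet_step grad \<delta> ^^ k) (x, v)) - energy (x, v)"] 1 2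
        by (simp del: funpow.simps)
      then show ?case by (simp del: funpow.simps add: algebra_simps)
    qed simp
    from this[of n] show ?thesis unfolding d(3)[symmetric] by (simp add: power2_eq_square mult_ac)
  qed
  then show ?thesis by blast
qed

text \<open>The image of the phase space law has as density the original one composed with the
  inverse Verlet map. The vanishing energy error makes it converge pointwise, and as the total mass
  is preserved, Scheffe's lemma upgrades this to convergence in L1.\<close>

lemma gibbs_verlet_limit:
  fixes \<psi> :: "'a \<Rightarrow> real"
  assumes d: "\<And>m. 0 \<le> \<delta> m" "\<And>m. \<delta> m \<le> T" "\<And>m. real (n m) * \<delta> m = T" and lim: "\<delta> \<longlonglongrightarrow> 0"
    and psi[measurable]: "\<psi> \<in> borel_measurable borel" and bd: "\<And>x. \<bar>\<psi> x\<bar> \<le> B"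
  shows "(\<lambda>m. \<integral>x. \<psi> x \<partial>distr (gibbs f \<Otimes>\<^sub>M std_gauss) borel (\<lambda>p. vpos grad (\<delta> m) (n m) (fst p) (snd p))) \<longlonglongrightarrow> (\<integral>x. \<psi> x \<partial>gibbs f)"
proof -
  interpret G: prob_space "gibbs f" by (rule prob_space_gibbs)
  interpret S: prob_space "std_gauss :: 'a measure" by (rule prob_space_std_gauss)
  interpret GS: pair_prob_space "gibbs f" "std_gauss :: 'a measure" ..
  define R :: "'a \<times> 'a \<Rightarrow> 'a \<times> 'a" where "R p = (fst p, - snd p)" for p
  define Ps where "Ps m p = (verlet_step grad (\<delta> m) ^^ n m) p" for m p
  have [measurable]: "Ps m \<in> measurable (borel \<Otimes>\<^sub>M borel) (borel \<Otimes>\<^sub>M borel)" for m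
    unfolding Ps_def by (rule verlet_measurable)
  have [measurable]: "R \<in> measurable (borel \<Otimes>\<^sub>M borel) (borel \<Otimes>\<^sub>M borel)" unfolding R_def by measurable
  have vol: "distr lb2 (borel \<Otimes>\<^sub>M borel) (Ps m) = lb2" for m unfolding Ps_def by (rule verlet_preserves_volume)
  have DnR: "phase_density (R p) = phase_density p" for p by (simp add: phase_density_def R_def gauss_density_def)
  have PsR: "R (Ps m (R (Ps m p))) = p" for m p unfolding Ps_def R_def by (rule verlet_reversible)
  \<comment> \<open>Reversibility exhibits the inverse of \<open>Ps m\<close> as \<open>Ps m\<close>
    conjugated by R, and the outer R may be dropped because the density is even in the
    velocity.\<close>
  define DD where "DD m p = phase_density (Ps m (R p))" for m p
  have [measurable]: "DD m \<in> borel_measurable (borel \<Otimes>\<^sub>M borel)" for m unfolding DD_def by measurable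
  have DDP: "DD m (Ps m p) = phase_density p" for m p unfolding DD_def using DnR[of "Ps m (R (Ps m p))"] by (simp add: PsR)
  have Di: "integrable lb2 phase_density"
  proof (rule integrableI_nonneg)
    have "(\<integral>\<^sup>+p. ennreal (phase_density p) \<partial>lb2) = emeasure (gibbs f \<Otimes>\<^sub>M (std_gauss :: 'a measure)) UNIV"
    proof -
      have "UNIV \<in> sets (borel \<Otimes>\<^sub>M borel :: ('a \<times> 'a) measure)"
        using sets.top[of "borel \<Otimes>\<^sub>M borel :: ('a \<times> 'a) measure"] by (simp add: space_pair_measure)
      then show ?thesis unfolding joint_density by (subst emeasure_density) auto
    qed
    also have "\<dots> \<le> 1" by (rule GS.emeasure_le_1)
    finally show "(\<integral>\<^sup>+p. ennreal (phase_density p) \<partial>lb2) < \<infinity>" by (simp add: order.strict_trans1)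
  qed (auto simp: phase_density_nonneg)
  have nnD: "(\<integral>\<^sup>+p. norm (DD m p) \<partial>lb2) = (\<integral>\<^sup>+p. norm (phase_density p) \<partial>lb2)" for m
  proof -
    have "(\<integral>\<^sup>+p. norm (DD m p) \<partial>distr lb2 (borel \<Otimes>\<^sub>M borel) (Ps m)) = (\<integral>\<^sup>+p. norm (DD m (Ps m p)) \<partial>lb2)"
      by (rule nn_integral_distr) measurable
    then show ?thesis by (simp add: vol DDP)
  qed
  have DDi: "integrable lb2 (DD m)" for m
    using Di nnD[of m] by (simp add: integrable_iff_bounded)
  have expr: "(\<integral>x. \<psi> x \<partial>distr (gibbs f \<Otimes>\<^sub>M std_gauss) borel (\<lambda>p. vpos grad (\<delta> m) (n m) (fst p) (snd p))) = (\<integral>p. DD m p * \<psi> (fst p) \<partial>lb2)" for m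
  proof -
    note [measurable] = vpos_measurable_pair
    have "(\<integral>x. \<psi> x \<partial>distr (gibbs f \<Otimes>\<^sub>M std_gauss) borel (\<lambda>p. vpos grad (\<delta> m) (n m) (fst p) (snd p)))
      = (\<integral>p. \<psi> (vpos grad (\<delta> m) (n m) (fst p) (snd p)) \<partial>(gibbs f \<Otimes>\<^sub>M std_gauss))"
      by (rule integral_distr) measurable
    also have "\<dots> = (\<integral>p. \<psi> (fst (Ps m p)) \<partial>(gibbs f \<Otimes>\<^sub>M std_gauss))" by (simp add: vpos_def Ps_def)
    also have "\<dots> = (\<integral>p. phase_density p * \<psi> (fst (Ps m p)) \<partial>lb2)"
      unfolding joint_density by (subst integral_density) (auto simp: phase_density_nonneg)
    also have "\<dots> = (\<integral>p. DD m (Ps m p) * \<psi> (fst (Ps m p)) \<partial>lb2)" unfolding DDP ..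
    also have "\<dots> = (\<integral>p. DD m p * \<psi> (fst p) \<partial>distr lb2 (borel \<Otimes>\<^sub>M borel) (Ps m))"
      by (rule integral_distr[symmetric]) measurable
    finally show ?thesis unfolding vol .
  qed
  have target: "(\<integral>x. \<psi> x \<partial>gibbs f) = (\<integral>p. phase_density p * \<psi> (fst p) \<partial>lb2)"
  proof -
    have i: "integrable (gibbs f \<Otimes>\<^sub>M (std_gauss :: 'a measure)) (\<lambda>p. \<psi> (fst p))"
      by (rule GS.integrable_bounded[where K=B]) (use bd in auto)
    have "(\<integral>p. \<psi> (fst p) \<partial>(gibbs f \<Otimes>\<^sub>M (std_gauss :: 'a measure))) = (\<integral>x. \<integral>v. \<psi> (fst (x, v)) \<partial>(std_gauss :: 'a measure) \<partial>gibbs f)"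
      by (rule GS.integral_fst'[OF i, symmetric])
    also have "\<dots> = (\<integral>x. \<psi> x \<partial>gibbs f)" using S.prob_space by simp
    finally have "(\<integral>x. \<psi> x \<partial>gibbs f) = (\<integral>p. \<psi> (fst p) \<partial>(gibbs f \<Otimes>\<^sub>M (std_gauss :: 'a measure)))" by simp
    also have "\<dots> = (\<integral>p. phase_density p * \<psi> (fst p) \<partial>lb2)"
      unfolding joint_density by (subst integral_density) (auto simp: phase_density_nonneg)
    finally show ?thesis .
  qed
  have ptw: "(\<lambda>m. DD m p) \<longlonglongrightarrow> phase_density p" for p
  proof -
    obtain x v where p: "R p = (x, v)" by (cases "R p")
    obtain C where C: "\<And>\<delta> n. 0 \<le> \<delta> \<Longrightarrow> \<delta> \<le> T \<Longrightarrow> real n * \<delta> = T \<Longrightarrow> \<bar>energy ((verlet_step grad \<delta> ^^ n) (x, v)) - energy (x, v)\<bar> \<le> C * \<delta>"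
      using energy_error[of x v] by blast
    have "(\<lambda>m. C * \<delta> m) \<longlonglongrightarrow> 0" using tendsto_mult_right_zero[OF lim] .
    then have "(\<lambda>m. energy (Ps m (R p)) - energy (R p)) \<longlonglongrightarrow> 0"
      by (rule Lim_null_comparison[rotated]) (use C d in \<open>auto simp: p Ps_def\<close>)
    then have "(\<lambda>m. energy (Ps m (R p))) \<longlonglongrightarrow> energy (R p)" by (rule LIM_zero_cancel)
    then have "(\<lambda>m. phase_density (Ps m (R p))) \<longlonglongrightarrow> phase_density (R p)"
      unfolding phase_density_energy by (intro tendsto_mult tendsto_const tendsto_exp tendsto_minus)
    then show ?thesis unfolding DD_def DnR .
  qed
  have Sch: "(\<lambda>m. \<integral>\<^sup>+ p. norm (DD m p - phase_density p) \<partial>lb2) \<longlonglongrightarrow> 0"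
    by (rule Scheffe_lemma2) (use Di ptw nnD in auto)
  have B0: "0 \<le> B" using bd[of 0] by linarith
  have "(\<lambda>m. (\<integral>p. DD m p * \<psi> (fst p) \<partial>lb2) - (\<integral>p. phase_density p * \<psi> (fst p) \<partial>lb2)) \<longlonglongrightarrow> 0"
  proof (rule Lim_null_comparison)
    have ip: "integrable lb2 (\<lambda>p. F p * \<psi> (fst p))" if F: "integrable lb2 F" for F :: "'a \<times> 'a \<Rightarrow> real"
    proof (rule Bochner_Integration.integrable_bound[OF integrable_mult_right[OF F, of B]])
      show "(\<lambda>p. F p * \<psi> (fst p)) \<in> borel_measurable lb2" using F by measurable
      show "AE p in lb2. norm (F p * \<psi> (fst p)) \<le> norm (B * F p)"
        using bd B0 by (intro AE_I2) (simp add: abs_mult mult.commute[of B] mult_left_mono)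
    qed
    show "\<forall>\<^sub>F m in sequentially. norm ((\<integral>p. DD m p * \<psi> (fst p) \<partial>lb2) - (\<integral>p. phase_density p * \<psi> (fst p) \<partial>lb2)) \<le> B * enn2real (\<integral>\<^sup>+ p. norm (DD m p - phase_density p) \<partial>lb2)"
    proof (rule always_eventually, rule allI)
      fix m
      have i: "integrable lb2 (\<lambda>p. DD m p - phase_density p)" using DDi Di by simp
      have "(\<integral>p. DD m p * \<psi> (fst p) \<partial>lb2) - (\<integral>p. phase_density p * \<psi> (fst p) \<partial>lb2) = (\<integral>p. (DD m p - phase_density p) * \<psi> (fst p) \<partial>lb2)"
        using ip[OF DDi] ip[OF Di] by (simp add: left_diff_distrib)
      also have "norm \<dots> \<le> (\<integral>p. norm ((DD m p - phase_density p) * \<psi> (fst p)) \<partial>lb2)" by (rule integral_norm_bound)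
      also have "\<dots> \<le> (\<integral>p. B * norm (DD m p - phase_density p) \<partial>lb2)"
      proof (rule integral_mono)
        show "integrable lb2 (\<lambda>p. norm ((DD m p - phase_density p) * \<psi> (fst p)))" by (rule integrable_norm[OF ip[OF i]])
        show "integrable lb2 (\<lambda>p. B * norm (DD m p - phase_density p))" using i by simp
        show "norm ((DD m p - phase_density p) * \<psi> (fst p)) \<le> B * norm (DD m p - phase_density p)" for p
          using bd by (simp add: abs_mult mult.commute[of B] mult_left_mono)
      qed
      also have "\<dots> = B * (\<integral>p. norm (DD m p - phase_density p) \<partial>lb2)" by simp
      also have "(\<integral>p. norm (DD m p - phase_density p) \<partial>lb2) = enn2real (\<integral>\<^sup>+ p. norm (DD m p - phase_density p) \<partial>lb2)"
        by (rule integral_eq_nn_integral) (use i in auto)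
      finally show "norm ((\<integral>p. DD m p * \<psi> (fst p) \<partial>lb2) - (\<integral>p. phase_density p * \<psi> (fst p) \<partial>lb2)) \<le> B * enn2real (\<integral>\<^sup>+ p. norm (DD m p - phase_density p) \<partial>lb2)" .
    qed
    have "(\<lambda>m. enn2real (\<integral>\<^sup>+ p. norm (DD m p - phase_density p) \<partial>lb2)) \<longlonglongrightarrow> enn2real 0"
      using Sch by (intro tendsto_enn2real) auto
    then show "(\<lambda>m. B * enn2real (\<integral>\<^sup>+ p. norm (DD m p - phase_density p) \<partial>lb2)) \<longlonglongrightarrow> 0"
      by (intro tendsto_mult_right_zero) simp
  qed
  then show ?thesis unfolding expr target by (rule LIM_zero_cancel)
qed

end

section \<open>Convergence of the Verlet scheme to the Hamiltonian flow\<close>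

lemma vector_mean_value_bound:
  fixes f :: "real \<Rightarrow> 'b::real_normed_vector"
  assumes "convex S" and der: "\<And>t. t \<in> S \<Longrightarrow> (f has_vector_derivative f' t) (at t within S)"
    and bd: "\<And>t. t \<in> S \<Longrightarrow> norm (f' t) \<le> B" and "a \<in> S" "b \<in> S"
  shows "norm (f b - f a) \<le> B * \<bar>b - a\<bar>"
proof -
  have "norm (f b - f a) \<le> B * norm (b - a)"
  proof (rule differentiable_bound[where f'="\<lambda>t h. h *\<^sub>R f' t"])
    show "(f has_derivative (\<lambda>h. h *\<^sub>R f' t)) (at t within S)" if "t \<in> S" for t
      using der[OF that] by (simp add: has_vector_derivative_def)
    show "onorm (\<lambda>h. h *\<^sub>R f' t) \<le> B" if "t \<in> S" for t
      by (rule onorm_bound) (use bd[OF that] order.trans[OF norm_ge_zero bd[OF that]] in \<open>auto simp: mult.commute[of B] mult_left_mono\<close>)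
  qed fact+
  then show ?thesis by simp
qed

lemma integral_exp_le:
  fixes l :: real
  assumes "0 < l" "0 \<le> t"
  shows "integral {0..t} (\<lambda>s. exp (l * s)) \<le> exp (l * t) / l" "(\<lambda>s. exp (l * s)) integrable_on {0..t}"
proof -
  have "((\<lambda>s. exp (l * s)) has_integral (exp (l * t) / l - exp (l * 0) / l)) {0..t}"
    by (rule fundamental_theorem_of_calculus[OF assms(2)])
      (use assms in \<open>auto intro!: derivative_eq_intros simp: has_real_derivative_iff_has_vector_derivative[symmetric]\<close>)
  then show "integral {0..t} (\<lambda>s. exp (l * s)) \<le> exp (l * t) / l" "(\<lambda>s. exp (l * s)) integrable_on {0..t}"
    using assms by (auto simp: integral_unique has_integral_integrable)
qed

text \<open>In the norm weighted by e^(-lt) with l = 2K the Picard operator is a 1/2-contraction on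
  the whole half line, so no continuation of local solutions is required. The fixed point u is the
  rescaled, hence bounded, solution.\<close>

lemma picard_forward:
  fixes F :: "'b::euclidean_space \<Rightarrow> 'b"
  assumes K: "0 < K" and lip: "\<And>y z. norm (F y - F z) \<le> K * norm (y - z)"
  shows "\<exists>z. z 0 = z0 \<and> (\<forall>t\<ge>0. (z has_vector_derivative F (z t)) (at t within {0..}))"
proof -
  define l where "l = 2 * K"
  have l: "0 < l" using K by (simp add: l_def)
  have cF: "continuous_on S F" for S
  proof (rule continuous_on_subset[OF _ subset_UNIV], unfold continuous_on_iff, intro ballI allI impI)
    fix x and e :: real assume "e > 0"
    then show "\<exists>d>0. \<forall>x'\<in>UNIV. dist x' x < d \<longrightarrow> dist (F x') (F x) < e"
    proof (intro exI[of _ "e / K"] conjI ballI impI)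
      show "0 < e / K" using \<open>e > 0\<close> K by simp
      fix x' assume "dist x' x < e / K"
      then have "K * norm (x' - x) < e" using K by (simp add: dist_norm pos_less_divide_eq mult.commute)
      then show "dist (F x') (F x) < e" unfolding dist_norm by (rule le_less_trans[OF lip])
    qed
  qed
  have Fb: "norm (F y) \<le> norm (F 0) + K * norm y" for y
    using lip[of y 0] norm_triangle_ineq[of "F y - F 0" "F 0"] by simp
  define g where "g u s = F (exp (l * s) *\<^sub>R apply_bcontfun u s)" for u :: "real \<Rightarrow>\<^sub>C 'b" and s
  have cg: "continuous_on S (g u)" for S u
    unfolding g_def by (intro continuous_on_compose2[OF cF[of UNIV]] continuous_intros) auto
  have gi: "g u integrable_on {0..t}" for u t by (rule integrable_continuous_interval[OF cg])
  \<comment> \<open>The absolute value extends the operator to the whole line, the domain of the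
    bounded continuous functions used; the solution is read off for t \<ge> 0.\<close>
  define h where "h u t = exp (- l * \<bar>t\<bar>) *\<^sub>R (z0 + integral {0..\<bar>t\<bar>} (g u))" for u t
  have ci: "continuous_on UNIV (\<lambda>t. integral {0..\<bar>t\<bar>} (g u))" for u
  proof -
    have "isCont (\<lambda>t. integral {0..\<bar>t\<bar>} (g u)) t" for t
    proof -
      have "continuous_on {- \<bar>t\<bar> - 1<..<\<bar>t\<bar> + 1} (\<lambda>t. integral {0..\<bar>t\<bar>} (g u))"
        by (rule continuous_on_compose2[OF indefinite_integral_continuous_1[OF gi[of u "\<bar>t\<bar> + 1"]]]) (auto intro!: continuous_intros)
      then show ?thesis by (rule continuous_on_interior) (auto simp: abs_if)
    qed
    then show ?thesis by (simp add: continuous_at_imp_continuous_on)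
  qed
  have int_le: "exp (- l * t) * integral {0..t} (\<lambda>s. C * exp (l * s)) \<le> C / l" if "0 \<le> t" "0 \<le> C" for t C
  proof -
    have "exp (- l * t) * integral {0..t} (\<lambda>s. C * exp (l * s)) \<le> exp (- l * t) * (C * (exp (l * t) / l))"
    proof (intro mult_left_mono)
      have "integral {0..t} (\<lambda>s. C * exp (l * s)) = C * integral {0..t} (\<lambda>s. exp (l * s))" by simp
      also have "\<dots> \<le> C * (exp (l * t) / l)" by (rule mult_left_mono[OF integral_exp_le(1)[OF l that(1)] that(2)])
      finally show "integral {0..t} (\<lambda>s. C * exp (l * s)) \<le> C * (exp (l * t) / l)" .
    qed simp
    also have "\<dots> = C / l" by (simp add: exp_minus field_simps)
    finally show ?thesis .
  qed
  have hb: "h u \<in> bcontfun" for u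
  proof -
    obtain B where B: "\<And>s. norm (apply_bcontfun u s) \<le> B" "0 \<le> B"
    proof -
      obtain B where "\<forall>y\<in>range (apply_bcontfun u). norm y \<le> B" using bounded_apply_bcontfun[of u] unfolding bounded_iff by blast
      then have "\<And>s. norm (apply_bcontfun u s) \<le> B" by blast
      then show ?thesis using that order.trans[OF norm_ge_zero] by blast
    qed
    have bound: "norm (h u t) \<le> norm z0 + (norm (F 0) + K * B) / l" for t
    proof -
    have "norm (integral {0..\<bar>t\<bar>} (g u)) \<le> integral {0..\<bar>t\<bar>} (\<lambda>s. (norm (F 0) + K * B) * exp (l * s))"
    proof (rule integral_norm_bound_integral[OF gi])
      show "(\<lambda>s. (norm (F 0) + K * B) * exp (l * s)) integrable_on {0..\<bar>t\<bar>}"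
        by (intro integrable_continuous_interval continuous_intros)
      fix s assume s: "s \<in> {0..\<bar>t\<bar>}"
      have "norm (g u s) \<le> norm (F 0) + K * (exp (l * s) * B)"
      proof -
        have "K * (exp (l * s) * norm (apply_bcontfun u s)) \<le> K * (exp (l * s) * B)" using B K by (intro mult_left_mono) auto
        then show ?thesis unfolding g_def using Fb[of "exp (l * s) *\<^sub>R apply_bcontfun u s"] by simp
      qed
      also have "\<dots> \<le> norm (F 0) * exp (l * s) + K * (exp (l * s) * B)"
        using s l by (intro add_right_mono) (simp add: mult_le_cancel_left1)
      finally show "norm (g u s) \<le> (norm (F 0) + K * B) * exp (l * s)" by (simp add: algebra_simps)
    qed
    then have "exp (- l * \<bar>t\<bar>) * norm (integral {0..\<bar>t\<bar>} (g u)) \<le> (norm (F 0) + K * B) / l"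
    proof -
      assume a: "norm (integral {0..\<bar>t\<bar>} (g u)) \<le> integral {0..\<bar>t\<bar>} (\<lambda>s. (norm (F 0) + K * B) * exp (l * s))"
      have "0 \<le> norm (F 0) + K * B" using B(2) K by simp
      then show ?thesis
        using mult_left_mono[OF a, of "exp (- l * \<bar>t\<bar>)"] int_le[of "\<bar>t\<bar>" "norm (F 0) + K * B"]
        by (meson abs_ge_zero exp_ge_zero order.trans)
    qed
    moreover have "exp (- l * \<bar>t\<bar>) * norm z0 \<le> 1 * norm z0" using l by (intro mult_right_mono) auto
    ultimately show ?thesis
      unfolding h_def norm_scaleR using mult_left_mono[OF norm_triangle_ineq[of z0 "integral {0..\<bar>t\<bar>} (g u)"], of "exp (- l * \<bar>t\<bar>)"]
      by (simp add: distrib_left)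
    qed
    have "continuous_on UNIV (h u)" unfolding h_def by (intro continuous_intros ci)
    then show ?thesis using bound by (rule bcontfun_normI)
  qed
  define Gm where "Gm u = Bcontfun (h u)" for u
  have ap: "apply_bcontfun (Gm u) = h u" for u unfolding Gm_def using hb by (simp add: Bcontfun_inverse)
  have "\<exists>!u. Gm u = u"
  proof (rule banach_fix_type[where c="1/2"])
    show "\<forall>u w. dist (Gm u) (Gm w) \<le> 1/2 * dist u w"
    proof (rule allI, rule allI, rule dist_bound)
      fix u w and t :: real
      have "norm (integral {0..\<bar>t\<bar>} (g u) - integral {0..\<bar>t\<bar>} (g w)) = norm (integral {0..\<bar>t\<bar>} (\<lambda>s. g u s - g w s))"
        by (simp add: integral_diff[OF gi gi])
      also have "\<dots> \<le> integral {0..\<bar>t\<bar>} (\<lambda>s. (K * dist u w) * exp (l * s))"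
      proof (rule integral_norm_bound_integral)
        show "(\<lambda>s. g u s - g w s) integrable_on {0..\<bar>t\<bar>}" by (intro integrable_diff gi)
        show "(\<lambda>s. (K * dist u w) * exp (l * s)) integrable_on {0..\<bar>t\<bar>}"
          by (intro integrable_continuous_interval continuous_intros)
        fix s
        have "norm (g u s - g w s) \<le> K * norm (exp (l * s) *\<^sub>R (apply_bcontfun u s - apply_bcontfun w s))"
          unfolding g_def using lip[of "exp (l * s) *\<^sub>R apply_bcontfun u s" "exp (l * s) *\<^sub>R apply_bcontfun w s"] by (simp add: scaleR_diff_right)
        also have "\<dots> \<le> K * (exp (l * s) * dist u w)"
          using dist_bounded[of u s w] K by (intro mult_left_mono) (auto simp: dist_norm)
        finally show "norm (g u s - g w s) \<le> (K * dist u w) * exp (l * s)" by (simp add: mult_ac)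
      qed
      finally have a: "norm (integral {0..\<bar>t\<bar>} (g u) - integral {0..\<bar>t\<bar>} (g w)) \<le> integral {0..\<bar>t\<bar>} (\<lambda>s. (K * dist u w) * exp (l * s))" .
      have "0 \<le> K * dist u w" using K by simp
      then have "exp (- l * \<bar>t\<bar>) * norm (integral {0..\<bar>t\<bar>} (g u) - integral {0..\<bar>t\<bar>} (g w)) \<le> (K * dist u w) / l"
        using mult_left_mono[OF a, of "exp (- l * \<bar>t\<bar>)"] int_le[of "\<bar>t\<bar>" "K * dist u w"]
        by (meson abs_ge_zero exp_ge_zero order.trans)
      moreover have "dist (h u t) (h w t) = exp (- l * \<bar>t\<bar>) * norm (integral {0..\<bar>t\<bar>} (g u) - integral {0..\<bar>t\<bar>} (g w))"
        unfolding h_def dist_norm scaleR_diff_right[symmetric] by simp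
      ultimately show "dist (apply_bcontfun (Gm u) t) (apply_bcontfun (Gm w) t) \<le> 1/2 * dist u w"
        using K by (simp add: ap l_def)
    qed
  qed auto
  then obtain u where u: "Gm u = u" by blast
  define z where "z t = z0 + integral {0..t} (g u)" for t
  have zu: "exp (l * t) *\<^sub>R apply_bcontfun u t = z t" if "0 \<le> t" for t
  proof -
    have "apply_bcontfun u t = h u t" using ap[of u] u by simp
    then show ?thesis using that by (simp add: h_def z_def exp_minus)
  qed
  have "(z has_vector_derivative F (z t)) (at t within {0..})" if t: "0 \<le> t" for t
  proof -
    have "((\<lambda>t. integral {0..t} (g u)) has_vector_derivative g u t) (at t within {0..t+1})"
      by (rule integral_has_vector_derivative[OF cg]) (use t in auto)
    from has_vector_derivative_add[OF has_vector_derivative_const this, of z0]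
    have "(z has_vector_derivative g u t) (at t within {0..t+1})"
      unfolding z_def by simp
    moreover have "at t within {0..t+1} = at t within {0..}"
      by (rule at_within_nhd[of _ "{t-1<..<t+1}"]) auto
    ultimately show ?thesis using zu[OF t] by (simp add: g_def)
  qed
  then show ?thesis by (intro exI[of _ z]) (auto simp: z_def)
qed

text \<open>Backward in time the equation is the forward one for -F; at 0 the two halves agree in
  value and in one-sided derivative.\<close>

lemma picard_global:
  fixes F :: "'b::euclidean_space \<Rightarrow> 'b"
  assumes K: "0 < K" and lip: "\<And>y z. norm (F y - F z) \<le> K * norm (y - z)"
  shows "\<exists>z. z 0 = z0 \<and> (\<forall>t. (z has_vector_derivative F (z t)) (at t))"
proof -
  obtain p where p: "p 0 = z0" "\<And>t. t \<ge> 0 \<Longrightarrow> (p has_vector_derivative F (p t)) (at t within {0..})"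
    using picard_forward[OF K lip, of z0] by blast
  have lip': "norm (- F y - - F z) \<le> K * norm (y - z)" for y z
    using lip[of y z] norm_minus_commute[of "F y" "F z"] by simp
  obtain q where q: "q 0 = z0" "\<And>t. t \<ge> 0 \<Longrightarrow> (q has_vector_derivative - F (q t)) (at t within {0..})"
    using picard_forward[OF K lip', of z0] by blast
  define z where "z t = (if 0 \<le> t then p t else q (- t))" for t
  have neg: "((\<lambda>t. q (- t)) has_vector_derivative F (q (- t))) (at t within {..0})" if t: "t \<le> 0" for t
  proof -
    have "((q \<circ> uminus) has_vector_derivative (- 1) *\<^sub>R (- F (q (- t)))) (at t within {..0})"
    proof (rule vector_diff_chain_within)
      show "(uminus has_vector_derivative - 1) (at t within {..0})" by (auto intro!: derivative_eq_intros)
      show "(q has_vector_derivative - F (q (- t))) (at (- t) within uminus ` {..0})"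
        by (rule has_vector_derivative_within_subset[OF q(2)]) (use t in auto)
    qed
    then show ?thesis by (simp add: o_def)
  qed
  have zr: "(z has_vector_derivative F (z t)) (at t within {0..})" if "0 \<le> t" for t
    using has_vector_derivative_transform[of t "{0..}" z p "F (p t)"] p(2)[OF that] that by (simp add: z_def)
  have zl: "(z has_vector_derivative F (z t)) (at t within {..0})" if "t \<le> 0" for t
  proof -
    have e: "z s = q (- s)" if "s \<le> 0" for s using that p(1) q(1) by (auto simp: z_def)
    have "(z has_vector_derivative F (q (- t))) (at t within {..0})"
      using has_vector_derivative_transform[of t "{..0}" z "\<lambda>s. q (- s)" "F (q (- t))"] neg[OF that] that e by simp
    then show ?thesis using e[OF that] by simp
  qed
  have "(z has_vector_derivative F (z t)) (at t)" for t
  proof -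
    consider "t > 0" | "t < 0" | "t = 0" by linarith
    then show ?thesis
    proof cases
      case 1
      then have "at t within {0..} = at t" by (intro at_within_interior) auto
      then show ?thesis using zr[of t] 1 by simp
    next
      case 2
      then have "at t within {..0} = at t" by (intro at_within_interior) auto
      then show ?thesis using zl[of t] 2 by simp
    next
      case 3
      have "(z has_vector_derivative F (z t)) (at t within {0..} \<union> {..0})"
        using zr[of t] zl[of t] 3
        unfolding has_vector_derivative_def has_derivative_iff_norm by (auto intro: Lim_Un)
      moreover have "{0..} \<union> {..0} = (UNIV :: real set)" by auto
      ultimately show ?thesis by simp
    qed
  qed
  then show ?thesis using p(1) by (intro exI[of _ z]) (auto simp: z_def)
qed

section \<open>The Hamiltonian flow as a limit of Verlet trajectories\<close>

context potential
begin

lemma ex_ham_flow: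
  "\<exists>X V. X 0 = x \<and> V 0 = v \<and> (\<forall>t. (X has_vector_derivative V t) (at t) \<and> (V has_vector_derivative - grad (X t)) (at t))"
proof -
  define F :: "'a \<times> 'a \<Rightarrow> 'a \<times> 'a" where "F p = (snd p, - grad (fst p))" for p
  have "norm (F p - F q) \<le> (1 + L) * norm (p - q)" for p q
  proof -
    have "norm (F p - F q) \<le> norm (snd p - snd q) + norm (- grad (fst p) - - grad (fst q))"
      unfolding F_def by (simp add: norm_Pair_le order.trans[OF norm_Pair_le])
    also have "norm (- grad (fst p) - - grad (fst q)) = norm (grad (fst p) - grad (fst q))" using norm_minus_commute[of "grad (fst q)" "grad (fst p)"] by simp
    also have "\<dots> \<le> L * norm (fst p - fst q)" by (rule grad_lip)
    also have "\<dots> \<le> L * norm (p - q)" using L0 norm_fst_le[of "fst p - fst q" "snd p - snd q"] by (intro mult_left_mono) (simp_all add: minus_prod_def)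
    also have "norm (snd p - snd q) \<le> norm (p - q)" using norm_snd_le[of "snd p - snd q" "fst p - fst q"] by (simp add: minus_prod_def)
    finally show ?thesis by (simp add: distrib_right)
  qed
  then obtain z where z: "z 0 = (x, v)" "\<And>t. (z has_vector_derivative F (z t)) (at t)"
    using picard_global[of "1 + L" F "(x, v)"] L0 by auto
  have "((\<lambda>t. fst (z t)) has_vector_derivative snd (z t)) (at t)" "((\<lambda>t. snd (z t)) has_vector_derivative - grad (fst (z t))) (at t)" for t
    using bounded_linear.has_vector_derivative[OF bounded_linear_fst z(2)[of t]] bounded_linear.has_vector_derivative[OF bounded_linear_snd z(2)[of t]]
    by (simp_all add: F_def)
  then show ?thesis using z(1) by (intro exI[of _ "\<lambda>t. fst (z t)"] exI[of _ "\<lambda>t. snd (z t)"]) auto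
qed

text \<open>Sampled on the grid, an exact solution satisfies the Verlet recursion with a modified
  force r read off from its second differences. Taylor's formula shows that r deviates from the
  gradient by O(\<delta>), and the stability bound applied to the difference gives convergence. The
  statement concerns every solution, not a chosen one.\<close>

lemma verlet_converges:
  assumes X0: "X 0 = x" "V 0 = v" and dX: "\<And>t. (X has_vector_derivative V t) (at t)"
    and dV: "\<And>t. (V has_vector_derivative - grad (X t)) (at t)"
  shows "(\<lambda>m. vpos grad (T / real (Suc m)) (Suc m) x v) \<longlonglongrightarrow> X T"
proof -
  have "continuous_on {0..T} V" using dV by (meson continuous_at_imp_continuous_on has_vector_derivative_continuous)
  then have "bounded (V ` {0..T})" by (intro compact_imp_bounded compact_continuous_image) auto
  then obtain A where "\<forall>y\<in>V ` {0..T}. norm y \<le> A" unfolding bounded_iff by blast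
  then have A: "norm (V t) \<le> A" if "t \<in> {0..T}" for t using that by blast
  have A0: "0 \<le> A" using A[of 0] T order.trans[OF norm_ge_zero] by fastforce
  \<comment> \<open>Two integrations using only the Lipschitz bound on the gradient: W is the
    velocity defect, of order t^2, and Y leads to the position defect, of order t^3.\<close>
  have taylor: "norm (X (s + t) - X s - t *\<^sub>R V s + (t\<^sup>2 / 2) *\<^sub>R grad (X s)) \<le> L * A * \<bar>t\<bar>^3"
    if st: "s \<in> {0..T}" "s + t \<in> {0..T}" for s t
  proof -
    let ?S = "closed_segment s (s + t)"
    have sub: "?S \<subseteq> {0..T}" using st by (intro closed_segment_subset) auto
    have near: "\<bar>r - s\<bar> \<le> \<bar>t\<bar>" if "r \<in> ?S" for r using that by (auto simp: closed_segment_eq_real_ivl split: if_splits)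
    have dx: "norm (X r - X s) \<le> A * \<bar>r - s\<bar>" if "r \<in> ?S" for r
      by (rule vector_mean_value_bound[of ?S X V]) (use that A sub in \<open>auto intro: has_vector_derivative_at_within[OF dX]\<close>)
    define W where "W r = V r - V s + (r - s) *\<^sub>R grad (X s)" for r
    have dW: "(W has_vector_derivative (- grad (X r) + grad (X s))) (at r within ?S)" for r
      unfolding W_def by (auto intro!: derivative_eq_intros has_vector_derivative_at_within[OF dV])
    have W: "norm (W r) \<le> L * A * \<bar>t\<bar>\<^sup>2" if r: "r \<in> ?S" for r
    proof -
      have "norm (W r - W s) \<le> (L * (A * \<bar>t\<bar>)) * \<bar>r - s\<bar>"
      proof (rule vector_mean_value_bound[OF _ dW])
        fix q assume q: "q \<in> ?S"
        have "norm (- grad (X q) + grad (X s)) = norm (grad (X q) - grad (X s))" using norm_minus_commute[of "grad (X s)" "grad (X q)"] by simp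
        also have "\<dots> \<le> L * norm (X q - X s)" by (rule grad_lip)
        also have "\<dots> \<le> L * (A * \<bar>t\<bar>)" using dx[OF q] near[OF q] A0 L0 by (intro mult_left_mono order.trans[OF dx[OF q]]) auto
        finally show "norm (- grad (X q) + grad (X s)) \<le> L * (A * \<bar>t\<bar>)" .
      qed (use r in auto)
      also have "\<dots> \<le> (L * (A * \<bar>t\<bar>)) * \<bar>t\<bar>" using near[OF r] L0 A0 by (intro mult_left_mono) auto
      finally show ?thesis by (simp add: W_def power2_eq_square mult_ac)
    qed
    define Y where "Y r = X r - r *\<^sub>R V s + ((r - s)\<^sup>2 / 2) *\<^sub>R grad (X s)" for r
    have dY: "(Y has_vector_derivative W r) (at r within ?S)" for r
      unfolding Y_def W_def by (auto intro!: derivative_eq_intros has_vector_derivative_at_within[OF dX] simp: algebra_simps diff_divide_distrib)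
    have Y: "Y (s + t) = X (s + t) - (s *\<^sub>R V s + t *\<^sub>R V s) + (t\<^sup>2 / 2) *\<^sub>R grad (X s)" "Y s = X s - s *\<^sub>R V s"
      by (simp_all add: Y_def scaleR_add_left)
    have "norm (Y (s + t) - Y s) \<le> (L * A * \<bar>t\<bar>\<^sup>2) * \<bar>s + t - s\<bar>"
      by (rule vector_mean_value_bound[OF _ dY W]) auto
    moreover have "Y (s + t) - Y s = X (s + t) - X s - t *\<^sub>R V s + (t\<^sup>2 / 2) *\<^sub>R grad (X s)"
      unfolding Y by (simp add: algebra_simps)
    ultimately show ?thesis by (simp add: power2_eq_square power3_eq_cube mult.assoc)
  qed
  have err: "norm (X T - vpos grad (T / real (Suc m)) (Suc m) x v) \<le> (11/10 * (T\<^sup>2 / 2) * (2 * L * A) * T) * (1 / real (Suc m))" for m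
  proof -
    define n \<delta> where "n = Suc m" and "\<delta> = T / real n"
    have d: "0 < \<delta>" "real n * \<delta> = T" using T by (auto simp: n_def \<delta>_def)
    define s where "s k = real k * \<delta>" for k
    have sT: "s k \<in> {0..T}" if "k \<le> n" for k
      using that d mult_right_mono[of "real k" "real n" \<delta>] by (auto simp: s_def)
    have sS: "s (Suc k) = s k + \<delta>" for k by (simp add: s_def algebra_simps)
    \<comment> \<open>At index 0 the force is read off from the first step with a factor 2, matching
      the half weight of the trapezoidal sum.\<close>
    define r where "r k = (if k = 0 then (2 / \<delta>\<^sup>2) *\<^sub>R (x + \<delta> *\<^sub>R v - X \<delta>) else - (1 / \<delta>\<^sup>2) *\<^sub>R (X (s (Suc k)) - 2 *\<^sub>R X (s k) + X (s (k - 1))))" for k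
    have step: "X (s (Suc k)) - X (s k) = \<delta> *\<^sub>R v - \<delta>\<^sup>2 *\<^sub>R trap1 r (Suc k)" for k
    proof (induction k)
      case 0
      then show ?case using d by (simp add: trap1_Suc trap_weight_def r_def s_def X0)
    next
      case (Suc k)
      have "\<delta>\<^sup>2 *\<^sub>R r (Suc k) = - (X (s (Suc (Suc k))) - 2 *\<^sub>R X (s (Suc k)) + X (s k))" using d by (simp add: r_def)
      then have "X (s (Suc (Suc k))) - X (s (Suc k)) = (X (s (Suc k)) - X (s k)) - \<delta>\<^sup>2 *\<^sub>R r (Suc k)"
        by (simp add: algebra_simps scaleR_2)
      also have "\<dots> = \<delta> *\<^sub>R v - \<delta>\<^sup>2 *\<^sub>R trap1 r (Suc (Suc k))"
        unfolding Suc trap1_Suc[of r "Suc k"] by (simp add: trap_weight_def scaleR_add_right)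
      finally show ?case .
    qed
    have form: "X (s k) = x + (real k * \<delta>) *\<^sub>R v - \<delta>\<^sup>2 *\<^sub>R trap2 r k" for k
    proof (induction k)
      case (Suc k)
      have "X (s (Suc k)) = X (s k) + (\<delta> *\<^sub>R v - \<delta>\<^sup>2 *\<^sub>R trap1 r (Suc k))" by (subst step[of k, symmetric]) simp
      then show ?case unfolding Suc trap2_Suc by (simp add: algebra_simps)
    qed (simp add: s_def X0)
    have res: "norm (r k - grad (X (s k))) \<le> 2 * L * A * \<delta>" if k: "k < n" for k
    proof -
      have p: "norm (X (s (Suc k)) - X (s k) - \<delta> *\<^sub>R V (s k) + (\<delta>\<^sup>2 / 2) *\<^sub>R grad (X (s k))) \<le> L * A * \<delta>^3"
        using taylor[of "s k" \<delta>] sT[of k] sT[of "Suc k"] k d by (simp add: sS)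
      have "\<delta>\<^sup>2 * norm (r k - grad (X (s k))) \<le> 2 * (L * A * \<delta>^3)"
      proof (cases "k = 0")
        case True
        have "\<delta>\<^sup>2 *\<^sub>R (r k - grad (X (s k))) = - (2 *\<^sub>R (X (s (Suc k)) - X (s k) - \<delta> *\<^sub>R V (s k) + (\<delta>\<^sup>2 / 2) *\<^sub>R grad (X (s k))))"
        proof -
          have "2 *\<^sub>R (a + b - c) - e *\<^sub>R w = - (2 *\<^sub>R (c - a - b + (e / 2) *\<^sub>R w))" for a b c w :: 'a and e :: real
            by (simp add: scaleR_diff_right scaleR_add_right)
          moreover have "\<delta>\<^sup>2 *\<^sub>R r k = 2 *\<^sub>R (x + \<delta> *\<^sub>R v - X \<delta>)" using True d by (simp add: r_def)
          ultimately show ?thesis using True X0 unfolding scaleR_diff_right[of _ "r k"] by (simp add: s_def)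
        qed
        then have "norm (\<delta>\<^sup>2 *\<^sub>R (r k - grad (X (s k)))) = 2 * norm (X (s (Suc k)) - X (s k) - \<delta> *\<^sub>R V (s k) + (\<delta>\<^sup>2 / 2) *\<^sub>R grad (X (s k)))"
          by (simp only: norm_minus_cancel norm_scaleR abs_numeral)
        then show ?thesis using p d by simp
      next
        case False
        then obtain j where j: "k = Suc j" by (cases k) auto
        have q: "norm (X (s j) - X (s k) + \<delta> *\<^sub>R V (s k) + (\<delta>\<^sup>2 / 2) *\<^sub>R grad (X (s k))) \<le> L * A * \<delta>^3"
          using taylor[of "s k" "- \<delta>"] sT[of k] sT[of j] k d by (simp add: sS j)
        have "\<delta>\<^sup>2 *\<^sub>R (r k - grad (X (s k))) = - ((X (s (Suc k)) - X (s k) - \<delta> *\<^sub>R V (s k) + (\<delta>\<^sup>2 / 2) *\<^sub>R grad (X (s k)))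
           + (X (s j) - X (s k) + \<delta> *\<^sub>R V (s k) + (\<delta>\<^sup>2 / 2) *\<^sub>R grad (X (s k))))"
        proof -
          have "\<delta>\<^sup>2 *\<^sub>R r k = - (X (s (Suc k)) - 2 *\<^sub>R X (s k) + X (s j))" using d by (simp add: r_def j)
          moreover have "\<delta>\<^sup>2 *\<^sub>R y = (\<delta>\<^sup>2 / 2) *\<^sub>R y + (\<delta>\<^sup>2 / 2) *\<^sub>R y" for y :: 'a by (simp add: scaleR_left_distrib[symmetric])
          moreover have "- (p - 2 *\<^sub>R x + q) - (u + u) = - ((p - x - v + u) + (q - x + v + u))" for p x q u v :: 'a
            by (simp add: scaleR_2)
          ultimately show ?thesis unfolding scaleR_diff_right[of _ "r k"] by (simp only:)
        qed
        then have "norm (\<delta>\<^sup>2 *\<^sub>R (r k - grad (X (s k)))) \<le> L * A * \<delta>^3 + L * A * \<delta>^3"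
          using p q by (simp only: norm_minus_cancel) (rule order.trans[OF norm_triangle_ineq add_mono])
        then show ?thesis by (simp add: mult_ac)
      qed
      then have "\<delta>\<^sup>2 * norm (r k - grad (X (s k))) \<le> \<delta>\<^sup>2 * (2 * L * A * \<delta>)" by (simp add: power2_eq_square power3_eq_cube mult_ac)
      then show ?thesis using d by simp
    qed
    have "vform \<delta> n (\<lambda>k. X (s k) - vpos grad \<delta> k x v) 0 0 (\<lambda>k. r k - grad (vpos grad \<delta> k x v))"
      unfolding vform_def trap2_diff
    proof (intro allI impI)
      fix k
      have "X (s k) - vpos grad \<delta> k x v = (x + (real k * \<delta>) *\<^sub>R v - \<delta>\<^sup>2 *\<^sub>R trap2 r k)
          - (x + (real k * \<delta>) *\<^sub>R v - \<delta>\<^sup>2 *\<^sub>R trap2 (\<lambda>i. grad (vpos grad \<delta> i x v)) k)"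
        using form[of k] vpos_trap2[of grad \<delta> k x v] by (simp only:)
      then show "X (s k) - vpos grad \<delta> k x v = 0 + (real k * \<delta>) *\<^sub>R 0 - \<delta>\<^sup>2 *\<^sub>R (trap2 r k - trap2 (\<lambda>i. grad (vpos grad \<delta> i x v)) k)"
        by (simp add: scaleR_diff_right)
    qed
    then have "norm (X (s n) - vpos grad \<delta> n x v) \<le> 11/10 * (norm (0::'a) + T * norm (0::'a) + T\<^sup>2 / 2 * (2 * L * A * \<delta>))"
    proof (rule vform_bound[where L=L])
      fix i assume i: "i < n"
      have "norm ((grad (X (s i)) - grad (vpos grad \<delta> i x v)) + (r i - grad (X (s i)))) \<le> L * norm (X (s i) - vpos grad \<delta> i x v) + 2 * L * A * \<delta>"
        by (rule order.trans[OF norm_triangle_ineq add_mono[OF grad_lip res[OF i]]])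
      then show "norm (r i - grad (vpos grad \<delta> i x v)) \<le> L * norm (X (s i) - vpos grad \<delta> i x v) + 2 * L * A * \<delta>" by simp
    qed (use d L0 A0 LT in auto)
    moreover have "s n = T" using d by (simp add: s_def)
    ultimately show ?thesis by (simp add: n_def \<delta>_def mult_ac)
  qed
  have "(\<lambda>m. (11/10 * (T\<^sup>2 / 2) * (2 * L * A) * T) * (1 / real (Suc m))) \<longlonglongrightarrow> 0"
    using tendsto_mult[OF tendsto_const[of "11/10 * (T\<^sup>2 / 2) * (2 * L * A) * T"] LIMSEQ_inverse_real_of_nat]
    unfolding inverse_eq_divide mult_zero_right .
  then have "(\<lambda>m. X T - vpos grad (T / real (Suc m)) (Suc m) x v) \<longlonglongrightarrow> 0"
    by (rule Lim_null_comparison[rotated]) (use err in auto)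
  from tendsto_diff[OF tendsto_const this, of "X T"] show ?thesis by simp
qed

text \<open>Uniqueness is a by-product: the position at T of every solution is the limit of the same
  Verlet sequence, so the definite description is determined.\<close>

lemma verlet_converges_flow: "(\<lambda>m. vpos grad (T / real (Suc m)) (Suc m) x v) \<longlonglongrightarrow> ham_flow_pos grad T x v"
proof -
  obtain X V where XV: "X 0 = x" "V 0 = v" "\<forall>t. (X has_vector_derivative V t) (at t) \<and> (V has_vector_derivative - grad (X t)) (at t)"
    using ex_ham_flow[of x v] by blast
  have lim: "(\<lambda>m. vpos grad (T / real (Suc m)) (Suc m) x v) \<longlonglongrightarrow> X T"
    by (rule verlet_converges[of X x V v]) (use XV in auto)
  have "ham_flow_pos grad T x v = X T"
    unfolding ham_flow_pos_def
  proof (rule the_equality)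
    show "\<exists>Xa V. Xa 0 = x \<and> V 0 = v \<and> (\<forall>t. (Xa has_vector_derivative V t) (at t) \<and> (V has_vector_derivative - grad (Xa t)) (at t)) \<and> X T = Xa T"
      using XV by blast
    fix p assume "\<exists>Xa V. Xa 0 = x \<and> V 0 = v \<and> (\<forall>t. (Xa has_vector_derivative V t) (at t) \<and> (V has_vector_derivative - grad (Xa t)) (at t)) \<and> p = Xa T"
    then obtain Y U where Y: "Y 0 = x" "U 0 = v" "\<forall>t. (Y has_vector_derivative U t) (at t) \<and> (U has_vector_derivative - grad (Y t)) (at t)" "p = Y T" by blast
    have "(\<lambda>m. vpos grad (T / real (Suc m)) (Suc m) x v) \<longlonglongrightarrow> Y T"
      by (rule verlet_converges[of Y x U v]) (use Y in auto)
    then show "p = X T" using LIMSEQ_unique[OF lim] Y(4) by simp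
  qed
  then show ?thesis using lim by simp
qed

end

section \<open>The Kullback--Leibler bound\<close>

context gibbs_potential
begin

lemma ln_integral_exp_tendsto:
  fixes \<phi> :: "'a \<Rightarrow> real"
  assumes I: "I \<longlonglongrightarrow> (\<integral>x. exp (\<phi> x) \<partial>gibbs f)" and le: "\<And>m::nat. a m \<le> R + ln (I m)"
    and phi[measurable]: "\<phi> \<in> borel_measurable borel" and bd: "\<And>x. \<bar>\<phi> x\<bar> \<le> B" and a: "a \<longlonglongrightarrow> A"
  shows "A \<le> R + ln (\<integral>x. exp (\<phi> x) \<partial>gibbs f)"
proof -
  interpret G: prob_space "gibbs f" by (rule prob_space_gibbs)
  have i: "integrable (gibbs f) (\<lambda>x. exp (\<phi> x))"
    by (rule G.integrable_const_bound[where B="exp B"]) (use bd in \<open>auto simp: abs_le_iff\<close>)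
  have "exp (- B) = (\<integral>x. exp (- B) \<partial>gibbs f)" by (simp add: G.prob_space)
  also have "\<dots> \<le> (\<integral>x. exp (\<phi> x) \<partial>gibbs f)"
  proof (rule integral_mono[OF _ i])
    show "exp (- B) \<le> exp (\<phi> x)" for x using bd[of x] by (simp add: abs_le_iff)
  qed simp
  finally have "0 < (\<integral>x. exp (\<phi> x) \<partial>gibbs f)" by (rule less_le_trans[OF exp_gt_zero])
  then have "(\<lambda>m. R + ln (I m)) \<longlonglongrightarrow> R + ln (\<integral>x. exp (\<phi> x) \<partial>gibbs f)"
    by (intro tendsto_intros I) simp
  from LIMSEQ_le[OF a this] le show ?thesis by blast
qed

text \<open>The fine step is h/(m + 1). The left side does not depend on m, while on the right the
  fine kernel applied to \<open>gibbs f\<close> tends to \<open>gibbs f\<close> itself.\<close>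

lemma verlet_gibbs_dual:
  fixes \<phi> :: "'a \<Rightarrow> real"
  assumes rho: "prob_space \<rho>" "sets \<rho> = sets borel" and pi: "\<pi> \<in> couplings \<rho> (gibbs f)"
    and h: "0 < h" "real K * h = T"
    and phi[measurable]: "\<phi> \<in> borel_measurable borel" and bd: "\<And>x. \<bar>\<phi> x\<bar> \<le> B"
    and R: "(\<integral>\<^sup>+p. ennreal (transport_const * (norm (fst p - snd p))\<^sup>2 + verlet_error (h\<^sup>2) (norm (fst p)) (real DIM('a)) (real DIM('a) * (real DIM('a) + 2))) \<partial>\<pi>) \<le> ennreal R" "0 \<le> R"
  shows "(\<integral>x. \<phi> x \<partial>distr (\<rho> \<Otimes>\<^sub>M std_gauss) borel (\<lambda>p. vpos grad h K (fst p) (snd p))) \<le> R + ln (\<integral>x. exp (\<phi> x) \<partial>gibbs f)"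
proof -
  let ?c = "\<lambda>(x::'a) (y::'a). transport_const * (norm (x - y))\<^sup>2 + verlet_error (h\<^sup>2) (norm x) (real DIM('a)) (real DIM('a) * (real DIM('a) + 2))"
  let ?d = "\<lambda>m. h / real (Suc m)"
  define I where "I m = (\<integral>x. exp (\<phi> x) \<partial>distr (gibbs f \<Otimes>\<^sub>M std_gauss) borel (\<lambda>p. vpos grad (?d m) (K * Suc m) (fst p) (snd p)))" for m
  have dm: "real (K * Suc m) * ?d m = T" for m
  proof -
    have "real (K * Suc m) * ?d m = real K * (real (Suc m) * ?d m)" by (simp only: of_nat_mult mult.assoc)
    then show ?thesis using h by (simp del: of_nat_Suc)
  qed
  have K: "1 \<le> K" using h T by (cases K) auto
  have coarse_horizon: "h \<le> T" using h mult_right_mono[of 1 "real K" h] K by simp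
  have dh: "?d m \<le> h" for m using h by (simp add: divide_le_eq_1 divide_le_eq mult_le_cancel_left1)
  have le: "(\<integral>x. \<phi> x \<partial>distr (\<rho> \<Otimes>\<^sub>M std_gauss) borel (\<lambda>p. vpos grad h K (fst p) (snd p))) \<le> R + ln (I m)" for m
    unfolding I_def
  proof (rule dual_coupling[OF rho prob_space_gibbs sets_gibbs pi vpos_measurable_pair vpos_measurable_pair phi bd, where c="?c"])
    show "(\<lambda>p. ?c (fst p) (snd p)) \<in> borel_measurable (borel \<Otimes>\<^sub>M borel)" unfolding verlet_error_def by measurable
    show "0 \<le> ?c x y" for x y
      unfolding transport_const_def verlet_error_def by (intro add_nonneg_nonneg mult_nonneg_nonneg divide_nonneg_nonneg) auto
    show "(\<integral>\<^sup>+p. ennreal (?c (fst p) (snd p)) \<partial>\<pi>) \<le> ennreal R" "0 \<le> R" by fact+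
    fix x y :: 'a
    \<comment> \<open>This difference of squared steps is at most h^2, which bounds the error term
      uniformly in m.\<close>
    let ?H = "(?d m)\<^sup>2 * ((real (Suc m))\<^sup>2 - 1)"
    have "?H \<le> (?d m)\<^sup>2 * (real (Suc m))\<^sup>2" by (intro mult_left_mono) auto
    also have "\<dots> = h\<^sup>2" by (simp add: power_divide del: of_nat_Suc)
    finally have "?H\<^sup>2 \<le> (h\<^sup>2)\<^sup>2" by (intro power_mono mult_nonneg_nonneg) auto
    then have e: "verlet_error ?H (norm x) (real DIM('a)) (real DIM('a) * (real DIM('a) + 2)) \<le> verlet_error (h\<^sup>2) (norm x) (real DIM('a)) (real DIM('a) * (real DIM('a) + 2))"
      by (rule verlet_error_mono) auto
    have "real (Suc m) * ?d m = h" by (simp del: of_nat_Suc)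
    then show "(\<integral>v. \<phi> (vpos grad h K x v) \<partial>std_gauss) \<le> ?c x y + ln (\<integral>w. exp (\<phi> (vpos grad (?d m) (K * Suc m) y w)) \<partial>std_gauss)"
      using verlet_pair_dual[where m="Suc m" and \<delta>="?d m" and K=K and \<phi>=\<phi> and B=B and x=x and y=y] dm[of m] bd phi h(1) e by simp
  qed
  have lim: "?d \<longlonglongrightarrow> 0"
    using tendsto_mult[OF tendsto_const[of h] LIMSEQ_inverse_real_of_nat] unfolding divide_inverse by simp
  have "I \<longlonglongrightarrow> (\<integral>x. exp (\<phi> x) \<partial>gibbs f)"
    unfolding I_def
  proof (rule gibbs_verlet_limit[where n="\<lambda>m. K * Suc m" and B="exp B", OF _ _ _ lim])
    show "0 \<le> ?d m" for m using h by simp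
    show "?d m \<le> T" for m using dh[of m] coarse_horizon by simp
    show "real (K * Suc m) * ?d m = T" for m by (rule dm)
    show "\<bar>exp (\<phi> x)\<bar> \<le> exp B" for x using bd[of x] by (simp add: abs_le_iff)
  qed measurable
  then show ?thesis by (rule ln_integral_exp_tendsto[OF _ le phi bd tendsto_const])
qed

lemma ham_flow_measurable_pair: "(\<lambda>p. ham_flow_pos grad T (fst p) (snd p)) \<in> borel_measurable (borel \<Otimes>\<^sub>M borel)"
  by (rule borel_measurable_LIMSEQ_metric[OF vpos_measurable_pair verlet_converges_flow])

text \<open>Both kernels use the same step T/n, so the two grids coincide, H = 0 and only the
  transport cost is left. Now the left side varies as well; its limit is taken along trajectories,
  which is where continuity of \<phi> enters.\<close>

lemma flow_gibbs_dual:
  fixes \<phi> :: "'a \<Rightarrow> real"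
  assumes rho: "prob_space \<rho>" "sets \<rho> = sets borel" and pi: "\<pi> \<in> couplings \<rho> (gibbs f)"
    and phi: "continuous_on UNIV \<phi>" and bd: "\<And>x. \<bar>\<phi> x\<bar> \<le> B"
    and R: "(\<integral>\<^sup>+p. ennreal (transport_const * (norm (fst p - snd p))\<^sup>2) \<partial>\<pi>) \<le> ennreal R" "0 \<le> R"
  shows "(\<integral>x. \<phi> x \<partial>distr (\<rho> \<Otimes>\<^sub>M std_gauss) borel (\<lambda>p. ham_flow_pos grad T (fst p) (snd p))) \<le> R + ln (\<integral>x. exp (\<phi> x) \<partial>gibbs f)"
proof -
  interpret rho: prob_space \<rho> by fact
  interpret S: prob_space "std_gauss :: 'a measure" by (rule prob_space_std_gauss)
  interpret RS: pair_prob_space \<rho> "std_gauss :: 'a measure" ..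
  note [measurable_cong] = rho(2)
  have phim[measurable]: "\<phi> \<in> borel_measurable borel" by (rule borel_measurable_continuous_onI[OF phi])
  note hm[measurable] = ham_flow_measurable_pair
  note vm[measurable] = vpos_measurable_pair
  have sp: "sets (\<rho> \<Otimes>\<^sub>M (std_gauss :: 'a measure)) = sets (borel \<Otimes>\<^sub>M borel)"
    by (rule sets_pair_measure_cong[OF rho(2) sets_std_gauss])
  have hm': "(\<lambda>p. ham_flow_pos grad T (fst p) (snd p)) \<in> borel_measurable (\<rho> \<Otimes>\<^sub>M (std_gauss :: 'a measure))"
    and vm': "(\<lambda>p. vpos grad \<delta> k (fst p) (snd p)) \<in> borel_measurable (\<rho> \<Otimes>\<^sub>M (std_gauss :: 'a measure))" for \<delta> k
    unfolding measurable_cong_sets[OF sp refl] by (rule hm, rule vm)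
  let ?d = "\<lambda>m. T / real (Suc m)"
  define I where "I m = (\<integral>x. exp (\<phi> x) \<partial>distr (gibbs f \<Otimes>\<^sub>M std_gauss) borel (\<lambda>p. vpos grad (?d m) (Suc m) (fst p) (snd p)))" for m
  define J where "J m = (\<integral>x. \<phi> x \<partial>distr (\<rho> \<Otimes>\<^sub>M std_gauss) borel (\<lambda>p. vpos grad (?d m) (Suc m) (fst p) (snd p)))" for m
  have dm: "real (Suc m) * ?d m = T" for m by (simp del: of_nat_Suc)
  have le: "J m \<le> R + ln (I m)" for m
    unfolding I_def J_def
  proof (rule dual_coupling[OF rho prob_space_gibbs sets_gibbs pi vpos_measurable_pair vpos_measurable_pair phim bd, where c="\<lambda>x y. transport_const * (norm (x - y))\<^sup>2"])
    show "(\<lambda>p::'a\<times>'a. transport_const * (norm (fst p - snd p))\<^sup>2) \<in> borel_measurable (borel \<Otimes>\<^sub>M borel)" by measurable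
    show "0 \<le> transport_const * (norm (x - y))\<^sup>2" for x y :: 'a
      unfolding transport_const_def by (intro add_nonneg_nonneg mult_nonneg_nonneg divide_nonneg_nonneg) auto
    show "(\<integral>\<^sup>+p. ennreal (transport_const * (norm (fst p - snd p))\<^sup>2) \<partial>\<pi>) \<le> ennreal R" "0 \<le> R" by fact+
    fix x y :: 'a
    have e: "verlet_error (0::real) (norm x) (real DIM('a)) (real DIM('a) * (real DIM('a) + 2)) = 0" by (simp add: verlet_error_def)
    then show "(\<integral>v. \<phi> (vpos grad (?d m) (Suc m) x v) \<partial>std_gauss) \<le> transport_const * (norm (x - y))\<^sup>2 + ln (\<integral>w. exp (\<phi> (vpos grad (?d m) (Suc m) y w)) \<partial>std_gauss)"
      using verlet_pair_dual[where m=1 and \<delta>="?d m" and K="Suc m" and \<phi>=\<phi> and B=B and x=x and y=y] dm[of m] bd phim T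
      unfolding of_nat_1 mult_1 power_one diff_self mult_zero_right e add_0_right by (simp only: mult_1_right) simp
  qed
  have lim: "?d \<longlonglongrightarrow> 0"
    using tendsto_mult[OF tendsto_const[of T] LIMSEQ_inverse_real_of_nat] unfolding divide_inverse by simp
  have I: "I \<longlonglongrightarrow> (\<integral>x. exp (\<phi> x) \<partial>gibbs f)"
    unfolding I_def
  proof (rule gibbs_verlet_limit[where n="\<lambda>m. Suc m" and B="exp B", OF _ _ _ lim])
    show "0 \<le> ?d m" for m using T by simp
    show "?d m \<le> T" for m using T by (simp add: divide_le_eq mult_le_cancel_left1)
    show "real (Suc m) * ?d m = T" for m by (rule dm)
    show "\<bar>exp (\<phi> x)\<bar> \<le> exp B" for x using bd[of x] by (simp add: abs_le_iff)
  qed measurable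
  have "(\<lambda>m. \<integral>p. \<phi> (vpos grad (?d m) (Suc m) (fst p) (snd p)) \<partial>(\<rho> \<Otimes>\<^sub>M std_gauss)) \<longlonglongrightarrow> (\<integral>p. \<phi> (ham_flow_pos grad T (fst p) (snd p)) \<partial>(\<rho> \<Otimes>\<^sub>M std_gauss))"
  proof (rule integral_dominated_convergence[where w="\<lambda>_. B"])
    show "(\<lambda>p. \<phi> (ham_flow_pos grad T (fst p) (snd p))) \<in> borel_measurable (\<rho> \<Otimes>\<^sub>M std_gauss)"
      by (rule measurable_compose[OF hm' phim])
    show "(\<lambda>p. \<phi> (vpos grad (?d m) (Suc m) (fst p) (snd p))) \<in> borel_measurable (\<rho> \<Otimes>\<^sub>M std_gauss)" for m
      by (rule measurable_compose[OF vm' phim])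
    have "isCont \<phi> x" for x using phi by (simp add: continuous_on_eq_continuous_at)
    then show "AE p in \<rho> \<Otimes>\<^sub>M std_gauss. (\<lambda>m. \<phi> (vpos grad (?d m) (Suc m) (fst p) (snd p))) \<longlonglongrightarrow> \<phi> (ham_flow_pos grad T (fst p) (snd p))"
      using isCont_tendsto_compose[OF _ verlet_converges_flow] by blast
  qed (use bd in auto)
  then have J: "J \<longlonglongrightarrow> (\<integral>x. \<phi> x \<partial>distr (\<rho> \<Otimes>\<^sub>M std_gauss) borel (\<lambda>p. ham_flow_pos grad T (fst p) (snd p)))"
    unfolding J_def integral_distr[OF hm' phim] integral_distr[OF vm' phim] .
  show ?thesis by (rule ln_integral_exp_tendsto[OF I le phim bd J])
qed

lemma KL_le_coupling:
  assumes rho: "prob_space \<rho>" "sets \<rho> = sets borel" and pi: "\<pi> \<in> couplings \<rho> (gibbs f)"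
    and h: "0 \<le> h" "h > 0 \<Longrightarrow> T / h \<in> \<nat>"
    and R: "(\<integral>\<^sup>+p. ennreal (transport_const * (norm (fst p - snd p))\<^sup>2 + verlet_error (h\<^sup>2) (norm (fst p)) (real DIM('a)) (real DIM('a) * (real DIM('a) + 2))) \<partial>\<pi>) \<le> ennreal R" "0 \<le> R"
  shows "KL (Ptilde grad T h \<rho>) (gibbs f) \<le> ereal R"
proof -
  interpret rho: prob_space \<rho> by fact
  interpret S: prob_space "std_gauss :: 'a measure" by (rule prob_space_std_gauss)
  interpret RS: pair_prob_space \<rho> "std_gauss :: 'a measure" ..
  note [measurable_cong] = rho(2)
  have sp: "sets (\<rho> \<Otimes>\<^sub>M (std_gauss :: 'a measure)) = sets (borel \<Otimes>\<^sub>M borel)"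
    by (rule sets_pair_measure_cong[OF rho(2) sets_std_gauss])
  have qm: "(\<lambda>p. qtilde grad T h (fst p) (snd p)) \<in> borel_measurable (\<rho> \<Otimes>\<^sub>M (std_gauss :: 'a measure))"
    unfolding measurable_cong_sets[OF sp refl] qtilde_def vpos_def[symmetric]
    using ham_flow_measurable_pair vpos_measurable_pair by (cases "h = 0") simp_all
  have P: "prob_space (Ptilde grad T h \<rho>)" unfolding Ptilde_def by (rule RS.prob_space_distr[OF qm])
  have sP: "sets (Ptilde grad T h \<rho>) = sets borel" by (simp add: Ptilde_def)
  show ?thesis
  proof (rule KL_le_of_dual[OF P prob_space_gibbs])
    show "sets (Ptilde grad T h \<rho>) = sets (gibbs f)" by (simp add: sP)
    fix \<phi> :: "'a \<Rightarrow> real" and B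
    assume "\<phi> \<in> borel_measurable (gibbs f)" and bd: "\<And>x. \<bar>\<phi> x\<bar> \<le> B"
    then have phi: "\<phi> \<in> borel_measurable borel" by measurable
    show "(\<integral>x. \<phi> x \<partial>Ptilde grad T h \<rho>) \<le> R + ln (\<integral>x. exp (\<phi> x) \<partial>gibbs f)"
    proof (cases "h = 0")
      case True
      show ?thesis
      proof (rule dual_of_continuous[OF P sP prob_space_gibbs sets_gibbs _ phi bd])
        fix \<psi> :: "'a \<Rightarrow> real" and K assume "continuous_on UNIV \<psi>" "\<And>x. \<bar>\<psi> x\<bar> \<le> K"
        then show "(\<integral>x. \<psi> x \<partial>Ptilde grad T h \<rho>) \<le> R + ln (\<integral>x. exp (\<psi> x) \<partial>gibbs f)"
          using flow_gibbs_dual[OF rho pi, of \<psi> K R] R True by (simp add: Ptilde_def qtilde_def verlet_error_def)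
      qed
    next
      case False
      then have h0: "0 < h" using h by simp
      from h(2)[OF this] obtain K where K: "T / h = real K" by (auto elim: Nats_cases)
      have "(\<lambda>p. qtilde grad T h (fst p) (snd p)) = (\<lambda>p. vpos grad h K (fst p) (snd p))"
        using h0 K by (simp add: qtilde_def vpos_def)
      moreover have "real K * h = T" using h0 by (simp add: K[symmetric])
      ultimately show ?thesis
        using verlet_gibbs_dual[OF rho pi h0 _ phi bd R, of K] by (simp add: Ptilde_def)
    qed
  qed
qed

text \<open>The h^4 part of B, spelled out as in the theorem so that the final step is mere
  unfolding.\<close>

definition err_moment :: "real \<Rightarrow> 'a measure \<Rightarrow> ennreal" where
  "err_moment h \<rho> = (let d = real DIM('a) in ennreal (4 * h ^ 4) *
      (ennreal (45 * d * L\<^sup>2)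
       + ennreal (4 * L\<^sup>2 / T\<^sup>2 + 45 * d * M\<^sup>2) * moment 2 \<rho>
       + ennreal ((4 * L\<^sup>2 + 45 * d * M\<^sup>2 * T\<^sup>2) * d)
       + ennreal (4 * M\<^sup>2 / T\<^sup>2 + 45 * d * (M\<^sup>2 * T\<^sup>2 + N)\<^sup>2) * moment 4 \<rho>
       + ennreal ((4 * M\<^sup>2 * T\<^sup>2 + 45 * d * (M\<^sup>2 * T ^ 4 + N * T\<^sup>2)\<^sup>2) * d * (d + 2))))"

lemma transport_const_pos: "0 < transport_const"
  unfolding transport_const_def by (rule add_pos_nonneg) (use T in auto)

text \<open>The error term involves the first coordinate alone, hence only moments of
  \<open>\<rho>\<close>; the infimum over couplings will act on the transport part only.\<close>

lemma coupling_cost: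
  assumes rho: "prob_space \<rho>" "sets \<rho> = sets borel" and pi: "\<pi> \<in> couplings \<rho> \<sigma>"
  shows "(\<integral>\<^sup>+p. ennreal (transport_const * (norm (fst p - snd p))\<^sup>2 + verlet_error (h\<^sup>2) (norm (fst p)) (real DIM('a)) (real DIM('a) * (real DIM('a) + 2))) \<partial>\<pi>)
    = ennreal transport_const * (\<integral>\<^sup>+p. ennreal ((dist (fst p) (snd p))\<^sup>2) \<partial>\<pi>) + err_moment h \<rho>"
proof -
  note pp = couplings_prob[OF rho pi]
  interpret pi: prob_space \<pi> by (rule pp(1))
  note [measurable_cong] = pp(2)
  define d where "d = real DIM('a)"
  have d0: "0 \<le> d" by (simp add: d_def)
  define a0 a2 b2 a4 b4 where "a0 = 45 * d * L\<^sup>2" and "a2 = 4 * L\<^sup>2 / T\<^sup>2 + 45 * d * M\<^sup>2"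
    and "b2 = (4 * L\<^sup>2 + 45 * d * M\<^sup>2 * T\<^sup>2) * d" and "a4 = 4 * M\<^sup>2 / T\<^sup>2 + 45 * d * (M\<^sup>2 * T\<^sup>2 + N)\<^sup>2"
    and "b4 = (4 * M\<^sup>2 * T\<^sup>2 + 45 * d * (M\<^sup>2 * T ^ 4 + N * T\<^sup>2)\<^sup>2) * d * (d + 2)"
  have nn: "0 \<le> a0" "0 \<le> a2" "0 \<le> b2" "0 \<le> a4" "0 \<le> b4"
    unfolding a0_def a2_def b2_def a4_def b4_def using d0 by (intro add_nonneg_nonneg mult_nonneg_nonneg divide_nonneg_nonneg; simp)+
  have mom: "(\<integral>\<^sup>+p. ennreal (norm (fst p) ^ j) \<partial>\<pi>) = moment j \<rho>" for j
    unfolding moment_def pp(4)[symmetric] by (subst nn_integral_distr) simp_all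
  have e: "verlet_error (h\<^sup>2) \<xi> d (d * (d + 2)) = 4 * h^4 * (a0 + a2 * \<xi>\<^sup>2 + b2 + a4 * \<xi>^4 + b4)" for \<xi>
    unfolding verlet_error_def a0_def a2_def b2_def a4_def b4_def d_def by (simp add: power_mult[symmetric] mult.assoc)
  have split: "ennreal (transport_const * D + 4 * h^4 * (a0 + a2 * \<xi>\<^sup>2 + b2 + a4 * \<xi>^4 + b4))
      = ennreal transport_const * ennreal D + ennreal (4 * h^4) * (ennreal a0 + ennreal a2 * ennreal (\<xi>\<^sup>2) + ennreal b2 + ennreal a4 * ennreal (\<xi>^4) + ennreal b4)"
    if "0 \<le> D" for D \<xi>
  proof -
    have 1: "0 \<le> a2 * \<xi>\<^sup>2" "0 \<le> a4 * \<xi>^4" "0 \<le> 4 * h^4" using nn by auto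
    have 2: "0 \<le> a0 + a2 * \<xi>\<^sup>2 + b2 + a4 * \<xi>^4 + b4" using nn 1 by (intro add_nonneg_nonneg)
    show ?thesis using nn 1 2 that transport_const_pos
      by (simp add: ennreal_plus[symmetric] ennreal_mult[symmetric] del: ennreal_plus)
  qed
  show ?thesis
    unfolding dist_norm[symmetric] err_moment_def Let_def d_def[symmetric] e split[OF zero_le_power2] a0_def[symmetric] a2_def[symmetric] b2_def[symmetric] a4_def[symmetric] b4_def[symmetric]
    by (simp add: nn_integral_add nn_integral_cmult mom pi.emeasure_space_1)
qed

text \<open>The infimum is approached by couplings within e/\<open>transport_const\<close> of it,
  and e tends to 0. For this the divergence is moved to \<open>ennreal\<close>, which can only raise
  a negative value to 0.\<close>

lemma KL_le_W2sq:
  assumes rho: "prob_space \<rho>" "sets \<rho> = sets borel"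
    and h: "0 \<le> h" "h > 0 \<Longrightarrow> T / h \<in> \<nat>"
  shows "KL (Ptilde grad T h \<rho>) (gibbs f) \<le> enn2ereal (ennreal transport_const * W2sq \<rho> (gibbs f) + err_moment h \<rho>)"
proof -
  let ?K = "KL (Ptilde grad T h \<rho>) (gibbs f)"
  let ?cost = "\<lambda>\<pi>. \<integral>\<^sup>+p. ennreal ((dist (fst p) (snd p))\<^sup>2) \<partial>\<pi>"
  have le: "e2ennreal ?K \<le> ennreal transport_const * ?cost \<pi> + err_moment h \<rho>" if pi: "\<pi> \<in> couplings \<rho> (gibbs f)" for \<pi>
  proof (cases "ennreal transport_const * ?cost \<pi> + err_moment h \<rho> = \<top>")
    case False
    then obtain R where R: "ennreal transport_const * ?cost \<pi> + err_moment h \<rho> = ennreal R" "0 \<le> R"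
      by (cases "ennreal transport_const * ?cost \<pi> + err_moment h \<rho>") auto
    have "?K \<le> ereal R"
      by (rule KL_le_coupling[OF rho pi h]) (use R coupling_cost[OF rho pi, of h] in auto)
    then have "e2ennreal ?K \<le> e2ennreal (ereal R)" by (rule e2ennreal_mono)
    then show ?thesis using R by (simp add: ennreal.rep_eq e2ennreal_ereal)
  qed (simp only: top_greatest)
  have "e2ennreal ?K \<le> ennreal transport_const * W2sq \<rho> (gibbs f) + err_moment h \<rho>"
  proof (cases "W2sq \<rho> (gibbs f) = \<top>")
    case True
    then show ?thesis using transport_const_pos by (simp add: ennreal_mult_top)
  next
    case False
    show ?thesis
    proof (rule ennreal_le_epsilon)
      fix e :: real assume e: "0 < e"
      have "W2sq \<rho> (gibbs f) < W2sq \<rho> (gibbs f) + ennreal (e / transport_const)"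
        using False e transport_const_pos by (cases "W2sq \<rho> (gibbs f)") (auto simp: ennreal_plus[symmetric] ennreal_less_iff simp del: ennreal_plus)
      then obtain \<pi> where pi: "\<pi> \<in> couplings \<rho> (gibbs f)" "?cost \<pi> < W2sq \<rho> (gibbs f) + ennreal (e / transport_const)"
        unfolding W2sq_def[of \<rho> "gibbs f"] INF_less_iff by blast
      have "e2ennreal ?K \<le> ennreal transport_const * (W2sq \<rho> (gibbs f) + ennreal (e / transport_const)) + err_moment h \<rho>"
        using le[OF pi(1)] pi(2) by (meson add_right_mono less_imp_le mult_left_mono order_trans zero_le)
      also have "ennreal transport_const * (W2sq \<rho> (gibbs f) + ennreal (e / transport_const)) = ennreal transport_const * W2sq \<rho> (gibbs f) + ennreal e"
        using transport_const_pos e by (simp add: distrib_left ennreal_mult[symmetric])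
      finally show "e2ennreal ?K \<le> ennreal transport_const * W2sq \<rho> (gibbs f) + err_moment h \<rho> + ennreal e"
        by (simp add: ac_simps)
    qed
  qed
  then have "enn2ereal (e2ennreal ?K) \<le> enn2ereal (ennreal transport_const * W2sq \<rho> (gibbs f) + err_moment h \<rho>)"
    by (simp add: less_eq_ennreal.rep_eq)
  then show ?thesis
    by (cases "0 \<le> ?K") (auto simp: enn2ereal_e2ennreal intro: order_trans[OF less_imp_le enn2ereal_nonneg])
qed

end

lemma prob_space_kiter:
  assumes "prob_space \<mu>" "sets \<mu> = sets borel" "Q \<in> borel \<rightarrow>\<^sub>M prob_algebra borel"
  shows "prob_space (kiter Q k \<mu>) \<and> sets (kiter Q k \<mu>) = sets borel"
proof (induction k)
  case 0
  then show ?case using assms by (simp add: kiter_def)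
next
  case (Suc k)
  have "kiter Q k \<mu> \<in> space (prob_algebra borel)" using Suc by (simp add: space_prob_algebra)
  note prob_space_bind'[OF this assms(3)] sets_bind'[OF this assms(3)]
  then show ?case by (simp add: kiter_def)
qed

theorem theorem2:
  fixes f :: "'a::euclidean_space \<Rightarrow> real"
    and grad :: "'a \<Rightarrow> 'a"
    and D2 :: "'a \<Rightarrow> 'a \<Rightarrow> 'a"
    and D3 :: "'a \<Rightarrow> 'a \<Rightarrow> 'a \<Rightarrow> 'a"
    and D4 :: "'a \<Rightarrow> 'a \<Rightarrow> 'a \<Rightarrow> 'a \<Rightarrow> 'a"
    and L M N T h c1 c2 :: real
    and \<Delta> :: "real \<Rightarrow> real"
    and \<mu> \<nu>Q :: "'a measure"
    and Q :: "'a \<Rightarrow> 'a measure"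
    and k :: nat
  assumes mu: "prob_space \<mu>" "sets \<mu> = sets borel"
    and integrable: "integrable lborel (\<lambda>x. exp (- f x))"
    and cond_a: "f 0 = 0" "\<forall>x. f 0 \<le> f x"
    and grad: "\<forall>x. (f has_derivative (\<lambda>u. grad x \<bullet> u)) (at x)"
    and hess: "\<forall>x. (grad has_derivative D2 x) (at x)"
    and der3: "\<forall>x u. ((\<lambda>y. D2 y u) has_derivative D3 x u) (at x)"
    and der4: "\<forall>x u v. ((\<lambda>y. D3 y u v) has_derivative D4 x u v) (at x)"
    and cont4: "\<forall>u v w. continuous_on UNIV (\<lambda>x. D4 x u v w)"
    and cond_b: "\<forall>x u v. \<bar>D2 x u \<bullet> v\<bar> \<le> L * norm u * norm v"
    and cond_c: "\<forall>x u v w. \<bar>D3 x u v \<bullet> w\<bar> \<le> M * norm u * norm v * norm w"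
    and cond_d: "\<forall>x u v w z. \<bar>D4 x u v w \<bullet> z\<bar> \<le> N * norm u * norm v * norm w * norm z"
    and T: "T > 0" and h: "h \<ge> 0" and Th_int: "h > 0 \<Longrightarrow> T / h \<in> \<nat>"
    and LTh: "L * (T\<^sup>2 + T * h) \<le> 1 / 12"
    and Q_kernel: "Q \<in> borel \<rightarrow>\<^sub>M prob_algebra borel"
    and nuQ: "prob_space \<nu>Q" "sets \<nu>Q = sets borel" "\<nu>Q \<bind> Q = \<nu>Q"
    and c: "c1 \<ge> 1" "c2 > 0"
    and contraction: "\<forall>j::nat. j \<ge> 1 \<longrightarrow> (\<forall>\<rho>. prob_space \<rho> \<and> sets \<rho> = sets borel \<longrightarrow>
         W2 (kiter Q j \<rho>) \<nu>Q \<le> ennreal (c1 * exp (- c2 * real j)) * W2 \<rho> \<nu>Q)"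
    and bias: "W2 \<nu>Q (gibbs f) \<le> ennreal (\<Delta> h)"
    and Delta_nonneg: "\<forall>s. \<Delta> s \<ge> 0"
    and Delta_lim: "(\<Delta> \<longlongrightarrow> 0) (at_right 0)"
  shows "let d = real DIM('a);
             C = 9 / (4 * T\<^sup>2) + 363 / 2 * d * M\<^sup>2 * T ^ 4;
             \<rho>k = kiter Q k \<mu>;
             B = ennreal (2 * (\<Delta> h)\<^sup>2 * C)
               + ennreal (4 * h ^ 4) *
                 (ennreal (45 * d * L\<^sup>2)
                  + ennreal (4 * L\<^sup>2 / T\<^sup>2 + 45 * d * M\<^sup>2) * moment 2 \<rho>k
                  + ennreal ((4 * L\<^sup>2 + 45 * d * M\<^sup>2 * T\<^sup>2) * d)
                  + ennreal (4 * M\<^sup>2 / T\<^sup>2 + 45 * d * (M\<^sup>2 * T\<^sup>2 + N)\<^sup>2) * moment 4 \<rho>k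
                  + ennreal ((4 * M\<^sup>2 * T\<^sup>2 + 45 * d * (M\<^sup>2 * T ^ 4 + N * T\<^sup>2)\<^sup>2) * d * (d + 2)))
         in KL (Ptilde grad T h \<rho>k) (gibbs f)
              \<le> enn2ereal (ennreal (2 * c1\<^sup>2 * exp (- 2 * c2 * real k) * C) * (W2 \<mu> \<nu>Q)\<^sup>2 + B)"
proof -
  \<comment> \<open>From multilinear forms to vector norms: the last slot is filled with the vector
    itself.\<close>
  have norm_le: "norm y \<le> b" if "\<bar>y \<bullet> y\<bar> \<le> b * norm y" "0 \<le> b \<or> y \<noteq> 0" for y :: 'a and b
    using that by (cases "y = 0") (auto simp: dot_square_norm power2_eq_square)
  obtain e :: 'a where e: "e \<in> Basis" using nonempty_Basis by blast
  have L0: "0 \<le> L" using order_trans[OF abs_ge_zero cond_b[rule_format, of 0 e e]] e by simp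
  have M0: "0 \<le> M" using order_trans[OF abs_ge_zero cond_c[rule_format, of 0 e e e]] e by simp
  have N0: "0 \<le> N" using order_trans[OF abs_ge_zero cond_d[rule_format, of 0 e e e e]] e by simp
  interpret gibbs_potential grad D2 D3 D4 L M N T f
  proof
    show "norm (D2 x u) \<le> L * norm u" for x u
      by (rule norm_le) (use cond_b[rule_format, of x u "D2 x u"] L0 in auto)
    show "norm (D3 x u v) \<le> M * norm u * norm v" for x u v
      by (rule norm_le) (use cond_c[rule_format, of x u v "D3 x u v"] M0 in auto)
    show "norm (D4 x u v w) \<le> N * norm u * norm v * norm w" for x u v w
      by (rule norm_le) (use cond_d[rule_format, of x u v w "D4 x u v w"] N0 in auto)
    \<comment> \<open>At a global minimum the derivative vanishes; evaluating it at
      \<open>grad 0\<close> shows that the gradient is zero.\<close>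
    have "(\<lambda>u. grad 0 \<bullet> u) = (\<lambda>u. 0)"
      by (rule has_derivative_local_min[OF grad[rule_format, of 0]]) (use cond_a in auto)
    then have "grad 0 \<bullet> grad 0 = 0" by (rule fun_cong)
    then show "grad 0 = 0" by simp
    have "L * T\<^sup>2 \<le> L * (T\<^sup>2 + T * h)" using L0 T h by (intro mult_left_mono) auto
    then show "L * T\<^sup>2 \<le> 1 / 12" using LTh by simp
  qed (use grad hess der3 der4 T integrable in auto)
  define \<rho> where "\<rho> = kiter Q k \<mu>"
  have rho: "prob_space \<rho>" "sets \<rho> = sets borel" using prob_space_kiter[OF mu Q_kernel, of k] by (auto simp: \<rho>_def)
  define r where "r = c1 * exp (- c2 * real k)"
  have r0: "0 \<le> r" using c by (simp add: r_def)
  have r2: "r\<^sup>2 = c1\<^sup>2 * exp (- 2 * c2 * real k)"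
    by (simp add: r_def power_mult_distrib power2_eq_square exp_add[symmetric])
  \<comment> \<open>The contraction concerns at least one step; for k = 0 the bound follows from c1
    \<ge> 1.\<close>
  have "W2 \<rho> \<nu>Q \<le> ennreal r * W2 \<mu> \<nu>Q"
  proof (cases "k = 0")
    case True
    have "ennreal 1 * W2 \<mu> \<nu>Q \<le> ennreal c1 * W2 \<mu> \<nu>Q" using c(1) by (intro mult_right_mono ennreal_leI) auto
    then show ?thesis using True by (simp add: \<rho>_def r_def kiter_def)
  next
    case False
    then show ?thesis using contraction mu unfolding \<rho>_def r_def by simp
  qed
  then have "W2sq \<rho> \<nu>Q \<le> ennreal (r\<^sup>2) * (W2 \<mu> \<nu>Q)\<^sup>2"
    using power_mono[of "W2 \<rho> \<nu>Q" "ennreal r * W2 \<mu> \<nu>Q" 2] r0 by (simp add: W2_squared power_mult_distrib ennreal_power)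
  moreover have "W2sq \<nu>Q (gibbs f) \<le> ennreal ((\<Delta> h)\<^sup>2)"
    using power_mono[OF bias, of 2] Delta_nonneg by (simp add: W2_squared ennreal_power)
  ultimately have "W2sq \<rho> (gibbs f) \<le> 2 * (ennreal (r\<^sup>2) * (W2 \<mu> \<nu>Q)\<^sup>2) + 2 * ennreal ((\<Delta> h)\<^sup>2)"
    using order_trans[OF W2sq_triangle[OF rho nuQ(1,2), of "gibbs f"] add_mono[OF mult_left_mono mult_left_mono]] by simp
  then have "ennreal transport_const * W2sq \<rho> (gibbs f) \<le> ennreal transport_const * (2 * (ennreal (r\<^sup>2) * (W2 \<mu> \<nu>Q)\<^sup>2) + 2 * ennreal ((\<Delta> h)\<^sup>2))"
    by (rule mult_left_mono) simp
  also have "\<dots> = ennreal transport_const * (2 * ennreal (r\<^sup>2)) * (W2 \<mu> \<nu>Q)\<^sup>2 + ennreal transport_const * (2 * ennreal ((\<Delta> h)\<^sup>2))"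
    by (simp add: distrib_left mult.assoc)
  also have "ennreal transport_const * (2 * ennreal (r\<^sup>2)) = ennreal (2 * c1\<^sup>2 * exp (- 2 * c2 * real k) * transport_const)"
    using transport_const_pos c unfolding r2 by (simp add: ennreal_two_mult[symmetric] ennreal_mult[symmetric] mult_ac)
  also have "ennreal transport_const * (2 * ennreal ((\<Delta> h)\<^sup>2)) = ennreal (2 * (\<Delta> h)\<^sup>2 * transport_const)"
    using transport_const_pos by (simp add: ennreal_two_mult[symmetric] ennreal_mult[symmetric] mult_ac)
  finally have "ennreal transport_const * W2sq \<rho> (gibbs f) + err_moment h \<rho>
    \<le> ennreal (2 * c1\<^sup>2 * exp (- 2 * c2 * real k) * transport_const) * (W2 \<mu> \<nu>Q)\<^sup>2 + (ennreal (2 * (\<Delta> h)\<^sup>2 * transport_const) + err_moment h \<rho>)"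
    unfolding add.assoc[symmetric] by (rule add_right_mono)
  then have "enn2ereal (ennreal transport_const * W2sq \<rho> (gibbs f) + err_moment h \<rho>)
    \<le> enn2ereal (ennreal (2 * c1\<^sup>2 * exp (- 2 * c2 * real k) * transport_const) * (W2 \<mu> \<nu>Q)\<^sup>2 + (ennreal (2 * (\<Delta> h)\<^sup>2 * transport_const) + err_moment h \<rho>))"
    by (simp only: less_eq_ennreal.rep_eq)
  from order_trans[OF KL_le_W2sq[OF rho h Th_int] this]
  show ?thesis unfolding Let_def err_moment_def transport_const_def \<rho>_def .
qed

end
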